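(* Let $n\ge 2$, let $\Omega\subset\mathbb R^n$ be an open set, and let $A$ be a Young function. Assume that either $n=2$, or $n\ge 3$ and $$\int^\infty\Big(\frac{t}{A(t)}\Big)^{\frac1{n-2}}\,dt<\infty .$$ Let $A_{n-1}$ be the Young function associated with $A$ and $n$ (defined in the context). Assume that $\sigma:[0,\infty)\to[0,\infty)$ is a continuous function such that $$\int^\infty\frac{A_{n-1}(\lambda t)}{t\,\sigma(t)\,A_{n-1}(t)}\,dt=\infty\qquad\text{for every }\lambda>0 .$$ Let $\Psi:[0,\infty)\to[0,\infty)$ be the function given by $$\Psi(t)=\sigma(t)\,A_{n-1}(t)\quad\text{for } t\ge0 .$$ Then every weakly monotone function $u\in W^{1,A}_{\rm loc}(\Omega)$ admits a representative whose restriction to the complement in $\Omega$ of an exceptional set of $C_{\Psi,1}$-capacity zero is continuous.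
   Context: Young function: a convex function $A:[0,\infty)\to[0,\infty]$, non-constant in $(0,\infty)$, with $A(0)=0$. An integral $\int^\infty$ with unspecified lower endpoint refers only to behaviour near infinity (lower limit any sufficiently large number). The Young conjugate is $\widetilde A(t)=\sup\{st-A(s): s\ge0\}$, $t\ge0$. Function $A_{n-1}$: if $n=2$, $A_{1}=A$. If $n\ge3$, $A_{n-1}$ is the Young conjugate of the function $t\mapsto t^{\frac{n-1}{n-2}}\int_t^\infty \frac{\widetilde A(r)}{r^{1+\frac{n-1}{n-2}}}\,dr$, $t>0$ (with value $0$ at $t=0$); the integral converges exactly when $\int^\infty(t/A(t))^{1/(n-2)}dt<\infty$. It is understood that $A_{n-1}$ is finite-valued, as required for $\Psi$ to take values in $[0,\infty)$. Capacity: for a continuous $\Psi:[0,\infty)\to[0,\infty)$ and a nonnegative measurable function $f$ on $\mathbb R^n$, set $$I_\Psi f(x)=\int_{\mathbb R^n}\frac{f(y)}{|x-y|^n\,\Psi(1/|x-y|)}\,dy,\qquad x\in\mathbb R^n$$ (with the usual conventions $1/0=\infty$, $0\cdot\infty=0$). For $E\subset\mathbb R^n$, $$C_{\Psi,1}(E)=\inf\Big\{\int_{\mathbb R^n}f\,dx:\ f\ge0\text{ measurable on }\mathbb R^n,\ I_\Psi f(x)\ge1\text{ for } x\in E\Big\}.$$ Orlicz and Orlicz–Sobolev spaces: for measurable $E\subset\mathbb R^n$, $L^A(E)$ is the space of measurable real-valued $u$ on $E$ with finite Luxemburg norm $\|u\|_{L^A(E)}=\inf\{\lambda>0:\int_E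 A(|u|/\lambda)\,dx\le1\}$. $W^{1,A}(\Omega)$ is the set of weakly differentiable $u\in L^A(\Omega)$ with $|\nabla u|\in L^A(\Omega)$; $W^{1,A}_{\rm loc}(\Omega)$ is the set of measurable $u$ with $u\in W^{1,A}(\Omega')$ for every bounded open $\Omega'\subset\subset\Omega$. Weakly monotone: $u\in W^{1,1}_{\rm loc}(\Omega)$ is weakly monotone if for every open $\Omega'\subset\subset\Omega$ and every $m,M\in\mathbb R$ with $m\le M$ and $(u-M)_+-(m-u)_+\in W^{1,1}_0(\Omega')$, one has $m\le u\le M$ a.e. in $\Omega'$ (here $_+$ denotes positive part). *)

theory Defs
  imports "HOL-Analysis.Analysis"
begin

section \<open>Young functions\<close>

text \<open>
  Functions on the half line with values in the extended half line are rendered as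
  functions \<^typ>\<open>real \<Rightarrow> ennreal\<close>; their values at negative arguments are never used.
\<close>

definition young_function :: "(real \<Rightarrow> ennreal) \<Rightarrow> bool" where
  "young_function A \<longleftrightarrow>
     A 0 = 0 \<and>
     (\<forall>s\<ge>0. \<forall>t\<ge>0. \<forall>c\<in>{0..1}.
        A ((1 - c) * s + c * t) \<le> ennreal (1 - c) * A s + ennreal c * A t) \<and>
     \<not> (\<exists>k. \<forall>t>0. A t = k)"

text \<open>
  The subtraction of \<^typ>\<open>ennreal\<close> is truncated at \<open>0\<close>, and it gives \<open>0\<close> when \<open>A s = \<infinity>\<close>.
  Neither changes the supremum when \<open>A 0 = 0\<close>, because the term with \<open>s = 0\<close> is \<open>0\<close>.
\<close>

definition young_conjugate :: "(real \<Rightarrow> ennreal) \<Rightarrow> real \<Rightarrow> ennreal" where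
  "young_conjugate A t = (SUP s\<in>{0..}. ennreal (s * t) - A s)"

text \<open>
  The function called $A_{n-1}$: it is \<open>A\<close> for \<open>n = 2\<close>, and for \<open>n \<ge> 3\<close> it is given by the
  conjugation formula. Values of \<open>n\<close> below \<open>2\<close> are not used.
\<close>

definition young_lower :: "nat \<Rightarrow> (real \<Rightarrow> ennreal) \<Rightarrow> real \<Rightarrow> ennreal" where
  "young_lower n A =
     (if n = 2 then A
      else let q = (real n - 1) / (real n - 2) in
        young_conjugate (\<lambda>t. if t = 0 then 0
          else ennreal (t powr q) *
            (\<integral>\<^sup>+r\<in>{t..}. young_conjugate A r / ennreal (r powr (1 + q)) \<partial>lborel)))"


section \<open>Integrals near infinity\<close>

definition converges_near_infinity :: "(real \<Rightarrow> ennreal) \<Rightarrow> bool" where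
  "converges_near_infinity h \<longleftrightarrow> (\<forall>\<^sub>F a in at_top. (\<integral>\<^sup>+t\<in>{a..}. h t \<partial>lborel) < \<infinity>)"

definition diverges_near_infinity :: "(real \<Rightarrow> ennreal) \<Rightarrow> bool" where
  "diverges_near_infinity h \<longleftrightarrow> (\<forall>\<^sub>F a in at_top. (\<integral>\<^sup>+t\<in>{a..}. h t \<partial>lborel) = \<infinity>)"

text \<open>Powers of extended nonnegative numbers, with a positive exponent.\<close>

definition epowr :: "ennreal \<Rightarrow> real \<Rightarrow> ennreal" where
  "epowr x p = (if x = \<infinity> then \<infinity> else ennreal (enn2real x powr p))"


section \<open>Capacity\<close>

text \<open>
  In \<^typ>\<open>ennreal\<close> one has \<open>0 / 0 = 0\<close> and \<open>c / 0 = \<infinity>\<close> for \<open>c > 0\<close>, which are the conventions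
  \<open>0 \<cdot> \<infinity> = 0\<close> and \<open>1 / 0 = \<infinity>\<close> for the kernel. The single point \<open>y = x\<close> does not
  contribute to the integral. Competitors for the capacity may take the value \<open>\<infinity>\<close>; this does
  not affect the infimum, because a function with finite integral is finite almost everywhere
  and the potential ignores null sets.
\<close>

definition potential :: "(real \<Rightarrow> real) \<Rightarrow> (real ^ 'n \<Rightarrow> ennreal) \<Rightarrow> real ^ 'n \<Rightarrow> ennreal" where
  "potential \<Psi> f x =
     (\<integral>\<^sup>+y. f y / ennreal (norm (x - y) ^ CARD('n) * \<Psi> (1 / norm (x - y))) \<partial>lebesgue)"

definition capacity :: "(real \<Rightarrow> real) \<Rightarrow> (real ^ 'n) set \<Rightarrow> ennreal" where
  "capacity \<Psi> E =
     Inf {\<integral>\<^sup>+x. f x \<partial>lebesgue | f.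
            f \<in> borel_measurable lebesgue \<and> (\<forall>x\<in>E. 1 \<le> potential \<Psi> f x)}"


section \<open>Weak gradients\<close>

text \<open>Infinite differentiability: all iterated directional derivatives are differentiable.\<close>

definition smooth :: "(real ^ 'n \<Rightarrow> real) \<Rightarrow> bool" where
  "smooth \<phi> \<longleftrightarrow>
     (\<forall>vs. foldr (\<lambda>v g x. frechet_derivative g (at x) v) vs \<phi> differentiable_on UNIV)"

definition test_function :: "(real ^ 'n) set \<Rightarrow> (real ^ 'n \<Rightarrow> real) \<Rightarrow> bool" where
  "test_function \<Omega> \<phi> \<longleftrightarrow>
     smooth \<phi> \<and> compact (closure {x. \<phi> x \<noteq> 0}) \<and> closure {x. \<phi> x \<noteq> 0} \<subseteq> \<Omega>"

definition grad :: "(real ^ 'n \<Rightarrow> real) \<Rightarrow> real ^ 'n \<Rightarrow> real ^ 'n" where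
  "grad \<phi> x = (\<chi> i. frechet_derivative \<phi> (at x) (axis i 1))"

definition locally_integrable :: "(real ^ 'n) set \<Rightarrow> (real ^ 'n \<Rightarrow> 'b::euclidean_space) \<Rightarrow> bool" where
  "locally_integrable \<Omega> u \<longleftrightarrow> (\<forall>K. compact K \<and> K \<subseteq> \<Omega> \<longrightarrow> set_integrable lebesgue K u)"

definition weak_gradient ::
  "(real ^ 'n) set \<Rightarrow> (real ^ 'n \<Rightarrow> real) \<Rightarrow> (real ^ 'n \<Rightarrow> real ^ 'n) \<Rightarrow> bool" where
  "weak_gradient \<Omega> u g \<longleftrightarrow>
     locally_integrable \<Omega> u \<and> locally_integrable \<Omega> g \<and>
     (\<forall>\<phi>. test_function \<Omega> \<phi> \<longrightarrow>
        (LINT x:\<Omega>|lebesgue. u x *\<^sub>R grad \<phi> x) = - (LINT x:\<Omega>|lebesgue. \<phi> x *\<^sub>R g x))"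


section \<open>Orlicz and Orlicz--Sobolev spaces\<close>

text \<open>
  Elements of these spaces are functions, not classes modulo equality almost everywhere.
  They are total functions of which only the values on the underlying set matter.
\<close>

definition luxemburg_norm ::
  "(real \<Rightarrow> ennreal) \<Rightarrow> (real ^ 'n) set \<Rightarrow> (real ^ 'n \<Rightarrow> real) \<Rightarrow> ennreal" where
  "luxemburg_norm A E u =
     Inf {ennreal l | l. l > 0 \<and> (\<integral>\<^sup>+x\<in>E. A (\<bar>u x\<bar> / l) \<partial>lebesgue) \<le> 1}"

definition orlicz :: "(real \<Rightarrow> ennreal) \<Rightarrow> (real ^ 'n) set \<Rightarrow> (real ^ 'n \<Rightarrow> real) set" where
  "orlicz A E = {u \<in> borel_measurable (lebesgue_on E). luxemburg_norm A E u < \<infinity>}"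

definition orlicz_sobolev ::
  "(real \<Rightarrow> ennreal) \<Rightarrow> (real ^ 'n) set \<Rightarrow> (real ^ 'n \<Rightarrow> real) set" where
  "orlicz_sobolev A \<Omega> =
     {u \<in> orlicz A \<Omega>. \<exists>g. weak_gradient \<Omega> u g \<and> (\<lambda>x. norm (g x)) \<in> orlicz A \<Omega>}"

definition compactly_inside :: "(real ^ 'n) set \<Rightarrow> (real ^ 'n) set \<Rightarrow> bool" where
  "compactly_inside U \<Omega> \<longleftrightarrow> compact (closure U) \<and> closure U \<subseteq> \<Omega>"

definition orlicz_sobolev_loc ::
  "(real \<Rightarrow> ennreal) \<Rightarrow> (real ^ 'n) set \<Rightarrow> (real ^ 'n \<Rightarrow> real) set" where
  "orlicz_sobolev_loc A \<Omega> =
     {u \<in> borel_measurable (lebesgue_on \<Omega>).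
        \<forall>U. open U \<and> bounded U \<and> compactly_inside U \<Omega> \<longrightarrow> u \<in> orlicz_sobolev A U}"


section \<open>Weakly monotone functions\<close>

text \<open>
  The space $W^{1,1}$ is the Orlicz--Sobolev space of the Young function \<open>A(t) = t\<close>, which is
  the embedding \<^term>\<open>ennreal\<close>; its Luxemburg norm is the norm of $L^1$. The space
  $W^{1,1}_0$ is the closure in $W^{1,1}$ of the smooth functions with compact support.
\<close>

definition sobolev_11_0 :: "(real ^ 'n) set \<Rightarrow> (real ^ 'n \<Rightarrow> real) set" where
  "sobolev_11_0 U =
     {v \<in> orlicz_sobolev ennreal U.
        \<exists>g \<phi>. weak_gradient U v g \<and> (\<forall>k::nat. test_function U (\<phi> k)) \<and>
          (\<lambda>k. luxemburg_norm ennreal U (\<lambda>x. v x - \<phi> k x)) \<longlonglongrightarrow> 0 \<and>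
          (\<lambda>k. luxemburg_norm ennreal U (\<lambda>x. norm (g x - grad (\<phi> k) x))) \<longlonglongrightarrow> 0}"

definition weakly_monotone :: "(real ^ 'n) set \<Rightarrow> (real ^ 'n \<Rightarrow> real) \<Rightarrow> bool" where
  "weakly_monotone \<Omega> u \<longleftrightarrow>
     u \<in> orlicz_sobolev_loc ennreal \<Omega> \<and>
     (\<forall>U m M. open U \<and> compactly_inside U \<Omega> \<and> m \<le> M \<and>
        (\<lambda>x. max (u x - M) 0 - max (m - u x) 0) \<in> sobolev_11_0 U \<longrightarrow>
        (AE x in lebesgue_on U. m \<le> u x \<and> u x \<le> M))"

end

theory Submission
  imports Defs
begin

text \<open>
  Let \<open>x\<close> be a point at which the oscillation of \<open>u\<close> over small balls stays above some \<open>L > 0\<close>.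
  Weak monotonicity forces the mollifications of \<open>u\<close> to oscillate by at least \<open>L / 4\<close> on every
  small sphere around \<open>x\<close>. Joining two points of a sphere to the points of a thin shell along
  paths of radially projected segments bounds this oscillation, averaged over the shell, by the
  integral of \<open>\<bar>\<nabla> u\<bar>\<close> against a kernel with the singularity of the Riesz potential of order one
  in dimension \<open>n - 1\<close>. Young's inequality splits the potential into a modular of
  the gradient and a modular of the kernel; the latter is an integral of the conjugate of \<open>A\<close>,
  which is where the function \<open>A\<^sub>n\<^sub>-\<^sub>1\<close> arises by duality. Letting the mollification
  parameter tend to \<open>0\<close>, the integral of \<open>A (\<bar>\<nabla> u\<bar> / \<Lambda>)\<close> over the shell \<open>a < \<bar>y - x\<bar> < b\<close> is at least
  \<open>(b - a) a\<^sup>n\<^sup>-\<^sup>1 A\<^sub>n\<^sub>-\<^sub>1 (l / a)\<close>. Summing over thin shells, the divergence hypothesis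
  makes the potential of \<open>A (\<bar>\<nabla> u\<bar> / \<Lambda>)\<close> infinite at \<open>x\<close>. Countably many balls cover
  \<open>\<Omega>\<close>, so the set of such points has capacity zero, and off this set \<open>u\<close> agrees
  almost everywhere with a function that is continuous there.
\<close>

section \<open>Young functions and kernel modulars\<close>

text \<open>The exponent \<open>q = (n - 1) / (n - 2)\<close> behind \<open>young_lower\<close> is
  the decay rate of the level sets of the kernel: \<open>riesz_kernel p\<close> exceeds
  \<open>2 ^ k\<close> only on a cone of aperture \<open>2 powr (- k / (n - 2))\<close>, whose part
  in a shell has volume of order \<open>2 powr (- k * q)\<close>. Young's inequality is applied to
  the kernel times a free factor \<open>s > 0\<close>; the supremum over \<open>s\<close> of the
  resulting bounds is a conjugate.

  Two obstacles shape the shell estimate. A mollification oscillates enough on a given sphere only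
  from an index on that depends on the radius, and the two extremal points move with the radius.
  Hence the estimate is stated for a measurable set of radii, whose measure tends to that of the
  full interval, and the shell is cut into pieces on which uniform continuity allows a fixed pair of
  points. The cutting is harmless because the bounds are linear in the thickness
  \<open>b - a\<close>.

  The passage from spheres to balls uses truncations that vanish near the sphere and are therefore
  approximated by test functions. Finally, \<open>\<Psi>\<close> may have zeros: positive constants
  are added to it and removed by monotone convergence.\<close>

lemma young_function_mono:
  assumes "young_function A" "0 \<le> s" "s \<le> t"
  shows "A s \<le> A t"
proof (cases "t = 0")
  case False
  define c where "c = s / t"
  have c: "c \<in> {0..1}" "(1 - c) * 0 + c * t = s"
    using assms False by (auto simp: c_def)
  have "A s \<le> ennreal (1 - c) * A 0 + ennreal c * A t"
  proof -
    have "\<forall>s\<ge>0. \<forall>t\<ge>0. \<forall>c\<in>{0..1}. A ((1 - c) * s + c * t) \<le> ennreal (1 - c) * A s + ennreal c * A t"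
      using assms by (simp add: young_function_def)
    then have "A ((1 - c) * 0 + c * t) \<le> ennreal (1 - c) * A 0 + ennreal c * A t"
      using assms c(1) by (meson order_refl order_trans)
    then show ?thesis by (simp only: c(2))
  qed
  also have "\<dots> \<le> 1 * A t"
    using assms c mult_right_mono[of "ennreal c" 1 "A t"]
    by (auto simp: young_function_def ennreal_le_1)
  finally show ?thesis by simp
qed (use assms in auto)

lemma young_conjugate_mono:
  assumes "s \<le> t"
  shows "young_conjugate A s \<le> young_conjugate A t"
  unfolding young_conjugate_def
proof (rule SUP_mono)
  fix r :: real assume "r \<in> {0..}"
  then show "\<exists>m\<in>{0..}. ennreal (r * s) - A r \<le> ennreal (m * t) - A m"
    using assms by (intro bexI[of _ r] ennreal_minus_mono ennreal_leI mult_left_mono) auto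
qed

lemma young_inequality:
  assumes "0 \<le> s"
  shows "ennreal (s * t) \<le> A s + young_conjugate A t"
proof -
  have "ennreal (s * t) - A s \<le> young_conjugate A t"
    unfolding young_conjugate_def by (rule SUP_upper) (use assms in auto)
  then show ?thesis by (simp add: ennreal_minus_le_iff)
qed

lemma young_conjugate_leI:
  assumes "\<And>s. 0 \<le> s \<Longrightarrow> ennreal (s * t) \<le> A s + I"
  shows "young_conjugate A t \<le> I"
  unfolding young_conjugate_def by (rule SUP_least) (use assms in \<open>auto simp: ennreal_minus_le_iff\<close>)

lemma young_conjugate_zero: "young_conjugate A 0 = 0"
  by (intro antisym young_conjugate_leI) auto

lemma borel_measurable_mono_ennreal:
  fixes f :: "real \<Rightarrow> ennreal"
  assumes "mono f"
  shows "f \<in> borel_measurable borel"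
proof (rule borel_measurableI_greater)
  fix c
  have "is_interval {x. c < f x}"
    unfolding is_interval_1 using assms by (auto simp: mono_def intro: less_le_trans)
  then show "{x \<in> space borel. c < f x} \<in> sets borel"
    by (auto dest: is_real_interval)
qed

lemma measurable_young_function:
  assumes "young_function A"
  shows "(\<lambda>t. A (max 0 t)) \<in> borel_measurable borel"
  by (intro borel_measurable_mono_ennreal monoI young_function_mono[OF assms]) auto

lemma measurable_young_conjugate [measurable]: "young_conjugate A \<in> borel_measurable borel"
  by (intro borel_measurable_mono_ennreal monoI young_conjugate_mono)

text \<open>A finite convex function has a supporting line at every \<open>t > 0\<close>. The
  conjugate at the slope of this line is at most minus its intercept, and testing the biconjugate
  with this slope recovers \<open>A t\<close>. This serves the case \<open>n = 2\<close>, where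
  \<open>young_lower\<close> is \<open>A\<close> itself and not a conjugate.\<close>

lemma young_function_le_biconjugate:
  assumes A: "young_function A" and fin: "\<forall>t\<ge>0. A t < \<infinity>" and t: "0 \<le> t"
  shows "A t \<le> young_conjugate (young_conjugate A) t"
proof (cases "t = 0")
  case True
  with A show ?thesis by (simp add: young_function_def)
next
  case False
  with t have t: "0 < t" by simp
  define a where "a s = enn2real (A s)" for s
  have Aa: "A s = ennreal (a s)" if "0 \<le> s" for s
    using fin that by (auto simp: a_def)
  have a0: "0 \<le> a s" for s by (simp add: a_def)
  have amono: "a s \<le> a r" if "0 \<le> s" "s \<le> r" for s r
    using young_function_mono[OF A that] Aa that a0 by (simp add: ennreal_le_iff)
  have conv: "convex_on {0..} a"
  proof (rule convex_onI)
    fix c s r :: real assume *: "0 < c" "c < 1" "s \<in> {0..}" "r \<in> {0..}"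
    then have "A ((1 - c) * s + c * r) \<le> ennreal (1 - c) * A s + ennreal c * A r"
      using A by (auto simp: young_function_def)
    also have "\<dots> = ennreal ((1 - c) * a s + c * a r)"
      using * by (simp add: Aa a0 ennreal_mult' ennreal_plus)
    finally show "a ((1 - c) *\<^sub>R s + c *\<^sub>R r) \<le> (1 - c) * a s + c * a r"
      using * a0 by (subst (asm) Aa) (auto simp: ennreal_le_iff ennreal_plus[symmetric] simp del: ennreal_plus)
  qed auto
  \<comment> \<open>The right derivative of \<open>a\<close> at \<open>t\<close>. By convexity every
    slope to the left of \<open>t\<close> is at most every slope to the right of it, so the line
    with this slope supports \<open>a\<close> on both sides.\<close>
  define m where "m = (INF x\<in>{t<..}. (a x - a t) / (x - t))"
  have ge0: "0 \<le> (a x - a t) / (x - t)" if "t < x" for x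
    using amono[of t x] t that by auto
  then have bdd: "bdd_below ((\<lambda>x. (a x - a t) / (x - t)) ` {t<..})"
    by (intro bdd_belowI2) auto
  have m0: "0 \<le> m" unfolding m_def by (rule cINF_greatest) (auto intro: ge0)
  have right: "a t + m * (x - t) \<le> a x" if "t < x" for x
  proof -
    have "m \<le> (a x - a t) / (x - t)" unfolding m_def by (rule cINF_lower[OF bdd]) (use that in auto)
    then show ?thesis using that by (simp add: field_simps)
  qed
  have left: "a t + m * (y - t) \<le> a y" if "0 \<le> y" "y < t" for y
  proof -
    have "(a t - a y) / (t - y) \<le> m" unfolding m_def
    proof (rule cINF_greatest)
      fix x assume "x \<in> {t<..}"
      then have x: "t < x" by simp
      show "(a t - a y) / (t - y) \<le> (a x - a t) / (x - t)"
      proof -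
        define c where "c = (t - y) / (x - y)"
        have c5: "t - y = c * (x - y)" using that x by (simp add: c_def)
        have c12: "0 < c" "c < 1" using that x by (auto simp: c_def)
        have "(1 - c) * y + c * x = y + c * (x - y)" by (simp add: algebra_simps)
        also have "\<dots> = t" unfolding c5[symmetric] by simp
        finally have c3: "(1 - c) * y + c * x = t" .
        have "(1 - c) * (x - y) = x - y - c * (x - y)" by (simp add: algebra_simps)
        also have "\<dots> = x - t" unfolding c5[symmetric] by simp
        finally have c4: "x - t = (1 - c) * (x - y)" by (rule sym)
        note c = c12 c3 c4 c5
        have "a ((1 - c) *\<^sub>R y + c *\<^sub>R x) \<le> (1 - c) * a y + c * a x"
          by (rule convex_onD[OF conv]) (use c12 that x in auto)
        then have "a t \<le> (1 - c) * a y + c * a x" by (simp only: real_scaleR_def c3)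
        then have "(1 - c) * (a t - a y) \<le> c * (a x - a t)" by (simp add: algebra_simps)
        then have "(1 - c) * (a t - a y) * (x - y) \<le> c * (a x - a t) * (x - y)"
          using x that by (intro mult_right_mono) auto
        then have "(a t - a y) * (x - t) \<le> (a x - a t) * (t - y)"
          unfolding c(4,5) by (simp add: algebra_simps)
        then show ?thesis using x that by (simp add: frac_le_eq divide_simps mult.commute)
      qed
    qed auto
    then show ?thesis using that by (simp add: field_simps)
  qed
  have supp: "a t + m * (x - t) \<le> a x" if "0 \<le> x" for x
    using left[of x] right[of x] that by (cases x t rule: linorder_cases) auto
  have "young_conjugate A m \<le> ennreal (m * t - a t)"
  proof (rule young_conjugate_leI)
    fix s :: real assume s: "0 \<le> s"
    have "0 \<le> m * t - a t" using supp[of 0] A by (auto simp: a_def young_function_def)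
    moreover have "s * m \<le> a s + (m * t - a t)" using supp[OF s] by (simp add: algebra_simps)
    ultimately show "ennreal (s * m) \<le> A s + ennreal (m * t - a t)"
      using s a0 by (simp add: Aa ennreal_plus[symmetric] ennreal_leI del: ennreal_plus)
  qed
  moreover have "ennreal (m * t) - young_conjugate A m \<le> young_conjugate (young_conjugate A) t"
    using m0 unfolding young_conjugate_def[of "young_conjugate A"] by (intro SUP_upper) auto
  moreover have "ennreal (a t) = ennreal (m * t) - ennreal (m * t - a t)"
    using supp[of 0] A by (subst ennreal_minus) (auto simp: a_def young_function_def)
  ultimately show ?thesis using Aa[of t] t
    by (metis ennreal_minus_mono order_refl order_trans less_imp_le)
qed

text \<open>For \<open>n \<ge> 3\<close> this is the function conjugated in the definition of
  \<open>young_lower\<close>, for \<open>n = 2\<close> the conjugate of \<open>A\<close>. In both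
  cases it bounds the modular of the kernel, so that one duality argument covers all
  dimensions.\<close>

definition young_dual :: "nat \<Rightarrow> (real \<Rightarrow> ennreal) \<Rightarrow> real \<Rightarrow> ennreal" where
  "young_dual n A =
     (if n = 2 then young_conjugate A
      else let q = (real n - 1) / (real n - 2) in
        (\<lambda>t. if t = 0 then 0
          else ennreal (t powr q) *
            (\<integral>\<^sup>+r\<in>{t..}. young_conjugate A r / ennreal (r powr (1 + q)) \<partial>lborel)))"

lemma young_lower_le_conjugate:
  assumes "young_function A" "\<forall>t\<ge>0. young_lower n A t < \<infinity>" "0 \<le> t"
  shows "young_lower n A t \<le> young_conjugate (young_dual n A) t"
proof (cases "n = 2")
  case True
  then show ?thesis using assms young_function_le_biconjugate[of A t]
    by (simp add: young_lower_def young_dual_def)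
next
  case False
  then show ?thesis by (simp add: young_lower_def young_dual_def Let_def)
qed

lemma young_lower_mono:
  assumes "young_function A" "0 \<le> s" "s \<le> t"
  shows "young_lower n A s \<le> young_lower n A t"
  using young_function_mono[OF assms] young_conjugate_mono[OF assms(3)]
  by (auto simp: young_lower_def Let_def)

text \<open>The sum is compared with the integral over \<open>{s..}\<close> block by block. On
  \<open>{s * 2 ^ k ..< s * 2 ^ Suc k}\<close> the conjugate is at least its value at the left end,
  and the power in the denominator is at most its value at the right end, which is twice the left
  end; this costs the factor \<open>2 powr (1 + q)\<close>.\<close>

lemma sum_young_conjugate_le_young_dual:
  assumes n: "3 \<le> n" and s: "0 < s"
  defines "q \<equiv> (real n - 1) / (real n - 2)"
  shows "(\<Sum>k. young_conjugate A (s * 2 ^ k) * ennreal (2 powr (- real k * q)))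
           \<le> ennreal (2 powr (1 + q)) * young_dual n A s"
proof -
  define h where "h r = young_conjugate A r / ennreal (r powr (1 + q))" for r
  have [measurable]: "h \<in> borel_measurable borel" unfolding h_def by measurable
  have q: "0 < q" using n by (simp add: q_def)
  define I where "I k = {s * 2 ^ k ..< s * 2 ^ Suc k}" for k :: nat
  have I: "indicator {s..} r \<ge> (\<Sum>k. indicator (I k) r :: ennreal)" for r
  proof -
    have disj: "disjoint_family I"
      unfolding disjoint_family_on_def
    proof (intro ballI impI)
      fix i j :: nat assume "i \<noteq> j"
      then consider "Suc i \<le> j" | "Suc j \<le> i" by linarith
      then show "I i \<inter> I j = {}"
      proof cases
        case 1
        then have "s * 2 ^ Suc i \<le> s * 2 ^ j" using s by (intro mult_left_mono power_increasing) auto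
        then show ?thesis by (auto simp: I_def)
      next
        case 2
        then have "s * 2 ^ Suc j \<le> s * 2 ^ i" using s by (intro mult_left_mono power_increasing) auto
        then show ?thesis by (auto simp: I_def)
      qed
    qed
    have sub: "(\<Union>k. I k) \<subseteq> {s..}"
    proof
      fix r assume "r \<in> (\<Union>k. I k)"
      then obtain k where "s * 2 ^ k \<le> r" by (auto simp: I_def)
      moreover have "s * 1 \<le> s * 2 ^ k" using s by (intro mult_left_mono) auto
      ultimately show "r \<in> {s..}" by auto
    qed
    have "(\<Sum>k. indicator (I k) r :: ennreal) = indicator (\<Union>k. I k) r"
      by (rule suminf_indicator[OF disj])
    also have "\<dots> \<le> indicator {s..} r" using sub by (auto simp: indicator_def)
    finally show ?thesis .
  qed
  have piece: "young_conjugate A (s * 2 ^ k) * ennreal (2 powr (- real k * q))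
      \<le> ennreal (2 powr (1 + q) * s powr q) * (\<integral>\<^sup>+r. h r * indicator (I k) r \<partial>lborel)" for k
  proof -
    define x where "x = s * 2 ^ k"
    have x: "0 < x" using s by (simp add: x_def)
    have Ik: "I k = {x..<2 * x}" by (simp add: I_def x_def algebra_simps)
    have "2 powr (- real k * q) = (2 powr real k) powr (- q)"
      by (simp add: powr_powr)
    also have "2 powr real k = x / s" using s by (simp add: x_def powr_realpow)
    also have "(x / s) powr (- q) = 2 powr (1 + q) * s powr q * (x / (2 * x) powr (1 + q))"
      using x s by (simp add: powr_minus powr_divide powr_mult powr_add field_simps)
    finally have eq: "2 powr (- real k * q) = 2 powr (1 + q) * s powr q * (x / (2 * x) powr (1 + q))" .
    have le: "young_conjugate A x * ennreal (1 / (2 * x) powr (1 + q)) \<le> h r" if "r \<in> I k" for r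
      unfolding h_def divide_ennreal_def
      by (intro mult_mono young_conjugate_mono)
         (use that x q in \<open>auto simp: Ik inverse_ennreal field_simps intro!: ennreal_leI powr_mono2\<close>)
    have "young_conjugate A x * ennreal (1 / (2 * x) powr (1 + q)) * ennreal x
        = (\<integral>\<^sup>+r. young_conjugate A x * ennreal (1 / (2 * x) powr (1 + q)) * indicator (I k) r \<partial>lborel)"
      using x by (simp add: Ik nn_integral_cmult_indicator)
    also have "\<dots> \<le> (\<integral>\<^sup>+r. h r * indicator (I k) r \<partial>lborel)"
      using le by (intro nn_integral_mono) (auto simp: indicator_def)
    finally have *: "young_conjugate A x * ennreal (1 / (2 * x) powr (1 + q)) * ennreal x
        \<le> (\<integral>\<^sup>+r. h r * indicator (I k) r \<partial>lborel)" .
    have "young_conjugate A x * ennreal (2 powr (- real k * q))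
       = ennreal (2 powr (1 + q) * s powr q)
          * (young_conjugate A x * (ennreal (1 / (2 * x) powr (1 + q)) * ennreal x))"
      unfolding eq using x by (simp add: ennreal_mult'[symmetric] mult_ac)
    also have "\<dots> \<le> ennreal (2 powr (1 + q) * s powr q) * (\<integral>\<^sup>+r. h r * indicator (I k) r \<partial>lborel)"
      using * by (intro mult_left_mono) (auto simp: mult_ac)
    finally show ?thesis by (simp add: x_def)
  qed
  have [measurable]: "I k \<in> sets borel" for k by (simp add: I_def)
  have "(\<Sum>k. young_conjugate A (s * 2 ^ k) * ennreal (2 powr (- real k * q)))
      \<le> (\<Sum>k. ennreal (2 powr (1 + q) * s powr q) * (\<integral>\<^sup>+r. h r * indicator (I k) r \<partial>lborel))"
    by (intro suminf_le piece) auto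
  also have "\<dots> = ennreal (2 powr (1 + q) * s powr q) * (\<integral>\<^sup>+r. h r * (\<Sum>k. indicator (I k) r) \<partial>lborel)"
    by (subst ennreal_suminf_cmult, subst nn_integral_suminf[symmetric]) auto
  also have "\<dots> \<le> ennreal (2 powr (1 + q) * s powr q) * (\<integral>\<^sup>+r. h r * indicator {s..} r \<partial>lborel)"
    by (intro mult_left_mono nn_integral_mono I) auto
  also have "\<dots> = ennreal (2 powr (1 + q)) * young_dual n A s"
    using n s by (simp add: young_dual_def h_def q_def Let_def ennreal_mult' mult_ac)
  finally show ?thesis .
qed

section \<open>Volume of cones in thin shells, and the modular of the kernel\<close>

lemma nn_integral_lborel_affine:
  fixes f :: "'a::euclidean_space \<Rightarrow> ennreal"
  assumes [measurable]: "f \<in> borel_measurable borel" and c: "c \<noteq> 0"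
  shows "(\<integral>\<^sup>+x. f x \<partial>lborel) = ennreal (\<bar>c\<bar> ^ DIM('a)) * (\<integral>\<^sup>+x. f (t + c *\<^sub>R x) \<partial>lborel)"
  by (subst lborel_affine[OF c, of t])
     (simp add: nn_integral_density nn_integral_distr nn_integral_cmult)

lemma power_diff_le:
  fixes a b :: real
  assumes "0 \<le> a" "a \<le> b"
  shows "b ^ Suc m - a ^ Suc m \<le> real (Suc m) * b ^ m * (b - a)"
proof (induction m)
  case (Suc m)
  have "b ^ Suc (Suc m) - a ^ Suc (Suc m) = b * (b ^ Suc m - a ^ Suc m) + a ^ Suc m * (b - a)"
    by (simp add: algebra_simps)
  also have "\<dots> \<le> b * (real (Suc m) * b ^ m * (b - a)) + b ^ Suc m * (b - a)"
    using assms by (intro add_mono mult_left_mono mult_right_mono Suc power_mono) auto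
  finally show ?case by (simp add: algebra_simps)
qed simp

text \<open>The factor \<open>1 / 2\<close> bounds this by \<open>1\<close>.\<close>

definition deviation :: "'a::euclidean_space \<Rightarrow> 'a \<Rightarrow> real" where
  "deviation p y = norm (sgn y - p) / 2"

text \<open>The kernel depends on the direction of \<open>y\<close> alone. On the ray through
  \<open>p\<close>, where \<open>deviation\<close> is \<open>0\<close>, the convention for
  \<open>powr\<close> gives the value \<open>0\<close> instead of infinity. In dimension 2 the
  kernel is the constant 1 off this ray.\<close>

definition riesz_kernel :: "'a::euclidean_space \<Rightarrow> 'a \<Rightarrow> real" where
  "riesz_kernel p y = deviation p y powr (2 - real DIM('a))"

lemma measurable_deviation [measurable]: "deviation p \<in> borel_measurable borel"
  unfolding deviation_def[abs_def] by measurable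

lemma measurable_riesz_kernel [measurable]: "riesz_kernel p \<in> borel_measurable borel"
  unfolding riesz_kernel_def[abs_def] by measurable

lemma deviation_le_1: "norm p = 1 \<Longrightarrow> deviation p y \<le> 1"
  using norm_triangle_ineq4[of "sgn y" p] by (auto simp: deviation_def norm_sgn split: if_splits)

lemma deviation_nonneg: "0 \<le> deviation p y"
  by (simp add: deviation_def)

lemma riesz_kernel_nonneg: "0 \<le> riesz_kernel p y"
  by (simp add: riesz_kernel_def)

lemma deviation_scaleR: "0 < c \<Longrightarrow> deviation p (c *\<^sub>R y) = deviation p y"
  by (simp add: deviation_def sgn_scaleR)

lemma norm_scaleR_sgn: "norm y *\<^sub>R sgn y = (y::'a::real_normed_vector)"
  by (cases "y = 0") (simp_all add: sgn_div_norm)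

text \<open>The part of the cone inside the unit ball is covered by about \<open>1 / \<theta>\<close> balls of radius \<open>3 \<theta>\<close>
  centred on its axis.\<close>

lemma emeasure_cone_le:
  fixes p :: "'a::euclidean_space"
  assumes p: "norm p = 1" and th: "0 < \<theta>" "\<theta> \<le> 1"
  shows "emeasure lborel {y. norm y < 1 \<and> deviation p y \<le> \<theta>}
     \<le> ennreal (2 * 3 ^ DIM('a) * unit_ball_vol (real DIM('a)) * \<theta> ^ (DIM('a) - 1))"
proof -
  define m where "m = nat \<lfloor>1 / \<theta>\<rfloor>"
  let ?B = "\<lambda>j::nat. cball ((real j * \<theta>) *\<^sub>R p) (3 * \<theta>)"
  have "{y. norm y < 1 \<and> deviation p y \<le> \<theta>} \<subseteq> (\<Union>j\<in>{..m}. ?B j)"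
  proof
    fix y assume "y \<in> {y. norm y < 1 \<and> deviation p y \<le> \<theta>}"
    then have y: "norm y < 1" "norm (sgn y - p) \<le> 2 * \<theta>" by (auto simp: deviation_def)
    define j where "j = nat \<lfloor>norm y / \<theta>\<rfloor>"
    have "norm y / \<theta> \<le> 1 / \<theta>" using y th by (simp add: divide_right_mono)
    then have "j \<le> m" unfolding j_def m_def by (intro nat_mono floor_mono)
    have fl: "real j = of_int \<lfloor>norm y / \<theta>\<rfloor>" using th by (simp add: j_def)
    have "real j \<le> norm y / \<theta>" "norm y / \<theta> < real j + 1"
      using floor_correct[of "norm y / \<theta>"] unfolding fl by linarith+
    then have "real j * \<theta> \<le> norm y" "norm y < real j * \<theta> + \<theta>"
      using th by (simp_all add: pos_le_divide_eq pos_divide_less_eq distrib_right)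
    \<comment> \<open>The centre on the axis misses \<open>y\<close> by two errors: at most
      \<open>\<theta>\<close> from rounding \<open>norm y\<close> down to a multiple of
      \<open>\<theta>\<close>, and at most \<open>2 * \<theta>\<close> from turning the direction
      \<open>sgn y\<close> into \<open>p\<close>. This is the radius
      \<open>3 * \<theta>\<close>.\<close>
    then have 1: "norm ((norm y - real j * \<theta>) *\<^sub>R p) \<le> \<theta>" using p by simp
    have "norm (norm y *\<^sub>R (sgn y - p)) \<le> 1 * (2 * \<theta>)"
      unfolding norm_scaleR using y th by (intro mult_mono) auto
    then have "norm (norm y *\<^sub>R (sgn y - p) + (norm y - real j * \<theta>) *\<^sub>R p) \<le> 2 * \<theta> + \<theta>"
      using 1 by (intro norm_triangle_le) auto
    also have "norm y *\<^sub>R (sgn y - p) + (norm y - real j * \<theta>) *\<^sub>R p = y - (real j * \<theta>) *\<^sub>R p"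
      by (simp add: algebra_simps norm_scaleR_sgn)
    finally have "y \<in> ?B j" by (simp add: dist_norm norm_minus_commute)
    with \<open>j \<le> m\<close> show "y \<in> (\<Union>j\<in>{..m}. ?B j)" by auto
  qed
  then have "emeasure lborel {y. norm y < 1 \<and> deviation p y \<le> \<theta>} \<le> emeasure lborel (\<Union>j\<in>{..m}. ?B j)"
    by (intro emeasure_mono) auto
  also have "\<dots> \<le> (\<Sum>j\<in>{..m}. emeasure lborel (?B j))"
    by (intro emeasure_subadditive_finite) auto
  also have "\<dots> = ennreal (real (Suc m) * (unit_ball_vol (real DIM('a)) * (3 * \<theta>) ^ DIM('a)))"
    using th by (simp add: emeasure_cball ennreal_of_nat_eq_real_of_nat ennreal_mult'[symmetric] del: of_nat_Suc)
  also have "\<dots> \<le> ennreal (2 / \<theta> * (unit_ball_vol (real DIM('a)) * (3 * \<theta>) ^ DIM('a)))"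
  proof (intro ennreal_leI mult_right_mono)
    have "real m \<le> 1 / \<theta>" using th by (simp add: m_def)
    moreover have "1 \<le> 1 / \<theta>" using th by simp
    ultimately show "real (Suc m) \<le> 2 / \<theta>" by simp
  qed (use th in auto)
  also have "2 / \<theta> * (unit_ball_vol (real DIM('a)) * (3 * \<theta>) ^ DIM('a))
     = 2 * 3 ^ DIM('a) * unit_ball_vol (real DIM('a)) * \<theta> ^ (DIM('a) - 1)"
    using th power_Suc[of \<theta> "DIM('a) - 1"] by (simp add: power_mult_distrib field_simps)
  finally show ?thesis .
qed

definition cone_const :: "nat \<Rightarrow> real" where
  "cone_const n = real n * (2 * 3 ^ n * unit_ball_vol (real n))"

lemma cone_const_nonneg: "0 \<le> cone_const n"
  by (simp add: cone_const_def)

text \<open>The cone is invariant under dilations, so its part in the ball of radius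
  \<open>r\<close> has \<open>r ^ n\<close> times the volume of the part in the unit ball, and
  \<open>b ^ n - a ^ n\<close> is at most \<open>n * b ^ (n - 1) * (b - a)\<close>. This is the
  origin of the factor \<open>n\<close> in \<open>cone_const\<close>, and it makes the bound linear
  in the thickness of the shell.\<close>

lemma emeasure_cone_annulus_le:
  fixes p :: "'a::euclidean_space"
  assumes p: "norm p = 1" and th: "0 < \<theta>" "\<theta> \<le> 1" and ab: "0 < a" "a \<le> b"
  shows "emeasure lborel {y. a < norm y \<and> norm y < b \<and> deviation p y \<le> \<theta>}
     \<le> ennreal (cone_const DIM('a) * (b - a) * b ^ (DIM('a) - 1) * \<theta> ^ (DIM('a) - 1))"
proof -
  let ?V = "\<lambda>r. {y::'a. norm y < r \<and> deviation p y \<le> \<theta>}"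
  define v where "v = 2 * 3 ^ DIM('a) * unit_ball_vol (real DIM('a)) * \<theta> ^ (DIM('a) - 1)"
  have fin: "emeasure lborel (?V 1) < \<infinity>"
    using emeasure_cone_le[OF p th] by (simp add: less_top[symmetric] top_unique)
       (metis ennreal_less_top less_top order_le_less_trans)
  define w where "w = enn2real (emeasure lborel (?V 1))"
  have w: "emeasure lborel (?V 1) = ennreal w" "0 \<le> w" using fin by (auto simp: w_def)
  have wv: "w \<le> v" using emeasure_cone_le[OF p th] th unfolding w v_def
    by (subst (asm) ennreal_le_iff) auto
  have V: "emeasure lborel (?V r) = ennreal (r ^ DIM('a) * w)" if r: "0 < r" for r
  proof -
    have [measurable]: "?V r \<in> sets borel" by measurable
    have "emeasure lborel (?V r) = (\<integral>\<^sup>+y. indicator (?V r) y \<partial>lborel)" by simp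
    also have "\<dots> = ennreal (r ^ DIM('a)) * (\<integral>\<^sup>+y. indicator (?V r) (0 + r *\<^sub>R y) \<partial>lborel)"
      using r by (subst nn_integral_lborel_affine[of _ r 0]) auto
    also have "(\<lambda>y. indicator (?V r) (0 + r *\<^sub>R y) :: ennreal) = indicator (?V 1)"
      using r by (auto simp: indicator_def deviation_scaleR fun_eq_iff)
    finally show ?thesis using r w by (simp add: ennreal_mult')
  qed
  have "emeasure lborel {y. a < norm y \<and> norm y < b \<and> deviation p y \<le> \<theta>} \<le> emeasure lborel (?V b - ?V a)"
    by (intro emeasure_mono) auto
  also have "\<dots> = emeasure lborel (?V b) - emeasure lborel (?V a)"
    using ab by (intro emeasure_Diff) (auto simp: V)
  also have "\<dots> = ennreal ((b ^ DIM('a) - a ^ DIM('a)) * w)"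
    using ab w by (simp add: V ennreal_minus left_diff_distrib)
  also have "\<dots> \<le> ennreal (real DIM('a) * b ^ (DIM('a) - 1) * (b - a) * v)"
  proof (intro ennreal_leI mult_mono wv)
    show "b ^ DIM('a) - a ^ DIM('a) \<le> real DIM('a) * b ^ (DIM('a) - 1) * (b - a)"
      using power_diff_le[of a b "DIM('a) - 1"] ab by simp
  qed (use w ab in auto)
  finally show ?thesis by (simp add: cone_const_def v_def mult_ac)
qed

text \<open>Write \<open>q\<close> for the quotient. The exponent is \<open>1 + q\<close> from the
  dyadic comparison plus another \<open>q\<close> from bounding the kernel on its
  \<open>k\<close>-th layer by \<open>2 ^ Suc k\<close>. For \<open>n = 2\<close> the quotient is a
  division by zero, hence \<open>0\<close>, and the constant is
  \<open>2 * cone_const 2\<close>.\<close>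

definition dual_const :: "nat \<Rightarrow> real" where
  "dual_const n = cone_const n * 2 powr (1 + 2 * ((real n - 1) / (real n - 2)))"

text \<open>The layer on which the kernel lies between \<open>2 ^ k\<close> and
  \<open>2 ^ Suc k\<close> is contained in the cone of aperture
  \<open>\<theta> k = 2 powr (- k / (n - 2))\<close>, whose volume in the shell carries the factor
  \<open>\<theta> k ^ (n - 1) = 2 powr (- k * q)\<close>. Summing over the layers produces the
  dyadic sum for \<open>young_dual\<close>. For \<open>n = 2\<close> the kernel is at most 1 and the
  whole shell is a cone of aperture 1.\<close>

lemma nn_integral_young_conjugate_riesz_kernel_le:
  fixes p :: "'a::euclidean_space"
  assumes n: "2 \<le> DIM('a)" and p: "norm p = 1" and ab: "0 < a" "a \<le> b" and s: "0 < s"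
  shows "(\<integral>\<^sup>+y\<in>{y. a < norm y \<and> norm y < b}. young_conjugate A (s * riesz_kernel p y) \<partial>lborel)
     \<le> ennreal (dual_const DIM('a) * (b - a) * b ^ (DIM('a) - 1)) * young_dual DIM('a) A s"
proof -
  define X where "X = {y::'a. a < norm y \<and> norm y < b}"
  have [measurable]: "X \<in> sets borel" unfolding X_def by measurable
  define M where "M = cone_const DIM('a) * (b - a) * b ^ (DIM('a) - 1)"
  have M: "0 \<le> M" using ab cone_const_nonneg by (auto simp: M_def)
  show ?thesis
  proof (cases "DIM('a) = 2")
    case True
    have le: "riesz_kernel p y \<le> 1" for y
      using True by (auto simp: riesz_kernel_def)
    have "(\<integral>\<^sup>+y\<in>X. young_conjugate A (s * riesz_kernel p y) \<partial>lborel)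
        \<le> (\<integral>\<^sup>+y\<in>X. young_conjugate A s \<partial>lborel)"
      using s le by (intro nn_integral_mono mult_right_mono young_conjugate_mono) auto
    also have "\<dots> = young_conjugate A s * emeasure lborel X"
      by (simp add: nn_integral_cmult_indicator)
    also have "\<dots> \<le> young_conjugate A s * ennreal M"
    proof (intro mult_left_mono)
      have "X = {y. a < norm y \<and> norm y < b \<and> deviation p y \<le> 1}"
        using deviation_le_1[OF p] by (auto simp: X_def)
      then show "emeasure lborel X \<le> ennreal M"
        using emeasure_cone_annulus_le[OF p, of 1 a b] ab by (simp add: M_def)
    qed auto
    also have "\<dots> \<le> ennreal (dual_const DIM('a) * (b - a) * b ^ (DIM('a) - 1)) * young_dual DIM('a) A s"
    proof -
      have "dual_const DIM('a) * (b - a) * b ^ (DIM('a) - 1) = 2 * M"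
        using True by (simp add: dual_const_def M_def)
      then show ?thesis using True M
        by (subst mult.commute) (auto simp: young_dual_def intro!: mult_right_mono ennreal_leI)
    qed
    finally show ?thesis by (simp add: X_def)
  next
    case False
    then have n3: "3 \<le> DIM('a)" using n by simp
    define q where "q = (real DIM('a) - 1) / (real DIM('a) - 2)"
    define \<theta> where "\<theta> k = 2 powr (- real k / (real DIM('a) - 2))" for k :: nat
    have th: "0 < \<theta> k" "\<theta> k \<le> 1" for k
      using n3 powr_mono[of "- real k / (real DIM('a) - 2)" 0 2] by (auto simp: \<theta>_def)
    define Y where "Y k = {y. a < norm y \<and> norm y < b \<and> deviation p y \<le> \<theta> k}" for k
    have [measurable]: "Y k \<in> sets borel" for k unfolding Y_def by measurable
    \<comment> \<open>The sets \<open>Y k\<close> are nested, so the sum counts a point several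
      times. Only one term is used for the lower bound, with \<open>k\<close> the integer part of
      the binary logarithm of the kernel. On the ray through \<open>p\<close> the kernel is
      \<open>0\<close>, and the conjugate vanishes there.\<close>
    have pw: "young_conjugate A (s * riesz_kernel p y) * indicator X y
       \<le> (\<Sum>k. young_conjugate A (s * 2 ^ Suc k) * indicator (Y k) y)" for y
    proof (cases "y \<in> X \<and> deviation p y \<noteq> 0")
      case True
      define d where "d = deviation p y"
      have d: "0 < d" "d \<le> 1" using True deviation_nonneg[of p y] deviation_le_1[OF p, of y] by (auto simp: d_def)
      define \<kappa> where "\<kappa> = riesz_kernel p y"
      have \<kappa>: "\<kappa> = d powr (2 - real DIM('a))" by (simp add: \<kappa>_def riesz_kernel_def d_def)
      have "1 \<le> \<kappa>" unfolding \<kappa> using d n3 powr_mono'[of "2 - real DIM('a)" 0 d] by simp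
      define k where "k = nat \<lfloor>log 2 \<kappa>\<rfloor>"
      have l0: "0 \<le> log 2 \<kappa>" using \<open>1 \<le> \<kappa>\<close> by simp
      then have k: "real k \<le> log 2 \<kappa>" "log 2 \<kappa> \<le> real k + 1"
        using floor_correct[of "log 2 \<kappa>"] by (auto simp: k_def)
      have "2 powr (log 2 \<kappa>) \<le> 2 powr (real (Suc k))" using k by (intro powr_mono) auto
      then have up: "\<kappa> \<le> 2 ^ Suc k" using \<open>1 \<le> \<kappa>\<close> by (simp only: powr_realpow powr_log_cancel)
      have dlog: "log 2 \<kappa> = (2 - real DIM('a)) * log 2 d" using d by (simp add: \<kappa> log_powr)
      have "log 2 d \<le> - real k / (real DIM('a) - 2)"
        using k(1) n3 unfolding dlog by (simp add: field_simps)
      then have "2 powr (log 2 d) \<le> \<theta> k" unfolding \<theta>_def by (intro powr_mono) auto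
      then have "y \<in> Y k" using True d by (simp add: Y_def X_def d_def)
      have "young_conjugate A (s * riesz_kernel p y) * indicator X y \<le> young_conjugate A (s * 2 ^ Suc k) * indicator (Y k) y"
        using \<open>y \<in> Y k\<close> up s by (auto simp: \<kappa>_def indicator_def intro!: young_conjugate_mono)
      also have "\<dots> \<le> (\<Sum>k. young_conjugate A (s * 2 ^ Suc k) * indicator (Y k) y)"
      proof -
        have "(\<Sum>k\<in>{k}. young_conjugate A (s * 2 ^ Suc k) * indicator (Y k) y)
            \<le> (\<Sum>k. young_conjugate A (s * 2 ^ Suc k) * indicator (Y k) y)"
          by (rule sum_le_suminf) auto
        then show ?thesis by (simp only: sum.insert sum.empty finite.intros empty_iff if_False add_0_right not_False_eq_True)
      qed
      finally show ?thesis .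
    qed (auto simp: riesz_kernel_def young_conjugate_zero)
    \<comment> \<open>The value on layer \<open>k\<close> is bounded by the conjugate at
      \<open>s * 2 ^ Suc k\<close>, so the power is rewritten with the same index
      \<open>Suc k\<close>.\<close>
    have pow: "\<theta> k ^ (DIM('a) - 1) = 2 powr q * 2 powr (- real (Suc k) * q)" for k
    proof -
      have "\<theta> k ^ (DIM('a) - 1) = \<theta> k powr real (DIM('a) - 1)" using th by (simp add: powr_realpow del: of_nat_diff)
      also have "\<dots> = 2 powr (- real k * q)" using n3
        by (simp add: \<theta>_def powr_powr q_def of_nat_diff)
      also have "\<dots> = 2 powr q * 2 powr (- real (Suc k) * q)"
        by (simp add: powr_add[symmetric] algebra_simps)
      finally show ?thesis .
    qed
    let ?f = "\<lambda>k. young_conjugate A (s * 2 ^ k) * ennreal (2 powr (- real k * q))"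
    have "(\<integral>\<^sup>+y\<in>X. young_conjugate A (s * riesz_kernel p y) \<partial>lborel)
        \<le> (\<integral>\<^sup>+y. (\<Sum>k. young_conjugate A (s * 2 ^ Suc k) * indicator (Y k) y) \<partial>lborel)"
      by (intro nn_integral_mono pw)
    also have "\<dots> = (\<Sum>k. young_conjugate A (s * 2 ^ Suc k) * emeasure lborel (Y k))"
      by (subst nn_integral_suminf) (auto simp: nn_integral_cmult_indicator)
    also have "\<dots> \<le> (\<Sum>k. young_conjugate A (s * 2 ^ Suc k) * ennreal (M * \<theta> k ^ (DIM('a) - 1)))"
      using emeasure_cone_annulus_le[OF p th ab]
      by (intro suminf_le mult_left_mono) (auto simp: Y_def M_def)
    also have "\<dots> = (\<Sum>k. ennreal (M * 2 powr q) * ?f (Suc k))"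
      unfolding pow using M by (intro suminf_cong) (simp add: ennreal_mult' mult_ac)
    also have "\<dots> = ennreal (M * 2 powr q) * (\<Sum>k. ?f (Suc k))"
      by simp
    also have "\<dots> \<le> ennreal (M * 2 powr q) * (\<Sum>k. ?f k)"
      using suminf_offset[of ?f 1] by (intro mult_left_mono) auto
    also have "\<dots> \<le> ennreal (M * 2 powr q) * (ennreal (2 powr (1 + q)) * young_dual DIM('a) A s)"
      unfolding q_def by (intro mult_left_mono sum_young_conjugate_le_young_dual n3 s) auto
    also have "\<dots> = ennreal (dual_const DIM('a) * (b - a) * b ^ (DIM('a) - 1)) * young_dual DIM('a) A s"
    proof -
      have "dual_const DIM('a) = cone_const DIM('a) * (2 powr q * 2 powr (1 + q))"
        by (simp add: dual_const_def q_def[symmetric] powr_add[symmetric] add_ac)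
      then have "dual_const DIM('a) * (b - a) * b ^ (DIM('a) - 1) = M * 2 powr q * 2 powr (1 + q)"
        by (simp add: M_def mult_ac)
      then show ?thesis using M by (simp add: mult.assoc[symmetric] ennreal_mult'[symmetric])
    qed
    finally show ?thesis by (simp add: X_def)
  qed
qed

section \<open>Oscillation on spheres\<close>

lemma nn_integral_inverse_power_tail:
  fixes c :: real
  assumes c: "0 < c" and m: "0 < m"
  shows "(\<integral>\<^sup>+t. ennreal (1 / t ^ Suc m) * indicator {c..} t \<partial>lborel) = ennreal (1 / (real m * c ^ m))"
proof -
  have "(\<integral>\<^sup>+t. ennreal (1 / t ^ Suc m) * indicator {c..} t \<partial>lborel) = 0 - (- 1 / (real m * c ^ m))"
  proof (rule nn_integral_FTC_atLeast)
    fix t :: real assume t: "c \<le> t"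
    then have t0: "t \<noteq> 0" using c by auto
    obtain k where k: "m = Suc k" using m by (cases m) auto
    have "((\<lambda>x. - 1 / (real m * x ^ m)) has_real_derivative
        - ((0 * (real m * t ^ m) - 1 * (real m * (real m * t ^ (m - Suc 0)))) / (real m * t ^ m * (real m * t ^ m)))) (at t)"
      using t0 m by (auto intro!: derivative_eq_intros)
    also have "- ((0 * (real m * t ^ m) - 1 * (real m * (real m * t ^ (m - Suc 0)))) / (real m * t ^ m * (real m * t ^ m)))
        = 1 / t ^ Suc m"
      using t0 m by (simp add: k del: of_nat_Suc) 
    finally show "((\<lambda>x. - 1 / (real m * x ^ m)) has_real_derivative 1 / t ^ Suc m) (at t)" .
    show "0 \<le> 1 / t ^ Suc m" using t c by simp
  next
    have "filterlim (\<lambda>x::real. real m * x ^ m) at_top at_top"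
      using m by (intro filterlim_tendsto_pos_mult_at_top[OF tendsto_const] filterlim_pow_at_top filterlim_ident) auto
    then show "((\<lambda>x. - 1 / (real m * x ^ m)) \<longlongrightarrow> 0) at_top"
      by (rule real_tendsto_divide_at_top[OF tendsto_const])
  qed measurable
  then show ?thesis by simp
qed

section \<open>Paths on spheres obtained by radial projection of segments\<close>

text \<open>This is the derivative in \<open>t\<close> of the direction
  \<open>sgn (p + t *\<^sub>R (z - p))\<close>: the component of \<open>z - p\<close> orthogonal to
  the current direction, divided by the distance from the origin.\<close>

definition radial_velocity :: "'a::euclidean_space \<Rightarrow> 'a \<Rightarrow> real \<Rightarrow> 'a" where
  "radial_velocity p z t = (1 / norm (p + t *\<^sub>R (z - p))) *\<^sub>R ((z - p)
        - (sgn (p + t *\<^sub>R (z - p)) \<bullet> (z - p)) *\<^sub>R sgn (p + t *\<^sub>R (z - p)))"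

context
  fixes p e z :: "'a::euclidean_space"
  assumes p: "norm p = 1" and e: "norm e = 1" "0 \<le> e \<bullet> p" and z: "norm (z - e) \<le> 1 / 4"
begin

text \<open>The angle between \<open>p\<close> and \<open>e\<close> is at most a right angle, so the
  chord from \<open>p\<close> to \<open>e\<close> keeps at least the distance \<open>1 / 2\<close>
  from the origin, and moving its end from \<open>e\<close> to \<open>z\<close> costs at most
  \<open>1 / 4\<close>. Thus the radial projection of the segment is defined, with bounded
  speed.\<close>

lemma segment_norm_ge:
  assumes t: "0 \<le> t" "t \<le> 1"
  shows "1 / 4 \<le> norm (p + t *\<^sub>R (z - p))"
proof -
  let ?v = "(1 - t) *\<^sub>R p + t *\<^sub>R e"
  have pe: "p \<bullet> p = 1" "e \<bullet> e = 1" using p e by (auto simp: dot_square_norm)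
  have "(norm ?v)\<^sup>2 = (1 - t)\<^sup>2 + t\<^sup>2 + 2 * t * (1 - t) * (e \<bullet> p)"
    unfolding power2_norm_eq_inner
    by (simp add: inner_add_left inner_add_right pe inner_commute power2_eq_square algebra_simps)
  also have "\<dots> \<ge> (1 - t)\<^sup>2 + t\<^sup>2" using t e by simp
  also have "(1 - t)\<^sup>2 + t\<^sup>2 = 2 * (t - 1 / 2)\<^sup>2 + 1 / 2" by (simp add: power2_eq_square algebra_simps)
  finally have "2 * (t - 1 / 2)\<^sup>2 + 1 / 2 \<le> (norm ?v)\<^sup>2" .
  moreover have "(1 / 2 :: real)\<^sup>2 = 1 / 4" by (simp add: power2_eq_square)
  ultimately have "(1 / 2)\<^sup>2 \<le> (norm ?v)\<^sup>2"
    using zero_le_power2[of "t - 1/2"] by linarith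
  then have "1 / 2 \<le> norm ?v" by (rule power2_le_imp_le) simp
  moreover have "norm (t *\<^sub>R (z - e)) \<le> 1 * (1 / 4)"
    unfolding norm_scaleR using t z by (intro mult_mono) auto
  moreover have "p + t *\<^sub>R (z - p) = ?v + t *\<^sub>R (z - e)" by (simp add: algebra_simps)
  ultimately show ?thesis using norm_diff_ineq[of ?v "t *\<^sub>R (z - e)"] by simp
qed

lemma segment_norm_le:
  assumes t: "0 \<le> t" "t \<le> 1"
  shows "norm (p + t *\<^sub>R (z - p)) \<le> 2"
proof -
  have "norm z \<le> 2" using z e norm_triangle_sub[of z e] by simp
  then have "norm ((1 - t) *\<^sub>R p + t *\<^sub>R z) \<le> (1 - t) * 2 + t * 2"
    using t p by (intro norm_triangle_le add_mono) (auto intro!: mult_mono)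
  then show ?thesis by (simp add: algebra_simps)
qed

lemma segment_dist_le:
  assumes t: "0 \<le> t"
  shows "norm (p + t *\<^sub>R (z - p) - p) \<le> 3 * t"
proof -
  have "norm (z - p) \<le> 3"
    using z e p norm_triangle_sub[of z e] norm_triangle_ineq4[of z p] by simp
  then show ?thesis using t by (simp add: mult_left_mono mult.commute[of 3])
qed

text \<open>The velocity of the radial projection of the segment is tangential, so only the
  component of \<open>p\<close> orthogonal to the current direction contributes to it.\<close>

lemma
  assumes t: "0 \<le> t" "t \<le> 1"
  shows has_vector_derivative_radial_projection:
      "((\<lambda>t. sgn (p + t *\<^sub>R (z - p))) has_vector_derivative radial_velocity p z t) (at t)"
    and norm_radial_velocity_le:
      "0 < t \<Longrightarrow> norm (radial_velocity p z t) \<le> 8 * deviation p (p + t *\<^sub>R (z - p)) / t"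
proof -
  define \<zeta> where "\<zeta> t = p + t *\<^sub>R (z - p)" for t :: real
  let ?d = "radial_velocity p z"
  note d_def = radial_velocity_def[of p z, folded \<zeta>_def]
  have nz: "norm (\<zeta> t) \<ge> 1 / 4" using segment_norm_ge[OF t] by (simp add: \<zeta>_def)
  then have z0: "\<zeta> t \<noteq> 0" by auto
  have der: "((\<lambda>t. sgn (\<zeta> t)) has_vector_derivative ?d t) (at t)"
  proof -
    have "((\<lambda>t. norm (\<zeta> t)) has_real_derivative (sgn (\<zeta> t) \<bullet> (z - p))) (at t)"
      unfolding has_field_derivative_def
    proof (rule has_derivative_eq_rhs)
      show "((\<lambda>t. norm (\<zeta> t)) has_derivative (\<lambda>h. (h *\<^sub>R (z - p)) \<bullet> sgn (\<zeta> t))) (at t)"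
      proof -
        have "(\<zeta> has_derivative (\<lambda>h. h *\<^sub>R (z - p))) (at t)"
          unfolding \<zeta>_def[abs_def] by (auto intro!: derivative_eq_intros)
        moreover have "(norm has_derivative (\<lambda>h. h \<bullet> sgn (\<zeta> t))) (at (\<zeta> t))"
          using z0 by (intro has_derivative_norm)
        ultimately show ?thesis using diff_chain_at by (fastforce simp: o_def)
      qed
    qed (simp add: fun_eq_iff inner_commute mult.commute)
    moreover have "(\<zeta> has_vector_derivative (z - p)) (at t)"
      unfolding \<zeta>_def[abs_def] by (auto intro!: derivative_eq_intros)
    ultimately have "((\<lambda>t. (inverse (norm (\<zeta> t))) *\<^sub>R \<zeta> t) has_vector_derivative
        (- (inverse (norm (\<zeta> t)) * (sgn (\<zeta> t) \<bullet> (z - p)) * inverse (norm (\<zeta> t)))) *\<^sub>R \<zeta> t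
          + inverse (norm (\<zeta> t)) *\<^sub>R (z - p)) (at t)"
      using z0 by (intro derivative_eq_intros | simp | assumption)+
    also have "(- (inverse (norm (\<zeta> t)) * (sgn (\<zeta> t) \<bullet> (z - p)) * inverse (norm (\<zeta> t)))) *\<^sub>R \<zeta> t
          + inverse (norm (\<zeta> t)) *\<^sub>R (z - p) = ?d t"
      using z0 by (simp add: d_def sgn_div_norm algebra_simps divide_inverse)
    finally show ?thesis by (simp add: sgn_div_norm)
  qed
  have bound: "norm (?d t) \<le> 8 * deviation p (\<zeta> t) / t" if "0 < t"
  proof -
    let ?w = "sgn (\<zeta> t)"
    have ww: "?w \<bullet> ?w = 1" "p \<bullet> p = 1" using z0 p by (auto simp: dot_square_norm norm_sgn)
    have zt: "\<zeta> t = norm (\<zeta> t) *\<^sub>R ?w" by (simp add: norm_scaleR_sgn)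
    have zp: "z - p = (1 / t) *\<^sub>R (\<zeta> t - p)" using that by (simp add: \<zeta>_def)
    have "\<zeta> t - (?w \<bullet> \<zeta> t) *\<^sub>R ?w = 0"
      by (subst (1 2) zt) (simp add: ww)
    then have "(z - p) - (?w \<bullet> (z - p)) *\<^sub>R ?w = (- 1 / t) *\<^sub>R (p - (?w \<bullet> p) *\<^sub>R ?w)"
    proof -
      assume *: "\<zeta> t - (?w \<bullet> \<zeta> t) *\<^sub>R ?w = 0"
      have "(1 / t) *\<^sub>R (\<zeta> t - p) - (?w \<bullet> ((1 / t) *\<^sub>R (\<zeta> t - p))) *\<^sub>R ?w
         = (1 / t) *\<^sub>R ((\<zeta> t - (?w \<bullet> \<zeta> t) *\<^sub>R ?w) - (p - (?w \<bullet> p) *\<^sub>R ?w))"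
        by (simp add: inner_diff_right algebra_simps)
      then show ?thesis unfolding * zp[symmetric] by (simp add: algebra_simps)
    qed
    then have "norm ((z - p) - (?w \<bullet> (z - p)) *\<^sub>R ?w) = norm (p - (?w \<bullet> p) *\<^sub>R ?w) / t"
      using that by simp
    \<comment> \<open>With \<open>c = ?w \<bullet> p\<close> the two squares are
      \<open>1 - c ^ 2\<close> and \<open>2 - 2 * c\<close>, and the second exceeds the first by
      \<open>(1 - c) ^ 2\<close>.\<close>
    moreover have "norm (p - (?w \<bullet> p) *\<^sub>R ?w) \<le> norm (?w - p)"
    proof (rule power2_le_imp_le)
      have "?w \<bullet> p \<le> 1" using norm_cauchy_schwarz[of ?w p] p z0 by (simp add: norm_sgn)
      moreover have "- 1 \<le> ?w \<bullet> p" using Cauchy_Schwarz_ineq2[of ?w p] p z0 by (simp add: norm_sgn)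
      ultimately have "0 \<le> (1 - ?w \<bullet> p) * (1 - ?w \<bullet> p)" by simp
      then show "(norm (p - (?w \<bullet> p) *\<^sub>R ?w))\<^sup>2 \<le> (norm (?w - p))\<^sup>2"
        unfolding power2_norm_eq_inner
        by (simp add: inner_diff_left inner_diff_right ww inner_commute algebra_simps)
    qed simp
    ultimately have "norm ((z - p) - (?w \<bullet> (z - p)) *\<^sub>R ?w) \<le> 2 * deviation p (\<zeta> t) / t"
      using that by (simp add: deviation_def divide_right_mono)
    \<comment> \<open>Together with the factor 2 in
      \<open>norm (?w - p) = 2 * deviation p (\<zeta> t)\<close> this gives the constant 8.\<close>
    moreover have "1 / norm (\<zeta> t) \<le> 4" using nz z0 by (simp add: field_simps)
    ultimately have "norm (?d t) \<le> 4 * (2 * deviation p (\<zeta> t) / t)"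
      unfolding d_def norm_scaleR by (intro mult_mono) auto
    then show ?thesis by simp
  qed
  show "((\<lambda>t. sgn (p + t *\<^sub>R (z - p))) has_vector_derivative ?d t) (at t)"
    using der by (simp only: \<zeta>_def)
  show "norm (?d t) \<le> 8 * deviation p (p + t *\<^sub>R (z - p)) / t" if "0 < t"
    using bound[OF that] by (simp only: \<zeta>_def)
qed

text \<open>The fundamental theorem of calculus along
  \<open>r *\<^sub>R sgn (p + t *\<^sub>R (z - p))\<close>, which stays on the sphere of radius
  \<open>r\<close> and runs from \<open>r *\<^sub>R p\<close> to \<open>r *\<^sub>R sgn z\<close>.
  The factor \<open>deviation / t\<close> of the speed is kept and not bounded by a constant: it
  later improves the singularity by one power, from that of a potential in space to that of one on
  the sphere.\<close>

lemma radial_path_estimate: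
  fixes w :: "'a \<Rightarrow> real" and D :: "'a \<Rightarrow> 'a"
  assumes w: "\<And>x. (w has_derivative (\<lambda>h. D x \<bullet> h)) (at x)" and D: "continuous_on UNIV D" and r: "0 \<le> r"
  shows "ennreal \<bar>w (r *\<^sub>R p) - w (r *\<^sub>R sgn z)\<bar>
    \<le> (\<integral>\<^sup>+t. ennreal (norm (D (r *\<^sub>R sgn (p + t *\<^sub>R (z - p))))
          * (8 * r * deviation p (p + t *\<^sub>R (z - p)) / t)) * indicator {0<..1} t \<partial>lborel)"
proof -
  define \<zeta> where "\<zeta> t = p + t *\<^sub>R (z - p)" for t :: real
  define d where "d = radial_velocity p z"
  have der: "((\<lambda>t. sgn (\<zeta> t)) has_vector_derivative d t) (at t)" if "0 \<le> t" "t \<le> 1" for t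
    using has_vector_derivative_radial_projection[OF that] by (simp only: \<zeta>_def d_def)
  have bound: "norm (d t) \<le> 8 * deviation p (\<zeta> t) / t" if "0 < t" "t \<le> 1" for t
    using norm_radial_velocity_le[of t] that by (simp add: \<zeta>_def d_def)
  define g where "g t = D (r *\<^sub>R sgn (\<zeta> t)) \<bullet> (r *\<^sub>R d t)" for t
  have nz: "\<zeta> t \<noteq> 0" if "0 \<le> t" "t \<le> 1" for t
    using segment_norm_ge[OF that] unfolding \<zeta>_def by auto
  have cont: "continuous_on {0..1} g"
    unfolding g_def d_def radial_velocity_def \<zeta>_def[symmetric]
    by (intro continuous_intros continuous_on_compose2[OF D] continuous_on_sgn)
       (use nz in \<open>auto simp: \<zeta>_def[abs_def] intro!: continuous_intros\<close>)
  have F: "((\<lambda>t. w (r *\<^sub>R sgn (\<zeta> t))) has_vector_derivative g t) (at t within {0..1})"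
    if "0 \<le> t" "t \<le> 1" for t
  proof -
    have "((\<lambda>t. r *\<^sub>R sgn (\<zeta> t)) has_derivative (\<lambda>h. h *\<^sub>R (r *\<^sub>R d t))) (at t)"
      using has_derivative_scaleR_right[OF der[OF that, unfolded has_vector_derivative_def], of r]
      by (simp add: mult.commute)
    from diff_chain_at[OF this w] have "((\<lambda>t. w (r *\<^sub>R sgn (\<zeta> t))) has_derivative (\<lambda>h. h * g t)) (at t)"
      by (simp add: o_def g_def mult_ac)
    then show ?thesis by (simp add: has_vector_derivative_def has_derivative_at_withinI)
  qed
  have int: "has_bochner_integral lborel (\<lambda>t. indicator {0..1} t *\<^sub>R g t) (w (r *\<^sub>R sgn (\<zeta> 1)) - w (r *\<^sub>R sgn (\<zeta> 0)))"
    using F by (intro has_bochner_integral_FTC_Icc cont) auto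
  have "\<bar>w (r *\<^sub>R sgn z) - w (r *\<^sub>R p)\<bar> = norm (\<integral>t. indicator {0..1} t *\<^sub>R g t \<partial>lborel)"
    using int p by (auto simp: has_bochner_integral_iff \<zeta>_def sgn_div_norm)
  then have "ennreal \<bar>w (r *\<^sub>R p) - w (r *\<^sub>R sgn z)\<bar> \<le> (\<integral>\<^sup>+t. norm (indicator {0..1} t *\<^sub>R g t) \<partial>lborel)"
    using integral_norm_bound_ennreal[OF integrable.intros[OF int]] by (simp add: abs_minus_commute)
  also have "\<dots> \<le> (\<integral>\<^sup>+t. ennreal (norm (D (r *\<^sub>R sgn (\<zeta> t)))
          * (8 * r * deviation p (\<zeta> t) / t)) * indicator {0<..1} t \<partial>lborel)"
  \<comment> \<open>The velocity bound contains \<open>1 / t\<close> and says nothing at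
    \<open>t = 0\<close>; this is one point of the parameter interval, hence null.\<close>
  proof (rule nn_integral_mono_AE)
    have "AE t in lborel. t \<noteq> (0::real)" by (rule AE_lborel_singleton)
    then show "AE t in lborel. ennreal (norm (indicator {0..1} t *\<^sub>R g t))
      \<le> ennreal (norm (D (r *\<^sub>R sgn (\<zeta> t))) * (8 * r * deviation p (\<zeta> t) / t)) * indicator {0<..1} t"
    proof eventually_elim
      case (elim t)
      have "norm (g t) \<le> norm (D (r *\<^sub>R sgn (\<zeta> t))) * (8 * r * deviation p (\<zeta> t) / t)" if "0 < t" "t \<le> 1"
      proof -
        have "\<bar>g t\<bar> \<le> norm (D (r *\<^sub>R sgn (\<zeta> t))) * (r * norm (d t))"
          using Cauchy_Schwarz_ineq2[of "D (r *\<^sub>R sgn (\<zeta> t))" "r *\<^sub>R d t"] r by (simp add: g_def)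
        also have "\<dots> \<le> norm (D (r *\<^sub>R sgn (\<zeta> t))) * (r * (8 * deviation p (\<zeta> t) / t))"
          using r by (intro mult_left_mono bound that) auto
        finally show ?thesis by (simp add: mult_ac)
      qed
      then show ?case using elim by (auto simp: indicator_def intro!: ennreal_leI)
    qed
  qed
  finally show ?thesis by (simp add: \<zeta>_def)
qed

end

section \<open>Averaging over paths: from segments to the kernel\<close>

lemma nn_integral_segment_substitution:
  fixes H :: "'a::euclidean_space \<Rightarrow> ennreal"
  assumes [measurable]: "H \<in> borel_measurable borel" and t: "0 < t"
  shows "(\<integral>\<^sup>+z. H (p + t *\<^sub>R (z - p)) \<partial>lborel) = ennreal (1 / t ^ DIM('a)) * (\<integral>\<^sup>+y. H y \<partial>lborel)"
proof -
  have "(\<integral>\<^sup>+y. H y \<partial>lborel) = ennreal (t ^ DIM('a)) * (\<integral>\<^sup>+z. H ((p - t *\<^sub>R p) + t *\<^sub>R z) \<partial>lborel)"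
    using t by (subst nn_integral_lborel_affine[of H t "p - t *\<^sub>R p"]) auto
  also have "(\<lambda>z. H ((p - t *\<^sub>R p) + t *\<^sub>R z)) = (\<lambda>z. H (p + t *\<^sub>R (z - p)))"
    by (simp add: algebra_simps)
  finally show ?thesis
    using t by (simp add: mult.assoc[symmetric] ennreal_mult'[symmetric])
qed

text \<open>With \<open>c = norm y * deviation p y\<close>, the distance from \<open>y\<close> to
  the point \<open>\<sigma> *\<^sub>R p\<close> is at least half of
  \<open>\<bar>\<sigma> - norm y\<bar> + c\<close>. So the integral along the axis is at most
  \<open>2 ^ n\<close> times two tails, one on either side of \<open>\<sigma> = norm y\<close>, of
  the function \<open>1 / v ^ n\<close> on \<open>{c..}\<close>.\<close>

lemma nn_integral_distance_line_le:
  fixes p y :: "'a::euclidean_space"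
  assumes p: "norm p = 1" and n: "2 \<le> DIM('a)" and c: "0 < norm y * deviation p y"
  shows "(\<integral>\<^sup>+\<sigma>. ennreal (1 / norm (y - \<sigma> *\<^sub>R p) ^ DIM('a)) * indicator {0<..} \<sigma> \<partial>lborel)
    \<le> ennreal (2 ^ (DIM('a) + 1) / (real (DIM('a) - 1) * (norm y * deviation p y) ^ (DIM('a) - 1)))"
proof -
  define c where "c = norm y * deviation p y"
  have c0: "0 < c" using c by (simp add: c_def)
  define m where "m = DIM('a) - 1"
  have m: "DIM('a) = Suc m" "0 < m" using n by (auto simp: m_def)
  let ?h = "\<lambda>v::real. ennreal (1 / v ^ Suc m) * indicator {c..} v"
  have pw: "ennreal (1 / norm (y - \<sigma> *\<^sub>R p) ^ DIM('a)) * indicator {0<..} \<sigma>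
     \<le> ennreal (2 ^ DIM('a)) * (?h (c - norm y + 1 * \<sigma>) + ?h (c + norm y + (- 1) * \<sigma>))" for \<sigma>
  proof (cases "0 < \<sigma>")
    case True
    define v where "v = \<bar>\<sigma> - norm y\<bar> + c"
    have 1: "\<bar>\<sigma> - norm y\<bar> \<le> norm (y - \<sigma> *\<^sub>R p)"
      using True p norm_triangle_ineq3[of y "\<sigma> *\<^sub>R p"] by (simp add: abs_minus_commute)
    have "norm y *\<^sub>R (sgn y - p) = (y - \<sigma> *\<^sub>R p) + (\<sigma> - norm y) *\<^sub>R p"
      by (simp add: algebra_simps norm_scaleR_sgn)
    then have "norm (norm y *\<^sub>R (sgn y - p)) \<le> norm (y - \<sigma> *\<^sub>R p) + norm ((\<sigma> - norm y) *\<^sub>R p)"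
      by (metis norm_triangle_ineq)
    then have "2 * c \<le> norm (y - \<sigma> *\<^sub>R p) + \<bar>\<sigma> - norm y\<bar>"
      using p by (simp add: c_def deviation_def)
    with 1 have v: "v \<le> 2 * norm (y - \<sigma> *\<^sub>R p)" "c \<le> v" by (auto simp: v_def)
    then have "v / 2 \<le> norm (y - \<sigma> *\<^sub>R p)" by simp
    then have "1 / norm (y - \<sigma> *\<^sub>R p) ^ DIM('a) \<le> 1 / (v / 2) ^ DIM('a)"
      using v c0 by (intro divide_left_mono power_mono mult_pos_pos zero_less_power) auto
    also have "\<dots> = 2 ^ DIM('a) * (1 / v ^ Suc m)" by (simp add: power_divide m)
    finally have "ennreal (1 / norm (y - \<sigma> *\<^sub>R p) ^ DIM('a)) \<le> ennreal (2 ^ DIM('a)) * ?h v"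
      using v c0 by (simp add: ennreal_mult'[symmetric] ennreal_leI)
    also have "?h v \<le> ?h (c - norm y + 1 * \<sigma>) + ?h (c + norm y + (- 1) * \<sigma>)"
    proof (cases "norm y \<le> \<sigma>")
      case True
      then have "v = c - norm y + 1 * \<sigma>" by (simp add: v_def)
      then show ?thesis by simp
    next
      case False
      then have "v = c + norm y + (- 1) * \<sigma>" by (simp add: v_def)
      then show ?thesis by simp
    qed
    finally show ?thesis using True by (simp add: mult_left_mono)
  qed simp
  have tail: "(\<integral>\<^sup>+v. ?h v \<partial>lborel) = ennreal (1 / (real m * c ^ m))"
    using nn_integral_inverse_power_tail[OF c0 m(2)] .
  have "(\<integral>\<^sup>+\<sigma>. ennreal (1 / norm (y - \<sigma> *\<^sub>R p) ^ DIM('a)) * indicator {0<..} \<sigma> \<partial>lborel)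
     \<le> (\<integral>\<^sup>+\<sigma>. ennreal (2 ^ DIM('a)) * (?h (c - norm y + 1 * \<sigma>) + ?h (c + norm y + (- 1) * \<sigma>)) \<partial>lborel)"
    by (intro nn_integral_mono pw)
  also have "\<dots> = ennreal (2 ^ DIM('a)) * ((\<integral>\<^sup>+\<sigma>. ?h (c - norm y + 1 * \<sigma>) \<partial>lborel) + (\<integral>\<^sup>+\<sigma>. ?h (c + norm y + (- 1) * \<sigma>) \<partial>lborel))"
    by (subst nn_integral_cmult, measurable, subst nn_integral_add) auto
  also have "(\<integral>\<^sup>+\<sigma>. ?h (c - norm y + 1 * \<sigma>) \<partial>lborel) = (\<integral>\<^sup>+v. ?h v \<partial>lborel)"
    by (subst (2) nn_integral_real_affine[of _ 1 "c - norm y"]) auto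
  also have "(\<integral>\<^sup>+\<sigma>. ?h (c + norm y + (- 1) * \<sigma>) \<partial>lborel) = (\<integral>\<^sup>+v. ?h v \<partial>lborel)"
    by (subst (2) nn_integral_real_affine[of _ "-1" "c + norm y"]) auto
  also have "ennreal (2 ^ DIM('a)) * ((\<integral>\<^sup>+v. ?h v \<partial>lborel) + (\<integral>\<^sup>+v. ?h v \<partial>lborel))
     = ennreal (2 ^ (DIM('a) + 1) / (real (DIM('a) - 1) * c ^ (DIM('a) - 1)))"
    unfolding tail using c0 m by (simp add: m_def[symmetric] ennreal_plus[symmetric] ennreal_mult'[symmetric] del: ennreal_plus)
  finally show ?thesis by (simp add: c_def)
qed

text \<open>The product of 8 from the velocity bound, 2 from \<open>norm \<zeta> \<le> 2\<close>,
  \<open>3 ^ n / n\<close> from the integral over \<open>t\<close>, and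
  \<open>2 ^ (n + 1) / (n - 1)\<close> from the integral along the axis.\<close>

definition potential_const :: "nat \<Rightarrow> real" where
  "potential_const n = 2 ^ (n + 5) * 3 ^ n / (real n * real (n - 1))"

text \<open>The path bound is averaged over radii \<open>r\<close> and end points \<open>z\<close>,
  and the order of integration is changed until one integral over the shell remains. The variable
  \<open>\<zeta> = p + t *\<^sub>R (z - p)\<close> replaces \<open>z\<close>; then \<open>t\<close>
  is integrated out; the radius is written as \<open>r = norm \<zeta> * \<sigma>\<close>, so that
  \<open>y = \<sigma> *\<^sub>R \<zeta>\<close> is the point on the sphere at which the gradient is
  evaluated; finally \<open>\<sigma>\<close> is integrated out.\<close>

lemma potential_estimate_one_pole:
  fixes w :: "'a::euclidean_space \<Rightarrow> real" and D :: "'a \<Rightarrow> 'a"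
  assumes n: "2 \<le> DIM('a)"
    and w: "\<And>x. (w has_derivative (\<lambda>h. D x \<bullet> h)) (at x)" and D: "continuous_on UNIV D"
    and p: "norm p = 1" and e: "norm e = 1" "0 \<le> e \<bullet> p" and a: "0 < a"
  shows "(\<integral>\<^sup>+r. (\<integral>\<^sup>+z. ennreal \<bar>w (r *\<^sub>R p) - w (r *\<^sub>R sgn z)\<bar> * indicator (cball e (1 / 4)) z \<partial>lborel)
        * indicator {a<..<b} r \<partial>lborel)
    \<le> ennreal (potential_const DIM('a)) *
       (\<integral>\<^sup>+y\<in>{y. a < norm y \<and> norm y < b}. ennreal (norm (D y) * (riesz_kernel p y / norm y ^ (DIM('a) - 2))) \<partial>lborel)"
    (is "?L \<le> _")
proof -
  let ?n = "DIM('a)"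
  have Dm [measurable]: "D \<in> borel_measurable borel"
    using D by (rule borel_measurable_continuous_onI)
  have "continuous_on UNIV w"
    by (rule has_derivative_continuous_on[of UNIV w "\<lambda>x h. D x \<bullet> h"]) (use w in auto)
  then have wm [measurable]: "w \<in> borel_measurable borel"
    by (rule borel_measurable_continuous_onI)
  define F where "F r \<zeta> = norm (D (r *\<^sub>R sgn \<zeta>)) * (8 * r * deviation p \<zeta>)" for r \<zeta>
  define K :: "'a set" where "K = {\<zeta>. norm \<zeta> \<le> 2}"
  have [measurable]: "K \<in> sets borel" unfolding K_def by measurable
  have [measurable]: "(\<lambda>x. F (f x) (g x)) \<in> borel_measurable M"
    if [measurable]: "f \<in> borel_measurable M" "g \<in> borel_measurable M" for f g and M :: "'m measure"
    unfolding F_def by measurable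
  \<comment> \<open>The cutoffs \<open>norm \<zeta> \<le> 2\<close> and
    \<open>t \<ge> norm (\<zeta> - p) / 3\<close> are all that is kept of the condition that
    \<open>z\<close> lies in the small ball. In this form \<open>t\<close> can be integrated out for
    fixed \<open>\<zeta>\<close>.\<close>
  let ?H = "\<lambda>r t \<zeta>. ennreal (F r \<zeta>) * indicator K \<zeta> * (if norm (\<zeta> - p) / 3 \<le> t then 1 else 0)"
  \<comment> \<open>The integrand after the substitution \<open>r = norm \<zeta> * \<sigma>\<close>;
    the leading factor \<open>norm \<zeta>\<close> is its Jacobian.\<close>
  define \<Phi> where "\<Phi> \<sigma> \<zeta> = ennreal (norm \<zeta>) * (ennreal (F (norm \<zeta> * \<sigma>) \<zeta> * (3 ^ ?n / (real ?n * norm (\<zeta> - p) ^ ?n)))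
        * indicator {a<..<b} (norm \<zeta> * \<sigma>)) * indicator K \<zeta>" for \<sigma> \<zeta>
  have [measurable]: "(\<lambda>x. \<Phi> (f x) (g x)) \<in> borel_measurable M"
    if [measurable]: "f \<in> borel_measurable M" "g \<in> borel_measurable M" for f g and M :: "'m measure"
    unfolding \<Phi>_def by measurable
  define G where "G y = ennreal (2 * (norm (D y) * (8 * norm y * deviation p y) * (3 ^ ?n / real ?n)))
      * indicator {y. a < norm y \<and> norm y < b} y" for y
  have [measurable]: "G \<in> borel_measurable borel" unfolding G_def by measurable
  have F0: "0 \<le> F r \<zeta>" if "0 \<le> r" for r \<zeta> using that deviation_nonneg[of p \<zeta>] by (auto simp: F_def intro!: mult_nonneg_nonneg)
  have pw: "ennreal \<bar>w (r *\<^sub>R p) - w (r *\<^sub>R sgn z)\<bar> * indicator (cball e (1 / 4)) z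
     \<le> (\<integral>\<^sup>+t. ?H r t (p + t *\<^sub>R (z - p)) * (ennreal (1 / t) * indicator {0<..1} t) \<partial>lborel)" if r: "0 \<le> r" for r z
  proof (cases "z \<in> cball e (1 / 4)")
    case True
    then have z: "norm (z - e) \<le> 1 / 4" by (simp add: dist_norm norm_minus_commute)
    have "ennreal \<bar>w (r *\<^sub>R p) - w (r *\<^sub>R sgn z)\<bar>
        \<le> (\<integral>\<^sup>+t. ennreal (norm (D (r *\<^sub>R sgn (p + t *\<^sub>R (z - p))))
          * (8 * r * deviation p (p + t *\<^sub>R (z - p)) / t)) * indicator {0<..1} t \<partial>lborel)"
      by (rule radial_path_estimate[OF p e z w D r])
    also have "\<dots> \<le> (\<integral>\<^sup>+t. ?H r t (p + t *\<^sub>R (z - p)) * (ennreal (1 / t) * indicator {0<..1} t) \<partial>lborel)"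
    proof (rule nn_integral_mono)
      fix t :: real
      show "ennreal (norm (D (r *\<^sub>R sgn (p + t *\<^sub>R (z - p))))
          * (8 * r * deviation p (p + t *\<^sub>R (z - p)) / t)) * indicator {0<..1} t
        \<le> ?H r t (p + t *\<^sub>R (z - p)) * (ennreal (1 / t) * indicator {0<..1} t)"
      proof (cases "t \<in> {0<..1}")
        case True
        then have t: "0 < t" "t \<le> 1" by auto
        have "p + t *\<^sub>R (z - p) \<in> K"
          using segment_norm_le[OF p e z, of t] t by (simp add: K_def)
        moreover have "norm (p + t *\<^sub>R (z - p) - p) / 3 \<le> t"
          using segment_dist_le[OF p e z, of t] t by simp
        ultimately show ?thesis using t F0[OF r]
          by (simp add: F_def ennreal_mult'[symmetric] mult_ac)
      qed simp
    qed
    finally show ?thesis using True by simp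
  qed simp
  have "?L \<le> (\<integral>\<^sup>+r. (\<integral>\<^sup>+z. (\<integral>\<^sup>+t. ?H r t (p + t *\<^sub>R (z - p)) * (ennreal (1 / t) * indicator {0<..1} t) \<partial>lborel) \<partial>lborel)
        * indicator {a<..<b} r \<partial>lborel)"
  proof (rule nn_integral_mono)
    fix r :: real
    show "(\<integral>\<^sup>+z. ennreal \<bar>w (r *\<^sub>R p) - w (r *\<^sub>R sgn z)\<bar> * indicator (cball e (1 / 4)) z \<partial>lborel) * indicator {a<..<b} r
      \<le> (\<integral>\<^sup>+z. (\<integral>\<^sup>+t. ?H r t (p + t *\<^sub>R (z - p)) * (ennreal (1 / t) * indicator {0<..1} t) \<partial>lborel) \<partial>lborel)
        * indicator {a<..<b} r"
    proof (cases "r \<in> {a<..<b}")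
      case True
      then have "0 \<le> r" using a by simp
      then show ?thesis by (intro mult_right_mono nn_integral_mono pw) simp_all
    qed simp
  qed
  also have "\<dots> = (\<integral>\<^sup>+r. (\<integral>\<^sup>+t. (\<integral>\<^sup>+z. ?H r t (p + t *\<^sub>R (z - p)) \<partial>lborel) * (ennreal (1 / t) * indicator {0<..1} t) \<partial>lborel)
        * indicator {a<..<b} r \<partial>lborel)"
  proof (rule nn_integral_cong, rule arg_cong2[where f = "(*)", OF _ refl])
    fix r :: real
    have "(\<integral>\<^sup>+z. (\<integral>\<^sup>+t. ?H r t (p + t *\<^sub>R (z - p)) * (ennreal (1 / t) * indicator {0<..1} t) \<partial>lborel) \<partial>lborel)
        = (\<integral>\<^sup>+t. (\<integral>\<^sup>+z. ?H r t (p + t *\<^sub>R (z - p)) * (ennreal (1 / t) * indicator {0<..1} t) \<partial>lborel) \<partial>lborel)"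
      by (rule lborel_pair.Fubini') measurable
    also have "\<dots> = (\<integral>\<^sup>+t. (\<integral>\<^sup>+z. ?H r t (p + t *\<^sub>R (z - p)) \<partial>lborel) * (ennreal (1 / t) * indicator {0<..1} t) \<partial>lborel)"
      by (intro nn_integral_cong nn_integral_multc) measurable
    finally show "(\<integral>\<^sup>+z. (\<integral>\<^sup>+t. ?H r t (p + t *\<^sub>R (z - p)) * (ennreal (1 / t) * indicator {0<..1} t) \<partial>lborel) \<partial>lborel)
        = (\<integral>\<^sup>+t. (\<integral>\<^sup>+z. ?H r t (p + t *\<^sub>R (z - p)) \<partial>lborel) * (ennreal (1 / t) * indicator {0<..1} t) \<partial>lborel)" .
  qed
  also have "\<dots> = (\<integral>\<^sup>+r. (\<integral>\<^sup>+t. (\<integral>\<^sup>+\<zeta>. ?H r t \<zeta> \<partial>lborel) * (ennreal (1 / t ^ Suc ?n) * indicator {0<..1} t) \<partial>lborel)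
        * indicator {a<..<b} r \<partial>lborel)"
  proof (rule nn_integral_cong, rule arg_cong2[where f = "(*)", OF _ refl], rule nn_integral_cong)
    fix r t :: real
    show "(\<integral>\<^sup>+z. ?H r t (p + t *\<^sub>R (z - p)) \<partial>lborel) * (ennreal (1 / t) * indicator {0<..1} t)
        = (\<integral>\<^sup>+\<zeta>. ?H r t \<zeta> \<partial>lborel) * (ennreal (1 / t ^ Suc ?n) * indicator {0<..1} t)"
    proof (cases "t \<in> {0<..1}")
      case True
      then have t: "0 < t" by simp
      have *: "ennreal (1 / t ^ Suc ?n) = ennreal (1 / t ^ ?n) * ennreal (1 / t)"
        using t by (simp add: ennreal_mult'[symmetric])
      have "(\<integral>\<^sup>+z. ?H r t (p + t *\<^sub>R (z - p)) \<partial>lborel) = ennreal (1 / t ^ ?n) * (\<integral>\<^sup>+\<zeta>. ?H r t \<zeta> \<partial>lborel)"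
        by (rule nn_integral_segment_substitution[OF _ t]) measurable
      then show ?thesis using True by (simp only: * indicator_simps mult_1_right) (simp only: mult_ac)
    qed simp
  qed
  also have "\<dots> = (\<integral>\<^sup>+r. (\<integral>\<^sup>+\<zeta>. (\<integral>\<^sup>+t. ?H r t \<zeta> * (ennreal (1 / t ^ Suc ?n) * indicator {0<..1} t) \<partial>lborel) \<partial>lborel)
        * indicator {a<..<b} r \<partial>lborel)"
  proof (rule nn_integral_cong, rule arg_cong2[where f = "(*)", OF _ refl])
    fix r :: real
    have "(\<integral>\<^sup>+t. (\<integral>\<^sup>+\<zeta>. ?H r t \<zeta> \<partial>lborel) * (ennreal (1 / t ^ Suc ?n) * indicator {0<..1} t) \<partial>lborel)
        = (\<integral>\<^sup>+t. (\<integral>\<^sup>+\<zeta>. ?H r t \<zeta> * (ennreal (1 / t ^ Suc ?n) * indicator {0<..1} t) \<partial>lborel) \<partial>lborel)"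
      by (intro nn_integral_cong nn_integral_multc[symmetric]) measurable
    also have "\<dots> = (\<integral>\<^sup>+\<zeta>. (\<integral>\<^sup>+t. ?H r t \<zeta> * (ennreal (1 / t ^ Suc ?n) * indicator {0<..1} t) \<partial>lborel) \<partial>lborel)"
      by (rule lborel_pair.Fubini') measurable
    finally show "(\<integral>\<^sup>+t. (\<integral>\<^sup>+\<zeta>. ?H r t \<zeta> \<partial>lborel) * (ennreal (1 / t ^ Suc ?n) * indicator {0<..1} t) \<partial>lborel)
        = (\<integral>\<^sup>+\<zeta>. (\<integral>\<^sup>+t. ?H r t \<zeta> * (ennreal (1 / t ^ Suc ?n) * indicator {0<..1} t) \<partial>lborel) \<partial>lborel)" .
  qed
  also have "\<dots> \<le> (\<integral>\<^sup>+r. (\<integral>\<^sup>+\<zeta>. ennreal (F r \<zeta> * (3 ^ ?n / (real ?n * norm (\<zeta> - p) ^ ?n))) * indicator K \<zeta> \<partial>lborel)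
        * indicator {a<..<b} r \<partial>lborel)"
  proof (intro nn_integral_mono)
    fix r :: real
    have "(\<integral>\<^sup>+t. ?H r t \<zeta> * (ennreal (1 / t ^ Suc ?n) * indicator {0<..1} t) \<partial>lborel)
       \<le> ennreal (F r \<zeta> * (3 ^ ?n / (real ?n * norm (\<zeta> - p) ^ ?n))) * indicator K \<zeta>" if r: "0 \<le> r" for \<zeta>
    \<comment> \<open>At the pole the bound on the right is \<open>0\<close>, since it contains a
      division by zero. It holds nevertheless, because the factor \<open>deviation\<close> in
      \<open>F\<close> vanishes there.\<close>
    proof (cases "\<zeta> = p")
      case True
      then have "deviation p \<zeta> = 0" using p by (simp add: deviation_def sgn_div_norm)
      then show ?thesis by (simp add: F_def)
    next
      case False
      define c where "c = norm (\<zeta> - p) / 3"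
      have c: "0 < c" using False by (simp add: c_def)
      have "(\<integral>\<^sup>+t. ?H r t \<zeta> * (ennreal (1 / t ^ Suc ?n) * indicator {0<..1} t) \<partial>lborel)
         \<le> (\<integral>\<^sup>+t. ennreal (F r \<zeta>) * indicator K \<zeta> * (ennreal (1 / t ^ Suc ?n) * indicator {c..} t) \<partial>lborel)"
        by (intro nn_integral_mono) (auto simp: indicator_def c_def)
      also have "\<dots> = ennreal (F r \<zeta>) * indicator K \<zeta> * ennreal (1 / (real ?n * c ^ ?n))"
        using nn_integral_inverse_power_tail[OF c, of ?n] n by (subst nn_integral_cmult) auto
      also have "\<dots> = ennreal (F r \<zeta> * (3 ^ ?n / (real ?n * norm (\<zeta> - p) ^ ?n))) * indicator K \<zeta>"
        using F0[OF r] by (simp add: c_def power_divide ennreal_mult'[symmetric] mult_ac)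
      finally show ?thesis .
    qed
    then show "(\<integral>\<^sup>+\<zeta>. (\<integral>\<^sup>+t. ?H r t \<zeta> * (ennreal (1 / t ^ Suc ?n) * indicator {0<..1} t) \<partial>lborel) \<partial>lborel) * indicator {a<..<b} r
      \<le> (\<integral>\<^sup>+\<zeta>. ennreal (F r \<zeta> * (3 ^ ?n / (real ?n * norm (\<zeta> - p) ^ ?n))) * indicator K \<zeta> \<partial>lborel) * indicator {a<..<b} r"
      using a by (auto simp: indicator_def intro!: nn_integral_mono)
  qed
  also have "\<dots> = (\<integral>\<^sup>+\<zeta>. (\<integral>\<^sup>+r. ennreal (F r \<zeta> * (3 ^ ?n / (real ?n * norm (\<zeta> - p) ^ ?n))) * indicator {a<..<b} r \<partial>lborel)
        * indicator K \<zeta> \<partial>lborel)"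
  proof -
    let ?c = "\<lambda>r \<zeta>. ennreal (F r \<zeta> * (3 ^ ?n / (real ?n * norm (\<zeta> - p) ^ ?n)))"
    have "(\<integral>\<^sup>+r. (\<integral>\<^sup>+\<zeta>. ?c r \<zeta> * indicator K \<zeta> \<partial>lborel) * indicator {a<..<b} r \<partial>lborel)
       = (\<integral>\<^sup>+r. (\<integral>\<^sup>+\<zeta>. ?c r \<zeta> * indicator K \<zeta> * indicator {a<..<b} r \<partial>lborel) \<partial>lborel)"
      by (intro nn_integral_cong nn_integral_multc[symmetric]) measurable
    also have "\<dots> = (\<integral>\<^sup>+\<zeta>. (\<integral>\<^sup>+r. ?c r \<zeta> * indicator K \<zeta> * indicator {a<..<b} r \<partial>lborel) \<partial>lborel)"
      by (rule lborel_pair.Fubini') measurable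
    also have "\<dots> = (\<integral>\<^sup>+\<zeta>. (\<integral>\<^sup>+r. ?c r \<zeta> * indicator {a<..<b} r * indicator K \<zeta> \<partial>lborel) \<partial>lborel)"
      by (simp only: mult_ac)
    also have "\<dots> = (\<integral>\<^sup>+\<zeta>. (\<integral>\<^sup>+r. ?c r \<zeta> * indicator {a<..<b} r \<partial>lborel) * indicator K \<zeta> \<partial>lborel)"
      by (intro nn_integral_cong nn_integral_multc) measurable
    finally show ?thesis .
  qed
  also have "\<dots> = (\<integral>\<^sup>+\<zeta>. (\<integral>\<^sup>+\<sigma>. \<Phi> \<sigma> \<zeta> \<partial>lborel) \<partial>lborel)"
  proof (intro nn_integral_cong_AE)
    have "AE \<zeta> in lborel. \<zeta> \<noteq> (0::'a)" by (rule AE_lborel_singleton)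
    then show "AE \<zeta> in lborel. (\<integral>\<^sup>+r. ennreal (F r \<zeta> * (3 ^ ?n / (real ?n * norm (\<zeta> - p) ^ ?n))) * indicator {a<..<b} r \<partial>lborel)
        * indicator K \<zeta> = (\<integral>\<^sup>+\<sigma>. \<Phi> \<sigma> \<zeta> \<partial>lborel)"
    proof eventually_elim
      case (elim \<zeta>)
      then show ?case
        by (subst nn_integral_real_affine[of _ "norm \<zeta>" 0])
          (auto simp: nn_integral_cmult[symmetric] nn_integral_multc[symmetric] \<Phi>_def mult_ac)
    qed
  qed
  also have "\<dots> = (\<integral>\<^sup>+\<sigma>. (\<integral>\<^sup>+\<zeta>. \<Phi> \<sigma> \<zeta> \<partial>lborel) \<partial>lborel)"
    by (rule lborel_pair.Fubini') simp
  also have "\<dots> \<le> (\<integral>\<^sup>+\<sigma>. (\<integral>\<^sup>+y. G y * (ennreal (1 / norm (y - \<sigma> *\<^sub>R p) ^ ?n) * indicator {0<..} \<sigma>) \<partial>lborel) \<partial>lborel)"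
  proof (rule nn_integral_mono)
    fix \<sigma> :: real
    show "(\<integral>\<^sup>+\<zeta>. \<Phi> \<sigma> \<zeta> \<partial>lborel) \<le> (\<integral>\<^sup>+y. G y * (ennreal (1 / norm (y - \<sigma> *\<^sub>R p) ^ ?n) * indicator {0<..} \<sigma>) \<partial>lborel)"
    proof (cases "0 < \<sigma>")
      case False
      then have "\<Phi> \<sigma> \<zeta> = 0" for \<zeta>
        using a mult_nonneg_nonpos[of "norm \<zeta>" \<sigma>] by (auto simp: \<Phi>_def indicator_def)
      then show ?thesis by simp
    next
      case True
      \<comment> \<open>For fixed \<open>\<sigma>\<close> the substitution is
        \<open>y = \<sigma> *\<^sub>R \<zeta>\<close>. Its Jacobian
        \<open>(1 / \<sigma>) ^ n\<close> cancels against the scaling of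
        \<open>norm (\<zeta> - p) ^ n\<close>, which is
        \<open>norm (y - \<sigma> *\<^sub>R p) ^ n\<close> divided by
        \<open>\<sigma> ^ n\<close>.\<close>
      have "(\<integral>\<^sup>+\<zeta>. \<Phi> \<sigma> \<zeta> \<partial>lborel) = ennreal ((1 / \<sigma>) ^ ?n) * (\<integral>\<^sup>+y. \<Phi> \<sigma> (0 + (1 / \<sigma>) *\<^sub>R y) \<partial>lborel)"
        using True by (subst nn_integral_lborel_affine[of _ "1 / \<sigma>" 0]) auto
      also have "\<dots> = (\<integral>\<^sup>+y. ennreal ((1 / \<sigma>) ^ ?n) * \<Phi> \<sigma> ((1 / \<sigma>) *\<^sub>R y) \<partial>lborel)"
        by (subst nn_integral_cmult) auto
      also have "\<dots> \<le> (\<integral>\<^sup>+y. G y * (ennreal (1 / norm (y - \<sigma> *\<^sub>R p) ^ ?n) * indicator {0<..} \<sigma>) \<partial>lborel)"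
      proof (rule nn_integral_mono)
        fix y :: 'a
        show "ennreal ((1 / \<sigma>) ^ ?n) * \<Phi> \<sigma> ((1 / \<sigma>) *\<^sub>R y)
           \<le> G y * (ennreal (1 / norm (y - \<sigma> *\<^sub>R p) ^ ?n) * indicator {0<..} \<sigma>)"
        proof (cases "a < norm y \<and> norm y < b \<and> norm y / \<sigma> \<le> 2")
          case False
          then have "\<Phi> \<sigma> ((1 / \<sigma>) *\<^sub>R y) = 0"
            using True by (auto simp: \<Phi>_def K_def indicator_def)
          then show ?thesis by simp
        next
          case in_ann: True
          define N where "N = norm (y - \<sigma> *\<^sub>R p)"
          have "(1 / \<sigma>) *\<^sub>R y - p = (1 / \<sigma>) *\<^sub>R (y - \<sigma> *\<^sub>R p)"
            using True by (simp add: algebra_simps)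
          then have N: "norm ((1 / \<sigma>) *\<^sub>R y - p) = N / \<sigma>"
            using True by (simp add: N_def)
          have N0: "0 \<le> N" by (simp add: N_def)
          have "norm y *\<^sub>R sgn ((1 / \<sigma>) *\<^sub>R y) = y"
            using True by (simp add: sgn_scaleR norm_scaleR_sgn)
          then have "F (norm y) ((1 / \<sigma>) *\<^sub>R y) = norm (D y) * (8 * norm y * deviation p y)"
            using True by (simp add: F_def deviation_scaleR)
          then have "ennreal ((1 / \<sigma>) ^ ?n) * \<Phi> \<sigma> ((1 / \<sigma>) *\<^sub>R y)
             = ennreal ((norm y / \<sigma>) * (norm (D y) * (8 * norm y * deviation p y) * (3 ^ ?n / real ?n)) * (1 / N ^ ?n))"
            using True in_ann N0 deviation_nonneg[of p y]
            by (simp add: \<Phi>_def K_def N ennreal_mult'[symmetric] ennreal_mult''[symmetric] power_divide mult_ac)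
          also have "\<dots> \<le> ennreal (2 * (norm (D y) * (8 * norm y * deviation p y) * (3 ^ ?n / real ?n)) * (1 / N ^ ?n))"
            using True in_ann N0 deviation_nonneg[of p y]
            by (intro ennreal_leI mult_right_mono) auto
          also have "\<dots> = G y * ennreal (1 / N ^ ?n)"
            using in_ann N0 deviation_nonneg[of p y] by (simp add: G_def ennreal_mult'[symmetric] ennreal_mult''[symmetric] mult_ac)
          finally show ?thesis using True by (simp add: N_def)
        qed
      qed
      finally show ?thesis .
    qed
  qed
  also have "\<dots> = (\<integral>\<^sup>+y. (\<integral>\<^sup>+\<sigma>. G y * (ennreal (1 / norm (y - \<sigma> *\<^sub>R p) ^ ?n) * indicator {0<..} \<sigma>) \<partial>lborel) \<partial>lborel)"
    by (rule lborel_pair.Fubini') simp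
  also have "\<dots> \<le> (\<integral>\<^sup>+y. ennreal (potential_const ?n) * (ennreal (norm (D y) * (riesz_kernel p y / norm y ^ (?n - 2)))
      * indicator {y. a < norm y \<and> norm y < b} y) \<partial>lborel)"
  proof (rule nn_integral_mono)
    fix y :: 'a
    show "(\<integral>\<^sup>+\<sigma>. G y * (ennreal (1 / norm (y - \<sigma> *\<^sub>R p) ^ ?n) * indicator {0<..} \<sigma>) \<partial>lborel)
       \<le> ennreal (potential_const ?n) * (ennreal (norm (D y) * (riesz_kernel p y / norm y ^ (?n - 2)))
          * indicator {y. a < norm y \<and> norm y < b} y)"
    proof (cases "a < norm y \<and> norm y < b \<and> deviation p y \<noteq> 0")
      case False
      then have "G y = 0" by (auto simp: G_def)
      then show ?thesis by simp
    next
      case True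
      define d where "d = deviation p y"
      define N where "N = norm y"
      have d: "0 < d" "0 < N" using True a deviation_nonneg[of p y] by (auto simp: d_def N_def)
      obtain m where m: "?n = Suc (Suc m)" using n by (metis Suc_le_D numeral_2_eq_2 Suc_le_mono)
      have "riesz_kernel p y = d powr (- real m)" by (simp add: riesz_kernel_def d_def m)
      then have rk: "riesz_kernel p y = 1 / d ^ m" using d by (simp add: powr_minus powr_realpow divide_inverse)
      have "(\<integral>\<^sup>+\<sigma>. G y * (ennreal (1 / norm (y - \<sigma> *\<^sub>R p) ^ ?n) * indicator {0<..} \<sigma>) \<partial>lborel)
         = G y * (\<integral>\<^sup>+\<sigma>. ennreal (1 / norm (y - \<sigma> *\<^sub>R p) ^ ?n) * indicator {0<..} \<sigma> \<partial>lborel)"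
        by (rule nn_integral_cmult) simp
      also have "\<dots> \<le> G y * ennreal (2 ^ (?n + 1) / (real (?n - 1) * (N * d) ^ (?n - 1)))"
        using nn_integral_distance_line_le[OF p n, of y] d unfolding d_def N_def
        by (intro mult_left_mono) auto
      also have "\<dots> = ennreal (2 * (norm (D y) * (8 * N * d) * (3 ^ ?n / real ?n)) * (2 ^ (?n + 1) / (real (?n - 1) * (N * d) ^ (?n - 1))))"
        using True d by (simp add: G_def d_def[symmetric] N_def[symmetric] ennreal_mult'[symmetric] del: power_Suc)
      \<comment> \<open>The factor \<open>N * d\<close> that comes from the velocity cancels one
        power of \<open>(N * d) ^ (n - 1)\<close>. The exponent \<open>n - 2\<close> that remains is
        that of the kernel.\<close>
      also have "2 * (norm (D y) * (8 * N * d) * (3 ^ ?n / real ?n)) * (2 ^ (?n + 1) / (real (?n - 1) * (N * d) ^ (?n - 1)))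
          = potential_const ?n * (norm (D y) * (riesz_kernel p y / norm y ^ (?n - 2)))"
        using d unfolding potential_const_def rk N_def[symmetric] m
        by (simp add: power_mult_distrib field_simps del: of_nat_Suc) (simp add: power_add)
      also have "ennreal (potential_const ?n * (norm (D y) * (riesz_kernel p y / norm y ^ (?n - 2))))
          = ennreal (potential_const ?n) * ennreal (norm (D y) * (riesz_kernel p y / norm y ^ (?n - 2)))"
        by (rule ennreal_mult'') (simp add: riesz_kernel_nonneg)
      finally show ?thesis using True by simp
    qed
  qed
  also have "\<dots> = ennreal (potential_const ?n) *
       (\<integral>\<^sup>+y\<in>{y. a < norm y \<and> norm y < b}. ennreal (norm (D y) * (riesz_kernel p y / norm y ^ (?n - 2))) \<partial>lborel)"
    by (rule nn_integral_cmult) measurable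
  finally show ?thesis .
qed

text \<open>The bisector of \<open>p\<close> and \<open>q\<close> serves unless
  \<open>q = - p\<close>; in that case any unit vector orthogonal to \<open>p\<close> does, and it
  exists because the dimension is at least 2.\<close>

lemma unit_vector_with_nonneg_inner:
  fixes p q :: "'a::euclidean_space"
  assumes n: "2 \<le> DIM('a)" and p: "norm p = 1" and q: "norm q = 1"
  obtains e where "norm e = 1" "0 \<le> e \<bullet> p" "0 \<le> e \<bullet> q"
proof (cases "p + q = 0")
  case True
  obtain y where "y \<noteq> 0" "orthogonal p y"
    using orthogonal_to_vector_exists[OF n] by blast
  then have "norm (sgn y) = 1" "sgn y \<bullet> p = 0"
    by (auto simp: norm_sgn sgn_div_norm orthogonal_def inner_commute)
  moreover have "q = - p" using True by (simp add: add_eq_0_iff)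
  ultimately show thesis using that[of "sgn y"] by simp
next
  case False
  have pq: "p \<bullet> p = 1" "q \<bullet> q = 1" using p q by (auto simp: dot_square_norm)
  have "- 1 \<le> p \<bullet> q" using Cauchy_Schwarz_ineq2[of p q] p q by simp
  then have "0 \<le> (p + q) \<bullet> p" "0 \<le> (p + q) \<bullet> q"
    using inner_commute[of p q] by (auto simp: inner_add_left pq)
  then show thesis using that[of "sgn (p + q)"] False by (simp add: norm_sgn sgn_div_norm)
qed

text \<open>The quotient \<open>unit_ball_vol (real n) / 4 ^ n\<close> is the volume of the ball of
  radius \<open>1 / 4\<close> over which the end points of the paths are averaged.\<close>

definition osc_const :: "nat \<Rightarrow> real" where
  "osc_const n = potential_const n * 4 ^ n / unit_ball_vol (real n)"

lemma osc_const_pos: "2 \<le> n \<Longrightarrow> 0 < osc_const n"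
  by (auto simp: osc_const_def potential_const_def intro!: divide_pos_pos mult_pos_pos)

text \<open>Both poles are joined to the same point \<open>sgn z\<close>, with \<open>z\<close> near
  a direction \<open>e\<close> that makes at most a right angle with \<open>p\<close> and with
  \<open>q\<close>. For every such \<open>z\<close> the oscillation \<open>l\<close> is at most the
  sum of the two differences along these paths, so it survives averaging over \<open>z\<close>. The
  poles are the same for all radii of the shell.\<close>

lemma potential_estimate:
  fixes w :: "'a::euclidean_space \<Rightarrow> real" and D :: "'a \<Rightarrow> 'a"
  assumes n: "2 \<le> DIM('a)"
    and w: "\<And>x. (w has_derivative (\<lambda>h. D x \<bullet> h)) (at x)" and D: "continuous_on UNIV D"
    and p: "norm p = 1" and q: "norm q = 1" and ab: "0 < a" "a \<le> b" and l: "0 \<le> l"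
    and osc: "\<And>r. a < r \<Longrightarrow> r < b \<Longrightarrow> l \<le> \<bar>w (x + r *\<^sub>R p) - w (x + r *\<^sub>R q)\<bar>"
  shows "ennreal (l * (b - a) * a ^ (DIM('a) - 2)) \<le> ennreal (osc_const DIM('a)) *
    (\<integral>\<^sup>+y\<in>{y. a < norm (y - x) \<and> norm (y - x) < b}.
        ennreal (norm (D y) * (riesz_kernel p (y - x) + riesz_kernel q (y - x))) \<partial>lborel)"
proof -
  let ?n = "DIM('a)"
  obtain e where e: "norm e = 1" "0 \<le> e \<bullet> p" "0 \<le> e \<bullet> q"
    using unit_vector_with_nonneg_inner[OF n p q] by blast
  define v where "v y = w (x + y)" for y
  define E where "E y = D (x + y)" for y
  have v: "(v has_derivative (\<lambda>h. E y \<bullet> h)) (at y)" for y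
  proof -
    have "((\<lambda>y. x + y) has_derivative (\<lambda>h. h)) (at y)" by (auto intro!: derivative_eq_intros)
    from diff_chain_at[OF this w] show ?thesis by (simp add: v_def[abs_def] E_def o_def)
  qed
  have E: "continuous_on UNIV E"
    unfolding E_def[abs_def] by (intro continuous_on_compose2[OF D] continuous_intros) auto
  have Em [measurable]: "E \<in> borel_measurable borel"
    using E by (rule borel_measurable_continuous_onI)
  have Dm [measurable]: "D \<in> borel_measurable borel"
    using D by (rule borel_measurable_continuous_onI)
  have "continuous_on UNIV v"
    by (rule has_derivative_continuous_on[of UNIV v "\<lambda>x h. E x \<bullet> h"]) (use v in auto)
  then have vm [measurable]: "v \<in> borel_measurable borel"
    by (rule borel_measurable_continuous_onI)
  let ?Z = "cball e (1 / 4) :: 'a set"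
  let ?L = "\<lambda>p. (\<integral>\<^sup>+r. (\<integral>\<^sup>+z. ennreal \<bar>v (r *\<^sub>R p) - v (r *\<^sub>R sgn z)\<bar> * indicator ?Z z \<partial>lborel)
        * indicator {a<..<b} r \<partial>lborel)"
  have [measurable]: "?Z \<in> sets borel" by simp
  define R where "R p = (\<integral>\<^sup>+y\<in>{y. a < norm (y - x) \<and> norm (y - x) < b}. ennreal (norm (D y) * riesz_kernel p (y - x)) \<partial>lborel)" for p
  have L: "?L p' \<le> ennreal (potential_const ?n / a ^ (?n - 2)) * R p'"
    if "norm p' = 1" "0 \<le> e \<bullet> p'" for p'
  proof -
    have "?L p' \<le> ennreal (potential_const ?n) *
       (\<integral>\<^sup>+y\<in>{y. a < norm y \<and> norm y < b}. ennreal (norm (E y) * (riesz_kernel p' y / norm y ^ (?n - 2))) \<partial>lborel)"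
      by (rule potential_estimate_one_pole[OF n v E that(1) e(1) that(2) ab(1)])
    also have "\<dots> \<le> ennreal (potential_const ?n) *
       (\<integral>\<^sup>+y. ennreal (1 / a ^ (?n - 2)) * (ennreal (norm (E y) * riesz_kernel p' y) * indicator {y. a < norm y \<and> norm y < b} y) \<partial>lborel)"
    proof (intro mult_left_mono nn_integral_mono)
      fix y :: 'a
      have "norm (E y) * (riesz_kernel p' y / norm y ^ (?n - 2)) \<le> 1 / a ^ (?n - 2) * (norm (E y) * riesz_kernel p' y)" if "a < norm y"
      proof -
        have "a ^ (?n - 2) \<le> norm y ^ (?n - 2)" using that ab by (intro power_mono) auto
        then have "1 / norm y ^ (?n - 2) \<le> 1 / a ^ (?n - 2)" using ab that
            by (intro divide_left_mono mult_pos_pos zero_less_power) (auto intro: less_trans)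
        then have "1 / norm y ^ (?n - 2) * (norm (E y) * riesz_kernel p' y) \<le> 1 / a ^ (?n - 2) * (norm (E y) * riesz_kernel p' y)"
          by (intro mult_right_mono) (auto simp: riesz_kernel_nonneg)
        then show ?thesis by (simp add: mult_ac)
      qed
      then show "ennreal (norm (E y) * (riesz_kernel p' y / norm y ^ (?n - 2))) * indicator {y. a < norm y \<and> norm y < b} y
        \<le> ennreal (1 / a ^ (?n - 2)) * (ennreal (norm (E y) * riesz_kernel p' y) * indicator {y. a < norm y \<and> norm y < b} y)"
        using ab by (auto simp: indicator_def ennreal_mult'[symmetric] intro!: ennreal_leI)
    qed simp
    also have "\<dots> = ennreal (potential_const ?n / a ^ (?n - 2)) *
       (\<integral>\<^sup>+y. ennreal (norm (E y) * riesz_kernel p' y) * indicator {y. a < norm y \<and> norm y < b} y \<partial>lborel)"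
      using ab by (subst nn_integral_cmult) (auto simp: mult.assoc[symmetric] ennreal_mult'[symmetric] potential_const_def)
    also have "(\<integral>\<^sup>+y. ennreal (norm (E y) * riesz_kernel p' y) * indicator {y. a < norm y \<and> norm y < b} y \<partial>lborel) = R p'"
      unfolding R_def by (subst (2) nn_integral_lborel_affine[of _ 1 x]) (auto simp: E_def indicator_def)
    finally show ?thesis .
  qed
  have Z: "emeasure lborel ?Z = ennreal (unit_ball_vol (real ?n) * (1 / 4) ^ ?n)"
    by (simp add: emeasure_cball)
  have "ennreal (l * (b - a)) * emeasure lborel ?Z
      = (\<integral>\<^sup>+r. (\<integral>\<^sup>+z. ennreal l * indicator ?Z z \<partial>lborel) * indicator {a<..<b} r \<partial>lborel)"
    using l ab by (simp add: nn_integral_cmult_indicator) (simp add: ennreal_mult' mult_ac)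
  also have "\<dots> \<le> (\<integral>\<^sup>+r. (\<integral>\<^sup>+z. ennreal \<bar>v (r *\<^sub>R p) - v (r *\<^sub>R sgn z)\<bar> * indicator ?Z z
        + ennreal \<bar>v (r *\<^sub>R q) - v (r *\<^sub>R sgn z)\<bar> * indicator ?Z z \<partial>lborel) * indicator {a<..<b} r \<partial>lborel)"
  proof (rule nn_integral_mono)
    fix r :: real
    show "(\<integral>\<^sup>+z. ennreal l * indicator ?Z z \<partial>lborel) * indicator {a<..<b} r
      \<le> (\<integral>\<^sup>+z. ennreal \<bar>v (r *\<^sub>R p) - v (r *\<^sub>R sgn z)\<bar> * indicator ?Z z
        + ennreal \<bar>v (r *\<^sub>R q) - v (r *\<^sub>R sgn z)\<bar> * indicator ?Z z \<partial>lborel) * indicator {a<..<b} r"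
    proof (cases "r \<in> {a<..<b}")
      case True
      then have le: "l \<le> \<bar>v (r *\<^sub>R p) - v (r *\<^sub>R q)\<bar>" using osc by (simp add: v_def)
      show ?thesis
      proof (intro mult_right_mono nn_integral_mono)
        fix z
        have "l \<le> \<bar>v (r *\<^sub>R p) - v (r *\<^sub>R sgn z)\<bar> + \<bar>v (r *\<^sub>R q) - v (r *\<^sub>R sgn z)\<bar>"
          using le by linarith
        then have "ennreal l \<le> ennreal \<bar>v (r *\<^sub>R p) - v (r *\<^sub>R sgn z)\<bar> + ennreal \<bar>v (r *\<^sub>R q) - v (r *\<^sub>R sgn z)\<bar>"
          by (simp add: ennreal_plus[symmetric] ennreal_leI del: ennreal_plus)
        then show "ennreal l * indicator ?Z z \<le> ennreal \<bar>v (r *\<^sub>R p) - v (r *\<^sub>R sgn z)\<bar> * indicator ?Z z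
            + ennreal \<bar>v (r *\<^sub>R q) - v (r *\<^sub>R sgn z)\<bar> * indicator ?Z z"
          by (cases "z \<in> ?Z") (simp_all del: mem_cball ennreal_plus)
      qed simp
    qed simp
  qed
  also have "\<dots> = (\<integral>\<^sup>+r. (\<integral>\<^sup>+z. ennreal \<bar>v (r *\<^sub>R p) - v (r *\<^sub>R sgn z)\<bar> * indicator ?Z z \<partial>lborel) * indicator {a<..<b} r
     + (\<integral>\<^sup>+z. ennreal \<bar>v (r *\<^sub>R q) - v (r *\<^sub>R sgn z)\<bar> * indicator ?Z z \<partial>lborel) * indicator {a<..<b} r \<partial>lborel)"
    by (intro nn_integral_cong) (subst nn_integral_add, measurable, simp add: distrib_right)
  also have "\<dots> = ?L p + ?L q"
    by (rule nn_integral_add) measurable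
  also have "\<dots> \<le> ennreal (potential_const ?n / a ^ (?n - 2)) * R p + ennreal (potential_const ?n / a ^ (?n - 2)) * R q"
    by (intro add_mono L p q e)
  finally have main: "ennreal (l * (b - a)) * ennreal (unit_ball_vol (real ?n) * (1 / 4) ^ ?n)
     \<le> ennreal (potential_const ?n / a ^ (?n - 2)) * (R p + R q)"
    by (simp add: Z distrib_left)
  have ubv: "unit_ball_vol (real ?n) \<noteq> 0" using unit_ball_vol_pos[of "real ?n"] by linarith
  define c where "c = a ^ (?n - 2) * 4 ^ ?n / unit_ball_vol (real ?n)"
  have c: "0 \<le> c" "c * (l * (b - a) * (unit_ball_vol (real ?n) * (1 / 4) ^ ?n)) = l * (b - a) * a ^ (?n - 2)"
    "c * (potential_const ?n / a ^ (?n - 2)) = osc_const ?n"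
    using ab ubv by (simp_all add: c_def osc_const_def power_divide)
  have pc: "0 \<le> potential_const ?n / a ^ (?n - 2)" using ab by (simp add: potential_const_def)
  have "ennreal (l * (b - a) * a ^ (?n - 2)) = ennreal c * (ennreal (l * (b - a)) * ennreal (unit_ball_vol (real ?n) * (1 / 4) ^ ?n))"
    using c ab l by (auto simp: ennreal_mult'[symmetric] ennreal_mult''[symmetric])
  also have "\<dots> \<le> ennreal c * (ennreal (potential_const ?n / a ^ (?n - 2)) * (R p + R q))"
    by (intro mult_left_mono main) auto
  also have "\<dots> = ennreal (osc_const ?n) * (R p + R q)"
    using c pc by (simp add: mult.assoc[symmetric] ennreal_mult'[symmetric])
  also have "R p + R q = (\<integral>\<^sup>+y\<in>{y. a < norm (y - x) \<and> norm (y - x) < b}.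
        ennreal (norm (D y) * (riesz_kernel p (y - x) + riesz_kernel q (y - x))) \<partial>lborel)"
    unfolding R_def
    by (subst nn_integral_add[symmetric])
       (auto intro!: nn_integral_cong simp: indicator_def distrib_left riesz_kernel_nonneg)
  finally show ?thesis .
qed

section \<open>Mollification\<close>

lemma nn_integral_lborel_translate:
  fixes f :: "'a::euclidean_space \<Rightarrow> ennreal"
  assumes [measurable]: "f \<in> borel_measurable borel"
  shows "(\<integral>\<^sup>+x. f (x + h) \<partial>lborel) = (\<integral>\<^sup>+x. f x \<partial>lborel)"
proof -
  have "(\<integral>\<^sup>+x. f x \<partial>lborel) = (\<integral>\<^sup>+x. f x \<partial>distr lborel borel ((+) h))"
    by (simp add: lborel_distr_plus)
  also have "\<dots> = (\<integral>\<^sup>+x. f (h + x) \<partial>lborel)"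
    by (rule nn_integral_distr) measurable
  finally show ?thesis by (simp add: add.commute)
qed

text \<open>Induction over integrable functions. The base case is an indicator: \<open>A\<close> is
  enclosed between a compact \<open>K\<close> and an open \<open>U\<close>, and a shift shorter than
  the distance from \<open>K\<close> to the complement of \<open>U\<close> changes the indicator
  only at points \<open>x\<close> for which \<open>x\<close> or \<open>x + h\<close> lies in
  \<open>U - K\<close>.\<close>

lemma L1_continuous_translation:
  fixes u :: "'a::euclidean_space \<Rightarrow> 'b::{banach, second_countable_topology}"
  assumes "integrable lborel u" and "0 < e"
  shows "\<exists>d>0. \<forall>h. norm h < d \<longrightarrow> (\<integral>\<^sup>+x. norm (u (x + h) - u x) \<partial>lborel) \<le> ennreal e"
  using assms
proof (induction arbitrary: e rule: integrable_induct)
  case (base A c)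
  \<comment> \<open>The set \<open>U - K\<close> is covered by three pieces, each of measure below
    \<open>e'\<close>, and it is counted once at \<open>x\<close> and once at \<open>x + h\<close>;
    hence the 6.\<close>
  define e' where "e' = e / (6 * (norm c + 1))"
  have e': "0 < e'" using base.prems by (auto simp: e'_def intro!: divide_pos_pos add_nonneg_pos)
  have A: "A \<in> sets lebesgue" using base by simp
  obtain U where U: "open U" "A \<subseteq> U" "U - A \<in> lmeasurable" "emeasure lebesgue (U - A) < ennreal e'"
    using sets_lebesgue_outer_open[OF A e'] .
  obtain C where C: "closed C" "C \<subseteq> A" "A - C \<in> lmeasurable" "emeasure lebesgue (A - C) < ennreal e'"
    using sets_lebesgue_inner_closed[OF A e'] .
  \<comment> \<open>The part of the closed set \<open>C\<close> far from the origin. It has small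
    measure for large \<open>n\<close> since \<open>A\<close> has finite measure, and removing it
    makes the inner set compact.\<close>
  define S where "S n = C - cball 0 (real n)" for n
  have [measurable]: "C \<in> sets borel" "U \<in> sets borel" "A \<in> sets borel" using C U base by auto
  have "(\<lambda>n. emeasure lborel (S n)) \<longlonglongrightarrow> emeasure lborel (\<Inter>n. S n)"
  proof (rule Lim_emeasure_decseq)
    show "range S \<subseteq> sets lborel" by (auto simp: S_def)
    show "decseq S" by (auto simp: decseq_def S_def intro: order_trans)
    show "emeasure lborel (S n) \<noteq> \<infinity>" for n
    proof -
      have "S n \<subseteq> A" using C by (auto simp: S_def)
      then have "emeasure lborel (S n) \<le> emeasure lborel A" using base by (intro emeasure_mono) auto
      then show ?thesis using base by (auto simp: top_unique)
    qed
  qed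
  also have "(\<Inter>n. S n) = {}"
  proof (rule equals0I)
    fix x assume x: "x \<in> (\<Inter>n. S n)"
    obtain n where "norm x \<le> real n" using real_arch_simple by blast
    with x show False by (auto simp: S_def)
  qed
  finally have "(\<lambda>n. emeasure lborel (S n)) \<longlonglongrightarrow> 0" by simp
  then have "eventually (\<lambda>n. emeasure lborel (S n) < ennreal e') sequentially"
    by (rule order_tendstoD) (use e' in simp)
  then obtain n where n: "emeasure lborel (S n) < ennreal e'"
    by (auto simp: eventually_sequentially)
  define K where "K = C \<inter> cball 0 (real n)"
  have K: "compact K" "K \<subseteq> U" using C U by (auto simp: K_def closed_Int_compact)
  have [measurable]: "K \<in> sets borel" by (simp add: K_def)
  have UK: "emeasure lborel (U - K) \<le> ennreal (3 * e')"
  proof -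
    have "emeasure lborel (U - K) \<le> emeasure lborel ((U - A) \<union> (A - C) \<union> S n)"
      by (intro emeasure_mono) (auto simp: K_def S_def)
    also have "\<dots> \<le> emeasure lborel (U - A) + emeasure lborel (A - C) + emeasure lborel (S n)"
      by (intro order_trans[OF emeasure_subadditive] add_mono emeasure_subadditive) (auto simp: S_def)
    also have "\<dots> \<le> ennreal e' + ennreal e' + ennreal e'"
      using n U C by (intro add_mono) auto
    also have "\<dots> = ennreal (3 * e')" using e' by (simp add: ennreal_plus[symmetric] del: ennreal_plus)
    finally show ?thesis .
  qed
  have "K \<inter> - U = {}" using K by auto
  then obtain d where d: "0 < d" "\<And>x y. x \<in> K \<Longrightarrow> y \<in> - U \<Longrightarrow> d \<le> dist x y"
    using separate_compact_closed[of K "- U"] K U(1) closed_Compl by blast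
  have "(\<integral>\<^sup>+x. norm (indicator A (x + h) *\<^sub>R c - indicator A x *\<^sub>R c) \<partial>lborel) \<le> ennreal e" if h: "norm h < d" for h
  proof -
    have "norm (indicator A (x + h) *\<^sub>R c - indicator A x *\<^sub>R c)
       \<le> norm c * (indicator (U - K) (x + h) + indicator (U - K) x)" for x
    proof -
      have "x + h \<in> U" if "x \<in> K" using d(2)[OF that, of "x + h"] h by (force simp: dist_norm)
      moreover have "x \<in> U" if "x + h \<in> K" using d(2)[OF that, of x] h by (force simp: dist_norm)
      moreover have "K \<subseteq> A" using C by (auto simp: K_def)
      ultimately show ?thesis using U(2) by (auto simp: indicator_def)
    qed
    then have "(\<integral>\<^sup>+x. norm (indicator A (x + h) *\<^sub>R c - indicator A x *\<^sub>R c) \<partial>lborel)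
       \<le> (\<integral>\<^sup>+x. ennreal (norm c) * (indicator (U - K) (x + h) + indicator (U - K) x) \<partial>lborel)"
      by (intro nn_integral_mono) (auto simp: ennreal_mult'[symmetric] ennreal_indicator[symmetric] ennreal_plus[symmetric] intro!: ennreal_leI simp del: ennreal_plus)
    also have "\<dots> = ennreal (norm c) * ((\<integral>\<^sup>+x. indicator (U - K) (x + h) \<partial>lborel) + (\<integral>\<^sup>+x. indicator (U - K) x \<partial>lborel))"
      by (subst nn_integral_cmult, measurable, subst nn_integral_add, measurable)
    also have "(\<integral>\<^sup>+x. indicator (U - K) (x + h) \<partial>lborel) = (\<integral>\<^sup>+x. indicator (U - K) x \<partial>(lborel :: 'a measure))"
      by (rule nn_integral_lborel_translate) measurable
    also have "ennreal (norm c) * ((\<integral>\<^sup>+x. indicator (U - K) x \<partial>lborel) + (\<integral>\<^sup>+x. indicator (U - K) x \<partial>lborel))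
        \<le> ennreal (norm c) * (ennreal (3 * e') + ennreal (3 * e'))"
      using UK by (intro mult_left_mono add_mono) auto
    also have "\<dots> = ennreal (norm c * (6 * e'))"
      using e' by (simp add: ennreal_mult'[symmetric] ennreal_plus[symmetric] del: ennreal_plus)
    also have "\<dots> \<le> ennreal e"
    proof (rule ennreal_leI)
      have "norm c * (6 * e') \<le> (norm c + 1) * (6 * e')" using e' by (intro mult_right_mono) auto
      also have "\<dots> = e"
      proof -
        have "norm c + 1 \<noteq> 0" using norm_ge_zero[of c] by linarith
        then show ?thesis by (simp add: e'_def field_simps)
      qed
      finally show "norm c * (6 * e') \<le> e" .
    qed
    finally show ?thesis .
  qed
  then show ?case using d by blast
next
  case (add f g)
  have [measurable]: "f \<in> borel_measurable borel" "g \<in> borel_measurable borel"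
    using add.hyps by auto
  obtain d1 where d1: "0 < d1" "\<And>h. norm h < d1 \<Longrightarrow> (\<integral>\<^sup>+x. norm (f (x + h) - f x) \<partial>lborel) \<le> ennreal (e / 2)"
    using add.IH(1)[of "e / 2"] add.prems by auto
  obtain d2 where d2: "0 < d2" "\<And>h. norm h < d2 \<Longrightarrow> (\<integral>\<^sup>+x. norm (g (x + h) - g x) \<partial>lborel) \<le> ennreal (e / 2)"
    using add.IH(2)[of "e / 2"] add.prems by auto
  have "(\<integral>\<^sup>+x. norm (f (x + h) + g (x + h) - (f x + g x)) \<partial>lborel) \<le> ennreal e" if "norm h < min d1 d2" for h
  proof -
    have "(\<integral>\<^sup>+x. norm (f (x + h) + g (x + h) - (f x + g x)) \<partial>lborel)
        \<le> (\<integral>\<^sup>+x. ennreal (norm (f (x + h) - f x)) + ennreal (norm (g (x + h) - g x)) \<partial>lborel)"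
    proof (rule nn_integral_mono)
      fix x
      have "norm (f (x + h) + g (x + h) - (f x + g x)) \<le> norm (f (x + h) - f x) + norm (g (x + h) - g x)"
        by (metis add_diff_add norm_triangle_ineq)
      then show "ennreal (norm (f (x + h) + g (x + h) - (f x + g x))) \<le> ennreal (norm (f (x + h) - f x)) + ennreal (norm (g (x + h) - g x))"
        by (simp add: ennreal_plus[symmetric] ennreal_leI del: ennreal_plus)
    qed
    also have "\<dots> = (\<integral>\<^sup>+x. norm (f (x + h) - f x) \<partial>lborel) + (\<integral>\<^sup>+x. norm (g (x + h) - g x) \<partial>lborel)"
      by (rule nn_integral_add) measurable
    also have "\<dots> \<le> ennreal (e / 2) + ennreal (e / 2)"
      using that by (intro add_mono d1 d2) auto
    finally show ?thesis using add.prems by (simp add: ennreal_plus[symmetric] del: ennreal_plus)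
  qed
  then show ?case using d1 d2 by (intro exI[of _ "min d1 d2"]) auto
next
  case (lim f s)
  have [measurable]: "f \<in> borel_measurable borel" "\<And>i. s i \<in> borel_measurable borel"
    using lim.hyps by auto
  have "(\<lambda>i. \<integral>\<^sup>+x. norm (s i x - f x) \<partial>lborel) \<longlonglongrightarrow> (\<integral>\<^sup>+x. 0 \<partial>(lborel :: 'a measure))"
  proof (rule nn_integral_dominated_convergence[where w = "\<lambda>x. ennreal (3 * norm (f x))"])
    show "AE x in lborel. ennreal (norm (s i x - f x)) \<le> ennreal (3 * norm (f x))" for i
    proof (intro AE_I2 ennreal_leI)
      fix x
      show "norm (s i x - f x) \<le> 3 * norm (f x)"
        using lim.hyps(3)[of x i] norm_triangle_ineq4[of "s i x" "f x"] by simp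
    qed
    show "(\<integral>\<^sup>+x. ennreal (3 * norm (f x)) \<partial>lborel) < \<infinity>"
      using lim.hyps(4) by (simp add: ennreal_mult' nn_integral_cmult integrable_iff_bounded ennreal_mult_less_top)
    show "AE x in lborel. (\<lambda>i. ennreal (norm (s i x - f x))) \<longlonglongrightarrow> 0"
    proof (rule AE_I2)
      fix x :: 'a
      have "(\<lambda>i. norm (s i x - f x)) \<longlonglongrightarrow> 0"
        using lim.hyps(2)[of x] by (simp add: LIM_zero tendsto_norm_zero)
      then show "(\<lambda>i. ennreal (norm (s i x - f x))) \<longlonglongrightarrow> 0"
        using tendsto_ennrealI by fastforce
    qed
  qed measurable
  then have "eventually (\<lambda>i. (\<integral>\<^sup>+x. norm (s i x - f x) \<partial>lborel) < ennreal (e / 3)) sequentially"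
    by (rule order_tendstoD(2)) (use lim.prems in simp)
  then obtain i where i: "(\<integral>\<^sup>+x. norm (s i x - f x) \<partial>lborel) < ennreal (e / 3)"
    by (auto simp: eventually_sequentially)
  obtain d where d: "0 < d" "\<And>h. norm h < d \<Longrightarrow> (\<integral>\<^sup>+x. norm (s i (x + h) - s i x) \<partial>lborel) \<le> ennreal (e / 3)"
    using lim.IH[of "e / 3" i] lim.prems by auto
  have "(\<integral>\<^sup>+x. norm (f (x + h) - f x) \<partial>lborel) \<le> ennreal e" if "norm h < d" for h
  proof -
    have "(\<integral>\<^sup>+x. norm (f (x + h) - f x) \<partial>lborel)
        \<le> (\<integral>\<^sup>+x. ennreal (norm (s i (x + h) - f (x + h))) + ennreal (norm (s i (x + h) - s i x)) + ennreal (norm (s i x - f x)) \<partial>lborel)"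
    proof (rule nn_integral_mono)
      fix x
      have eq: "f (x + h) - f x = (s i (x + h) - s i x) - (s i (x + h) - f (x + h)) + (s i x - f x)" by simp
      have "norm (f (x + h) - f x) \<le> norm (s i (x + h) - f (x + h)) + norm (s i (x + h) - s i x) + norm (s i x - f x)"
        unfolding eq using norm_triangle_ineq[of "(s i (x + h) - s i x) - (s i (x + h) - f (x + h))" "s i x - f x"]
          norm_triangle_ineq4[of "s i (x + h) - s i x" "s i (x + h) - f (x + h)"] by linarith
      then show "ennreal (norm (f (x + h) - f x)) \<le> ennreal (norm (s i (x + h) - f (x + h))) + ennreal (norm (s i (x + h) - s i x)) + ennreal (norm (s i x - f x))"
        by (simp add: ennreal_plus[symmetric] ennreal_leI del: ennreal_plus)
    qed
    also have "\<dots> = (\<integral>\<^sup>+x. norm (s i (x + h) - f (x + h)) \<partial>lborel) + (\<integral>\<^sup>+x. norm (s i (x + h) - s i x) \<partial>lborel) + (\<integral>\<^sup>+x. norm (s i x - f x) \<partial>lborel)"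
      by (subst nn_integral_add, measurable, subst nn_integral_add, measurable)
    also have "(\<integral>\<^sup>+x. norm (s i (x + h) - f (x + h)) \<partial>lborel) = (\<integral>\<^sup>+x. norm (s i x - f x) \<partial>lborel)"
      by (rule nn_integral_lborel_translate) measurable
    also have "(\<integral>\<^sup>+x. norm (s i x - f x) \<partial>lborel) + (\<integral>\<^sup>+x. norm (s i (x + h) - s i x) \<partial>lborel) + (\<integral>\<^sup>+x. norm (s i x - f x) \<partial>lborel)
       \<le> ennreal (e / 3) + ennreal (e / 3) + ennreal (e / 3)"
      using that i by (intro add_mono d) auto
    finally show ?thesis using lim.prems by (simp add: ennreal_plus[symmetric] del: ennreal_plus)
  qed
  then show ?case using d by blast
qed

section \<open>Smooth functions and their gradients\<close>

text \<open>The definition of \<open>smooth\<close> ranges over lists of directions, so induction on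
  the list reduces it to a class of differentiable functions closed under directional derivatives.
  Each proof of smoothness below exhibits such a class.\<close>

lemma smooth_coinduct:
  assumes "\<phi> \<in> C" "\<And>f. f \<in> C \<Longrightarrow> f differentiable_on UNIV"
    and "\<And>f v. f \<in> C \<Longrightarrow> (\<lambda>x. frechet_derivative f (at x) v) \<in> C"
  shows "smooth \<phi>"
  unfolding smooth_def
proof
  fix vs
  have "foldr (\<lambda>v g x. frechet_derivative g (at x) v) vs \<phi> \<in> C"
    by (induction vs) (use assms in auto)
  then show "foldr (\<lambda>v g x. frechet_derivative g (at x) v) vs \<phi> differentiable_on UNIV"
    by (rule assms)
qed

lemma smooth_imp_differentiable:
  assumes "smooth \<phi>"
  shows "\<phi> differentiable (at x)"
  using assms[unfolded smooth_def, rule_format, of "[]"] by (simp add: differentiable_on_def)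

lemma smooth_frechet_derivative:
  assumes "smooth \<phi>"
  shows "smooth (\<lambda>x. frechet_derivative \<phi> (at x) v)"
  unfolding smooth_def
proof
  fix vs
  show "foldr (\<lambda>v g x. frechet_derivative g (at x) v) vs (\<lambda>x. frechet_derivative \<phi> (at x) v) differentiable_on UNIV"
    using assms[unfolded smooth_def, rule_format, of "vs @ [v]"] by simp
qed

lemma inner_grad:
  assumes "\<phi> differentiable (at x)"
  shows "grad \<phi> x \<bullet> h = frechet_derivative \<phi> (at x) h"
proof -
  have lin: "linear (frechet_derivative \<phi> (at x))"
    using assms frechet_derivative_works has_derivative_linear by blast
  have "h = (\<Sum>i\<in>UNIV. (h $ i) *\<^sub>R axis i 1)"
    using basis_expansion[of h] by (simp add: scalar_mult_eq_scaleR)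
  then have "frechet_derivative \<phi> (at x) h = frechet_derivative \<phi> (at x) (\<Sum>i\<in>UNIV. (h $ i) *\<^sub>R axis i 1)"
    by (rule arg_cong)
  also have "\<dots> = (\<Sum>i\<in>UNIV. h $ i * frechet_derivative \<phi> (at x) (axis i 1))"
    by (simp add: linear_sum[OF lin] linear_cmul[OF lin])
  finally show ?thesis by (simp add: grad_def inner_vec_def mult.commute)
qed

lemma has_derivative_grad:
  assumes "\<phi> differentiable (at x)"
  shows "(\<phi> has_derivative (\<lambda>h. grad \<phi> x \<bullet> h)) (at x)"
  using assms inner_grad[OF assms] frechet_derivative_works[of \<phi> "at x"] by (simp add: fun_eq_iff[symmetric])

lemma grad_eqI:
  assumes "(\<phi> has_derivative (\<lambda>h. d \<bullet> h)) (at x)"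
  shows "grad \<phi> x = d"
proof -
  have "frechet_derivative \<phi> (at x) = (\<lambda>h. d \<bullet> h)"
    using assms by (rule frechet_derivative_at[symmetric])
  then show ?thesis by (simp add: grad_def vec_eq_iff inner_axis)
qed

lemma smooth_imp_continuous_on: "smooth \<phi> \<Longrightarrow> continuous_on S \<phi>"
  by (meson smooth_imp_differentiable differentiable_imp_continuous_within continuous_at_imp_continuous_on)

lemma smooth_imp_continuous_on_grad:
  assumes "smooth \<phi>"
  shows "continuous_on S (grad \<phi>)"
  unfolding grad_def
  by (intro continuous_on_vec_lambda smooth_imp_continuous_on smooth_frechet_derivative assms)

text \<open>The inner derivative \<open>s\<close> is absorbed into the constant, so the functions
  \<open>c * f (s *\<^sub>R x + z)\<close> with varying \<open>c\<close> and \<open>f\<close> form a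
  class closed under directional derivatives.\<close>

lemma smooth_affine:
  assumes "smooth f"
  shows "smooth (\<lambda>x. c * f (s *\<^sub>R x + z))"
proof (rule smooth_coinduct)
  show "(\<lambda>x. c * f (s *\<^sub>R x + z)) \<in> {(\<lambda>x. c * f (s *\<^sub>R x + z)) | c f. smooth f}"
    using assms by blast
  have der: "((\<lambda>x. c * f (s *\<^sub>R x + z)) has_derivative (\<lambda>h. (c * s) * frechet_derivative f (at (s *\<^sub>R x + z)) h)) (at x)"
    if f: "smooth f" for c f and x :: "real ^ 'a"
  proof -
    have fd: "(f has_derivative frechet_derivative f (at (s *\<^sub>R x + z))) (at (s *\<^sub>R x + z))"
      using smooth_imp_differentiable[OF f] frechet_derivative_works by blast
    have "((\<lambda>x. s *\<^sub>R x + z) has_derivative (\<lambda>h. s *\<^sub>R h)) (at x)" by (auto intro!: derivative_eq_intros)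
    from has_derivative_mult_right[OF diff_chain_at[OF this fd], of c]
    show ?thesis using linear_cmul[OF has_derivative_linear[OF fd]] by (simp add: o_def mult.assoc)
  qed
  show "g differentiable_on UNIV" if "g \<in> {(\<lambda>x. c * f (s *\<^sub>R x + z)) | c f. smooth f}" for g
    using that der by (auto simp: differentiable_on_def differentiable_def intro: has_derivative_at_withinI)
  show "(\<lambda>x. frechet_derivative g (at x) v) \<in> {(\<lambda>x. c * f (s *\<^sub>R x + z)) | c f. smooth f}"
    if g: "g \<in> {(\<lambda>x. c * f (s *\<^sub>R x + z)) | c f. smooth f}" for g v
  proof -
    obtain c f where g: "g = (\<lambda>x. c * f (s *\<^sub>R x + z))" "smooth f" using g by blast
    have "frechet_derivative g (at x) v = (c * s) * frechet_derivative f (at (s *\<^sub>R x + z)) v" for x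
      using frechet_derivative_at[OF der[OF g(2)], of c x] unfolding g by (metis (no_types))
    then have "(\<lambda>x. frechet_derivative g (at x) v)
        = (\<lambda>x. (c * s) * (\<lambda>y. frechet_derivative f (at y) v) (s *\<^sub>R x + z))"
      by (simp only:)
    then show ?thesis
      by (intro CollectI exI[of _ "c * s"] exI[of _ "\<lambda>y. frechet_derivative f (at y) v"])
        (simp add: smooth_frechet_derivative[OF g(2)])
  qed
qed

section \<open>Bump functions and mollifiers\<close>

text \<open>The classical flat function \<open>exp (- 1 / t)\<close>, multiplied by the powers of
  \<open>1 / t\<close> that its derivatives produce: the derivative of a member of this family is a
  linear combination of two others.\<close>

definition flat_exp :: "nat \<Rightarrow> real \<Rightarrow> real" where
  "flat_exp k t = (if 0 < t then exp (- inverse t) * inverse t ^ k else 0)"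

lemma flat_exp_has_derivative:
  "(flat_exp k has_real_derivative flat_exp (k + 2) t - real k * flat_exp (k + 1) t) (at t)"
proof (cases t "0 :: real" rule: linorder_cases)
  case less
  have "((\<lambda>_. 0) has_real_derivative 0) (at t)" by simp
  then have "(flat_exp k has_real_derivative 0) (at t)"
    by (rule has_field_derivative_transform_within_open[where S = "{..<0}"])
      (use less in \<open>auto simp: flat_exp_def\<close>)
  then show ?thesis using less by (simp add: flat_exp_def)
next
  case greater
  have "((\<lambda>t. exp (- inverse t) * inverse t ^ k) has_real_derivative
     (exp (- inverse t) * inverse t ^ 2 * inverse t ^ k
       - exp (- inverse t) * (real k * inverse t ^ (k - Suc 0) * inverse t ^ 2))) (at t)"
    using greater by (auto intro!: derivative_eq_intros simp: power2_eq_square)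
  also have "real k * inverse t ^ (k - Suc 0) * inverse t ^ 2 = real k * inverse t ^ (k + 1)"
    by (cases k) (auto simp: power2_eq_square)
  also have "exp (- inverse t) * inverse t ^ 2 * inverse t ^ k - exp (- inverse t) * (real k * inverse t ^ (k + 1))
     = exp (- inverse t) * inverse t ^ (k + 2) - real k * (exp (- inverse t) * inverse t ^ (k + 1))"
    by (simp add: power_add power2_eq_square)
  finally have "((\<lambda>t. exp (- inverse t) * inverse t ^ k) has_real_derivative
     (flat_exp (k + 2) t - real k * flat_exp (k + 1) t)) (at t)"
    using greater by (simp only: flat_exp_def if_True)
  then show ?thesis
    by (rule has_field_derivative_transform_within_open[where S = "{0<..}"])
      (use greater in \<open>auto simp: flat_exp_def\<close>)
next
  case equal
  have "((\<lambda>h. flat_exp k h / h) \<longlongrightarrow> 0) (at 0)"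
  proof (rule filterlim_split_at)
    show "((\<lambda>h. flat_exp k h / h) \<longlongrightarrow> 0) (at_left 0)"
      by (rule tendsto_eventually) (auto simp: eventually_at_filter flat_exp_def intro!: always_eventually)
    have "((\<lambda>h::real. inverse h ^ Suc k / exp (inverse h)) \<longlongrightarrow> 0) (at_right 0)"
      by (rule filterlim_compose[OF tendsto_power_div_exp_0 filterlim_inverse_at_top_right])
    then show "((\<lambda>h. flat_exp k h / h) \<longlongrightarrow> 0) (at_right 0)"
      by (rule tendsto_cong[THEN iffD1, rotated])
        (auto simp: eventually_at_filter flat_exp_def exp_minus divide_inverse mult_ac intro!: always_eventually)
  qed
  then have "(flat_exp k has_real_derivative 0) (at 0)"
    by (simp add: has_field_derivative_iff flat_exp_def)
  then show ?thesis using equal by (simp add: flat_exp_def)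
qed

text \<open>The derivatives of the bump function are polynomials in \<open>x\<close> and in the
  functions \<open>flat_exp k (1 - x \<bullet> x)\<close>. An algebra containing these is closed
  under directional derivatives, so it is a class to which \<open>smooth_coinduct\<close> applies,
  without formulas for higher derivatives.\<close>

inductive bump_algebra :: "(real ^ 'n \<Rightarrow> real) \<Rightarrow> bool" where
  flat: "bump_algebra (\<lambda>x. flat_exp k (1 - x \<bullet> x))"
| const: "bump_algebra (\<lambda>x. c)"
| lin: "bump_algebra (\<lambda>x. v \<bullet> x)"
| add: "bump_algebra f \<Longrightarrow> bump_algebra g \<Longrightarrow> bump_algebra (\<lambda>x. f x + g x)"
| mult: "bump_algebra f \<Longrightarrow> bump_algebra g \<Longrightarrow> bump_algebra (\<lambda>x. f x * g x)"

lemma bump_algebra_derivative: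
  assumes "bump_algebra f"
  shows "\<exists>f'. (\<forall>x. (f has_derivative f' x) (at x)) \<and> (\<forall>v. bump_algebra (\<lambda>x. f' x v))"
  using assms
proof (induction rule: bump_algebra.induct)
  case (flat k)
  let ?g = "\<lambda>x. flat_exp (k + 2) (1 - x \<bullet> x) + (- real k) * flat_exp (k + 1) (1 - x \<bullet> x)"
  have "((\<lambda>x. flat_exp k (1 - x \<bullet> x)) has_derivative (\<lambda>v. ?g x * ((- 2 *\<^sub>R v) \<bullet> x))) (at x)" for x :: "real ^ 'n"
  proof -
    have 1: "((\<lambda>x::real ^ 'n. 1 - x \<bullet> x) has_derivative (\<lambda>v. (- 2 *\<^sub>R v) \<bullet> x)) (at x)"
      by (auto intro!: derivative_eq_intros simp: inner_commute)
    have 2: "(flat_exp k has_derivative (\<lambda>h. ?g x * h)) (at (1 - x \<bullet> x))"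
      using flat_exp_has_derivative[of k "1 - x \<bullet> x"] by (simp add: has_field_derivative_def)
    from diff_chain_at[OF 1 2] show ?thesis by (simp add: o_def)
  qed
  moreover have "bump_algebra (\<lambda>x::real ^ 'n. ?g x * ((- 2 *\<^sub>R v) \<bullet> x))" for v
    by (intro bump_algebra.intros)
  ultimately show ?case by (intro exI conjI allI)
next
  case (const c)
  have "((\<lambda>x::real ^ 'n. c) has_derivative (\<lambda>v. 0)) (at x)" for x by simp
  then show ?case by (intro exI[of _ "\<lambda>x h. 0"] conjI allI bump_algebra.const)
next
  case (lin v)
  have "((\<lambda>x. v \<bullet> x) has_derivative (\<lambda>h. v \<bullet> h)) (at x)" for x by (auto intro!: derivative_eq_intros)
  then show ?case by (intro exI[of _ "\<lambda>x h. v \<bullet> h"] conjI allI bump_algebra.const)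
next
  case (add f g)
  then obtain f' g' where fg: "\<And>x. (f has_derivative f' x) (at x)" "\<And>v. bump_algebra (\<lambda>x. f' x v)"
      "\<And>x. (g has_derivative g' x) (at x)" "\<And>v. bump_algebra (\<lambda>x. g' x v)" by blast
  show ?case
    by (rule exI[of _ "\<lambda>x h. f' x h + g' x h"])
       (auto intro!: has_derivative_add fg bump_algebra.add)
next
  case (mult f g)
  then obtain f' g' where fg: "\<And>x. (f has_derivative f' x) (at x)" "\<And>v. bump_algebra (\<lambda>x. f' x v)"
      "\<And>x. (g has_derivative g' x) (at x)" "\<And>v. bump_algebra (\<lambda>x. g' x v)" by blast
  show ?case
    by (rule exI[of _ "\<lambda>x h. f x * g' x h + f' x h * g x"])
       (auto intro!: has_derivative_mult fg bump_algebra.add bump_algebra.mult mult.hyps)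
qed

lemma bump_algebra_imp_smooth:
  assumes "bump_algebra f"
  shows "smooth f"
proof (rule smooth_coinduct[of _ "{f. bump_algebra f}"])
  show "g differentiable_on UNIV" if "g \<in> {f. bump_algebra f}" for g
    using that bump_algebra_derivative[of g]
    by (auto simp: differentiable_on_def differentiable_def)
  show "(\<lambda>x. frechet_derivative g (at x) v) \<in> {f. bump_algebra f}" if g: "g \<in> {f. bump_algebra f}" for g v
  proof -
    obtain g' where g': "\<And>x. (g has_derivative g' x) (at x)" "\<And>v. bump_algebra (\<lambda>x. g' x v)"
      using g bump_algebra_derivative[of g] by blast
    have "(\<lambda>x. frechet_derivative g (at x) v) = (\<lambda>x. g' x v)"
      using frechet_derivative_at[OF g'(1)] by (simp add: fun_eq_iff)
    then show ?thesis using g'(2) by simp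
  qed
qed (use assms in simp)

definition mollifier :: "real \<Rightarrow> (real ^ 'n \<Rightarrow> real) \<Rightarrow> bool" where
  "mollifier \<epsilon> \<psi> \<longleftrightarrow> smooth \<psi> \<and> (\<forall>x. 0 \<le> \<psi> x) \<and> (\<forall>x. \<epsilon> \<le> norm x \<longrightarrow> \<psi> x = 0) \<and>
     integrable lborel \<psi> \<and> (\<integral>x. \<psi> x \<partial>lborel) = 1"

lemma integrable_compact_support:
  fixes f :: "'a::euclidean_space \<Rightarrow> 'b::euclidean_space"
  assumes "continuous_on UNIV f" "\<And>x. R < norm x \<Longrightarrow> f x = 0"
  shows "integrable lborel f"
proof -
  have "integrable lborel (\<lambda>x. indicator (cball 0 R) x *\<^sub>R f x)"
    by (intro borel_integrable_compact continuous_on_subset[OF assms(1)]) auto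
  also have "(\<lambda>x. indicator (cball 0 R) x *\<^sub>R f x) = f"
    using assms(2) by (auto simp: indicator_def fun_eq_iff not_le)
  finally show ?thesis .
qed

lemma mollifier_exists:
  assumes e: "0 < \<epsilon>"
  shows "\<exists>\<psi> :: real ^ 'n \<Rightarrow> real. mollifier \<epsilon> \<psi>"
proof -
  define f where "f x = flat_exp 0 (1 - x \<bullet> x)" for x :: "real ^ 'n"
  define g where "g x = 1 * f ((1 / \<epsilon>) *\<^sub>R x + 0)" for x
  have "smooth g" unfolding g_def f_def
    by (intro smooth_affine bump_algebra_imp_smooth bump_algebra.flat)
  have g0: "0 \<le> g x" for x by (simp add: g_def f_def flat_exp_def)
  have supp: "g x = 0" if "\<epsilon> \<le> norm x" for x
  proof -
    have "1 \<le> norm ((1 / \<epsilon>) *\<^sub>R x)" using that e by simp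
    then have "1 \<le> ((1 / \<epsilon>) *\<^sub>R x) \<bullet> ((1 / \<epsilon>) *\<^sub>R x)"
      by (simp only: dot_square_norm) (simp add: one_le_power)
    then show ?thesis by (simp add: g_def f_def flat_exp_def)
  qed
  have gpos: "0 < g x" if "norm x < \<epsilon>" for x
  proof -
    have "norm ((1 / \<epsilon>) *\<^sub>R x) < 1" using that e by simp
    then have "((1 / \<epsilon>) *\<^sub>R x) \<bullet> ((1 / \<epsilon>) *\<^sub>R x) < 1"
      by (simp only: dot_square_norm) (simp add: power_less_one_iff abs_square_less_1)
    then show ?thesis by (simp add: g_def f_def flat_exp_def)
  qed
  have int: "integrable lborel g"
    using smooth_imp_continuous_on[OF \<open>smooth g\<close>, of UNIV] supp
    by (intro integrable_compact_support[where R = \<epsilon>]) auto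
  have [measurable]: "g \<in> borel_measurable borel" using int by auto
  define I where "I = (\<integral>x. g x \<partial>lborel)"
  have "I \<noteq> 0"
  proof
    assume "I = 0"
    then have "AE x in lborel. g x = 0"
      using integral_nonneg_eq_0_iff_AE[OF int] g0 by (simp add: I_def)
    then have "AE x in lborel. x \<notin> ball (0 :: real ^ 'n) \<epsilon>"
    proof eventually_elim
      case (elim x)
      then show ?case using gpos[of x] by auto
    qed
    then have "emeasure lborel (ball (0::real ^ 'n) \<epsilon>) = 0"
      by (intro AE_iff_measurable[THEN iffD1, of _ _ "\<lambda>x. x \<notin> ball (0::real ^ 'n) \<epsilon>"]) auto
    then show False
      using e emeasure_ball[of \<epsilon> "0::real ^ 'n"] unit_ball_vol_pos[of "real DIM(real ^ 'n)"] by simp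
  qed
  moreover have "0 \<le> I" unfolding I_def by (intro integral_nonneg_AE AE_I2 g0)
  ultimately have I: "0 < I" by simp
  have "mollifier \<epsilon> (\<lambda>x. (1 / I) * g (1 *\<^sub>R x + 0))"
    unfolding mollifier_def
    using smooth_affine[OF \<open>smooth g\<close>, of "1 / I" 1 0] int g0 supp I by (auto simp: I_def[symmetric])
  then show ?thesis by blast
qed

section \<open>Continuously differentiable functions of bounded support and their
  convolutions\<close>

lemma uniformly_continuous_compact_support:
  fixes D :: "'a::euclidean_space \<Rightarrow> 'b::real_normed_vector"
  assumes D: "continuous_on UNIV D" and supp: "\<And>x. R < norm x \<Longrightarrow> D x = 0"
  shows "uniformly_continuous_on UNIV D"
  unfolding uniformly_continuous_on_def
proof (intro allI impI)
  fix e :: real assume "0 < e"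
  have "uniformly_continuous_on (cball 0 (R + 1)) D"
    by (intro compact_uniformly_continuous continuous_on_subset[OF D]) auto
  then obtain d where d: "0 < d"
    "\<And>x y. x \<in> cball 0 (R + 1) \<Longrightarrow> y \<in> cball 0 (R + 1) \<Longrightarrow> dist y x < d \<Longrightarrow> dist (D y) (D x) < e"
    using \<open>0 < e\<close> unfolding uniformly_continuous_on_def by metis
  have "dist (D y) (D x) < e" if xy: "dist y x < min d 1" for x y
  proof (cases "x \<in> cball 0 (R + 1) \<and> y \<in> cball 0 (R + 1)")
    case True
    then show ?thesis using d(2) xy by auto
  next
    case False
    have "\<bar>norm x - norm y\<bar> < 1" using xy norm_triangle_ineq3[of x y] by (auto simp: dist_norm norm_minus_commute)
    then have "R < norm x" "R < norm y" using False by auto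
    then show ?thesis using supp \<open>0 < e\<close> by simp
  qed
  then show "\<exists>d>0. \<forall>x\<in>UNIV. \<forall>x'\<in>UNIV. dist x' x < d \<longrightarrow> dist (D x') (D x) < e"
    using d(1) by (intro exI[of _ "min d 1"]) auto
qed

lemma bounded_compact_support:
  fixes D :: "'a::euclidean_space \<Rightarrow> 'b::real_normed_vector"
  assumes D: "continuous_on UNIV D" and supp: "\<And>x. R < norm x \<Longrightarrow> D x = 0"
  obtains B where "0 \<le> B" "\<And>x. norm (D x) \<le> B"
proof -
  have "compact (D ` cball 0 R)"
    by (intro compact_continuous_image continuous_on_subset[OF D]) auto
  then obtain B where B: "\<And>x. x \<in> cball 0 R \<Longrightarrow> norm (D x) \<le> B"
    using compact_imp_bounded bounded_iff by (metis image_eqI)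
  have "norm (D x) \<le> max B 0" for x
    using B[of x] supp[of x] by (cases "norm x \<le> R") auto
  then show thesis using that[of "max B 0"] by auto
qed

text \<open>The truncations used below are composed with a function that is only once continuously
  differentiable, so smoothness would be too strong a requirement. The derivative is carried as a
  vector field \<open>D\<close>, and \<open>R\<close> bounds the support with respect to the
  origin.\<close>

definition C1_support :: "real \<Rightarrow> ('a::euclidean_space \<Rightarrow> real) \<Rightarrow> ('a \<Rightarrow> 'a) \<Rightarrow> bool" where
  "C1_support R f D \<longleftrightarrow> (\<forall>x. (f has_derivative (\<lambda>h. D x \<bullet> h)) (at x)) \<and> continuous_on UNIV D \<and>
     (\<forall>x. R < norm x \<longrightarrow> f x = 0 \<and> D x = 0)"

lemma C1_supportD:
  assumes "C1_support R f D"
  shows "(f has_derivative (\<lambda>h. D x \<bullet> h)) (at x)" "continuous_on S D" "continuous_on S f"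
    "R < norm x \<Longrightarrow> f x = 0" "R < norm x \<Longrightarrow> D x = 0"
    "f \<in> borel_measurable borel" "D \<in> borel_measurable borel" "integrable lborel f" "integrable lborel D"
proof -
  have f: "continuous_on UNIV f"
    by (rule has_derivative_continuous_on[of UNIV f "\<lambda>x h. D x \<bullet> h"])
       (use assms in \<open>auto simp: C1_support_def\<close>)
  have D: "continuous_on UNIV D" using assms by (simp add: C1_support_def)
  show "(f has_derivative (\<lambda>h. D x \<bullet> h)) (at x)" "R < norm x \<Longrightarrow> f x = 0" "R < norm x \<Longrightarrow> D x = 0"
    using assms by (simp_all add: C1_support_def)
  show "continuous_on S f" "continuous_on S D" using f D continuous_on_subset by blast+
  show "f \<in> borel_measurable borel" "D \<in> borel_measurable borel"
    using f D by (auto intro: borel_measurable_continuous_onI)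
  show "integrable lborel f" "integrable lborel D"
    using assms by (auto intro!: integrable_compact_support[where R = R] f D simp: C1_support_def)
qed

lemma smooth_C1_support:
  assumes "smooth f" "\<And>x. R < norm x \<Longrightarrow> f x = 0"
  shows "C1_support R f (grad f)"
  unfolding C1_support_def
proof (intro conjI allI impI)
  fix x
  show "(f has_derivative (\<lambda>h. grad f x \<bullet> h)) (at x)"
    by (intro has_derivative_grad smooth_imp_differentiable assms)
  show "continuous_on UNIV (grad f)" by (intro smooth_imp_continuous_on_grad assms)
  assume x: "R < norm x"
  show "f x = 0" using assms x by simp
  have "((\<lambda>_. 0::real) has_derivative (\<lambda>h. 0)) (at x)" by simp
  then have "(f has_derivative (\<lambda>h. 0 \<bullet> h)) (at x)"
    by (subst inner_zero_left, elim has_derivative_transform_within_open[where s = "- cball 0 R"])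
      (use x assms in \<open>auto simp: not_le\<close>)
  then show "grad f x = 0" by (rule grad_eqI)
qed

text \<open>Uniform continuity of \<open>D\<close> makes the linearisation error uniform in the base
  point \<open>x\<close>. It can therefore be integrated against an arbitrary integrable function,
  or over a fixed ball.\<close>

lemma C1_support_uniform_taylor:
  assumes C: "C1_support R f D" and e: "0 < e"
  shows "\<exists>d>0. \<forall>x y. norm (y - x) < d \<longrightarrow> \<bar>f y - f x - D x \<bullet> (y - x)\<bar> \<le> e * norm (y - x)"
proof -
  have "uniformly_continuous_on UNIV D"
    by (rule uniformly_continuous_compact_support[where R = R]) (use C1_supportD[OF C] in auto)
  then obtain d where d: "0 < d" "\<And>x y. dist y x < d \<Longrightarrow> dist (D y) (D x) < e"
    using e unfolding uniformly_continuous_on_def by (metis UNIV_I)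
  have "\<bar>f y - f x - D x \<bullet> (y - x)\<bar> \<le> e * norm (y - x)" if xy: "norm (y - x) < d" for x y
  proof -
    have "norm (f y - f x - (\<lambda>h. D x \<bullet> h) (y - x)) \<le> norm (y - x) * e"
    proof (rule differentiable_bound_linearization[where S = "ball x d" and f' = "\<lambda>z h. D z \<bullet> h"])
      fix t :: real assume "t \<in> {0..1}"
      then have "norm (t *\<^sub>R (y - x)) \<le> norm (y - x)" by (simp add: mult_left_le_one_le)
      then show "x + t *\<^sub>R (y - x) \<in> ball x d" using xy by (simp add: dist_norm)
    next
      fix z assume z: "z \<in> ball x d"
      show "(f has_derivative (\<lambda>h. D z \<bullet> h)) (at z within ball x d)"
        using C1_supportD(1)[OF C] by (rule has_derivative_at_withinI)
      have "norm (D z - D x) \<le> e" using d(2)[of z x] z by (simp add: dist_norm norm_minus_commute)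
      then show "onorm ((\<lambda>h. D z \<bullet> h) - (\<lambda>h. D x \<bullet> h)) \<le> e"
        using e by (intro onorm_le) 
          (auto simp: inner_diff_left[symmetric] intro!: order_trans[OF Cauchy_Schwarz_ineq2] mult_right_mono)
    qed (use d in auto)
    then show ?thesis by (simp add: mult.commute)
  qed
  then show ?thesis using d(1) by blast
qed

lemma lborel_distr_reflect: "distr lborel borel (\<lambda>y. x - y) = (lborel :: 'a::euclidean_space measure)"
  using lborel_affine[of "-1" x] by (simp add: density_1)

lemma lborel_integral_reflect:
  fixes f :: "'a::euclidean_space \<Rightarrow> 'b::{banach, second_countable_topology}"
  assumes [measurable]: "f \<in> borel_measurable borel"
  shows "(\<integral>y. f (x - y) \<partial>lborel) = (\<integral>y. f y \<partial>lborel)"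
proof -
  have "(\<integral>y. f y \<partial>lborel) = (\<integral>y. f y \<partial>distr lborel borel (\<lambda>y. x - y))"
    by (simp add: lborel_distr_reflect)
  also have "\<dots> = (\<integral>y. f (x - y) \<partial>lborel)"
    by (rule integral_distr) measurable
  finally show ?thesis ..
qed

lemma integrable_scaleR_bounded:
  fixes u :: "'a::euclidean_space \<Rightarrow> real" and f :: "'a \<Rightarrow> 'b::euclidean_space"
  assumes u: "integrable lborel u" and [measurable]: "f \<in> borel_measurable borel" and B: "\<And>x. norm (f x) \<le> B"
  shows "integrable lborel (\<lambda>y. u y *\<^sub>R f (x - y))"
proof (rule Bochner_Integration.integrable_bound)
  show "integrable lborel (\<lambda>y. B * norm (u y))" using u by auto
  have [measurable]: "u \<in> borel_measurable borel" using u by auto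
  show "(\<lambda>y. u y *\<^sub>R f (x - y)) \<in> borel_measurable lborel" by measurable
  have "0 \<le> B" using B[of 0] norm_ge_zero order_trans by blast
  then show "AE y in lborel. norm (u y *\<^sub>R f (x - y)) \<le> norm (B * norm (u y))"
    using B by (intro AE_I2) (auto simp: abs_mult mult.commute[of B] intro!: mult_left_mono)
qed

lemma integrable_bounded_scaleR:
  fixes u :: "'a::euclidean_space \<Rightarrow> 'b::euclidean_space" and f :: "'a \<Rightarrow> real"
  assumes u: "integrable lborel u" and [measurable]: "f \<in> borel_measurable borel" and B: "\<And>x. \<bar>f x\<bar> \<le> B"
  shows "integrable lborel (\<lambda>y. f (x - y) *\<^sub>R u y)"
proof (rule Bochner_Integration.integrable_bound)
  show "integrable lborel (\<lambda>y. B * norm (u y))" using u by auto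
  have [measurable]: "u \<in> borel_measurable borel" using u by auto
  show "(\<lambda>y. f (x - y) *\<^sub>R u y) \<in> borel_measurable lborel" by measurable
  have "0 \<le> B" using B[of 0] abs_ge_zero order_trans by blast
  then show "AE y in lborel. norm (f (x - y) *\<^sub>R u y) \<le> norm (B * norm (u y))"
    using B by (intro AE_I2) (auto simp: abs_mult intro!: mult_right_mono)
qed

lemma C1_support_bound:
  assumes "C1_support R f D"
  obtains B where "0 \<le> B" "\<And>x. \<bar>f x\<bar> \<le> B" "\<And>x. norm (D x) \<le> B"
proof -
  obtain B1 where "0 \<le> B1" "\<And>x. norm (f x) \<le> B1"
    using bounded_compact_support[of f R] C1_supportD[OF assms] by metis
  moreover obtain B2 where "0 \<le> B2" "\<And>x. norm (D x) \<le> B2"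
    using bounded_compact_support[of D R] C1_supportD[OF assms] by metis
  ultimately show thesis by (intro that[of "max B1 B2"]) (auto simp: le_max_iff_disj)
qed

text \<open>The derivative falls on \<open>f\<close>: the integrated linearisation error is at most
  \<open>e'\<close> times the norm of the increment times the integral of
  \<open>\<bar>u\<bar>\<close>, whatever the regularity of \<open>u\<close>.\<close>

lemma convolution_has_derivative:
  fixes u :: "'a::euclidean_space \<Rightarrow> real"
  assumes u: "integrable lborel u" and C: "C1_support R f D"
  shows "((\<lambda>x. \<integral>y. u y * f (x - y) \<partial>lborel) has_derivative
     (\<lambda>h. (\<integral>y. u y *\<^sub>R D (x - y) \<partial>lborel) \<bullet> h)) (at x)"
  unfolding has_derivative_at_alt
proof (intro conjI allI impI)
  show "bounded_linear (\<lambda>h. (\<integral>y. u y *\<^sub>R D (x - y) \<partial>lborel) \<bullet> h)"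
    by (rule bounded_linear_inner_right)
  fix e :: real assume e: "0 < e"
  obtain B where B: "0 \<le> B" "\<And>x. \<bar>f x\<bar> \<le> B" "\<And>x. norm (D x) \<le> B" using C1_support_bound[OF C] by blast
  have [measurable]: "f \<in> borel_measurable borel" "D \<in> borel_measurable borel" using C1_supportD[OF C] by auto
  define U where "U = (\<integral>y. \<bar>u y\<bar> \<partial>lborel)"
  have U: "0 \<le> U" by (simp add: U_def)
  define e' where "e' = e / (U + 1)"
  have e': "0 < e'" "U * e' \<le> e" using e U by (auto simp: e'_def field_simps)
  obtain d where d: "0 < d" "\<And>x y. norm (y - x) < d \<Longrightarrow> \<bar>f y - f x - D x \<bullet> (y - x)\<bar> \<le> e' * norm (y - x)"
    using C1_support_uniform_taylor[OF C e'(1)] by blast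
  have if1: "integrable lborel (\<lambda>y. u y * f (x - y))" for x
    using integrable_scaleR_bounded[OF u, of f B x] B by simp
  have iD: "integrable lborel (\<lambda>y. u y *\<^sub>R D (x - y))" for x
    using integrable_scaleR_bounded[OF u, of D B x] B by simp
  have "norm ((\<integral>z. u z * f (y - z) \<partial>lborel) - (\<integral>z. u z * f (x - z) \<partial>lborel)
        - (\<integral>z. u z *\<^sub>R D (x - z) \<partial>lborel) \<bullet> (y - x)) \<le> e * norm (y - x)" if y: "norm (y - x) < d" for y
  proof -
    have iDi: "integrable lborel (\<lambda>z. (u z *\<^sub>R D (x - z)) \<bullet> (y - x))"
      by (intro integrable_inner_left) (rule iD)
    have "(\<integral>z. u z *\<^sub>R D (x - z) \<partial>lborel) \<bullet> (y - x) = (\<integral>z. (u z *\<^sub>R D (x - z)) \<bullet> (y - x) \<partial>lborel)"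
      by (rule integral_inner_left[symmetric]) (rule iD)
    then have "(\<integral>z. u z * f (y - z) \<partial>lborel) - (\<integral>z. u z * f (x - z) \<partial>lborel)
        - (\<integral>z. u z *\<^sub>R D (x - z) \<partial>lborel) \<bullet> (y - x)
       = (\<integral>z. u z * f (y - z) - u z * f (x - z) - (u z *\<^sub>R D (x - z)) \<bullet> (y - x) \<partial>lborel)"
      using if1 iDi by (subst Bochner_Integration.integral_diff) auto
    also have "norm \<dots> \<le> (\<integral>z. \<bar>u z\<bar> * (e' * norm (y - x)) \<partial>lborel)"
    proof (rule Bochner_Integration.integral_norm_bound_integral)
      fix z
      have "u z * f (y - z) - u z * f (x - z) - (u z *\<^sub>R D (x - z)) \<bullet> (y - x)
          = u z * (f (y - z) - f (x - z) - D (x - z) \<bullet> ((y - z) - (x - z)))"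
        by (simp add: algebra_simps)
      then show "norm (u z * f (y - z) - u z * f (x - z) - (u z *\<^sub>R D (x - z)) \<bullet> (y - x)) \<le> \<bar>u z\<bar> * (e' * norm (y - x))"
        using d(2)[of "y - z" "x - z"] y by (simp add: abs_mult mult_left_mono)
    qed (use if1 iDi u in auto)
    also have "\<dots> = U * e' * norm (y - x)" using u by (simp add: U_def)
    also have "\<dots> \<le> e * norm (y - x)" using e' by (intro mult_right_mono) auto
    finally show ?thesis .
  qed
  then show "\<exists>d>0. \<forall>y. norm (y - x) < d \<longrightarrow> norm ((\<integral>z. u z * f (y - z) \<partial>lborel) - (\<integral>z. u z * f (x - z) \<partial>lborel)
        - (\<integral>z. u z *\<^sub>R D (x - z) \<partial>lborel) \<bullet> (y - x)) \<le> e * norm (y - x)"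
    using d(1) by blast
qed

text \<open>The class for the coinduction consists of the convolutions of the fixed \<open>u\<close>
  with varying smooth \<open>f\<close> supported in the ball of radius \<open>R\<close>; a
  directional derivative only replaces \<open>f\<close> by its own directional derivative.\<close>

lemma convolution_smooth:
  fixes u :: "real ^ 'n \<Rightarrow> real"
  assumes u: "integrable lborel u" and f: "smooth f" "\<And>x. R < norm x \<Longrightarrow> f x = 0"
  shows "smooth (\<lambda>x. \<integral>y. u y * f (x - y) \<partial>lborel)"
proof -
  let ?C = "{(\<lambda>x. \<integral>y. u y * f (x - y) \<partial>lborel) | f. smooth f \<and> (\<forall>x. R < norm x \<longrightarrow> f x = 0)}"
  show ?thesis
  proof (rule smooth_coinduct[of _ ?C])
    show "(\<lambda>x. \<integral>y. u y * f (x - y) \<partial>lborel) \<in> ?C" using f by blast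
    fix g assume "g \<in> ?C"
    then obtain f where f: "smooth f" "\<And>x. R < norm x \<Longrightarrow> f x = 0" and g: "g = (\<lambda>x. \<integral>y. u y * f (x - y) \<partial>lborel)"
      by blast
    note C = smooth_C1_support[OF f]
    have der: "(g has_derivative (\<lambda>h. (\<integral>y. u y *\<^sub>R grad f (x - y) \<partial>lborel) \<bullet> h)) (at x)" for x
      unfolding g by (rule convolution_has_derivative[OF u C])
    show "g differentiable_on UNIV"
      using der by (auto simp: differentiable_on_def differentiable_def)
    fix v
    obtain B where B: "0 \<le> B" "\<And>x. \<bar>f x\<bar> \<le> B" "\<And>x. norm (grad f x) \<le> B" using C1_support_bound[OF C] by blast
    have [measurable]: "grad f \<in> borel_measurable borel" using C1_supportD[OF C] by auto
    have "frechet_derivative g (at x) v = (\<integral>y. u y * frechet_derivative f (at (x - y)) v \<partial>lborel)" for x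
    proof -
      have "frechet_derivative g (at x) v = (\<integral>y. u y *\<^sub>R grad f (x - y) \<partial>lborel) \<bullet> v"
        using frechet_derivative_at[OF der[of x]] by metis
      also have "\<dots> = (\<integral>y. (u y *\<^sub>R grad f (x - y)) \<bullet> v \<partial>lborel)"
        using integrable_scaleR_bounded[OF u, of "grad f" B x] B by (intro integral_inner_left[symmetric]) auto
      finally show ?thesis
        using smooth_imp_differentiable[OF f(1)] by (simp add: inner_grad)
    qed
    moreover have "frechet_derivative f (at x) v = 0" if "R < norm x" for x
      using inner_grad[OF smooth_imp_differentiable[OF f(1)], of x v] C1_supportD(5)[OF C that] by simp
    ultimately show "(\<lambda>x. frechet_derivative g (at x) v) \<in> ?C"
      using smooth_frechet_derivative[OF f(1), of v]
      by (intro CollectI exI[of _ "\<lambda>x. frechet_derivative f (at x) v"]) auto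
  qed
qed

section \<open>Mollification of integrable functions and of weak gradients\<close>

definition mollify :: "('a::euclidean_space \<Rightarrow> real) \<Rightarrow> ('a \<Rightarrow> 'b::euclidean_space) \<Rightarrow> 'a \<Rightarrow> 'b" where
  "mollify \<psi> u x = (\<integral>y. \<psi> (x - y) *\<^sub>R u y \<partial>lborel)"

lemma mollifierD:
  assumes "mollifier \<epsilon> \<psi>"
  shows "smooth \<psi>" "0 \<le> \<psi> x" "\<epsilon> \<le> norm x \<Longrightarrow> \<psi> x = 0" "integrable lborel \<psi>" "(\<integral>x. \<psi> x \<partial>lborel) = 1"
    "C1_support \<epsilon> \<psi> (grad \<psi>)" "\<psi> \<in> borel_measurable borel" "(\<integral>\<^sup>+x. ennreal (\<psi> x) \<partial>lborel) = 1"
proof -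
  note m = assms[unfolded mollifier_def]
  show "smooth \<psi>" "0 \<le> \<psi> x" "\<epsilon> \<le> norm x \<Longrightarrow> \<psi> x = 0" "integrable lborel \<psi>" "(\<integral>x. \<psi> x \<partial>lborel) = 1"
    using m by auto
  show "C1_support \<epsilon> \<psi> (grad \<psi>)" using m by (intro smooth_C1_support) auto
  show "\<psi> \<in> borel_measurable borel" using m by auto
  show "(\<integral>\<^sup>+x. ennreal (\<psi> x) \<partial>lborel) = 1" using m by (subst nn_integral_eq_integral) auto
qed

lemma mollify_smooth:
  fixes u :: "real ^ 'n \<Rightarrow> real"
  assumes u: "integrable lborel u" and m: "mollifier \<epsilon> \<psi>"
  shows "smooth (mollify \<psi> u)"
  unfolding mollify_def[abs_def]
  using convolution_smooth[OF u mollifierD(1)[OF m], of \<epsilon>] mollifierD(3)[OF m]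
  by (simp add: mult.commute)

lemma grad_mollify:
  fixes u :: "real ^ 'n \<Rightarrow> real"
  assumes u: "integrable lborel u" and m: "mollifier \<epsilon> \<psi>"
  shows "grad (mollify \<psi> u) x = (\<integral>y. u y *\<^sub>R grad \<psi> (x - y) \<partial>lborel)"
  unfolding mollify_def[abs_def]
  using convolution_has_derivative[OF u mollifierD(6)[OF m], of x]
  by (intro grad_eqI) (simp add: mult.commute)

lemma mollify_reflect:
  assumes m: "mollifier \<epsilon> \<psi>" and [measurable]: "u \<in> borel_measurable borel"
  shows "mollify \<psi> u x = (\<integral>z. \<psi> z *\<^sub>R u (x - z) \<partial>lborel)"
proof -
  note mollifierD(7)[OF m, measurable]
  have "(\<integral>z. (\<lambda>y. \<psi> (x - y) *\<^sub>R u y) (x - z) \<partial>lborel) = mollify \<psi> u x"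
    unfolding mollify_def by (rule lborel_integral_reflect) measurable
  then show ?thesis by simp
qed

lemma measurable_mollify:
  assumes m: "mollifier \<epsilon> \<psi>" and [measurable]: "u \<in> borel_measurable borel"
  shows "mollify \<psi> u \<in> borel_measurable borel"
proof -
  note mollifierD(7)[OF m, measurable]
  have "(\<lambda>x. \<integral>y. \<psi> (x - y) *\<^sub>R u y \<partial>lborel) \<in> borel_measurable lborel"
    by (rule lborel.borel_measurable_lebesgue_integral) measurable
  then show ?thesis by (simp add: mollify_def[abs_def])
qed

text \<open>A mollification is an average, of total weight 1, of translates by vectors shorter than
  \<open>\<epsilon>\<close>. By Tonelli its distance from \<open>u\<close> in the mean is at most
  the largest distance of such a translate.\<close>

lemma mollify_L1_le:
  fixes u :: "real ^ 'n \<Rightarrow> 'b::euclidean_space"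
  assumes u: "integrable lborel u" and m: "mollifier \<epsilon> \<psi>"
    and h: "\<And>h. norm h < \<epsilon> \<Longrightarrow> (\<integral>\<^sup>+x. norm (u (x + h) - u x) \<partial>lborel) \<le> e"
  shows "(\<integral>\<^sup>+x. norm (mollify \<psi> u x - u x) \<partial>lborel) \<le> e"
proof -
  note [measurable] = mollifierD(7)[OF m]
  have [measurable]: "u \<in> borel_measurable borel" using u by auto
  obtain B where B: "\<And>x. \<bar>\<psi> x\<bar> \<le> B" using C1_support_bound[OF mollifierD(6)[OF m]] by metis
  have int: "integrable lborel (\<lambda>z. \<psi> z *\<^sub>R u (x - z))" for x
  proof -
    have "integrable lborel (\<lambda>y. \<psi> (x - y) *\<^sub>R u y)"
      using integrable_bounded_scaleR[OF u, of \<psi> B x] B by simp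
    then have "integrable (distr lborel borel (\<lambda>y. x - y)) (\<lambda>y. \<psi> (x - y) *\<^sub>R u y)"
      by (simp add: lborel_distr_reflect)
    then show ?thesis by (subst (asm) integrable_distr_eq) auto
  qed
  have "ennreal (norm (mollify \<psi> u x - u x)) \<le> (\<integral>\<^sup>+z. ennreal (\<psi> z) * ennreal (norm (u (x + - z) - u x)) \<partial>lborel)" for x
  proof -
    have "mollify \<psi> u x - u x = (\<integral>z. \<psi> z *\<^sub>R u (x - z) \<partial>lborel) - (\<integral>z. \<psi> z *\<^sub>R u x \<partial>lborel)"
      using mollifierD(4,5)[OF m] by (simp add: mollify_reflect[OF m])
    also have "\<dots> = (\<integral>z. \<psi> z *\<^sub>R u (x - z) - \<psi> z *\<^sub>R u x \<partial>lborel)"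
      using int mollifierD(4)[OF m] by (intro Bochner_Integration.integral_diff[symmetric]) auto
    finally have "ennreal (norm (mollify \<psi> u x - u x)) \<le> (\<integral>\<^sup>+z. ennreal (norm (\<psi> z *\<^sub>R u (x - z) - \<psi> z *\<^sub>R u x)) \<partial>lborel)"
      using integral_norm_bound_ennreal[of lborel "\<lambda>z. \<psi> z *\<^sub>R u (x - z) - \<psi> z *\<^sub>R u x"] int mollifierD(4)[OF m] by simp
    also have "\<dots> = (\<integral>\<^sup>+z. ennreal (\<psi> z) * ennreal (norm (u (x + - z) - u x)) \<partial>lborel)"
      using mollifierD(2)[OF m] by (simp add: scaleR_diff_right[symmetric] ennreal_mult)
    finally show ?thesis .
  qed
  then have "(\<integral>\<^sup>+x. norm (mollify \<psi> u x - u x) \<partial>lborel)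
     \<le> (\<integral>\<^sup>+x. (\<integral>\<^sup>+z. ennreal (\<psi> z) * ennreal (norm (u (x + - z) - u x)) \<partial>lborel) \<partial>lborel)"
    by (intro nn_integral_mono)
  also have "\<dots> = (\<integral>\<^sup>+z. (\<integral>\<^sup>+x. ennreal (\<psi> z) * ennreal (norm (u (x + - z) - u x)) \<partial>lborel) \<partial>lborel)"
    by (rule lborel_pair.Fubini') measurable
  also have "\<dots> \<le> (\<integral>\<^sup>+z. ennreal (\<psi> z) * e \<partial>lborel)"
  proof (rule nn_integral_mono)
    fix z
    show "(\<integral>\<^sup>+x. ennreal (\<psi> z) * ennreal (norm (u (x + - z) - u x)) \<partial>lborel) \<le> ennreal (\<psi> z) * e"
    proof (cases "norm z < \<epsilon>")
      case True
      have "(\<integral>\<^sup>+x. ennreal (\<psi> z) * ennreal (norm (u (x + - z) - u x)) \<partial>lborel)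
        = ennreal (\<psi> z) * (\<integral>\<^sup>+x. ennreal (norm (u (x + - z) - u x)) \<partial>lborel)"
        by (rule nn_integral_cmult) measurable
      then show ?thesis using h[of "- z"] True by (auto intro!: mult_left_mono)
    qed (use mollifierD(3)[OF m, of z] in simp)
  qed
  also have "\<dots> = e"
    using mollifierD(8)[OF m] by (subst nn_integral_multc) auto
  finally show ?thesis .
qed

text \<open>The weak gradient is tested with the reflected mollifier \<open>\<psi> (x - y)\<close>,
  whose support lies in \<open>cball x \<epsilon>\<close>. The functions \<open>uB\<close> and
  \<open>gB\<close> are Borel versions cut off outside \<open>V\<close>; this cutoff may destroy the
  gradient relation across the boundary of \<open>V\<close>, so the identity is stated at points
  whose \<open>\<epsilon>\<close>-ball stays inside \<open>V\<close>.\<close>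

lemma grad_mollify_eq_mollify:
  fixes u uB :: "real ^ 'n \<Rightarrow> real" and g gB :: "real ^ 'n \<Rightarrow> real ^ 'n"
  assumes wg: "weak_gradient U u g" and VU: "V \<subseteq> U" and m: "mollifier \<epsilon> \<psi>" and x: "cball x \<epsilon> \<subseteq> V"
    and uB: "integrable lborel uB" "AE y in lborel. uB y = (if y \<in> V then u y else 0)"
    and gB: "integrable lborel gB" "AE y in lborel. gB y = (if y \<in> V then g y else 0)"
  shows "grad (mollify \<psi> uB) x = mollify \<psi> gB x"
proof -
  note [measurable] = mollifierD(7)[OF m]
  have [measurable]: "uB \<in> borel_measurable borel" "gB \<in> borel_measurable borel" using uB gB by auto
  define \<phi> where "\<phi> y = 1 * \<psi> ((-1) *\<^sub>R y + x)" for y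
  have smooth: "smooth \<phi>" unfolding \<phi>_def by (rule smooth_affine[OF mollifierD(1)[OF m]])
  have \<phi>: "\<phi> y = \<psi> (x - y)" for y by (simp add: \<phi>_def)
  have grad\<phi>: "grad \<phi> y = - grad \<psi> (x - y)" for y
  proof (rule grad_eqI)
    have 1: "((\<lambda>y. x - y) has_derivative (\<lambda>h. - h)) (at y)" by (auto intro!: derivative_eq_intros)
    from diff_chain_at[OF 1 C1_supportD(1)[OF mollifierD(6)[OF m]]]
    show "(\<phi> has_derivative (\<lambda>h. (- grad \<psi> (x - y)) \<bullet> h)) (at y)"
      by (simp add: \<phi>[abs_def] o_def)
  qed
  have supp: "{y. \<phi> y \<noteq> 0} \<subseteq> cball x \<epsilon>"
    using mollifierD(3)[OF m] by (auto simp: \<phi> dist_norm) (metis linear)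
  then have clo: "closure {y. \<phi> y \<noteq> 0} \<subseteq> cball x \<epsilon>" by (rule closure_minimal) auto
  have "test_function U \<phi>"
    unfolding test_function_def
    using smooth clo x VU by (auto intro: compact_closure[THEN iffD2] bounded_subset[OF bounded_cball supp])
  then have eq: "(LINT y:U|lebesgue. u y *\<^sub>R grad \<phi> y) = - (LINT y:U|lebesgue. \<phi> y *\<^sub>R g y)"
    using wg by (simp add: weak_gradient_def)
  have K: "compact (cball x \<epsilon>)" "cball x \<epsilon> \<subseteq> U" using x VU by auto
  have "set_integrable lebesgue (cball x \<epsilon>) u" "set_integrable lebesgue (cball x \<epsilon>) g"
    using wg K unfolding weak_gradient_def locally_integrable_def by blast+
  \<comment> \<open>The functions \<open>u\<close> and \<open>g\<close> are known to be measurable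
    only after restriction to compact sets. Since the test function and its gradient vanish off
    \<open>cball x \<epsilon>\<close>, the indicator of this ball can be inserted into both
    integrals.\<close>
  then have mu: "(\<lambda>y. indicator (cball x \<epsilon>) y *\<^sub>R u y) \<in> borel_measurable lebesgue"
    and mg: "(\<lambda>y. indicator (cball x \<epsilon>) y *\<^sub>R g y) \<in> borel_measurable lebesgue"
    unfolding set_integrable_def by (blast dest: borel_measurable_integrable)+
  have g0: "grad \<phi> y = 0" if "y \<notin> cball x \<epsilon>" for y
    using C1_supportD(5)[OF mollifierD(6)[OF m], of "x - y"] that by (simp add: grad\<phi> dist_norm)
  have \<phi>0: "\<phi> y = 0" if "y \<notin> cball x \<epsilon>" for y using supp that by auto
  have [measurable]: "grad \<phi> \<in> borel_measurable borel" "\<phi> \<in> borel_measurable borel"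
    using smooth by (auto intro!: borel_measurable_continuous_onI smooth_imp_continuous_on smooth_imp_continuous_on_grad)
  have gm: "grad \<phi> \<in> borel_measurable lebesgue" "\<phi> \<in> borel_measurable lebesgue"
    by (auto intro!: measurable_completion)
  have "(LINT y:U|lebesgue. u y *\<^sub>R grad \<phi> y) = (\<integral>y. (indicator (cball x \<epsilon>) y *\<^sub>R u y) *\<^sub>R grad \<phi> y \<partial>lebesgue)"
    unfolding set_lebesgue_integral_def
    by (rule Bochner_Integration.integral_cong) (use g0 K in \<open>auto simp: indicator_def\<close>)
  also have "\<dots> = (\<integral>y. uB y *\<^sub>R grad \<phi> y \<partial>lebesgue)"
  proof (rule integral_cong_AE)
    show "(\<lambda>y. uB y *\<^sub>R grad \<phi> y) \<in> borel_measurable lebesgue"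
      by (intro measurable_completion) measurable
    have "AE y in lebesgue. uB y = (if y \<in> V then u y else 0)" using uB(2) by (rule AE_completion)
    then show "AE y in lebesgue. (indicator (cball x \<epsilon>) y *\<^sub>R u y) *\<^sub>R grad \<phi> y = uB y *\<^sub>R grad \<phi> y"
      by eventually_elim (use g0 x in \<open>auto simp: indicator_def\<close>)
  qed (intro borel_measurable_scaleR mu gm)
  also have "\<dots> = (\<integral>y. uB y *\<^sub>R grad \<phi> y \<partial>lborel)"
    by (rule integral_completion) measurable
  finally have 1: "(LINT y:U|lebesgue. u y *\<^sub>R grad \<phi> y) = - (\<integral>y. uB y *\<^sub>R grad \<psi> (x - y) \<partial>lborel)"
    by (simp add: grad\<phi>)
  have "(LINT y:U|lebesgue. \<phi> y *\<^sub>R g y) = (\<integral>y. \<phi> y *\<^sub>R (indicator (cball x \<epsilon>) y *\<^sub>R g y) \<partial>lebesgue)"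
    unfolding set_lebesgue_integral_def
    by (rule Bochner_Integration.integral_cong) (use \<phi>0 K in \<open>auto simp: indicator_def\<close>)
  also have "\<dots> = (\<integral>y. \<phi> y *\<^sub>R gB y \<partial>lebesgue)"
  proof (rule integral_cong_AE)
    show "(\<lambda>y. \<phi> y *\<^sub>R gB y) \<in> borel_measurable lebesgue"
      by (intro measurable_completion) measurable
    have "AE y in lebesgue. gB y = (if y \<in> V then g y else 0)" using gB(2) by (rule AE_completion)
    then show "AE y in lebesgue. \<phi> y *\<^sub>R (indicator (cball x \<epsilon>) y *\<^sub>R g y) = \<phi> y *\<^sub>R gB y"
      by eventually_elim (use \<phi>0 x in \<open>auto simp: indicator_def\<close>)
  qed (intro borel_measurable_scaleR mg gm)
  also have "\<dots> = (\<integral>y. \<phi> y *\<^sub>R gB y \<partial>lborel)"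
    by (rule integral_completion) measurable
  finally have 2: "(LINT y:U|lebesgue. \<phi> y *\<^sub>R g y) = mollify \<psi> gB x"
    by (simp add: \<phi> mollify_def)
  show ?thesis using eq 1 2 by (simp add: grad_mollify[OF uB(1) m])
qed

section \<open>Boundary values and weak monotonicity\<close>

lemma lborel_integral_translate:
  fixes f :: "'a::euclidean_space \<Rightarrow> 'b::{banach, second_countable_topology}"
  assumes [measurable]: "f \<in> borel_measurable borel"
  shows "(\<integral>x. f (x + h) \<partial>lborel) = (\<integral>x. f x \<partial>lborel)"
proof -
  have "(\<integral>x. f x \<partial>lborel) = (\<integral>x. f x \<partial>distr lborel borel ((+) h))"
    by (simp add: lborel_distr_plus)
  also have "\<dots> = (\<integral>x. f (h + x) \<partial>lborel)"
    by (rule integral_distr) measurable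
  finally show ?thesis by (simp add: add.commute)
qed

lemma lborel_integrable_translate:
  fixes f :: "'a::euclidean_space \<Rightarrow> 'b::{banach, second_countable_topology}"
  assumes f: "integrable lborel f"
  shows "integrable lborel (\<lambda>x. f (x + h))"
proof -
  have "integrable (distr lborel borel ((+) h)) f" using f by (simp add: lborel_distr_plus)
  then show ?thesis using f by (subst (asm) integrable_distr_eq) (auto simp: add.commute)
qed

text \<open>By translation invariance \<open>f (x + t *\<^sub>R v) - f x\<close> has integral zero,
  so \<open>t\<close> times the integral of \<open>D x \<bullet> v\<close> is minus the integral of
  the linearisation error. That error is an arbitrarily small multiple of \<open>t\<close>, which
  forces the integral of \<open>D x \<bullet> v\<close> to be zero.\<close>

lemma integral_grad_C1_support:
  fixes f :: "'a::euclidean_space \<Rightarrow> real"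
  assumes C: "C1_support R f D"
  shows "(\<integral>x. D x \<partial>lborel) = 0"
proof -
  note C1 = C1_supportD[OF C]
  note [measurable] = C1(6,7)
  have "(\<integral>x. D x \<partial>lborel) \<bullet> v = 0" for v
  proof -
    define V where "V = measure lborel (cball (0::'a) (R + norm v + 1))"
    have D: "integrable lborel (\<lambda>x. D x \<bullet> v)" by (intro integrable_inner_left C1(9))
    have "\<bar>\<integral>x. D x \<bullet> v \<partial>lborel\<bar> \<le> e" if e: "0 < e" for e
    proof -
      define e' where "e' = e / (norm v * V + 1)"
      have V0: "0 \<le> V" by (simp add: V_def)
      have N: "0 < norm v * V + 1" using V0 by (intro add_nonneg_pos) auto
      then have e': "0 < e'" using e by (simp add: e'_def)
      have e'2: "e' * (norm v * V) \<le> e"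
      proof -
        have "e' * (norm v * V) \<le> e' * (norm v * V + 1)" using e' by (intro mult_left_mono) auto
        also have "\<dots> = e" using N by (simp add: e'_def)
        finally show ?thesis .
      qed
      obtain d where d: "0 < d" "\<And>x y. norm (y - x) < d \<Longrightarrow> \<bar>f y - f x - D x \<bullet> (y - x)\<bar> \<le> e' * norm (y - x)"
        using C1_support_uniform_taylor[OF C e'] by blast
      define t where "t = min 1 (d / (norm v + 1) / 2)"
      have t: "0 < t" "t \<le> 1" using d by (auto simp: t_def intro!: divide_pos_pos add_nonneg_pos)
      have tv: "norm (t *\<^sub>R v) < d"
      proof -
        have n0: "0 < norm v + 1" using norm_ge_zero[of v] by linarith
        have "t * norm v \<le> d / (norm v + 1) / 2 * (norm v + 1)"
          using t d n0 by (intro mult_mono) (auto simp: t_def)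
        also have "\<dots> = d / 2" using n0 by (simp add: field_simps)
        finally show ?thesis using t d by simp
      qed
      have i1: "integrable lborel (\<lambda>x. f (x + t *\<^sub>R v) - f x - D x \<bullet> (t *\<^sub>R v))"
        by (intro Bochner_Integration.integrable_diff lborel_integrable_translate integrable_inner_left C1)
      have "t * (\<integral>x. D x \<bullet> v \<partial>lborel) = - (\<integral>x. f (x + t *\<^sub>R v) - f x - D x \<bullet> (t *\<^sub>R v) \<partial>lborel)"
        using C1(8) D lborel_integrable_translate[OF C1(8), of "t *\<^sub>R v"]
        by (simp add: lborel_integral_translate)
      also have "\<bar>\<dots>\<bar> = norm (\<integral>x. f (x + t *\<^sub>R v) - f x - D x \<bullet> (t *\<^sub>R v) \<partial>lborel)"
        by simp
      \<comment> \<open>Because \<open>t \<le> 1\<close>, both \<open>f x\<close> and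
        \<open>f (x + t *\<^sub>R v)\<close> vanish off the enlarged ball; the error lives on a set
        whose measure \<open>V\<close> does not depend on \<open>t\<close>.\<close>
      also have "\<dots> \<le> (\<integral>x. e' * norm (t *\<^sub>R v) * indicator (cball (0::'a) (R + norm v + 1)) x \<partial>lborel)"
      proof (rule Bochner_Integration.integral_norm_bound_integral)
        show "integrable lborel (\<lambda>x. f (x + t *\<^sub>R v) - f x - D x \<bullet> (t *\<^sub>R v))" by (rule i1)
        show "integrable lborel (\<lambda>x::'a. e' * norm (t *\<^sub>R v) * indicator (cball 0 (R + norm v + 1)) x)"
          by (intro integrable_mult_right integrable_real_indicator emeasure_bounded_finite) auto
        fix x :: 'a
        show "norm (f (x + t *\<^sub>R v) - f x - D x \<bullet> (t *\<^sub>R v)) \<le> e' * norm (t *\<^sub>R v) * indicator (cball 0 (R + norm v + 1)) x"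
        proof (cases "x \<in> cball 0 (R + norm v + 1)")
          case True
          then show ?thesis using d(2)[of "x + t *\<^sub>R v" x] tv by simp
        next
          case False
          then have "R + norm v + 1 < norm x" by simp
          moreover have "norm (t *\<^sub>R v) \<le> norm v" using t by (simp add: mult_left_le_one_le)
          moreover have "norm x - norm (t *\<^sub>R v) \<le> norm (x + t *\<^sub>R v)" by (rule norm_diff_ineq)
          ultimately have "R < norm x" "R < norm (x + t *\<^sub>R v)" using norm_ge_zero[of v] by linarith+
          then show ?thesis using C1(4,5) False by simp
        qed
      qed
      also have "\<dots> = t * (e' * (norm v * V))" using t by (simp add: V_def)
      also have "\<dots> \<le> t * e" using e'2 t by (intro mult_left_mono) auto
      finally show ?thesis using t by (simp add: abs_mult)
    qed
    then have "(\<integral>x. D x \<bullet> v \<partial>lborel) = 0"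
      using field_le_epsilon[of "\<bar>\<integral>x. D x \<bullet> v \<partial>lborel\<bar>" 0] by simp
    then show ?thesis using integral_inner_left[of v lborel D] C1(9) by simp
  qed
  from this[of "\<integral>x. D x \<partial>lborel"] show ?thesis by simp
qed

lemma C1_support_integration_by_parts:
  assumes f: "C1_support R f D" and h: "C1_support S h E"
  shows "(\<integral>x. f x *\<^sub>R E x \<partial>lborel) = - (\<integral>x. h x *\<^sub>R D x \<partial>lborel)"
proof -
  note F = C1_supportD[OF f] and H = C1_supportD[OF h]
  have "C1_support R (\<lambda>x. f x * h x) (\<lambda>x. f x *\<^sub>R E x + h x *\<^sub>R D x)"
    unfolding C1_support_def
  proof (intro conjI allI impI)
    fix x
    show "((\<lambda>x. f x * h x) has_derivative (\<lambda>v. (f x *\<^sub>R E x + h x *\<^sub>R D x) \<bullet> v)) (at x)"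
      using has_derivative_mult[OF F(1)[of x] H(1)[of x]] by (simp add: inner_add_left algebra_simps)
    show "continuous_on UNIV (\<lambda>x. f x *\<^sub>R E x + h x *\<^sub>R D x)"
      by (intro continuous_intros F H)
  qed (use F H in auto)
  from integral_grad_C1_support[OF this]
  have "(\<integral>x. f x *\<^sub>R E x + h x *\<^sub>R D x \<partial>lborel) = 0" .
  moreover have "integrable lborel (\<lambda>x. f x *\<^sub>R E x)"
    by (rule integrable_compact_support[where R = R]) (use F in \<open>auto intro!: continuous_intros H\<close>)
  moreover have "integrable lborel (\<lambda>x. h x *\<^sub>R D x)"
    by (rule integrable_compact_support[where R = R]) (use F in \<open>auto intro!: continuous_intros H\<close>)
  ultimately show ?thesis by (simp add: add_eq_0_iff2)
qed

text \<open>A shift by \<open>s = 2 * r + 1\<close> in a coordinate direction moves every point of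
  the ball out of it, so \<open>f y\<close> is minus the integral of the derivative along this
  segment. Integration over \<open>y\<close> and Tonelli then give the factor
  \<open>s\<close>.\<close>

lemma C1_support_poincare:
  fixes f :: "'a::euclidean_space \<Rightarrow> real"
  assumes C: "C1_support R f D" and supp: "\<And>y. r < norm (y - x) \<Longrightarrow> f y = 0" and r: "0 \<le> r"
  shows "(\<integral>\<^sup>+y. \<bar>f y\<bar> \<partial>lborel) \<le> ennreal (2 * r + 1) * (\<integral>\<^sup>+y. norm (D y) \<partial>lborel)"
proof -
  note C1 = C1_supportD[OF C]
  note [measurable] = C1(6,7)
  obtain e :: 'a where "e \<in> Basis" using nonempty_Basis by blast
  then have e: "norm e = 1" by simp
  define s where "s = 2 * r + 1"
  have s: "0 \<le> s" using r by (simp add: s_def)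
  have pw: "ennreal \<bar>f y\<bar> \<le> (\<integral>\<^sup>+t. ennreal (norm (D (y + t *\<^sub>R e))) * indicator {0..s} t \<partial>lborel)" for y
  proof (cases "r < norm (y - x)")
    case False
    define F where "F t = f (y + t *\<^sub>R e)" for t :: real
    have der: "(F has_vector_derivative (D (y + t *\<^sub>R e) \<bullet> e)) (at t within {0..s})" for t
    proof -
      have "((\<lambda>t. y + t *\<^sub>R e) has_derivative (\<lambda>h. h *\<^sub>R e)) (at t)" by (auto intro!: derivative_eq_intros)
      from diff_chain_at[OF this C1(1)] show ?thesis
        by (simp add: F_def[abs_def] o_def has_vector_derivative_def has_derivative_at_withinI)
    qed
    have cont: "continuous_on {0..s} (\<lambda>t. D (y + t *\<^sub>R e) \<bullet> e)"
      by (intro continuous_intros continuous_on_compose2[OF C1(2)[of UNIV]]) auto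
    have int: "has_bochner_integral lborel (\<lambda>t. indicator {0..s} t *\<^sub>R (D (y + t *\<^sub>R e) \<bullet> e)) (F s - F 0)"
      by (intro has_bochner_integral_FTC_Icc s der cont)
    have "norm (s *\<^sub>R e) \<le> norm (y + s *\<^sub>R e - x) + norm (y - x)"
      using norm_triangle_ineq4[of "y + s *\<^sub>R e - x" "y - x"] by (simp add: algebra_simps)
    then have "r < norm (y + s *\<^sub>R e - x)" using False e s by (simp add: s_def)
    then have "F s = 0" using supp by (simp add: F_def)
    then have "ennreal \<bar>f y\<bar> = ennreal (norm (\<integral>t. indicator {0..s} t *\<^sub>R (D (y + t *\<^sub>R e) \<bullet> e) \<partial>lborel))"
      using has_bochner_integral_integral_eq[OF int] by (simp add: F_def)
    also have "\<dots> \<le> (\<integral>\<^sup>+t. norm (indicator {0..s} t *\<^sub>R (D (y + t *\<^sub>R e) \<bullet> e)) \<partial>lborel)"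
      using integral_norm_bound_ennreal[OF integrable.intros[OF int]] .
    also have "\<dots> \<le> (\<integral>\<^sup>+t. ennreal (norm (D (y + t *\<^sub>R e))) * indicator {0..s} t \<partial>lborel)"
    proof (rule nn_integral_mono)
      fix t
      show "ennreal (norm (indicator {0..s} t *\<^sub>R (D (y + t *\<^sub>R e) \<bullet> e))) \<le> ennreal (norm (D (y + t *\<^sub>R e))) * indicator {0..s} t"
        using Cauchy_Schwarz_ineq2[of "D (y + t *\<^sub>R e)" e] e by (auto simp: indicator_def intro!: ennreal_leI)
    qed
    finally show ?thesis .
  qed (simp add: supp)
  have "(\<integral>\<^sup>+y. \<bar>f y\<bar> \<partial>lborel) \<le> (\<integral>\<^sup>+y. (\<integral>\<^sup>+t. ennreal (norm (D (y + t *\<^sub>R e))) * indicator {0..s} t \<partial>lborel) \<partial>lborel)"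
    by (intro nn_integral_mono pw)
  also have "\<dots> = (\<integral>\<^sup>+t. (\<integral>\<^sup>+y. ennreal (norm (D (y + t *\<^sub>R e))) * indicator {0..s} t \<partial>lborel) \<partial>lborel)"
    by (rule lborel_pair.Fubini') measurable
  also have "\<dots> = (\<integral>\<^sup>+t. (\<integral>\<^sup>+y. norm (D y) \<partial>lborel) * indicator {0..s} t \<partial>lborel)"
  proof (rule nn_integral_cong)
    fix t :: real
    have "(\<integral>\<^sup>+y. ennreal (norm (D (y + t *\<^sub>R e))) * indicator {0..s} t \<partial>lborel)
       = (\<integral>\<^sup>+y. ennreal (norm (D (y + t *\<^sub>R e))) \<partial>lborel) * indicator {0..s} t"
      by (rule nn_integral_multc) measurable
    also have "(\<integral>\<^sup>+y. ennreal (norm (D (y + t *\<^sub>R e))) \<partial>lborel) = (\<integral>\<^sup>+y. norm (D y) \<partial>lborel)"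
      using nn_integral_lborel_translate[of "\<lambda>y. ennreal (norm (D y))" "t *\<^sub>R e"] by simp
    finally show "(\<integral>\<^sup>+y. ennreal (norm (D (y + t *\<^sub>R e))) * indicator {0..s} t \<partial>lborel) = (\<integral>\<^sup>+y. norm (D y) \<partial>lborel) * indicator {0..s} t" .
  qed
  also have "\<dots> = ennreal s * (\<integral>\<^sup>+y. norm (D y) \<partial>lborel)"
    using s by (simp add: nn_integral_cmult_indicator) (simp add: mult.commute)
  finally show ?thesis by (simp add: s_def)
qed

text \<open>Mollification at a scale below half of the gap \<open>r - \<rho>\<close> keeps the
  support inside the open ball. Its gradient is the mollification of \<open>D\<close>, so uniform
  continuity of \<open>f\<close> and \<open>D\<close> controls both errors uniformly.\<close>

lemma C1_support_approx_test_function: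
  fixes f :: "real ^ 'n \<Rightarrow> real"
  assumes C: "C1_support R f D" and supp: "\<And>y. \<rho> < norm (y - x) \<Longrightarrow> f y = 0" and r: "\<rho> < r" and e: "0 < e"
  shows "\<exists>\<phi>. test_function (ball x r) \<phi> \<and> (\<forall>y. \<bar>\<phi> y - f y\<bar> \<le> e) \<and> (\<forall>y. norm (grad \<phi> y - D y) \<le> e)"
proof -
  note C1 = C1_supportD[OF C]
  note [measurable] = C1(6,7)
  obtain d1 where d1: "0 < d1" "\<And>x y. dist y x < d1 \<Longrightarrow> dist (f y) (f x) < e"
    using uniformly_continuous_compact_support[of f R] C1 e unfolding uniformly_continuous_on_def by (metis UNIV_I)
  obtain d2 where d2: "0 < d2" "\<And>x y. dist y x < d2 \<Longrightarrow> dist (D y) (D x) < e"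
    using uniformly_continuous_compact_support[of D R] C1 e unfolding uniformly_continuous_on_def by (metis UNIV_I)
  define \<epsilon> where "\<epsilon> = min (min d1 d2) ((r - \<rho>) / 2)"
  have \<epsilon>: "0 < \<epsilon>" "\<epsilon> \<le> d1" "\<epsilon> \<le> d2" "\<epsilon> \<le> (r - \<rho>) / 2" using d1 d2 r unfolding \<epsilon>_def by (auto simp del: le_divide_eq_numeral1)
  obtain \<psi> :: "real ^ 'n \<Rightarrow> real" where m: "mollifier \<epsilon> \<psi>" using mollifier_exists[OF \<epsilon>(1)] by blast
  note [measurable] = mollifierD(7)[OF m]
  define \<phi> where "\<phi> = mollify \<psi> f"
  have sm: "smooth \<phi>" unfolding \<phi>_def by (rule mollify_smooth[OF C1(8) m])
  have \<phi>: "\<phi> y = (\<integral>z. \<psi> z * f (y - z) \<partial>lborel)" for y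
    by (simp add: \<phi>_def mollify_reflect[OF m])
  have supp\<phi>: "\<phi> y = 0" if "\<rho> + \<epsilon> < norm (y - x)" for y
  proof -
    have "\<psi> z * f (y - z) = 0" for z
    proof (cases "norm z < \<epsilon>")
      case True
      have "norm (y - x) \<le> norm (y - z - x) + norm z"
        using norm_triangle_ineq[of "y - z - x" z] by (simp add: algebra_simps)
      then have "\<rho> < norm (y - z - x)" using that True by linarith
      then show ?thesis using supp by simp
    qed (use mollifierD(3)[OF m, of z] in simp)
    then have "(\<lambda>z. \<psi> z * f (y - z)) = (\<lambda>z. 0)" by (rule ext)
    then show ?thesis by (simp only: \<phi> Bochner_Integration.integral_zero)
  qed
  have sub: "{y. \<phi> y \<noteq> 0} \<subseteq> cball x (\<rho> + \<epsilon>)"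
    using supp\<phi> by (force simp: dist_norm norm_minus_commute)
  have clo: "closure {y. \<phi> y \<noteq> 0} \<subseteq> cball x (\<rho> + \<epsilon>)" by (rule closure_minimal[OF sub]) simp
  have "cball x (\<rho> + \<epsilon>) \<subseteq> ball x r" using \<epsilon> r by auto
  then have test: "test_function (ball x r) \<phi>"
    unfolding test_function_def using sm clo
    by (auto intro: compact_closure[THEN iffD2] bounded_subset[OF bounded_cball sub])
  have gr: "grad \<phi> y = (\<integral>z. \<psi> z *\<^sub>R D (y - z) \<partial>lborel)" for y
    using convolution_has_derivative[OF mollifierD(4)[OF m] C, of y]
    by (intro grad_eqI) (simp add: \<phi>[abs_def])
  obtain B where B: "\<And>x. \<bar>f x\<bar> \<le> B" "\<And>x. norm (D x) \<le> B" using C1_support_bound[OF C] by metis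
  have close: "norm ((\<integral>z. \<psi> z *\<^sub>R g (y - z) \<partial>lborel) - g y) \<le> e"
    if g: "\<And>x y. dist y x < \<epsilon> \<Longrightarrow> dist (g y) (g x) < e" and int: "integrable lborel (\<lambda>z. \<psi> z *\<^sub>R g (y - z))"
    for g :: "real ^ 'n \<Rightarrow> 'b::euclidean_space" and y
  proof -
    have "(\<integral>z. \<psi> z *\<^sub>R g (y - z) \<partial>lborel) - g y = (\<integral>z. \<psi> z *\<^sub>R g (y - z) - \<psi> z *\<^sub>R g y \<partial>lborel)"
      using int mollifierD(4,5)[OF m] by simp
    also have "norm \<dots> \<le> (\<integral>z. \<psi> z * e \<partial>lborel)"
    proof (rule Bochner_Integration.integral_norm_bound_integral)
      fix z
      show "norm (\<psi> z *\<^sub>R g (y - z) - \<psi> z *\<^sub>R g y) \<le> \<psi> z * e"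
      proof (cases "norm z < \<epsilon>")
        case True
        then have "norm (g (y - z) - g y) \<le> e" using g[of "y - z" y] by (simp add: dist_norm)
        then show ?thesis using mollifierD(2)[OF m, of z]
          by (simp add: scaleR_diff_right[symmetric] mult_left_mono)
      qed (use mollifierD(3)[OF m, of z] in simp)
    qed (use int mollifierD(4)[OF m] in auto)
    also have "\<dots> = e" using mollifierD(4,5)[OF m] by simp
    finally show ?thesis .
  qed
  have "\<bar>\<phi> y - f y\<bar> \<le> e" for y
    using close[of f y] integrable_scaleR_bounded[OF mollifierD(4)[OF m], of f B y] d1 \<epsilon> B by (auto simp: \<phi>)
  moreover have "norm (grad \<phi> y - D y) \<le> e" for y
    unfolding gr using close[of D y] integrable_scaleR_bounded[OF mollifierD(4)[OF m], of D B y] d2 \<epsilon> B by auto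
  ultimately show ?thesis using test by blast
qed

section \<open>Limits of test functions and \<open>sobolev_11_0\<close>\<close>

lemma measurable_lebesgue_on_indicator:
  fixes w :: "'a::euclidean_space \<Rightarrow> real"
  assumes "w \<in> borel_measurable (lebesgue_on E)" "E \<in> sets borel"
  shows "(\<lambda>y. ennreal \<bar>w y\<bar> * indicator E y) \<in> borel_measurable lebesgue"
  using assms by (subst borel_measurable_restrict_space_iff_ennreal[symmetric]) auto

text \<open>For the Young function \<open>A(t) = t\<close> any positive \<open>l\<close> not below
  the integral is admissible. The integral may be zero, so it is first enlarged by
  \<open>e\<close>.\<close>

lemma luxemburg_norm_ennreal_le:
  assumes w: "w \<in> borel_measurable (lebesgue_on E)" and E: "E \<in> sets borel"
  shows "luxemburg_norm ennreal E w \<le> (\<integral>\<^sup>+y\<in>E. ennreal \<bar>w y\<bar> \<partial>lborel)" (is "_ \<le> ?I")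
proof (rule ennreal_le_epsilon)
  fix e :: real assume I: "?I < top" and e: "0 < e"
  define l where "l = enn2real ?I + e"
  have l: "0 < l" using e by (simp add: l_def add_nonneg_pos)
  have le: "?I \<le> ennreal l" using I e by (simp add: l_def ennreal_plus)
  have "luxemburg_norm ennreal E w \<le> ennreal l"
    unfolding luxemburg_norm_def
  proof (rule Inf_lower, intro CollectI exI conjI)
    have "(\<integral>\<^sup>+x\<in>E. ennreal (\<bar>w x\<bar> / l) \<partial>lebesgue) = (\<integral>\<^sup>+x. ennreal (1 / l) * (ennreal \<bar>w x\<bar> * indicator E x) \<partial>lebesgue)"
      using l by (intro nn_integral_cong) (simp add: ennreal_mult'[symmetric] mult.assoc[symmetric])
    also have "\<dots> = ennreal (1 / l) * ?I"
      by (subst nn_integral_cmult) (auto intro!: measurable_lebesgue_on_indicator w E simp: nn_integral_completion)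
    also have "\<dots> \<le> ennreal (1 / l) * ennreal l" by (intro mult_left_mono le) auto
    also have "\<dots> = 1" using l by (simp add: ennreal_mult'[symmetric])
    finally show "(\<integral>\<^sup>+x\<in>E. ennreal (\<bar>w x\<bar> / l) \<partial>lebesgue) \<le> 1" .
  qed (use l in auto)
  also have "\<dots> = ?I + ennreal e" using I e by (simp add: l_def ennreal_plus)
  finally show "luxemburg_norm ennreal E w \<le> ?I + ennreal e" .
qed

lemma test_function_C1_support:
  fixes \<phi> :: "real ^ 'n \<Rightarrow> real"
  assumes "test_function U \<phi>"
  obtains R where "C1_support R \<phi> (grad \<phi>)"
    and "\<And>y. y \<notin> U \<Longrightarrow> \<phi> y = 0" "\<And>y. y \<notin> U \<Longrightarrow> grad \<phi> y = 0"
proof -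
  have s: "smooth \<phi>" and c: "compact (closure {x. \<phi> x \<noteq> 0})" "closure {x. \<phi> x \<noteq> 0} \<subseteq> U"
    using assms by (auto simp: test_function_def)
  obtain R where R: "\<And>y. y \<in> closure {x. \<phi> x \<noteq> 0} \<Longrightarrow> norm y \<le> R"
    using compact_imp_bounded[OF c(1)] by (auto simp: bounded_iff)
  have "C1_support R \<phi> (grad \<phi>)"
  proof (rule smooth_C1_support[OF s])
    fix y :: "real ^ 'n" assume "R < norm y"
    then have "y \<notin> closure {x. \<phi> x \<noteq> 0}" using R[of y] by linarith
    then show "\<phi> y = 0" using closure_subset[of "{x. \<phi> x \<noteq> 0}"] by auto
  qed
  moreover have "\<phi> y = 0" if "y \<notin> U" for y
    using that c(2) closure_subset[of "{x. \<phi> x \<noteq> 0}"] by auto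
  moreover have "grad \<phi> y = 0" if "y \<notin> U" for y
  proof (rule grad_eqI)
    have "((\<lambda>_. 0::real) has_derivative (\<lambda>h. 0 \<bullet> h)) (at y)" by simp
    then show "(\<phi> has_derivative (\<lambda>h. 0 \<bullet> h)) (at y)"
      by (rule has_derivative_transform_within_open[where s = "- closure {x. \<phi> x \<noteq> 0}"])
        (use that c(2) closure_subset[of "{x. \<phi> x \<noteq> 0}"] in auto)
  qed
  ultimately show thesis by (rule that)
qed

lemma tendsto_integral_scaleR_bounded:
  fixes f :: "'a::euclidean_space \<Rightarrow> real" and g :: "'a \<Rightarrow> 'b::euclidean_space"
  assumes int: "\<And>k. integrable lborel (\<lambda>y. u k y *\<^sub>R g y)" "integrable lborel (\<lambda>y. f y *\<^sub>R g y)"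
    and [measurable]: "\<And>k. u k \<in> borel_measurable borel" "f \<in> borel_measurable borel" "U \<in> sets borel"
    and B: "\<And>y. norm (g y) \<le> B" and g0: "\<And>y. y \<notin> U \<Longrightarrow> g y = 0"
    and lim: "(\<lambda>k. \<integral>\<^sup>+y\<in>U. ennreal \<bar>f y - u k y\<bar> \<partial>lborel) \<longlonglongrightarrow> 0"
  shows "(\<lambda>k. \<integral>y. u k y *\<^sub>R g y \<partial>lborel) \<longlonglongrightarrow> (\<integral>y. f y *\<^sub>R g y \<partial>lborel)"
proof (rule tendsto_L1_int[OF int])
  show "(\<lambda>k. \<integral>\<^sup>+y. norm (u k y *\<^sub>R g y - f y *\<^sub>R g y) \<partial>lborel) \<longlonglongrightarrow> 0"
  proof (rule tendsto_sandwich[OF _ _ tendsto_const])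
    show "\<forall>\<^sub>F k in sequentially. (\<integral>\<^sup>+y. norm (u k y *\<^sub>R g y - f y *\<^sub>R g y) \<partial>lborel)
       \<le> ennreal B * (\<integral>\<^sup>+y\<in>U. ennreal \<bar>f y - u k y\<bar> \<partial>lborel)"
    proof (rule always_eventually, rule allI)
      fix k
      have "(\<integral>\<^sup>+y. norm (u k y *\<^sub>R g y - f y *\<^sub>R g y) \<partial>lborel) \<le> (\<integral>\<^sup>+y. ennreal B * (ennreal \<bar>f y - u k y\<bar> * indicator U y) \<partial>lborel)"
      proof (rule nn_integral_mono)
        fix y
        have "norm (u k y *\<^sub>R g y - f y *\<^sub>R g y) \<le> B * \<bar>f y - u k y\<bar>"
          using B[of y] by (simp add: scaleR_diff_left[symmetric] abs_minus_commute mult.commute[of _ "norm (g y)"] mult_right_mono)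
        then show "ennreal (norm (u k y *\<^sub>R g y - f y *\<^sub>R g y)) \<le> ennreal B * (ennreal \<bar>f y - u k y\<bar> * indicator U y)"
          using g0[of y] by (cases "y \<in> U") (auto simp: ennreal_mult''[symmetric] intro!: ennreal_leI)
      qed
      then show "(\<integral>\<^sup>+y. norm (u k y *\<^sub>R g y - f y *\<^sub>R g y) \<partial>lborel) \<le> ennreal B * (\<integral>\<^sup>+y\<in>U. ennreal \<bar>f y - u k y\<bar> \<partial>lborel)"
        by (subst (asm) nn_integral_cmult) auto
    qed
    show "(\<lambda>k. ennreal B * (\<integral>\<^sup>+y\<in>U. ennreal \<bar>f y - u k y\<bar> \<partial>lborel)) \<longlonglongrightarrow> 0"
      using ennreal_tendsto_cmult[OF _ lim, of "ennreal B"] by simp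
  qed auto
qed

text \<open>That \<open>hB\<close> is the weak gradient of \<open>v\<close> is not assumed:
  integration by parts holds for each test function \<open>\<phi> k\<close>, and convergence in the
  mean of the functions and of their gradients carries it to the limit. The function
  \<open>v\<close> is linked to its Borel version \<open>vB\<close> only almost everywhere.\<close>

lemma sobolev_11_0I:
  fixes v :: "real ^ 'n \<Rightarrow> real"
  assumes U: "open U" and \<phi>: "\<And>k. test_function U (\<phi> k)"
    and vB: "integrable lborel vB" and hB: "integrable lborel hB"
    and v: "v \<in> borel_measurable (lebesgue_on U)" "AE y in lborel. y \<in> U \<longrightarrow> v y = vB y"
    and lim1: "(\<lambda>k. \<integral>\<^sup>+y\<in>U. ennreal \<bar>vB y - \<phi> k y\<bar> \<partial>lborel) \<longlonglongrightarrow> 0"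
    and lim2: "(\<lambda>k. \<integral>\<^sup>+y\<in>U. ennreal (norm (hB y - grad (\<phi> k) y)) \<partial>lborel) \<longlonglongrightarrow> 0"
  shows "v \<in> sobolev_11_0 U"
proof -
  have [measurable]: "vB \<in> borel_measurable borel" "hB \<in> borel_measurable borel" "U \<in> sets borel"
    using vB hB U by auto
  have \<phi>m [measurable]: "\<phi> k \<in> borel_measurable borel" "grad (\<phi> k) \<in> borel_measurable borel" for k
    using \<phi>[of k] by (auto simp: test_function_def intro!: borel_measurable_continuous_onI smooth_imp_continuous_on smooth_imp_continuous_on_grad)
  have on: "f \<in> borel_measurable (lebesgue_on U)" if "f \<in> borel_measurable borel"
    for f :: "real ^ 'n \<Rightarrow> 'b::euclidean_space"
    using that by (intro measurable_restrict_space1 measurable_completion) simp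
  have orl: "f \<in> orlicz ennreal U" if f: "f \<in> borel_measurable (lebesgue_on U)" "AE y in lborel. y \<in> U \<longrightarrow> \<bar>f y\<bar> = norm (g y)"
     "integrable lborel g" for f and g :: "real ^ 'n \<Rightarrow> 'b::euclidean_space"
  proof -
    have "luxemburg_norm ennreal U f \<le> (\<integral>\<^sup>+y\<in>U. ennreal \<bar>f y\<bar> \<partial>lborel)"
      by (rule luxemburg_norm_ennreal_le[OF f(1)]) measurable
    also have "\<dots> \<le> (\<integral>\<^sup>+y. ennreal (norm (g y)) \<partial>lborel)"
      using f(2) by (intro nn_integral_mono_AE) (auto simp: indicator_def elim: eventually_mono)
    also have "\<dots> < \<infinity>" using f(3) by (simp add: integrable_iff_bounded)
    finally show ?thesis using f(1) by (simp add: orlicz_def)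
  qed
  have vU: "(\<lambda>y. indicator U y *\<^sub>R v y) \<in> borel_measurable lebesgue"
    using v(1) by (subst borel_measurable_restrict_space_iff[symmetric]) auto
  have vAE: "AE y in lebesgue. y \<in> U \<longrightarrow> v y = vB y" using v(2) by (rule AE_completion)
  have wg: "weak_gradient U v hB"
    unfolding weak_gradient_def
  proof (intro conjI allI impI)
    show "locally_integrable U v"
      unfolding locally_integrable_def
    proof (intro allI impI)
      fix K assume K: "compact K \<and> K \<subseteq> U"
      then have [measurable]: "K \<in> sets borel" by (auto intro: borel_compact)
      have "integrable lebesgue (\<lambda>y. indicator K y *\<^sub>R vB y)"
        using vB by (intro integrable_completion[THEN iffD2] integrable_mult_indicator) auto
      moreover have "(\<lambda>y. indicator K y *\<^sub>R v y) \<in> borel_measurable lebesgue"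
      proof -
        have "(\<lambda>y. indicator K y *\<^sub>R (indicator U y *\<^sub>R v y)) \<in> borel_measurable lebesgue"
          by (intro borel_measurable_scaleR vU measurable_completion) measurable
        also have "(\<lambda>y. indicator K y *\<^sub>R (indicator U y *\<^sub>R v y)) = (\<lambda>y. indicator K y *\<^sub>R v y)"
          using K by (auto simp: indicator_def fun_eq_iff)
        finally show ?thesis .
      qed
      moreover have "AE y in lebesgue. indicator K y *\<^sub>R vB y = indicator K y *\<^sub>R v y"
        using vAE by eventually_elim (use K in \<open>auto simp: indicator_def\<close>)
      ultimately show "set_integrable lebesgue K v"
        unfolding set_integrable_def by (rule integrable_cong_AE_imp)
    qed
    show "locally_integrable U hB"
      unfolding locally_integrable_def set_integrable_def
    proof (intro allI impI)
      fix K assume K: "compact K \<and> K \<subseteq> U"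
      then have [measurable]: "K \<in> sets borel" by (auto intro: borel_compact)
      show "integrable lebesgue (\<lambda>y. indicator K y *\<^sub>R hB y)"
        using hB by (intro integrable_completion[THEN iffD2] integrable_mult_indicator) auto
    qed
    fix \<psi> assume "test_function U \<psi>"
    then obtain R where C: "C1_support R \<psi> (grad \<psi>)" and z: "\<And>y. y \<notin> U \<Longrightarrow> \<psi> y = 0" "\<And>y. y \<notin> U \<Longrightarrow> grad \<psi> y = 0"
      using test_function_C1_support by metis
    note C1 = C1_supportD[OF C]
    note [measurable] = C1(6,7)
    obtain B where B: "\<And>x. \<bar>\<psi> x\<bar> \<le> B" "\<And>x. norm (grad \<psi> x) \<le> B" using C1_support_bound[OF C] by metis
    have "(LINT y:U|lebesgue. v y *\<^sub>R grad \<psi> y) = (\<integral>y. vB y *\<^sub>R grad \<psi> y \<partial>lebesgue)"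
      unfolding set_lebesgue_integral_def
    proof (rule integral_cong_AE)
      have "(\<lambda>y. (indicator U y *\<^sub>R v y) *\<^sub>R grad \<psi> y) \<in> borel_measurable lebesgue"
        by (intro borel_measurable_scaleR vU measurable_completion) measurable
      then show "(\<lambda>y. indicator U y *\<^sub>R v y *\<^sub>R grad \<psi> y) \<in> borel_measurable lebesgue" by simp
      show "(\<lambda>y. vB y *\<^sub>R grad \<psi> y) \<in> borel_measurable lebesgue"
        by (intro measurable_completion) measurable
      show "AE y in lebesgue. indicator U y *\<^sub>R v y *\<^sub>R grad \<psi> y = vB y *\<^sub>R grad \<psi> y"
        using vAE by eventually_elim (use z in \<open>auto simp: indicator_def\<close>)
    qed
    also have "\<dots> = (\<integral>y. vB y *\<^sub>R grad \<psi> y \<partial>lborel)" by (rule integral_completion) measurable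
    finally have 1: "(LINT y:U|lebesgue. v y *\<^sub>R grad \<psi> y) = (\<integral>y. vB y *\<^sub>R grad \<psi> y \<partial>lborel)" .
    have "(LINT y:U|lebesgue. \<psi> y *\<^sub>R hB y) = (\<integral>y. \<psi> y *\<^sub>R hB y \<partial>lebesgue)"
      unfolding set_lebesgue_integral_def
      by (rule Bochner_Integration.integral_cong) (use z in \<open>auto simp: indicator_def\<close>)
    also have "\<dots> = (\<integral>y. \<psi> y *\<^sub>R hB y \<partial>lborel)" by (rule integral_completion) measurable
    finally have 2: "(LINT y:U|lebesgue. \<psi> y *\<^sub>R hB y) = (\<integral>y. \<psi> y *\<^sub>R hB y \<partial>lborel)" .
    have ibp: "(\<integral>y. \<phi> k y *\<^sub>R grad \<psi> y \<partial>lborel) = - (\<integral>y. \<psi> y *\<^sub>R grad (\<phi> k) y \<partial>lborel)" for k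
    proof -
      obtain R' where "C1_support R' (\<phi> k) (grad (\<phi> k))" using test_function_C1_support[OF \<phi>[of k]] by metis
      then show ?thesis using C by (rule C1_support_integration_by_parts)
    qed
    have cont\<phi>: "continuous_on UNIV (\<phi> k)" "continuous_on UNIV (grad (\<phi> k))" for k
      using \<phi>[of k] by (auto simp: test_function_def intro!: smooth_imp_continuous_on smooth_imp_continuous_on_grad)
    have lim: "(\<lambda>k. \<integral>y. \<phi> k y *\<^sub>R grad \<psi> y \<partial>lborel) \<longlonglongrightarrow> (\<integral>y. vB y *\<^sub>R grad \<psi> y \<partial>lborel)"
    proof (rule tendsto_integral_scaleR_bounded[where B = B and U = U])
      show "integrable lborel (\<lambda>y. \<phi> k y *\<^sub>R grad \<psi> y)" for k
        by (rule integrable_compact_support[where R = R]) (use C1 in \<open>auto intro!: continuous_intros cont\<phi>\<close>)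
      have "integrable lborel (\<lambda>y. vB y *\<^sub>R (\<lambda>y. grad \<psi> (- y)) (0 - y))"
        by (rule integrable_scaleR_bounded[OF vB, where B = B]) (use B in auto)
      then show "integrable lborel (\<lambda>y. vB y *\<^sub>R grad \<psi> y)" by simp
    qed (use B z lim1 in auto)
    have "(\<lambda>k. \<integral>y. \<psi> y *\<^sub>R grad (\<phi> k) y \<partial>lborel) \<longlonglongrightarrow> (\<integral>y. \<psi> y *\<^sub>R hB y \<partial>lborel)"
    proof (rule tendsto_L1_int)
      show "integrable lborel (\<lambda>y. \<psi> y *\<^sub>R grad (\<phi> k) y)" for k
        by (rule integrable_compact_support[where R = R]) (use C1 in \<open>auto intro!: continuous_intros cont\<phi>\<close>)
      have "integrable lborel (\<lambda>y. (\<lambda>y. \<psi> (- y)) (0 - y) *\<^sub>R hB y)"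
        by (rule integrable_bounded_scaleR[OF hB, where B = B]) (use B in auto)
      then show "integrable lborel (\<lambda>y. \<psi> y *\<^sub>R hB y)" by simp
      show "(\<lambda>k. \<integral>\<^sup>+y. norm (\<psi> y *\<^sub>R grad (\<phi> k) y - \<psi> y *\<^sub>R hB y) \<partial>lborel) \<longlonglongrightarrow> 0"
      proof (rule tendsto_sandwich[OF _ _ tendsto_const])
        show "\<forall>\<^sub>F k in sequentially. (\<integral>\<^sup>+y. norm (\<psi> y *\<^sub>R grad (\<phi> k) y - \<psi> y *\<^sub>R hB y) \<partial>lborel)
           \<le> ennreal B * (\<integral>\<^sup>+y\<in>U. ennreal (norm (hB y - grad (\<phi> k) y)) \<partial>lborel)"
        proof (rule always_eventually, rule allI)
          fix k
          have "(\<integral>\<^sup>+y. norm (\<psi> y *\<^sub>R grad (\<phi> k) y - \<psi> y *\<^sub>R hB y) \<partial>lborel)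
             \<le> (\<integral>\<^sup>+y. ennreal B * (ennreal (norm (hB y - grad (\<phi> k) y)) * indicator U y) \<partial>lborel)"
          proof (rule nn_integral_mono)
            fix y
            have "norm (\<psi> y *\<^sub>R grad (\<phi> k) y - \<psi> y *\<^sub>R hB y) \<le> B * norm (hB y - grad (\<phi> k) y)"
              using B(1)[of y] by (simp add: scaleR_diff_right[symmetric] norm_minus_commute mult_right_mono)
            then show "ennreal (norm (\<psi> y *\<^sub>R grad (\<phi> k) y - \<psi> y *\<^sub>R hB y)) \<le> ennreal B * (ennreal (norm (hB y - grad (\<phi> k) y)) * indicator U y)"
              using z(1)[of y] by (cases "y \<in> U") (auto simp: ennreal_mult''[symmetric] intro!: ennreal_leI)
          qed
          then show "(\<integral>\<^sup>+y. norm (\<psi> y *\<^sub>R grad (\<phi> k) y - \<psi> y *\<^sub>R hB y) \<partial>lborel)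
             \<le> ennreal B * (\<integral>\<^sup>+y\<in>U. ennreal (norm (hB y - grad (\<phi> k) y)) \<partial>lborel)"
            by (subst (asm) nn_integral_cmult) auto
        qed
        show "(\<lambda>k. ennreal B * (\<integral>\<^sup>+y\<in>U. ennreal (norm (hB y - grad (\<phi> k) y)) \<partial>lborel)) \<longlonglongrightarrow> 0"
          using ennreal_tendsto_cmult[OF _ lim2, of "ennreal B"] by simp
      qed auto
    qed
    then have "(\<lambda>k. \<integral>y. \<phi> k y *\<^sub>R grad \<psi> y \<partial>lborel) \<longlonglongrightarrow> - (\<integral>y. \<psi> y *\<^sub>R hB y \<partial>lborel)"
      unfolding ibp by (rule tendsto_minus)
    with lim have "(\<integral>y. vB y *\<^sub>R grad \<psi> y \<partial>lborel) = - (\<integral>y. \<psi> y *\<^sub>R hB y \<partial>lborel)"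
      by (rule LIMSEQ_unique)
    then show "(LINT y:U|lebesgue. v y *\<^sub>R grad \<psi> y) = - (LINT y:U|lebesgue. \<psi> y *\<^sub>R hB y)"
      by (simp only: 1 2)
  qed
  have "v \<in> orlicz ennreal U"
    by (rule orl[OF v(1) _ vB]) (use v(2) in \<open>auto elim: eventually_mono\<close>)
  moreover have "(\<lambda>x. norm (hB x)) \<in> orlicz ennreal U"
    by (rule orl[OF _ _ hB]) (auto intro!: on)
  ultimately have "v \<in> orlicz_sobolev ennreal U"
    using wg by (auto simp: orlicz_sobolev_def)
  moreover have "(\<lambda>k. luxemburg_norm ennreal U (\<lambda>x. v x - \<phi> k x)) \<longlonglongrightarrow> 0"
  proof (rule tendsto_sandwich[OF _ _ tendsto_const lim1])
    show "\<forall>\<^sub>F k in sequentially. luxemburg_norm ennreal U (\<lambda>x. v x - \<phi> k x) \<le> (\<integral>\<^sup>+y\<in>U. ennreal \<bar>vB y - \<phi> k y\<bar> \<partial>lborel)"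
    proof (rule always_eventually, rule allI)
      fix k
      have "luxemburg_norm ennreal U (\<lambda>x. v x - \<phi> k x) \<le> (\<integral>\<^sup>+y\<in>U. ennreal \<bar>v y - \<phi> k y\<bar> \<partial>lborel)"
        by (intro luxemburg_norm_ennreal_le borel_measurable_diff v on) measurable
      also have "\<dots> = (\<integral>\<^sup>+y\<in>U. ennreal \<bar>vB y - \<phi> k y\<bar> \<partial>lborel)"
        using v(2) by (intro nn_integral_cong_AE) (auto simp: indicator_def elim: eventually_mono)
      finally show "luxemburg_norm ennreal U (\<lambda>x. v x - \<phi> k x) \<le> (\<integral>\<^sup>+y\<in>U. ennreal \<bar>vB y - \<phi> k y\<bar> \<partial>lborel)" .
    qed
  qed auto
  moreover have "(\<lambda>k. luxemburg_norm ennreal U (\<lambda>x. norm (hB x - grad (\<phi> k) x))) \<longlonglongrightarrow> 0"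
  proof (rule tendsto_sandwich[OF _ _ tendsto_const lim2])
    show "\<forall>\<^sub>F k in sequentially. luxemburg_norm ennreal U (\<lambda>x. norm (hB x - grad (\<phi> k) x)) \<le> (\<integral>\<^sup>+y\<in>U. ennreal (norm (hB y - grad (\<phi> k) y)) \<partial>lborel)"
    proof (rule always_eventually, rule allI)
      fix k
      have "(\<lambda>x. norm (hB x - grad (\<phi> k) x)) \<in> borel_measurable (lebesgue_on U)" by (intro on) measurable
      then show "luxemburg_norm ennreal U (\<lambda>x. norm (hB x - grad (\<phi> k) x)) \<le> (\<integral>\<^sup>+y\<in>U. ennreal (norm (hB y - grad (\<phi> k) y)) \<partial>lborel)"
        using luxemburg_norm_ennreal_le[of "\<lambda>x. norm (hB x - grad (\<phi> k) x)" U] by simp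
    qed
  qed auto
  ultimately show ?thesis using wg \<phi> unfolding sobolev_11_0_def by blast
qed

section \<open>Truncations and bounds for boundary values\<close>

text \<open>A continuously differentiable approximation of the positive part, with uniform error at
  most \<open>\<delta>\<close>. It vanishes on the whole half line \<open>s \<le> 0\<close>, so a
  truncation built from it is zero wherever its argument stays on the right side of the
  level.\<close>

definition smooth_pos :: "real \<Rightarrow> real \<Rightarrow> real" where
  "smooth_pos \<delta> s = (max s 0)\<^sup>2 / (max s 0 + \<delta>)"

definition smooth_pos' :: "real \<Rightarrow> real \<Rightarrow> real" where
  "smooth_pos' \<delta> s = 1 - \<delta>\<^sup>2 / (max s 0 + \<delta>)\<^sup>2"

lemma smooth_pos_nonneg: "0 < \<delta> \<Longrightarrow> 0 \<le> smooth_pos \<delta> s"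
  by (simp add: smooth_pos_def)

lemma smooth_pos_eq_0: "s \<le> 0 \<Longrightarrow> smooth_pos \<delta> s = 0"
  by (simp add: smooth_pos_def)

lemma smooth_pos_near:
  assumes "0 < \<delta>"
  shows "\<bar>smooth_pos \<delta> s - max s 0\<bar> \<le> \<delta>"
proof -
  have "smooth_pos \<delta> s - max s 0 = - (\<delta> * (max s 0 / (max s 0 + \<delta>)))"
    using assms by (auto simp: smooth_pos_def max_def power2_eq_square field_simps)
  moreover have "max s 0 / (max s 0 + \<delta>) \<le> 1" "0 \<le> max s 0 / (max s 0 + \<delta>)"
    using assms by (auto simp: field_simps)
  ultimately show ?thesis using assms mult_left_mono[of "max s 0 / (max s 0 + \<delta>)" 1 \<delta>]
    by (simp add: abs_mult)
qed

lemma smooth_pos'_bounds: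
  assumes "0 < \<delta>"
  shows "0 \<le> smooth_pos' \<delta> s" "smooth_pos' \<delta> s \<le> 1"
proof -
  have "\<delta>\<^sup>2 \<le> (max s 0 + \<delta>)\<^sup>2" using assms by (intro power_mono) auto
  then show "0 \<le> smooth_pos' \<delta> s" using assms
    by (simp add: smooth_pos'_def divide_le_eq_1 zero_less_power add_nonneg_pos)
qed (simp add: smooth_pos'_def)

lemma continuous_on_smooth_pos':
  assumes "0 < \<delta>"
  shows "continuous_on S (smooth_pos' \<delta>)"
proof -
  have "max s 0 + \<delta> \<noteq> 0" for s using assms by (metis add_nonneg_pos less_irrefl max.cobounded2)
  then show ?thesis unfolding smooth_pos'_def[abs_def] by (intro continuous_intros) auto
qed

lemma smooth_pos_has_derivative:
  assumes d: "0 < \<delta>"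
  shows "(smooth_pos \<delta> has_real_derivative smooth_pos' \<delta> s) (at s)"
proof (cases s "0 :: real" rule: linorder_cases)
  case less
  have "((\<lambda>_. 0) has_real_derivative 0) (at s)" by simp
  then have "(smooth_pos \<delta> has_real_derivative 0) (at s)"
    by (rule has_field_derivative_transform_within_open[where S = "{..<0}"])
      (use less in \<open>auto simp: smooth_pos_def\<close>)
  then show ?thesis using less d by (simp add: smooth_pos'_def)
next
  case greater
  have "((\<lambda>s. s\<^sup>2 / (s + \<delta>)) has_real_derivative (2 * s * (s + \<delta>) - s\<^sup>2 * 1) / ((s + \<delta>) * (s + \<delta>))) (at s)"
    using greater d by (auto intro!: derivative_eq_intros)
  also have "(2 * s * (s + \<delta>) - s\<^sup>2 * 1) / ((s + \<delta>) * (s + \<delta>)) = smooth_pos' \<delta> s"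
  proof -
    have "2 * s * (s + \<delta>) - s\<^sup>2 * 1 = (s + \<delta>) * (s + \<delta>) - \<delta>\<^sup>2"
      by (simp add: power2_eq_square algebra_simps)
    then show ?thesis
      using greater d by (simp add: smooth_pos'_def diff_divide_distrib power2_eq_square[of "s + \<delta>"])
  qed
  finally show ?thesis
    by (rule has_field_derivative_transform_within_open[where S = "{0<..}"])
      (use greater in \<open>auto simp: smooth_pos_def\<close>)
next
  case equal
  have "((\<lambda>h. smooth_pos \<delta> h / h) \<longlongrightarrow> 0) (at 0)"
  proof (rule Lim_null_comparison)
    show "\<forall>\<^sub>F h in at 0. norm (smooth_pos \<delta> h / h) \<le> \<bar>h\<bar> / \<delta>"
    proof (rule always_eventually, rule allI)
      fix h :: real
      show "norm (smooth_pos \<delta> h / h) \<le> \<bar>h\<bar> / \<delta>"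
      proof (cases "0 < h")
        case True
        then have "smooth_pos \<delta> h / h = h / (h + \<delta>)" by (simp add: smooth_pos_def power2_eq_square)
        also have "\<dots> \<le> h / \<delta>" using True d by (intro divide_left_mono) auto
        finally show ?thesis using True d smooth_pos_nonneg[OF d, of h] by simp
      qed (use d in \<open>simp add: smooth_pos_def divide_nonpos_pos\<close>)
    qed
    show "((\<lambda>h. \<bar>h\<bar> / \<delta>) \<longlongrightarrow> 0) (at 0)"
      by (rule tendsto_eq_intros refl | use d in simp)+
  qed
  then have "(smooth_pos \<delta> has_real_derivative 0) (at 0)"
    by (simp add: has_field_derivative_iff smooth_pos_def)
  then show ?thesis using equal d by (simp add: smooth_pos'_def)
qed

text \<open>The derivatives tend to the indicator of the positive half line away from the kink. At
  \<open>s = 0\<close> the limit would depend on how \<open>S k\<close> compares with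
  \<open>\<delta> k\<close>; the truncation levels are therefore chosen later so that this value is
  attained only on a null set.\<close>

lemma smooth_pos'_tendsto:
  assumes d: "\<And>k. 0 < \<delta> k" "\<delta> \<longlonglongrightarrow> 0" and s: "S \<longlonglongrightarrow> s" "s \<noteq> 0"
  shows "(\<lambda>k. smooth_pos' (\<delta> k) (S k)) \<longlonglongrightarrow> (if 0 < s then 1 else 0)"
proof (cases "0 < s")
  case True
  have "(\<lambda>k. 1 - (\<delta> k)\<^sup>2 / (max (S k) 0 + \<delta> k)\<^sup>2) \<longlonglongrightarrow> 1 - 0\<^sup>2 / (max s 0 + 0)\<^sup>2"
    using True by (intro tendsto_intros d s) auto
  then show ?thesis using True by (simp add: smooth_pos'_def)
next
  case False
  then have "s < 0" using s by simp
  then have "eventually (\<lambda>k. S k < 0) sequentially" using order_tendstoD(2)[OF s(1)] by blast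
  then have "eventually (\<lambda>k. smooth_pos' (\<delta> k) (S k) = 0) sequentially"
  proof eventually_elim
    case (elim k)
    then show ?case using d(1)[of k] by (simp add: smooth_pos'_def)
  qed
  then show ?thesis using False by (simp add: tendsto_eventually)
qed

text \<open>On the sphere \<open>w\<close> takes values in the open set \<open>P\<close> on which
  \<open>T\<close> vanishes, and by compactness it still does so on a ring
  \<open>\<rho> < norm (y - x) < r\<close>. Hence the extension of \<open>T (w y)\<close> by zero is
  continuously differentiable across the sphere and supported in a strictly smaller ball.\<close>

lemma C1_support_truncation:
  fixes w :: "'a::euclidean_space \<Rightarrow> real" and D :: "'a \<Rightarrow> 'a"
  assumes w: "\<And>x. (w has_derivative (\<lambda>h. D x \<bullet> h)) (at x)" and D: "continuous_on UNIV D"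
    and T: "\<And>s. (T has_real_derivative T' s) (at s)" and T': "continuous_on UNIV T'"
    and P: "open P" "\<And>s. s \<in> P \<Longrightarrow> T s = 0" and sph: "\<And>y. norm (y - x) = r \<Longrightarrow> w y \<in> P" and r: "0 < r"
  obtains \<rho> where "\<rho> < r"
    "C1_support (norm x + r) (\<lambda>y. if norm (y - x) < r then T (w y) else 0)
       (\<lambda>y. if norm (y - x) < r then T' (w y) *\<^sub>R D y else 0)"
    "\<And>y. \<rho> < norm (y - x) \<Longrightarrow> (if norm (y - x) < r then T (w y) else 0) = 0"
proof -
  let ?f = "\<lambda>y. if norm (y - x) < r then T (w y) else 0"
  let ?E = "\<lambda>y. if norm (y - x) < r then T' (w y) *\<^sub>R D y else 0"
  have wc: "continuous_on UNIV w"
    by (rule has_derivative_continuous_on[of UNIV w "\<lambda>x h. D x \<bullet> h"]) (use w in auto)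
  have T'0: "T' s = 0" if "s \<in> P" for s
  proof -
    have "((\<lambda>_. 0) has_real_derivative 0) (at s)" by simp
    then have "(T has_real_derivative 0) (at s)"
      by (rule has_field_derivative_transform_within_open[OF _ P(1) that]) (use P in auto)
    then show ?thesis using T DERIV_unique by blast
  qed
  \<comment> \<open>The compact set of points of the closed ball with values outside
    \<open>P\<close>. It misses the sphere, so its largest distance from the centre is some
    \<open>\<rho> < r\<close>; if it is empty, \<open>\<rho> = 0\<close> will do.\<close>
  define S where "S = cball x r \<inter> w -` (- P)"
  have "compact S" unfolding S_def
    by (intro compact_Int_closed continuous_closed_vimage compact_cball) (use P wc in \<open>auto simp: closed_Compl continuous_on_eq_continuous_at\<close>)
  obtain \<rho> where \<rho>: "\<rho> < r" "\<And>y. y \<in> S \<Longrightarrow> norm (y - x) \<le> \<rho>"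
  proof (cases "S = {}")
    case True
    then show thesis using that[of 0] r by auto
  next
    case False
    have "continuous_on S (\<lambda>y. norm (y - x))" by (intro continuous_intros)
    then obtain y0 where y0: "y0 \<in> S" "\<And>y. y \<in> S \<Longrightarrow> norm (y - x) \<le> norm (y0 - x)"
      using continuous_attains_sup[OF \<open>compact S\<close> False, of "\<lambda>y. norm (y - x)"] by blast
    have "norm (y0 - x) \<le> r" using y0 by (simp add: S_def dist_norm norm_minus_commute)
    moreover have "norm (y0 - x) \<noteq> r" using sph[of y0] y0 by (auto simp: S_def)
    ultimately show thesis using that[of "norm (y0 - x)"] y0 by auto
  qed
  have inP: "w y \<in> P" if "\<rho> < norm (y - x)" "norm (y - x) < r" for y
  proof (rule ccontr)
    assume "w y \<notin> P"
    then have "y \<in> S" using that by (simp add: S_def dist_norm norm_minus_commute)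
    then show False using \<rho>(2)[of y] that by simp
  qed
  have f0: "?f y = 0" and E0: "?E y = 0" if "\<rho> < norm (y - x)" for y
    using inP[OF that] P T'0 by auto
  let ?out = "{y. \<rho> < norm (y - x)}"
  have out: "open ?out" by (intro open_Collect_less continuous_intros)
  have ball: "open {y. norm (y - x) < r}" by (intro open_Collect_less continuous_intros)
  have cov: "UNIV = {y. norm (y - x) < r} \<union> ?out" using \<rho> by auto
  have "C1_support (norm x + r) ?f ?E"
    unfolding C1_support_def
  proof (intro conjI allI impI)
    fix y
    show "(?f has_derivative (\<lambda>h. ?E y \<bullet> h)) (at y)"
    proof (cases "\<rho> < norm (y - x)")
      case True
      have "((\<lambda>_. 0::real) has_derivative (\<lambda>h. ?E y \<bullet> h)) (at y)" using E0[OF True] by simp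
      then show ?thesis
        by (rule has_derivative_transform_within_open[OF _ out]) (use True f0 in auto)
    next
      case False
      then have yr: "norm (y - x) < r" using \<rho> by simp
      have "((\<lambda>y. T (w y)) has_derivative (\<lambda>h. ?E y \<bullet> h)) (at y)"
        using diff_chain_at[OF w[of y] T[of "w y", unfolded has_field_derivative_def]] yr
        by (simp add: o_def mult.commute)
      then show ?thesis
        by (rule has_derivative_transform_within_open[OF _ ball]) (use yr in auto)
    qed
    have "continuous_on {y. norm (y - x) < r} ?E"
      by (rule continuous_on_eq[where f = "\<lambda>y. T' (w y) *\<^sub>R D y"])
        (auto intro!: continuous_intros continuous_on_compose2[OF T'] continuous_on_subset[OF wc] continuous_on_subset[OF D])
    moreover have "continuous_on ?out ?E"
      by (rule continuous_on_eq[where f = "\<lambda>y. 0"]) (use E0 in auto)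
    ultimately show "continuous_on UNIV ?E"
      unfolding cov by (rule continuous_on_open_Un[OF ball out])
  next
    fix y :: 'a assume y: "norm x + r < norm y"
    then have "r < norm (y - x)" using norm_triangle_ineq2[of y x] by simp
    then show "?f y = 0" "?E y = 0" by auto
  qed
  then show thesis using that \<rho>(1) f0 by blast
qed

text \<open>A substitute for a trace inequality. If \<open>w\<close> is at least
  \<open>c - l\<close> on the sphere, then the smoothed positive part of
  \<open>c - l - 1 - w\<close> vanishes near the sphere, and the Poincare inequality bounds its
  integral by that of the gradient. Inside the ball \<open>c\<close> is at most \<open>l + 2\<close>
  plus \<open>\<bar>w\<bar>\<close> plus this truncation, and integration gives the claim.\<close>

lemma boundary_value_lower_bound:
  fixes w :: "'a::euclidean_space \<Rightarrow> real" and D :: "'a \<Rightarrow> 'a"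
  assumes w: "\<And>x. (w has_derivative (\<lambda>h. D x \<bullet> h)) (at x)" and D: "continuous_on UNIV D"
    and r: "0 < r" and l: "0 \<le> l" and sph: "\<And>y. norm (y - x) = r \<Longrightarrow> c - l \<le> w y"
  shows "ennreal c * emeasure lborel (ball x r) \<le> ennreal (l + 2) * emeasure lborel (ball x r)
     + (\<integral>\<^sup>+y\<in>ball x r. ennreal \<bar>w y\<bar> \<partial>lborel) + ennreal (2 * r + 1) * (\<integral>\<^sup>+y\<in>ball x r. ennreal (norm (D y)) \<partial>lborel)"
proof -
  \<comment> \<open>Lowering the level by 1 makes the zero set \<open>{c - l - 1<..}\<close> of the
    truncation an open neighbourhood of the boundary values. This 1 and the smoothing error 1 add up
    to the 2 in \<open>l + 2\<close>.\<close>
  let ?T = "\<lambda>s. smooth_pos 1 (c - l - 1 - s)" and ?T' = "\<lambda>s. - smooth_pos' 1 (c - l - 1 - s)"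
  have T: "(?T has_real_derivative ?T' s) (at s)" for s
    by (rule DERIV_chain'[OF _ smooth_pos_has_derivative, THEN DERIV_cong]) (auto intro!: derivative_eq_intros)
  have T': "continuous_on UNIV ?T'"
    by (intro continuous_intros continuous_on_compose2[OF continuous_on_smooth_pos'[of 1 UNIV]]) auto
  obtain \<rho> where \<rho>: "\<rho> < r" and C: "C1_support (norm x + r) (\<lambda>y. if norm (y - x) < r then ?T (w y) else 0)
       (\<lambda>y. if norm (y - x) < r then ?T' (w y) *\<^sub>R D y else 0)"
    using C1_support_truncation[OF w D T T', of "{c - l - 1<..}" x r] sph r
    by (force simp: smooth_pos_def)
  let ?f = "\<lambda>y. if norm (y - x) < r then ?T (w y) else 0"
  let ?E = "\<lambda>y. if norm (y - x) < r then ?T' (w y) *\<^sub>R D y else 0"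
  have wc: "continuous_on UNIV w"
    by (rule has_derivative_continuous_on[of UNIV w "\<lambda>x h. D x \<bullet> h"]) (use w in auto)
  note [measurable] = C1_supportD(6,7)[OF C] borel_measurable_continuous_onI[OF wc] borel_measurable_continuous_onI[OF D]
  have in_ball: "y \<in> ball x r \<longleftrightarrow> norm (y - x) < r" for y by (simp add: dist_norm norm_minus_commute)
  have p: "(\<integral>\<^sup>+y. \<bar>?f y\<bar> \<partial>lborel) \<le> ennreal (2 * r + 1) * (\<integral>\<^sup>+y. norm (?E y) \<partial>lborel)"
    by (rule C1_support_poincare[OF C, of r x]) (use r in auto)
  also have "(\<integral>\<^sup>+y. norm (?E y) \<partial>lborel) \<le> (\<integral>\<^sup>+y\<in>ball x r. ennreal (norm (D y)) \<partial>lborel)"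
  proof (rule nn_integral_mono)
    fix y
    have "\<bar>?T' (w y)\<bar> * norm (D y) \<le> 1 * norm (D y)"
      using smooth_pos'_bounds[of 1 "c - l - 1 - w y"] by (intro mult_right_mono) auto
    then show "ennreal (norm (?E y)) \<le> ennreal (norm (D y)) * indicator (ball x r) y"
      by (auto simp: indicator_def in_ball simp del: mem_ball intro!: ennreal_leI)
  qed
  finally have p: "(\<integral>\<^sup>+y. \<bar>?f y\<bar> \<partial>lborel) \<le> ennreal (2 * r + 1) * (\<integral>\<^sup>+y\<in>ball x r. ennreal (norm (D y)) \<partial>lborel)"
    by (simp add: mult_left_mono)
  have "ennreal c * emeasure lborel (ball x r) = (\<integral>\<^sup>+y. ennreal c * indicator (ball x r) y \<partial>lborel)"
    by (simp add: nn_integral_cmult_indicator)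
  also have "\<dots> \<le> (\<integral>\<^sup>+y. ennreal (l + 2) * indicator (ball x r) y + ennreal \<bar>w y\<bar> * indicator (ball x r) y + ennreal \<bar>?f y\<bar> \<partial>lborel)"
  proof (rule nn_integral_mono)
    fix y
    show "ennreal c * indicator (ball x r) y \<le> ennreal (l + 2) * indicator (ball x r) y + ennreal \<bar>w y\<bar> * indicator (ball x r) y + ennreal \<bar>?f y\<bar>"
    proof (cases "y \<in> ball x r")
      case True
      have "c \<le> (l + 2) + \<bar>w y\<bar> + \<bar>?f y\<bar>"
        using True smooth_pos_near[of 1 "c - l - 1 - w y"] by (auto simp: in_ball simp del: mem_ball)
      then have "ennreal c \<le> ennreal (l + 2) + ennreal \<bar>w y\<bar> + ennreal \<bar>?f y\<bar>"
        using l by (simp add: ennreal_plus[symmetric] ennreal_leI del: ennreal_plus)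
      then show ?thesis using True by simp
    qed simp
  qed
  also have "\<dots> = (\<integral>\<^sup>+y. ennreal (l + 2) * indicator (ball x r) y \<partial>lborel)
      + (\<integral>\<^sup>+y. ennreal \<bar>w y\<bar> * indicator (ball x r) y \<partial>lborel) + (\<integral>\<^sup>+y. ennreal \<bar>?f y\<bar> \<partial>lborel)"
  proof -
    define F where "F y = ennreal \<bar>?f y\<bar>" for y
    have [measurable]: "F \<in> borel_measurable borel" "ball x r \<in> sets borel"
      unfolding F_def using C1_supportD(6)[OF C] by auto
    have "(\<integral>\<^sup>+y. ennreal (l + 2) * indicator (ball x r) y + ennreal \<bar>w y\<bar> * indicator (ball x r) y + F y \<partial>lborel)
      = (\<integral>\<^sup>+y. ennreal (l + 2) * indicator (ball x r) y + ennreal \<bar>w y\<bar> * indicator (ball x r) y \<partial>lborel) + (\<integral>\<^sup>+y. F y \<partial>lborel)"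
      by (rule nn_integral_add) measurable
    also have "(\<integral>\<^sup>+y. ennreal (l + 2) * indicator (ball x r) y + ennreal \<bar>w y\<bar> * indicator (ball x r) y \<partial>lborel)
      = (\<integral>\<^sup>+y. ennreal (l + 2) * indicator (ball x r) y \<partial>lborel) + (\<integral>\<^sup>+y. ennreal \<bar>w y\<bar> * indicator (ball x r) y \<partial>lborel)"
      by (rule nn_integral_add) measurable
    finally show ?thesis by (simp only: F_def)
  qed
  also have "\<dots> \<le> ennreal (l + 2) * emeasure lborel (ball x r)
     + (\<integral>\<^sup>+y\<in>ball x r. ennreal \<bar>w y\<bar> \<partial>lborel) + ennreal (2 * r + 1) * (\<integral>\<^sup>+y\<in>ball x r. ennreal (norm (D y)) \<partial>lborel)"
    by (intro add_mono p) (simp_all add: nn_integral_cmult_indicator)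
  finally show ?thesis .
qed

lemma boundary_value_bound:
  fixes w :: "'a::euclidean_space \<Rightarrow> real" and D :: "'a \<Rightarrow> 'a"
  assumes w: "\<And>x. (w has_derivative (\<lambda>h. D x \<bullet> h)) (at x)" and D: "continuous_on UNIV D"
    and r: "0 < r" and l: "0 \<le> l" and sph: "\<And>y. norm (y - x) = r \<Longrightarrow> \<bar>w y - c\<bar> \<le> l"
  shows "ennreal \<bar>c\<bar> * emeasure lborel (ball x r) \<le> ennreal (l + 2) * emeasure lborel (ball x r)
     + (\<integral>\<^sup>+y\<in>ball x r. ennreal \<bar>w y\<bar> \<partial>lborel) + ennreal (2 * r + 1) * (\<integral>\<^sup>+y\<in>ball x r. ennreal (norm (D y)) \<partial>lborel)"
proof (cases "0 \<le> c")
  case True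
  have "c - l \<le> w y" if "norm (y - x) = r" for y using sph[OF that] by linarith
  from boundary_value_lower_bound[OF w D r l, of x c, OF this] True show ?thesis by simp
next
  case False
  have w': "((\<lambda>y. - w y) has_derivative (\<lambda>h. - D y \<bullet> h)) (at y)" for y
    using has_derivative_minus[OF w[of y]] by simp
  have D': "continuous_on UNIV (\<lambda>y. - D y)" by (intro continuous_intros D)
  have "- c - l \<le> - w y" if "norm (y - x) = r" for y using sph[OF that] by linarith
  from boundary_value_lower_bound[OF w' D' r l, of x "- c", OF this] False show ?thesis by simp
qed

section \<open>Transfer of oscillation from spheres to balls\<close>

text \<open>The image under \<open>f\<close> of Lebesgue measure on \<open>B\<close> is a finite
  measure and has at most countably many atoms, while the interval is uncountable. Levels of this
  kind make the derivatives of the smoothed truncations converge almost everywhere.\<close>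

lemma ex_null_level_set:
  fixes f :: "'a::euclidean_space \<Rightarrow> real" and a b :: real
  assumes [measurable]: "f \<in> borel_measurable borel" "B \<in> sets borel"
    and fin: "emeasure lborel B < \<infinity>" and ab: "a < b"
  obtains m where "a < m" "m < b" "AE y in lborel. y \<in> B \<longrightarrow> f y \<noteq> m"
proof -
  define N where "N = distr (density lborel (indicator B)) borel f"
  have N: "emeasure N X = emeasure lborel (B \<inter> f -` X)" if [measurable]: "X \<in> sets borel" for X
  proof -
    have [measurable]: "f -` X \<in> sets borel" using measurable_sets[of f borel borel X] by simp
    have "emeasure N X = emeasure (density lborel (indicator B)) (f -` X)"
      unfolding N_def by (subst emeasure_distr) auto
    also have "\<dots> = (\<integral>\<^sup>+y. indicator B y * indicator (f -` X) y \<partial>lborel)"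
      by (rule emeasure_density) auto
    also have "\<dots> = (\<integral>\<^sup>+y. indicator (B \<inter> f -` X) y \<partial>lborel)"
      by (intro nn_integral_cong) (auto simp: indicator_def)
    also have "\<dots> = emeasure lborel (B \<inter> f -` X)" by (rule nn_integral_indicator) measurable
    finally show ?thesis .
  qed
  have "emeasure N (space N) \<noteq> \<infinity>"
    using N[of UNIV] fin by (simp add: N_def)
  then interpret N: finite_measure N by (rule finite_measureI)
  have "countable {m. measure N {m} \<noteq> 0}" by (rule N.countable_support)
  then have "\<not> {a<..<b} \<subseteq> {m. measure N {m} \<noteq> 0}"
    using uncountable_open_interval[of a b] ab countable_subset by blast
  then obtain m where m: "a < m" "m < b" "measure N {m} = 0" by auto
  then have "emeasure lborel (B \<inter> f -` {m}) = 0"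
    using N[of "{m}"] N.emeasure_eq_measure[of "{m}"] by simp
  then have "AE y in lborel. y \<notin> B \<inter> f -` {m}"
  proof -
    have [measurable]: "f -` {m} \<in> sets borel" using measurable_sets[of f borel borel "{m}"] by simp
    have "B \<inter> f -` {m} \<in> null_sets lborel"
      using \<open>emeasure lborel (B \<inter> f -` {m}) = 0\<close> by (intro null_setsI) auto
    then show ?thesis by (rule AE_not_in)
  qed
  then have "AE y in lborel. y \<in> B \<longrightarrow> f y \<noteq> m" by eventually_elim auto
  then show thesis using that m by blast
qed

lemma clamp_excess_lipschitz:
  fixes a b m M :: real
  assumes "m \<le> M"
  shows "\<bar>(max (a - M) 0 - max (m - a) 0) - (max (b - M) 0 - max (m - b) 0)\<bar> \<le> \<bar>a - b\<bar>"
  using assms by (auto simp: max_def abs_if)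

text \<open>The part of \<open>u\<close> exceeding \<open>[m, M]\<close> is the limit of the
  smoothed excesses of \<open>w k\<close>. Since the boundary values of \<open>w k\<close> lie
  strictly between \<open>m\<close> and \<open>M\<close>, these excesses vanish near the sphere, so
  the limit belongs to \<open>sobolev_11_0\<close> and weak monotonicity gives
  \<open>m \<le> u \<le> M\<close> in the ball.\<close>

lemma weakly_monotone_ball_bound_aux:
  fixes u :: "real ^ 'n \<Rightarrow> real"
  assumes wm: "weakly_monotone \<Omega> u" and um: "u \<in> borel_measurable (lebesgue_on \<Omega>)"
    and \<Omega>: "open \<Omega>" and r: "0 < r" and sub: "cball x r \<subseteq> \<Omega>"
    and uB: "integrable lborel uB" and gB: "integrable lborel gB"
    and uAE: "AE y in lborel. y \<in> ball x r \<longrightarrow> u y = uB y"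
    and w: "\<And>k y. (w k has_derivative (\<lambda>h. D k y \<bullet> h)) (at y)" and D: "\<And>k. continuous_on UNIV (D k)"
    and lim1: "(\<lambda>k. \<integral>\<^sup>+y\<in>ball x r. ennreal \<bar>uB y - w k y\<bar> \<partial>lborel) \<longlonglongrightarrow> 0"
    and lim2: "(\<lambda>k. \<integral>\<^sup>+y\<in>ball x r. ennreal (norm (gB y - D k y)) \<partial>lborel) \<longlonglongrightarrow> 0"
    and limAE: "AE y in lborel. y \<in> ball x r \<longrightarrow> (\<lambda>k. w k y) \<longlonglongrightarrow> uB y"
    and sph: "\<And>k y. norm (y - x) = r \<Longrightarrow> m < w k y \<and> w k y < M"
    and mM: "m \<le> M" and null: "AE y in lborel. y \<in> ball x r \<longrightarrow> uB y \<noteq> m" "AE y in lborel. y \<in> ball x r \<longrightarrow> uB y \<noteq> M"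
  shows "AE y in lborel. y \<in> ball x r \<longrightarrow> m \<le> u y \<and> u y \<le> M"
proof -
  let ?U = "ball x r"
  have in_ball: "y \<in> ?U \<longleftrightarrow> norm (y - x) < r" for y by (simp add: dist_norm norm_minus_commute)
  have [measurable]: "?U \<in> sets borel" by simp
  have [measurable]: "uB \<in> borel_measurable borel" "gB \<in> borel_measurable borel" using uB gB by auto
  have wc: "continuous_on UNIV (w k)" for k
    by (rule has_derivative_continuous_on[of UNIV "w k" "\<lambda>x h. D k x \<bullet> h"]) (use w in auto)
  have [measurable]: "w k \<in> borel_measurable borel" "D k \<in> borel_measurable borel" for k
    using borel_measurable_continuous_onI[OF wc] borel_measurable_continuous_onI[OF D] by auto
  define V where "V = measure lborel ?U"
  have V: "emeasure lborel ?U = ennreal V"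
    unfolding V_def by (rule emeasure_eq_ennreal_measure) (use emeasure_bounded_finite[of ?U] in auto)
  define \<delta> where "\<delta> k = 1 / real (Suc k)" for k
  have \<delta>: "0 < \<delta> k" for k by (simp add: \<delta>_def)
  have \<delta>lim: "\<delta> \<longlonglongrightarrow> 0" unfolding \<delta>_def[abs_def] by (rule LIMSEQ_Suc[OF lim_1_over_n])
  define T where "T k s = smooth_pos (\<delta> k) (s - M) - smooth_pos (\<delta> k) (m - s)" for k s
  define T' where "T' k s = smooth_pos' (\<delta> k) (s - M) + smooth_pos' (\<delta> k) (m - s)" for k s
  have T: "(T k has_real_derivative T' k s) (at s)" for k s
  proof -
    have 1: "((\<lambda>s. smooth_pos (\<delta> k) (s - M)) has_real_derivative smooth_pos' (\<delta> k) (s - M) * 1) (at s)"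
      by (rule DERIV_chain2[OF smooth_pos_has_derivative[OF \<delta>]]) (auto intro!: derivative_eq_intros)
    have 2: "((\<lambda>s. smooth_pos (\<delta> k) (m - s)) has_real_derivative smooth_pos' (\<delta> k) (m - s) * (- 1)) (at s)"
      by (rule DERIV_chain2[OF smooth_pos_has_derivative[OF \<delta>]]) (auto intro!: derivative_eq_intros)
    from DERIV_diff[OF 1 2] show ?thesis by (simp add: T_def[abs_def] T'_def)
  qed
  have T'c: "continuous_on UNIV (T' k)" for k
    unfolding T'_def[abs_def]
    by (intro continuous_intros continuous_on_compose2[OF continuous_on_smooth_pos'[OF \<delta>, of UNIV]]) auto
  have T'm [measurable]: "T' k \<in> borel_measurable borel" for k using T'c by (rule borel_measurable_continuous_onI)
  have T'b: "\<bar>T' k s\<bar> \<le> 2" for k s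
    using smooth_pos'_bounds[OF \<delta>, of k "s - M"] smooth_pos'_bounds[OF \<delta>, of k "m - s"] by (simp add: T'_def)
  \<comment> \<open>The truncation of \<open>w k\<close> is only continuously differentiable. It is
    replaced by a test function with uniform error \<open>\<delta> k\<close> in value and gradient;
    on a ball of finite volume this error also vanishes in the mean.\<close>
  have "\<exists>\<phi>. test_function ?U \<phi> \<and>
     (\<forall>y. \<bar>\<phi> y - (if norm (y - x) < r then T k (w k y) else 0)\<bar> \<le> \<delta> k) \<and>
     (\<forall>y. norm (grad \<phi> y - (if norm (y - x) < r then T' k (w k y) *\<^sub>R D k y else 0)) \<le> \<delta> k)" for k
  proof -
    have "T k s = 0" if "s \<in> {m<..<M}" for s using that by (simp add: T_def smooth_pos_eq_0)
    then obtain \<rho> where \<rho>: "\<rho> < r" "C1_support (norm x + r) (\<lambda>y. if norm (y - x) < r then T k (w k y) else 0)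
       (\<lambda>y. if norm (y - x) < r then T' k (w k y) *\<^sub>R D k y else 0)"
      "\<And>y. \<rho> < norm (y - x) \<Longrightarrow> (if norm (y - x) < r then T k (w k y) else 0) = 0"
      using C1_support_truncation[OF w[of k] D T[of k] T'c, of "{m<..<M}" x r] sph r by auto
    show ?thesis by (rule C1_support_approx_test_function[OF \<rho>(2) \<rho>(3) \<rho>(1) \<delta>])
  qed
  then have "\<forall>k. \<exists>\<phi>. test_function ?U \<phi> \<and>
     (\<forall>y. \<bar>\<phi> y - (if norm (y - x) < r then T k (w k y) else 0)\<bar> \<le> \<delta> k) \<and>
     (\<forall>y. norm (grad \<phi> y - (if norm (y - x) < r then T' k (w k y) *\<^sub>R D k y else 0)) \<le> \<delta> k)" by (rule allI)
  from choice[OF this] obtain \<phi> where \<phi>0: "\<forall>k. test_function ?U (\<phi> k) \<and>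
     (\<forall>y. \<bar>\<phi> k y - (if norm (y - x) < r then T k (w k y) else 0)\<bar> \<le> \<delta> k) \<and>
     (\<forall>y. norm (grad (\<phi> k) y - (if norm (y - x) < r then T' k (w k y) *\<^sub>R D k y else 0)) \<le> \<delta> k)" ..
  have \<phi>: "\<And>k. test_function ?U (\<phi> k)"
     "\<And>k y. norm (y - x) < r \<Longrightarrow> \<bar>\<phi> k y - T k (w k y)\<bar> \<le> \<delta> k"
     "\<And>k y. norm (y - x) < r \<Longrightarrow> norm (grad (\<phi> k) y - T' k (w k y) *\<^sub>R D k y) \<le> \<delta> k"
  proof -
    show "test_function ?U (\<phi> k)" for k using \<phi>0 by blast
    show "\<bar>\<phi> k y - T k (w k y)\<bar> \<le> \<delta> k" if "norm (y - x) < r" for k y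
      using \<phi>0[rule_format, of k] that by (metis (full_types))
    show "norm (grad (\<phi> k) y - T' k (w k y) *\<^sub>R D k y) \<le> \<delta> k" if "norm (y - x) < r" for k y
      using \<phi>0[rule_format, of k] that by (metis (full_types))
  qed
  define T0 where "T0 s = max (s - M) 0 - max (m - s) 0" for s
  define vB where "vB y = indicator ?U y * T0 (uB y)" for y
  \<comment> \<open>The expected gradient of the excess, by the chain rule: its derivative is 1
    outside \<open>[m, M]\<close> and 0 inside.\<close>
  define hB where "hB y = (if y \<in> ?U \<and> (uB y < m \<or> M < uB y) then gB y else 0)" for y
  have [measurable]: "T0 \<in> borel_measurable borel" unfolding T0_def[abs_def] by measurable
  have vBm [measurable]: "vB \<in> borel_measurable borel" unfolding vB_def[abs_def] by measurable
  have hBm [measurable]: "hB \<in> borel_measurable borel" unfolding hB_def[abs_def] by measurable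
  have vBi: "integrable lborel vB"
  proof (rule Bochner_Integration.integrable_bound)
    show "integrable lborel (\<lambda>y. \<bar>uB y\<bar> + (\<bar>m\<bar> + \<bar>M\<bar>) * indicator ?U y)"
      using uB by (intro Bochner_Integration.integrable_add integrable_abs integrable_mult_right integrable_real_indicator)
        (auto simp: V)
    show "AE y in lborel. norm (vB y) \<le> norm (\<bar>uB y\<bar> + (\<bar>m\<bar> + \<bar>M\<bar>) * indicator ?U y)"
      by (rule AE_I2) (auto simp: vB_def T0_def indicator_def max_def abs_if)
  qed measurable
  have hBi: "integrable lborel hB"
    by (rule Bochner_Integration.integrable_bound[OF gB]) (auto simp: hB_def intro!: AE_I2)
  have wmeas: "u \<in> borel_measurable (lebesgue_on ?U)"
    by (rule measurable_restrict_mono[OF um]) (use sub in auto)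
  have wlim1: "(\<lambda>k. \<integral>\<^sup>+y\<in>?U. ennreal \<bar>vB y - \<phi> k y\<bar> \<partial>lborel) \<longlonglongrightarrow> 0"
  proof (rule tendsto_sandwich[OF _ _ tendsto_const])
    show "\<forall>\<^sub>F k in sequentially. (\<integral>\<^sup>+y\<in>?U. ennreal \<bar>vB y - \<phi> k y\<bar> \<partial>lborel)
       \<le> (\<integral>\<^sup>+y\<in>?U. ennreal \<bar>uB y - w k y\<bar> \<partial>lborel) + ennreal (3 * \<delta> k) * ennreal V"
    proof (rule always_eventually, rule allI)
      fix k
      have "(\<integral>\<^sup>+y\<in>?U. ennreal \<bar>vB y - \<phi> k y\<bar> \<partial>lborel)
         \<le> (\<integral>\<^sup>+y. ennreal \<bar>uB y - w k y\<bar> * indicator ?U y + ennreal (3 * \<delta> k) * indicator ?U y \<partial>lborel)"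
      proof (rule nn_integral_mono)
        fix y
        show "ennreal \<bar>vB y - \<phi> k y\<bar> * indicator ?U y \<le> ennreal \<bar>uB y - w k y\<bar> * indicator ?U y + ennreal (3 * \<delta> k) * indicator ?U y"
        proof (cases "y \<in> ?U")
          case True
          have "\<bar>T0 (uB y) - T0 (w k y)\<bar> \<le> \<bar>uB y - w k y\<bar>"
            unfolding T0_def by (rule clamp_excess_lipschitz[OF mM])
          moreover have "\<bar>\<phi> k y - T k (w k y)\<bar> \<le> \<delta> k" using \<phi>(2) True by (simp add: in_ball del: mem_ball)
          moreover have "\<bar>T k (w k y) - T0 (w k y)\<bar> \<le> 2 * \<delta> k"
            using smooth_pos_near[OF \<delta>, of k "w k y - M"] smooth_pos_near[OF \<delta>, of k "m - w k y"]
            unfolding T_def T0_def by linarith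
          ultimately have "\<bar>T0 (uB y) - \<phi> k y\<bar> \<le> \<bar>uB y - w k y\<bar> + 3 * \<delta> k" by linarith
          then have "ennreal \<bar>T0 (uB y) - \<phi> k y\<bar> \<le> ennreal \<bar>uB y - w k y\<bar> + ennreal (3 * \<delta> k)"
            using \<delta>[of k] by (simp add: ennreal_plus[symmetric] ennreal_leI del: ennreal_plus)
          then show ?thesis using True by (simp add: vB_def)
        qed simp
      qed
      also have "\<dots> = (\<integral>\<^sup>+y\<in>?U. ennreal \<bar>uB y - w k y\<bar> \<partial>lborel) + (\<integral>\<^sup>+y. ennreal (3 * \<delta> k) * indicator ?U y \<partial>lborel)"
        by (rule nn_integral_add) measurable
      also have "(\<integral>\<^sup>+y. ennreal (3 * \<delta> k) * indicator ?U y \<partial>lborel) = ennreal (3 * \<delta> k) * ennreal V"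
        by (simp add: nn_integral_cmult_indicator V)
      finally show "(\<integral>\<^sup>+y\<in>?U. ennreal \<bar>vB y - \<phi> k y\<bar> \<partial>lborel)
       \<le> (\<integral>\<^sup>+y\<in>?U. ennreal \<bar>uB y - w k y\<bar> \<partial>lborel) + ennreal (3 * \<delta> k) * ennreal V" .
    qed
    have "(\<lambda>k. ennreal (3 * \<delta> k * V)) \<longlonglongrightarrow> ennreal (3 * 0 * V)"
      by (intro tendsto_ennrealI tendsto_intros \<delta>lim)
    then have "(\<lambda>k. ennreal (3 * \<delta> k) * ennreal V) \<longlonglongrightarrow> 0"
      using \<delta> by (simp add: ennreal_mult'' V_def)
    from tendsto_add[OF lim1 this]
    show "(\<lambda>k. (\<integral>\<^sup>+y\<in>?U. ennreal \<bar>uB y - w k y\<bar> \<partial>lborel) + ennreal (3 * \<delta> k) * ennreal V) \<longlonglongrightarrow> 0" by simp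
  qed auto
  define \<xi> where "\<xi> y = (if uB y < m \<or> M < uB y then 1 else 0 :: real)" for y
  have [measurable]: "\<xi> \<in> borel_measurable borel" unfolding \<xi>_def[abs_def] by measurable
  \<comment> \<open>The factor \<open>T' k (w k y)\<close> tends to the indicator
    \<open>\<xi>\<close> of \<open>{uB < m} \<union> {uB > M}\<close> almost everywhere in the ball,
    because the levels \<open>m\<close> and \<open>M\<close> are attained only on null sets. It
    stays bounded, and \<open>gB\<close> is integrable, so dominated convergence applies.\<close>
  have dom: "(\<lambda>k. \<integral>\<^sup>+y\<in>?U. ennreal (\<bar>\<xi> y - T' k (w k y)\<bar> * norm (gB y)) \<partial>lborel) \<longlonglongrightarrow> (\<integral>\<^sup>+y. 0 \<partial>(lborel :: (real ^ 'n) measure))"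
  proof (rule nn_integral_dominated_convergence[where w = "\<lambda>y. ennreal (3 * norm (gB y))"])
    show "AE y in lborel. ennreal (\<bar>\<xi> y - T' k (w k y)\<bar> * norm (gB y)) * indicator ?U y \<le> ennreal (3 * norm (gB y))" for k
    proof (rule AE_I2)
      fix y
      have "\<bar>\<xi> y - T' k (w k y)\<bar> \<le> 3" using T'b[of k "w k y"] by (auto simp: \<xi>_def)
      then show "ennreal (\<bar>\<xi> y - T' k (w k y)\<bar> * norm (gB y)) * indicator ?U y \<le> ennreal (3 * norm (gB y))"
        by (auto simp: indicator_def intro!: ennreal_leI mult_right_mono)
    qed
    show "(\<integral>\<^sup>+y. ennreal (3 * norm (gB y)) \<partial>lborel) < \<infinity>"
      using gB by (simp add: ennreal_mult' nn_integral_cmult integrable_iff_bounded ennreal_mult_less_top)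
    show "AE y in lborel. (\<lambda>k. ennreal (\<bar>\<xi> y - T' k (w k y)\<bar> * norm (gB y)) * indicator ?U y) \<longlonglongrightarrow> 0"
      using limAE null
    proof eventually_elim
      case (elim y)
      show ?case
      proof (cases "y \<in> ?U")
        case True
        then have l: "(\<lambda>k. w k y) \<longlonglongrightarrow> uB y" and ne: "uB y \<noteq> m" "uB y \<noteq> M" using elim by auto
        have "(\<lambda>k. T' k (w k y)) \<longlonglongrightarrow> (if 0 < uB y - M then 1 else 0) + (if 0 < m - uB y then 1 else 0)"
          unfolding T'_def using ne by (intro tendsto_add smooth_pos'_tendsto \<delta> \<delta>lim tendsto_diff l tendsto_const) auto
        also have "(if 0 < uB y - M then 1 else 0) + (if 0 < m - uB y then 1 else 0) = \<xi> y"
          using mM by (auto simp: \<xi>_def)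
        finally have "(\<lambda>k. \<bar>\<xi> y - T' k (w k y)\<bar> * norm (gB y)) \<longlonglongrightarrow> \<bar>\<xi> y - \<xi> y\<bar> * norm (gB y)"
          by (intro tendsto_intros)
        then have "(\<lambda>k. ennreal (\<bar>\<xi> y - T' k (w k y)\<bar> * norm (gB y))) \<longlonglongrightarrow> ennreal 0"
          by (intro tendsto_ennrealI) simp
        then show ?thesis using True by simp
      qed simp
    qed
  qed measurable
  have wlim2: "(\<lambda>k. \<integral>\<^sup>+y\<in>?U. ennreal (norm (hB y - grad (\<phi> k) y)) \<partial>lborel) \<longlonglongrightarrow> 0"
  proof (rule tendsto_sandwich[OF _ _ tendsto_const])
    show "\<forall>\<^sub>F k in sequentially. (\<integral>\<^sup>+y\<in>?U. ennreal (norm (hB y - grad (\<phi> k) y)) \<partial>lborel)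
       \<le> (\<integral>\<^sup>+y\<in>?U. ennreal (\<bar>\<xi> y - T' k (w k y)\<bar> * norm (gB y)) \<partial>lborel)
          + 2 * (\<integral>\<^sup>+y\<in>?U. ennreal (norm (gB y - D k y)) \<partial>lborel) + ennreal (\<delta> k) * ennreal V"
    proof (rule always_eventually, rule allI)
      fix k
      have "(\<integral>\<^sup>+y\<in>?U. ennreal (norm (hB y - grad (\<phi> k) y)) \<partial>lborel)
         \<le> (\<integral>\<^sup>+y. (ennreal (\<bar>\<xi> y - T' k (w k y)\<bar> * norm (gB y)) * indicator ?U y
             + 2 * (ennreal (norm (gB y - D k y)) * indicator ?U y)) + ennreal (\<delta> k) * indicator ?U y \<partial>lborel)"
      proof (rule nn_integral_mono)
        fix y
        show "ennreal (norm (hB y - grad (\<phi> k) y)) * indicator ?U y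
          \<le> (ennreal (\<bar>\<xi> y - T' k (w k y)\<bar> * norm (gB y)) * indicator ?U y
             + 2 * (ennreal (norm (gB y - D k y)) * indicator ?U y)) + ennreal (\<delta> k) * indicator ?U y"
        proof (cases "y \<in> ?U")
          case True
          have h: "hB y = \<xi> y *\<^sub>R gB y" using True by (simp add: hB_def \<xi>_def)
          have g: "norm (T' k (w k y) *\<^sub>R D k y - grad (\<phi> k) y) \<le> \<delta> k"
            using \<phi>(3)[of y k] True by (simp add: in_ball norm_minus_commute del: mem_ball)
          \<comment> \<open>Three errors: convergence of the chain rule factor, convergence of the
            gradients \<open>D k\<close> to \<open>gB\<close>, and the replacement of the truncation
            by a test function.\<close>
          have "hB y - grad (\<phi> k) y = (\<xi> y - T' k (w k y)) *\<^sub>R gB y + T' k (w k y) *\<^sub>R (gB y - D k y)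
              + (T' k (w k y) *\<^sub>R D k y - grad (\<phi> k) y)"
            by (simp add: h algebra_simps)
          also have "norm \<dots> \<le> norm ((\<xi> y - T' k (w k y)) *\<^sub>R gB y) + norm (T' k (w k y) *\<^sub>R (gB y - D k y))
              + norm (T' k (w k y) *\<^sub>R D k y - grad (\<phi> k) y)"
            by (intro norm_triangle_le add_right_mono norm_triangle_ineq)
          also have "\<dots> \<le> \<bar>\<xi> y - T' k (w k y)\<bar> * norm (gB y) + 2 * norm (gB y - D k y) + \<delta> k"
            using T'b[of k "w k y"] by (intro add_mono g) (auto intro!: mult_right_mono)
          finally have "ennreal (norm (hB y - grad (\<phi> k) y))
             \<le> ennreal (\<bar>\<xi> y - T' k (w k y)\<bar> * norm (gB y) + 2 * norm (gB y - D k y) + \<delta> k)" by (rule ennreal_leI)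
          also have "\<dots> = ennreal (\<bar>\<xi> y - T' k (w k y)\<bar> * norm (gB y)) + 2 * ennreal (norm (gB y - D k y)) + ennreal (\<delta> k)"
            using \<delta>[of k] by (simp add: ennreal_plus ennreal_mult')
          finally show ?thesis using True by simp
        qed simp
      qed
      also have "\<dots> = (\<integral>\<^sup>+y. ennreal (\<bar>\<xi> y - T' k (w k y)\<bar> * norm (gB y)) * indicator ?U y
             + 2 * (ennreal (norm (gB y - D k y)) * indicator ?U y) \<partial>lborel) + (\<integral>\<^sup>+y. ennreal (\<delta> k) * indicator ?U y \<partial>lborel)"
        by (rule nn_integral_add) measurable
      also have "(\<integral>\<^sup>+y. ennreal (\<bar>\<xi> y - T' k (w k y)\<bar> * norm (gB y)) * indicator ?U y
             + 2 * (ennreal (norm (gB y - D k y)) * indicator ?U y) \<partial>lborel)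
         = (\<integral>\<^sup>+y\<in>?U. ennreal (\<bar>\<xi> y - T' k (w k y)\<bar> * norm (gB y)) \<partial>lborel)
           + (\<integral>\<^sup>+y. 2 * (ennreal (norm (gB y - D k y)) * indicator ?U y) \<partial>lborel)"
        by (rule nn_integral_add) measurable
      also have "(\<integral>\<^sup>+y. 2 * (ennreal (norm (gB y - D k y)) * indicator ?U y) \<partial>lborel)
         = 2 * (\<integral>\<^sup>+y\<in>?U. ennreal (norm (gB y - D k y)) \<partial>lborel)"
        by (rule nn_integral_cmult) measurable
      also have "(\<integral>\<^sup>+y. ennreal (\<delta> k) * indicator ?U y \<partial>lborel) = ennreal (\<delta> k) * ennreal V"
        by (simp add: nn_integral_cmult_indicator V)
      finally show "(\<integral>\<^sup>+y\<in>?U. ennreal (norm (hB y - grad (\<phi> k) y)) \<partial>lborel)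
       \<le> (\<integral>\<^sup>+y\<in>?U. ennreal (\<bar>\<xi> y - T' k (w k y)\<bar> * norm (gB y)) \<partial>lborel)
          + 2 * (\<integral>\<^sup>+y\<in>?U. ennreal (norm (gB y - D k y)) \<partial>lborel) + ennreal (\<delta> k) * ennreal V" .
    qed
    have "(\<lambda>k. ennreal (\<delta> k * V)) \<longlonglongrightarrow> ennreal (0 * V)"
      by (intro tendsto_ennrealI tendsto_intros \<delta>lim)
    then have 1: "(\<lambda>k. ennreal (\<delta> k) * ennreal V) \<longlonglongrightarrow> 0"
      using \<delta> by (simp add: ennreal_mult'' V_def)
    have 2: "(\<lambda>k. 2 * (\<integral>\<^sup>+y\<in>?U. ennreal (norm (gB y - D k y)) \<partial>lborel)) \<longlonglongrightarrow> 0"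
      using ennreal_tendsto_cmult[OF _ lim2, of 2] by simp
    from tendsto_add[OF tendsto_add[OF dom 2] 1]
    show "(\<lambda>k. (\<integral>\<^sup>+y\<in>?U. ennreal (\<bar>\<xi> y - T' k (w k y)\<bar> * norm (gB y)) \<partial>lborel)
          + 2 * (\<integral>\<^sup>+y\<in>?U. ennreal (norm (gB y - D k y)) \<partial>lborel) + ennreal (\<delta> k) * ennreal V) \<longlonglongrightarrow> 0" by simp
  qed auto
  have "(\<lambda>y. max (u y - M) 0 - max (m - u y) 0) \<in> sobolev_11_0 ?U"
  proof (rule sobolev_11_0I[OF _ \<phi>(1) vBi hBi _ _ wlim1 wlim2])
    show "(\<lambda>y. max (u y - M) 0 - max (m - u y) 0) \<in> borel_measurable (lebesgue_on ?U)"
      using wmeas by measurable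
    show "AE y in lborel. y \<in> ?U \<longrightarrow> max (u y - M) 0 - max (m - u y) 0 = vB y"
      using uAE by eventually_elim (auto simp: vB_def T0_def)
  qed simp
  moreover have "compactly_inside ?U \<Omega>"
    using sub r by (simp add: compactly_inside_def)
  moreover have "\<forall>U m M. open U \<and> compactly_inside U \<Omega> \<and> m \<le> M \<and>
        (\<lambda>x. max (u x - M) 0 - max (m - u x) 0) \<in> sobolev_11_0 U \<longrightarrow>
        (AE x in lebesgue_on U. m \<le> u x \<and> u x \<le> M)"
    using wm unfolding weakly_monotone_def by (rule conjunct2)
  ultimately have "AE y in lebesgue_on ?U. m \<le> u y \<and> u y \<le> M"
    using mM open_ball by blast
  then have "AE y in lebesgue. y \<in> ?U \<longrightarrow> m \<le> u y \<and> u y \<le> M"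
    by (subst (asm) AE_restrict_space_iff) auto
  then show ?thesis by (simp add: AE_completion_iff)
qed

text \<open>On the sphere \<open>w k\<close> stays within \<open>l\<close> of its value
  \<open>c k\<close> at one point. These values are eventually bounded by
  \<open>boundary_value_bound\<close>, so along a subsequence they converge to some
  \<open>c0\<close>. Levels slightly outside \<open>[c0 - l, c0 + l]\<close> then strictly enclose
  the boundary values of a tail of the subsequence, to which
  \<open>weakly_monotone_ball_bound_aux\<close> applies.\<close>

lemma weakly_monotone_ball_bound:
  fixes u :: "real ^ 'n \<Rightarrow> real"
  assumes wm: "weakly_monotone \<Omega> u" and um: "u \<in> borel_measurable (lebesgue_on \<Omega>)"
    and \<Omega>: "open \<Omega>" and r: "0 < r" and sub: "cball x r \<subseteq> \<Omega>"
    and uB: "integrable lborel uB" and gB: "integrable lborel gB"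
    and uAE: "AE y in lborel. y \<in> ball x r \<longrightarrow> u y = uB y"
    and w: "\<And>k y. (w k has_derivative (\<lambda>h. D k y \<bullet> h)) (at y)" and D: "\<And>k. continuous_on UNIV (D k)"
    and lim1: "(\<lambda>k. \<integral>\<^sup>+y\<in>ball x r. ennreal \<bar>uB y - w k y\<bar> \<partial>lborel) \<longlonglongrightarrow> 0"
    and lim2: "(\<lambda>k. \<integral>\<^sup>+y\<in>ball x r. ennreal (norm (gB y - D k y)) \<partial>lborel) \<longlonglongrightarrow> 0"
    and limAE: "AE y in lborel. y \<in> ball x r \<longrightarrow> (\<lambda>k. w k y) \<longlonglongrightarrow> uB y"
    and sph: "\<And>k y z. norm (y - x) = r \<Longrightarrow> norm (z - x) = r \<Longrightarrow> \<bar>w k y - w k z\<bar> \<le> l" and l: "0 \<le> l" and \<eta>: "0 < \<eta>"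
  shows "\<exists>m M. M - m \<le> 2 * l + \<eta> \<and> (AE y in lborel. y \<in> ball x r \<longrightarrow> m \<le> u y \<and> u y \<le> M)"
proof -
  let ?U = "ball x r"
  have [measurable]: "?U \<in> sets borel" by simp
  have [measurable]: "uB \<in> borel_measurable borel" "gB \<in> borel_measurable borel" using uB gB by auto
  have wc: "continuous_on UNIV (w k)" for k
    by (rule has_derivative_continuous_on[of UNIV "w k" "\<lambda>x h. D k x \<bullet> h"]) (use w in auto)
  have [measurable]: "w k \<in> borel_measurable borel" "D k \<in> borel_measurable borel" for k
    using borel_measurable_continuous_onI[OF wc] borel_measurable_continuous_onI[OF D] by auto
  define V where "V = measure lborel ?U"
  have V: "emeasure lborel ?U = ennreal V"
    unfolding V_def by (rule emeasure_eq_ennreal_measure) (use emeasure_bounded_finite[of ?U] in auto)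
  have V0: "0 < V" using r content_ball_pos[of r x] by (simp add: V_def)
  obtain e :: "real ^ 'n" where "e \<in> Basis" using nonempty_Basis by blast
  then have e: "norm e = 1" by simp
  define z0 where "z0 = x + r *\<^sub>R e"
  have z0: "norm (z0 - x) = r" using e r by (simp add: z0_def)
  define c where "c k = w k z0" for k
  have cs: "\<bar>w k y - c k\<bar> \<le> l" if "norm (y - x) = r" for k y
    using sph[OF that z0] by (simp add: c_def)
  have uL: "(\<integral>\<^sup>+y. ennreal \<bar>uB y\<bar> \<partial>lborel) < \<infinity>" using uB by (simp add: integrable_iff_bounded)
  have gL: "(\<integral>\<^sup>+y. ennreal (norm (gB y)) \<partial>lborel) < \<infinity>" using gB by (simp add: integrable_iff_bounded)
  \<comment> \<open>The bound of \<open>boundary_value_bound\<close> with the integrals of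
    \<open>w k\<close> and \<open>D k\<close> replaced by those of \<open>uB\<close> and
    \<open>gB\<close>; each summand 1 allows for the error in the mean, which is eventually below
    1.\<close>
  define Q where "Q = ennreal (l + 2) * ennreal V + ((\<integral>\<^sup>+y. ennreal \<bar>uB y\<bar> \<partial>lborel) + 1)
      + ennreal (2 * r + 1) * ((\<integral>\<^sup>+y. ennreal (norm (gB y)) \<partial>lborel) + 1)"
  have Q: "Q < \<infinity>" using uL gL by (simp add: Q_def ennreal_mult_less_top)
  have ev: "eventually (\<lambda>k. ennreal \<bar>c k\<bar> * ennreal V \<le> Q) sequentially"
    using order_tendstoD(2)[OF lim1, of 1, OF zero_less_one] order_tendstoD(2)[OF lim2, of 1, OF zero_less_one]
  proof eventually_elim
    case (elim k)
    have "(\<integral>\<^sup>+y\<in>?U. ennreal \<bar>w k y\<bar> \<partial>lborel) \<le> (\<integral>\<^sup>+y. ennreal \<bar>uB y\<bar> + ennreal \<bar>uB y - w k y\<bar> * indicator ?U y \<partial>lborel)"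
    proof (rule nn_integral_mono)
      fix y
      have "ennreal \<bar>w k y\<bar> \<le> ennreal \<bar>uB y\<bar> + ennreal \<bar>uB y - w k y\<bar>"
        by (simp add: ennreal_plus[symmetric] del: ennreal_plus)
      then show "ennreal \<bar>w k y\<bar> * indicator ?U y \<le> ennreal \<bar>uB y\<bar> + ennreal \<bar>uB y - w k y\<bar> * indicator ?U y"
        by (auto simp: indicator_def)
    qed
    also have "\<dots> = (\<integral>\<^sup>+y. ennreal \<bar>uB y\<bar> \<partial>lborel) + (\<integral>\<^sup>+y\<in>?U. ennreal \<bar>uB y - w k y\<bar> \<partial>lborel)"
      by (rule nn_integral_add) measurable
    also have "\<dots> \<le> (\<integral>\<^sup>+y. ennreal \<bar>uB y\<bar> \<partial>lborel) + 1" using elim by (intro add_mono) auto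
    finally have 1: "(\<integral>\<^sup>+y\<in>?U. ennreal \<bar>w k y\<bar> \<partial>lborel) \<le> (\<integral>\<^sup>+y. ennreal \<bar>uB y\<bar> \<partial>lborel) + 1" .
    have "(\<integral>\<^sup>+y\<in>?U. ennreal (norm (D k y)) \<partial>lborel) \<le> (\<integral>\<^sup>+y. ennreal (norm (gB y)) + ennreal (norm (gB y - D k y)) * indicator ?U y \<partial>lborel)"
    proof (rule nn_integral_mono)
      fix y
      have "norm (D k y) \<le> norm (gB y) + norm (gB y - D k y)"
        using norm_triangle_ineq4[of "gB y" "gB y - D k y"] by simp
      then have "ennreal (norm (D k y)) \<le> ennreal (norm (gB y)) + ennreal (norm (gB y - D k y))"
        by (simp add: ennreal_plus[symmetric] ennreal_leI del: ennreal_plus)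
      then show "ennreal (norm (D k y)) * indicator ?U y \<le> ennreal (norm (gB y)) + ennreal (norm (gB y - D k y)) * indicator ?U y"
        by (auto simp: indicator_def)
    qed
    also have "\<dots> = (\<integral>\<^sup>+y. ennreal (norm (gB y)) \<partial>lborel) + (\<integral>\<^sup>+y\<in>?U. ennreal (norm (gB y - D k y)) \<partial>lborel)"
      by (rule nn_integral_add) measurable
    also have "\<dots> \<le> (\<integral>\<^sup>+y. ennreal (norm (gB y)) \<partial>lborel) + 1" using elim by (intro add_mono) auto
    finally have 2: "(\<integral>\<^sup>+y\<in>?U. ennreal (norm (D k y)) \<partial>lborel) \<le> (\<integral>\<^sup>+y. ennreal (norm (gB y)) \<partial>lborel) + 1" .
    have "ennreal \<bar>c k\<bar> * ennreal V \<le> ennreal (l + 2) * ennreal V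
     + (\<integral>\<^sup>+y\<in>?U. ennreal \<bar>w k y\<bar> \<partial>lborel) + ennreal (2 * r + 1) * (\<integral>\<^sup>+y\<in>?U. ennreal (norm (D k y)) \<partial>lborel)"
      unfolding V[symmetric] by (rule boundary_value_bound[OF w D r l cs])
    also have "\<dots> \<le> Q" unfolding Q_def by (intro add_mono mult_left_mono 1 2) auto
    finally show ?case .
  qed
  then obtain k0 where k0: "\<And>k. k0 \<le> k \<Longrightarrow> ennreal \<bar>c k\<bar> * ennreal V \<le> Q"
    by (auto simp: eventually_sequentially)
  have "c (k + k0) \<in> cball 0 (enn2real Q / V)" for k
  proof -
    have "ennreal (\<bar>c (k + k0)\<bar> * V) \<le> ennreal (enn2real Q)"
      using k0[of "k + k0"] Q V0 by (simp add: ennreal_mult)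
    then have "\<bar>c (k + k0)\<bar> * V \<le> enn2real Q" by (simp add: ennreal_le_iff)
    then show ?thesis using V0 by (simp add: pos_le_divide_eq)
  qed
  then obtain c0 s where s: "strict_mono s" and c0: "((\<lambda>k. c (k + k0)) \<circ> s) \<longlonglongrightarrow> c0"
    using compact_cball[of "0::real" "enn2real Q / V"] unfolding compact_def by meson
  \<comment> \<open>Each level has a margin of \<open>\<eta> / 2\<close> in which it can be chosen
    with a null level set; the two margins make up the \<open>\<eta>\<close> in the
    conclusion.\<close>
  obtain m where m: "c0 - l - \<eta> / 2 < m" "m < c0 - l" "AE y in lborel. y \<in> ?U \<longrightarrow> uB y \<noteq> m"
    using ex_null_level_set[of uB ?U "c0 - l - \<eta> / 2" "c0 - l"] \<eta> V by auto
  obtain M where M: "c0 + l < M" "M < c0 + l + \<eta> / 2" "AE y in lborel. y \<in> ?U \<longrightarrow> uB y \<noteq> M"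
    using ex_null_level_set[of uB ?U "c0 + l" "c0 + l + \<eta> / 2"] \<eta> V by auto
  have "eventually (\<lambda>k. m + l < c (s k + k0)) sequentially" "eventually (\<lambda>k. c (s k + k0) < M - l) sequentially"
    using order_tendstoD(1)[OF c0, of "m + l"] order_tendstoD(2)[OF c0, of "M - l"] m M by (simp_all add: o_def)
  then have "eventually (\<lambda>k. m + l < c (s k + k0) \<and> c (s k + k0) < M - l) sequentially"
    by eventually_elim auto
  then obtain k1 where k1: "\<And>k. k1 \<le> k \<Longrightarrow> m + l < c (s k + k0) \<and> c (s k + k0) < M - l"
    by (auto simp: eventually_sequentially)
  define t where "t k = s (k + k1) + k0" for k
  have t: "strict_mono t" using s by (auto simp: t_def strict_mono_def)
  have "AE y in lborel. y \<in> ?U \<longrightarrow> m \<le> u y \<and> u y \<le> M"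
  proof (rule weakly_monotone_ball_bound_aux[OF wm um \<Omega> r sub uB gB uAE, where w = "\<lambda>k. w (t k)" and D = "\<lambda>k. D (t k)"])
    show "(w (t k) has_derivative (\<lambda>h. D (t k) y \<bullet> h)) (at y)" for k y by (rule w)
    show "continuous_on UNIV (D (t k))" for k by (rule D)
    show "(\<lambda>k. \<integral>\<^sup>+y\<in>?U. ennreal \<bar>uB y - w (t k) y\<bar> \<partial>lborel) \<longlonglongrightarrow> 0"
      using LIMSEQ_subseq_LIMSEQ[OF lim1 t] by (simp add: o_def)
    show "(\<lambda>k. \<integral>\<^sup>+y\<in>?U. ennreal (norm (gB y - D (t k) y)) \<partial>lborel) \<longlonglongrightarrow> 0"
      using LIMSEQ_subseq_LIMSEQ[OF lim2 t] by (simp add: o_def)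
    show "AE y in lborel. y \<in> ?U \<longrightarrow> (\<lambda>k. w (t k) y) \<longlonglongrightarrow> uB y"
      using limAE
    proof eventually_elim
      case (elim y)
      then show ?case using LIMSEQ_subseq_LIMSEQ[of "\<lambda>k. w k y" "uB y" t] t by (auto simp: o_def)
    qed
    show "m < w (t k) y \<and> w (t k) y < M" if "norm (y - x) = r" for k y
      using k1[of "k + k1"] cs[OF that, of "t k"] unfolding t_def by linarith
    show "m \<le> M" using m M l by linarith
  qed (use m M in auto)
  moreover have "M - m \<le> 2 * l + \<eta>" using m M by linarith
  ultimately show ?thesis by blast
qed

text \<open>If the oscillation on the sphere stayed below \<open>L / 4\<close> for infinitely many
  \<open>k\<close>, then \<open>weakly_monotone_ball_bound\<close> along these \<open>k\<close>,
  with \<open>l = L / 4\<close> and \<open>\<eta> = L / 4\<close>, would enclose \<open>u\<close> on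
  the ball in an interval of length at most \<open>3 * L / 4\<close>, less than
  \<open>L\<close>.\<close>

lemma eventually_large_oscillation:
  fixes u :: "real ^ 'n \<Rightarrow> real"
  assumes wm: "weakly_monotone \<Omega> u" and um: "u \<in> borel_measurable (lebesgue_on \<Omega>)"
    and \<Omega>: "open \<Omega>" and r: "0 < r" and sub: "cball x r \<subseteq> \<Omega>"
    and uB: "integrable lborel uB" and gB: "integrable lborel gB"
    and uAE: "AE y in lborel. y \<in> ball x r \<longrightarrow> u y = uB y"
    and w: "\<And>k y. (w k has_derivative (\<lambda>h. D k y \<bullet> h)) (at y)" and D: "\<And>k. continuous_on UNIV (D k)"
    and lim1: "(\<lambda>k. \<integral>\<^sup>+y\<in>ball x r. ennreal \<bar>uB y - w k y\<bar> \<partial>lborel) \<longlonglongrightarrow> 0"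
    and lim2: "(\<lambda>k. \<integral>\<^sup>+y\<in>ball x r. ennreal (norm (gB y - D k y)) \<partial>lborel) \<longlonglongrightarrow> 0"
    and limAE: "AE y in lborel. y \<in> ball x r \<longrightarrow> (\<lambda>k. w k y) \<longlonglongrightarrow> uB y"
    and L: "0 < L" and bad: "\<And>m M. AE y in lborel. y \<in> ball x r \<longrightarrow> m \<le> u y \<and> u y \<le> M \<Longrightarrow> L \<le> M - m"
  shows "eventually (\<lambda>k. \<exists>y z. norm (y - x) = r \<and> norm (z - x) = r \<and> L / 4 \<le> w k y - w k z) sequentially"
proof (rule ccontr)
  let ?P = "\<lambda>k. \<exists>y z. norm (y - x) = r \<and> norm (z - x) = r \<and> L / 4 \<le> w k y - w k z"
  assume "\<not> eventually ?P sequentially"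
  then have inf: "infinite {k. \<not> ?P k}"
    by (simp add: not_eventually cofinite_eq_sequentially[symmetric] frequently_cofinite)
  define t where "t = enumerate {k. \<not> ?P k}"
  have t: "strict_mono t" unfolding t_def using inf by (rule strict_mono_enumerate)
  have nP: "\<not> ?P (t k)" for k
    using enumerate_in_set[OF inf, of k] unfolding t_def by simp
  have "\<exists>m M. M - m \<le> 2 * (L / 4) + L / 4 \<and> (AE y in lborel. y \<in> ball x r \<longrightarrow> m \<le> u y \<and> u y \<le> M)"
  proof (rule weakly_monotone_ball_bound[OF wm um \<Omega> r sub uB gB uAE, where w = "\<lambda>k. w (t k)" and D = "\<lambda>k. D (t k)"])
    show "(w (t k) has_derivative (\<lambda>h. D (t k) y \<bullet> h)) (at y)" for k y by (rule w)
    show "continuous_on UNIV (D (t k))" for k by (rule D)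
    show "(\<lambda>k. \<integral>\<^sup>+y\<in>ball x r. ennreal \<bar>uB y - w (t k) y\<bar> \<partial>lborel) \<longlonglongrightarrow> 0"
      using LIMSEQ_subseq_LIMSEQ[OF lim1 t] by (simp add: o_def)
    show "(\<lambda>k. \<integral>\<^sup>+y\<in>ball x r. ennreal (norm (gB y - D (t k) y)) \<partial>lborel) \<longlonglongrightarrow> 0"
      using LIMSEQ_subseq_LIMSEQ[OF lim2 t] by (simp add: o_def)
    show "AE y in lborel. y \<in> ball x r \<longrightarrow> (\<lambda>k. w (t k) y) \<longlonglongrightarrow> uB y"
      using limAE
    proof eventually_elim
      case (elim y)
      then show ?case using LIMSEQ_subseq_LIMSEQ[of "\<lambda>k. w k y" "uB y" t] t by (auto simp: o_def)
    qed
    show "\<bar>w (t k) y - w (t k) z\<bar> \<le> L / 4" if yz: "norm (y - x) = r" "norm (z - x) = r" for k y z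
    proof -
      have "\<not> L / 4 \<le> w (t k) y - w (t k) z" "\<not> L / 4 \<le> w (t k) z - w (t k) y"
        using nP[of k] yz by blast+
      then show ?thesis by linarith
    qed
  qed (use L in auto)
  then obtain m M where "M - m \<le> 2 * (L / 4) + L / 4" "L \<le> M - m" using bad by blast
  then show False using L by linarith
qed

section \<open>Lower bound for the modular on shells\<close>

text \<open>Young's inequality is applied with \<open>t\<close> equal to \<open>s\<close> times the
  kernel at each pole; the free scale \<open>s\<close> later becomes the variable of a conjugate.
  \<open>F\<close> is any function for which Young's inequality holds, and not
  \<open>A (norm (D y))\<close>, because \<open>D\<close> will be a mollified gradient and the
  available majorant is then the mollified modular density.\<close>

lemma piece_estimate:
  fixes w :: "'a::euclidean_space \<Rightarrow> real" and D :: "'a \<Rightarrow> 'a"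
  assumes n: "2 \<le> DIM('a)"
    and w: "\<And>x. (w has_derivative (\<lambda>h. D x \<bullet> h)) (at x)" and D: "continuous_on UNIV D"
    and p: "norm p = 1" and q: "norm q = 1" and ab: "0 < a" "a \<le> b" and l: "0 \<le> l" and s: "0 < s"
    and osc: "\<And>r. a < r \<Longrightarrow> r < b \<Longrightarrow> l \<le> \<bar>w (x + r *\<^sub>R p) - w (x + r *\<^sub>R q)\<bar>"
    and Fm [measurable]: "F \<in> borel_measurable borel"
    and F: "\<And>y t. 0 \<le> t \<Longrightarrow> a < norm (y - x) \<Longrightarrow> norm (y - x) < b \<Longrightarrow> ennreal (norm (D y) * t) \<le> F y + young_conjugate A t"
  shows "ennreal (s * l * (b - a) * a ^ (DIM('a) - 2)) \<le> ennreal (osc_const DIM('a)) *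
    (2 * (\<integral>\<^sup>+y\<in>{y. a < norm (y - x) \<and> norm (y - x) < b}. F y \<partial>lborel)
      + 2 * (ennreal (dual_const DIM('a) * (b - a) * b ^ (DIM('a) - 1)) * young_dual DIM('a) A s))"
proof -
  let ?n = "DIM('a)"
  define X where "X = {y. a < norm (y - x) \<and> norm (y - x) < b}"
  have [measurable]: "X \<in> sets borel" unfolding X_def by measurable
  have Dm [measurable]: "D \<in> borel_measurable borel" using D by (rule borel_measurable_continuous_onI)
  let ?B = "ennreal (dual_const ?n * (b - a) * b ^ (?n - 1)) * young_dual ?n A s"
  have S2: "(\<integral>\<^sup>+y. young_conjugate A (s * riesz_kernel p' (y - x)) * indicator X y \<partial>lborel) \<le> ?B" if "norm p' = 1" for p'
  proof -
    have "(\<integral>\<^sup>+y. young_conjugate A (s * riesz_kernel p' (y - x)) * indicator X y \<partial>lborel)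
       = (\<integral>\<^sup>+y. young_conjugate A (s * riesz_kernel p' y) * indicator {y. a < norm y \<and> norm y < b} y \<partial>lborel)"
      by (subst nn_integral_lborel_affine[of _ 1 x]) (auto simp: X_def indicator_def)
    also have "\<dots> \<le> ?B" by (rule nn_integral_young_conjugate_riesz_kernel_le[OF n that ab s])
    finally show ?thesis .
  qed
  have "ennreal (s * l * (b - a) * a ^ (?n - 2)) = ennreal s * ennreal (l * (b - a) * a ^ (?n - 2))"
    using s by (simp add: ennreal_mult'[symmetric] mult_ac)
  also have "\<dots> \<le> ennreal s * (ennreal (osc_const ?n) *
      (\<integral>\<^sup>+y. ennreal (norm (D y) * (riesz_kernel p (y - x) + riesz_kernel q (y - x))) * indicator X y \<partial>lborel))"
    unfolding X_def by (intro mult_left_mono potential_estimate[OF n w D p q ab l osc]) auto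
  also have "\<dots> = ennreal (osc_const ?n) *
      (\<integral>\<^sup>+y. ennreal s * (ennreal (norm (D y) * (riesz_kernel p (y - x) + riesz_kernel q (y - x))) * indicator X y) \<partial>lborel)"
    by (subst nn_integral_cmult) (auto simp: mult_ac)
  also have "\<dots> \<le> ennreal (osc_const ?n) *
      (\<integral>\<^sup>+y. 2 * (F y * indicator X y) + (young_conjugate A (s * riesz_kernel p (y - x)) * indicator X y
          + young_conjugate A (s * riesz_kernel q (y - x)) * indicator X y) \<partial>lborel)"
  proof (intro mult_left_mono nn_integral_mono)
    fix y
    show "ennreal s * (ennreal (norm (D y) * (riesz_kernel p (y - x) + riesz_kernel q (y - x))) * indicator X y)
      \<le> 2 * (F y * indicator X y) + (young_conjugate A (s * riesz_kernel p (y - x)) * indicator X y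
          + young_conjugate A (s * riesz_kernel q (y - x)) * indicator X y)"
    proof (cases "y \<in> X")
      case True
      then have y: "a < norm (y - x)" "norm (y - x) < b" by (auto simp: X_def)
      have "ennreal s * ennreal (norm (D y) * (riesz_kernel p (y - x) + riesz_kernel q (y - x)))
         = ennreal (norm (D y) * (s * riesz_kernel p (y - x)) + norm (D y) * (s * riesz_kernel q (y - x)))"
        using s by (simp add: ennreal_mult'[symmetric] algebra_simps)
      also have "\<dots> = ennreal (norm (D y) * (s * riesz_kernel p (y - x))) + ennreal (norm (D y) * (s * riesz_kernel q (y - x)))"
        using s by (intro ennreal_plus) (auto simp: riesz_kernel_nonneg)
      also have "\<dots> \<le> (F y + young_conjugate A (s * riesz_kernel p (y - x))) + (F y + young_conjugate A (s * riesz_kernel q (y - x)))"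
        using s by (intro add_mono F y) (auto simp: riesz_kernel_nonneg)
      also have "\<dots> = 2 * F y + (young_conjugate A (s * riesz_kernel p (y - x)) + young_conjugate A (s * riesz_kernel q (y - x)))"
        by (simp add: mult_2 add_ac)
      finally show ?thesis using True by simp
    qed simp
  qed simp
  also have "(\<integral>\<^sup>+y. 2 * (F y * indicator X y) + (young_conjugate A (s * riesz_kernel p (y - x)) * indicator X y
          + young_conjugate A (s * riesz_kernel q (y - x)) * indicator X y) \<partial>lborel)
     = (\<integral>\<^sup>+y. 2 * (F y * indicator X y) \<partial>lborel) + (\<integral>\<^sup>+y. young_conjugate A (s * riesz_kernel p (y - x)) * indicator X y
          + young_conjugate A (s * riesz_kernel q (y - x)) * indicator X y \<partial>lborel)"
    by (rule nn_integral_add) measurable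
  also have "(\<integral>\<^sup>+y. 2 * (F y * indicator X y) \<partial>lborel) = 2 * (\<integral>\<^sup>+y. F y * indicator X y \<partial>lborel)"
    by (rule nn_integral_cmult) measurable
  also have "(\<integral>\<^sup>+y. young_conjugate A (s * riesz_kernel p (y - x)) * indicator X y
          + young_conjugate A (s * riesz_kernel q (y - x)) * indicator X y \<partial>lborel)
     = (\<integral>\<^sup>+y. young_conjugate A (s * riesz_kernel p (y - x)) * indicator X y \<partial>lborel)
        + (\<integral>\<^sup>+y. young_conjugate A (s * riesz_kernel q (y - x)) * indicator X y \<partial>lborel)"
    by (rule nn_integral_add) measurable
  also have "ennreal (osc_const ?n) * (2 * (\<integral>\<^sup>+y. F y * indicator X y \<partial>lborel)
      + ((\<integral>\<^sup>+y. young_conjugate A (s * riesz_kernel p (y - x)) * indicator X y \<partial>lborel)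
        + (\<integral>\<^sup>+y. young_conjugate A (s * riesz_kernel q (y - x)) * indicator X y \<partial>lborel)))
     \<le> ennreal (osc_const ?n) * (2 * (\<integral>\<^sup>+y. F y * indicator X y \<partial>lborel) + (?B + ?B))"
    by (intro mult_left_mono add_mono S2 p q order_refl) auto
  also have "?B + ?B = 2 * ?B" by (simp only: mult_2)
  finally show ?thesis by (simp add: X_def)
qed

text \<open>Here the poles may depend on the radius, and the oscillation is large only for radii in
  \<open>R\<close>. The shell is cut into pieces so thin that the poles of one radius in
  \<open>R\<close> serve the whole piece with \<open>l / 2\<close> in place of \<open>l\<close>. The
  pieces that meet \<open>R\<close> cover it, and their estimates are added.\<close>

lemma annulus_estimate:
  fixes w :: "'a::euclidean_space \<Rightarrow> real" and D :: "'a \<Rightarrow> 'a"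
  assumes n: "2 \<le> DIM('a)"
    and w: "\<And>x. (w has_derivative (\<lambda>h. D x \<bullet> h)) (at x)" and D: "continuous_on UNIV D"
    and ab: "0 < a" "a < b" and l: "0 < l" and s: "0 < s"
    and R: "R \<subseteq> {a..b}" "R \<in> sets borel"
    and osc: "\<And>r. r \<in> R \<Longrightarrow> \<exists>p q. norm p = 1 \<and> norm q = 1 \<and> l \<le> w (x + r *\<^sub>R p) - w (x + r *\<^sub>R q)"
    and Fm [measurable]: "F \<in> borel_measurable borel"
    and F: "\<And>y t. 0 \<le> t \<Longrightarrow> a < norm (y - x) \<Longrightarrow> norm (y - x) < b \<Longrightarrow> ennreal (norm (D y) * t) \<le> F y + young_conjugate A t"
  shows "ennreal (s * l / 2 * a ^ (DIM('a) - 2)) * emeasure lborel R \<le> ennreal (osc_const DIM('a)) *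
    (2 * (\<integral>\<^sup>+y\<in>{y. a < norm (y - x) \<and> norm (y - x) < b}. F y \<partial>lborel)
      + 2 * (ennreal (dual_const DIM('a) * (b - a) * b ^ (DIM('a) - 1)) * young_dual DIM('a) A s))"
proof -
  let ?n = "DIM('a)"
  have wc: "continuous_on UNIV w"
    by (rule has_derivative_continuous_on[of UNIV w "\<lambda>x h. D x \<bullet> h"]) (use w in auto)
  have "uniformly_continuous_on (cball x b) w"
    by (rule compact_uniformly_continuous[OF continuous_on_subset[OF wc]]) auto
  \<comment> \<open>Moving the radius by less than \<open>d\<close> changes the value at each of the
    two poles by less than \<open>l / 4\<close>, so at least \<open>l / 2\<close> of the oscillation
    survives.\<close>
  then obtain d where d: "0 < d"
    "\<And>y z. y \<in> cball x b \<Longrightarrow> z \<in> cball x b \<Longrightarrow> dist z y < d \<Longrightarrow> dist (w z) (w y) < l / 4"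
  proof (rule uniformly_continuous_onE)
    show "0 < l / 4" using l by simp
  qed blast
  have near: "\<bar>w (x + r *\<^sub>R p) - w (x + r' *\<^sub>R p)\<bar> < l / 4"
    if "norm p = 1" "0 \<le> r" "r \<le> b" "0 \<le> r'" "r' \<le> b" "\<bar>r - r'\<bar> < d" for p r r'
  proof -
    have "dist (x + r *\<^sub>R p) (x + r' *\<^sub>R p) = \<bar>r - r'\<bar>"
      using that by (simp add: dist_norm scaleR_diff_left[symmetric])
    then show ?thesis using d(2)[of "x + r' *\<^sub>R p" "x + r *\<^sub>R p"] that by (simp add: dist_norm)
  qed
  obtain N :: nat where N: "(b - a) / d < real N" using reals_Archimedean2 by blast
  have "0 < (b - a) / d" using ab d by simp
  then have N0: "0 < real N" using N by linarith
  define h where "h = (b - a) / real N"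
  have h: "0 < h" "h < d" "real N * h = b - a"
    using ab N N0 d by (auto simp: h_def field_simps)
  define c where "c i = a + real i * h" for i
  have c: "c i < c (Suc i)" "c (Suc i) - c i = h" "a \<le> c i" for i using h by (auto simp: c_def algebra_simps)
  have cb: "c i \<le> b" if "i \<le> N" for i
  proof -
    have "real i * h \<le> real N * h" using that h by (intro mult_right_mono) auto
    then show ?thesis using h by (simp add: c_def)
  qed
  have cmono: "c i \<le> c j" if "i \<le> j" for i j
    using that h by (simp add: c_def mult_right_mono)
  \<comment> \<open>Pieces that miss \<open>R\<close> have no poles and are discarded. On the right
    side this is harmless, since the remaining open pieces are disjoint parts of the shell and their
    number is at most \<open>N\<close>.\<close>
  define J where "J = {i \<in> {..<N}. {c i..c (Suc i)} \<inter> R \<noteq> {}}"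
  have fin: "finite J" by (simp add: J_def)
  let ?X = "\<lambda>i. {y. c i < norm (y - x) \<and> norm (y - x) < c (Suc i)}"
  let ?Y = "{y. a < norm (y - x) \<and> norm (y - x) < b}"
  have [measurable]: "?X i \<in> sets borel" "?Y \<in> sets borel" for i by measurable
  let ?B = "young_dual ?n A s"
  have piece: "ennreal (s * l / 2 * a ^ (?n - 2)) * ennreal h \<le> ennreal (osc_const ?n) *
     (2 * (\<integral>\<^sup>+y\<in>?X i. F y \<partial>lborel) + 2 * (ennreal (dual_const ?n * h * b ^ (?n - 1)) * ?B))" if i: "i \<in> J" for i
  proof -
    have iN: "i < N" using i by (simp add: J_def)
    obtain r where r: "r \<in> R" "c i \<le> r" "r \<le> c (Suc i)" using i by (auto simp: J_def)
    obtain p q where pq: "norm p = 1" "norm q = 1" "l \<le> w (x + r *\<^sub>R p) - w (x + r *\<^sub>R q)" using osc[OF r(1)] by blast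
    have rb: "0 \<le> r" "r \<le> b" using r R ab by auto
    have osc': "l / 2 \<le> \<bar>w (x + r' *\<^sub>R p) - w (x + r' *\<^sub>R q)\<bar>" if "c i < r'" "r' < c (Suc i)" for r'
    proof -
      have "0 \<le> r'" "r' \<le> b" "\<bar>r - r'\<bar> < d"
        using that c[of i] ab cb[of "Suc i"] iN r h by auto
      then show ?thesis using near[of p r r'] near[of q r r'] pq rb by linarith
    qed
    have ci: "0 < c i" using c(3)[of i] ab by simp
    have "ennreal (s * (l / 2) * (c (Suc i) - c i) * c i ^ (?n - 2)) \<le> ennreal (osc_const ?n) *
      (2 * (\<integral>\<^sup>+y\<in>?X i. F y \<partial>lborel)
      + 2 * (ennreal (dual_const ?n * (c (Suc i) - c i) * c (Suc i) ^ (?n - 1)) * ?B))"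
    proof (rule piece_estimate[OF n w D pq(1,2) ci less_imp_le[OF c(1)] _ s osc' Fm])
      show "ennreal (norm (D y) * t) \<le> F y + young_conjugate A t"
        if "0 \<le> t" "c i < norm (y - x)" "norm (y - x) < c (Suc i)" for y t
        using F[of t y] that c(3)[of i] cb[of "Suc i"] iN by auto
    qed (use l in auto)
    also have "\<dots> \<le> ennreal (osc_const ?n) *
      (2 * (\<integral>\<^sup>+y\<in>?X i. F y \<partial>lborel) + 2 * (ennreal (dual_const ?n * h * b ^ (?n - 1)) * ?B))"
      unfolding c(2) using cb[of "Suc i"] iN ci c(1)[of i] h
      by (intro mult_left_mono add_mono order_refl mult_right_mono ennreal_leI mult_left_mono power_mono)
         (auto simp: dual_const_def cone_const_nonneg)
    finally have le: "ennreal (s * (l / 2) * h * c i ^ (?n - 2)) \<le> ennreal (osc_const ?n) *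
      (2 * (\<integral>\<^sup>+y\<in>?X i. F y \<partial>lborel) + 2 * (ennreal (dual_const ?n * h * b ^ (?n - 1)) * ?B))" by (simp only: c(2))
    have "ennreal (s * l / 2 * a ^ (?n - 2)) * ennreal h = ennreal (s * (l / 2) * h * a ^ (?n - 2))"
      using s l h ab by (simp add: ennreal_mult'[symmetric] ennreal_mult''[symmetric] mult_ac)
    also have "\<dots> \<le> ennreal (s * (l / 2) * h * c i ^ (?n - 2))"
      using c(3)[of i] ab s l h by (intro ennreal_leI mult_left_mono power_mono) auto
    also note le
    finally show ?thesis .
  qed
  have cover: "R \<subseteq> (\<Union>i\<in>J. {c i..c (Suc i)})"
  proof
    fix r assume r: "r \<in> R"
    then have rab: "a \<le> r" "r \<le> b" using R by auto
    define i where "i = (if r = b then N - 1 else nat \<lfloor>(r - a) / h\<rfloor>)"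
    have "i < N \<and> c i \<le> r \<and> r \<le> c (Suc i)"
    proof (cases "r = b")
      case True
      have Ni: "Suc (N - 1) = N" using N0 by simp
      have "c (Suc (N - 1)) = b" using h N0 unfolding Ni by (simp add: c_def)
      then show ?thesis using True N0 c(1)[of "N - 1"] by (auto simp: i_def)
    next
      case False
      have ie: "real i = of_int \<lfloor>(r - a) / h\<rfloor>" using False rab h by (simp add: i_def)
      have "real i \<le> (r - a) / h" "(r - a) / h < real i + 1" unfolding ie by linarith+
      then have 1: "real i * h \<le> r - a" "r - a < (real i + 1) * h"
        using h by (simp_all add: pos_le_divide_eq pos_divide_less_eq)
      have "real i * h < real N * h" using 1 False rab h by linarith
      then have "i < N" using mult_less_cancel_right_pos[OF h(1), of "real i" "real N"] by simp
      then show ?thesis using 1 by (simp add: c_def algebra_simps)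
    qed
    then have "i \<in> J" "r \<in> {c i..c (Suc i)}" using r by (auto simp: J_def)
    then show "r \<in> (\<Union>i\<in>J. {c i..c (Suc i)})" by blast
  qed
  have "emeasure lborel R \<le> emeasure lborel (\<Union>i\<in>J. {c i..c (Suc i)})"
    by (rule emeasure_mono[OF cover]) (use fin in auto)
  also have "\<dots> \<le> (\<Sum>i\<in>J. emeasure lborel {c i..c (Suc i)})"
    by (rule emeasure_subadditive_finite) (use fin in auto)
  also have "\<dots> = (\<Sum>i\<in>J. ennreal h)"
    by (rule sum.cong) (use c in \<open>auto simp: less_imp_le\<close>)
  finally have Rle: "emeasure lborel R \<le> (\<Sum>i\<in>J. ennreal h)" .
  have ind: "(\<Sum>i\<in>J. indicator (?X i) y) \<le> (indicator ?Y y :: ennreal)" for y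
  proof (cases "\<exists>i\<in>J. y \<in> ?X i")
    case True
    then obtain i where i: "i \<in> J" "y \<in> ?X i" by blast
    have "y \<notin> ?X j" if "j \<noteq> i" for j
    proof (cases "j < i")
      case True
      then have "c (Suc j) \<le> c i" by (intro cmono) auto
      then show ?thesis using i by auto
    next
      case False
      then have "c (Suc i) \<le> c j" using that by (intro cmono) auto
      then show ?thesis using i by auto
    qed
    then have "(\<Sum>j\<in>J. indicator (?X j) y) = (\<Sum>j\<in>J. if j = i then 1 else 0 :: ennreal)"
      using i by (intro sum.cong) (auto simp: indicator_def)
    also have "\<dots> = 1" using i fin by simp
    also have "1 \<le> (indicator ?Y y :: ennreal)"
      using i c(3)[of i] cb[of "Suc i"] by (auto simp: indicator_def J_def)
    finally show ?thesis .
  next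
    case False
    then have "(\<Sum>i\<in>J. indicator (?X i) y :: ennreal) = 0" by (intro sum.neutral) auto
    then show ?thesis by simp
  qed
  have "ennreal (s * l / 2 * a ^ (?n - 2)) * emeasure lborel R \<le> ennreal (s * l / 2 * a ^ (?n - 2)) * (\<Sum>i\<in>J. ennreal h)"
    by (intro mult_left_mono Rle) auto
  also have "\<dots> = (\<Sum>i\<in>J. ennreal (s * l / 2 * a ^ (?n - 2)) * ennreal h)" by (rule sum_distrib_left)
  also have "\<dots> \<le> (\<Sum>i\<in>J. ennreal (osc_const ?n) *
     (2 * (\<integral>\<^sup>+y\<in>?X i. F y \<partial>lborel) + 2 * (ennreal (dual_const ?n * h * b ^ (?n - 1)) * ?B)))"
    by (rule sum_mono) (rule piece)
  also have "\<dots> = ennreal (osc_const ?n) * (2 * (\<Sum>i\<in>J. \<integral>\<^sup>+y\<in>?X i. F y \<partial>lborel)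
       + 2 * ((\<Sum>i\<in>J. ennreal (dual_const ?n * h * b ^ (?n - 1))) * ?B))"
    by (simp only: sum_distrib_left sum.distrib sum_distrib_right distrib_left)
  also have "\<dots> \<le> ennreal (osc_const ?n) * (2 * (\<integral>\<^sup>+y\<in>?Y. F y \<partial>lborel)
       + 2 * (ennreal (dual_const ?n * (b - a) * b ^ (?n - 1)) * ?B))"
  proof (intro mult_left_mono add_mono mult_right_mono)
    have "(\<Sum>i\<in>J. \<integral>\<^sup>+y\<in>?X i. F y \<partial>lborel) = (\<integral>\<^sup>+y. (\<Sum>i\<in>J. F y * indicator (?X i) y) \<partial>lborel)"
      by (rule nn_integral_sum[symmetric]) measurable
    also have "\<dots> \<le> (\<integral>\<^sup>+y\<in>?Y. F y \<partial>lborel)"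
      unfolding sum_distrib_left[symmetric] by (intro nn_integral_mono mult_left_mono ind) auto
    finally show "(\<Sum>i\<in>J. \<integral>\<^sup>+y\<in>?X i. F y \<partial>lborel) \<le> (\<integral>\<^sup>+y\<in>?Y. F y \<partial>lborel)" .
    have dc: "0 \<le> dual_const ?n * b ^ (?n - 1)" using ab by (simp add: dual_const_def cone_const_nonneg)
    have "(\<Sum>i\<in>J. ennreal (dual_const ?n * h * b ^ (?n - 1))) = ennreal (real (card J) * h * (dual_const ?n * b ^ (?n - 1)))"
      using h dc by (simp add: ennreal_of_nat_eq_real_of_nat ennreal_mult'[symmetric] mult_ac)
    also have "\<dots> \<le> ennreal (real N * h * (dual_const ?n * b ^ (?n - 1)))"
    proof (intro ennreal_leI mult_right_mono dc)
      have "card J \<le> card {..<N}" by (intro card_mono) (auto simp: J_def)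
      then show "real (card J) \<le> real N" by simp
    qed (use h in auto)
    also have "real N * h * (dual_const ?n * b ^ (?n - 1)) = dual_const ?n * (b - a) * b ^ (?n - 1)"
      by (simp add: h(3))
    finally show "(\<Sum>i\<in>J. ennreal (dual_const ?n * h * b ^ (?n - 1))) \<le> ennreal (dual_const ?n * (b - a) * b ^ (?n - 1))" .
  qed auto
  finally show ?thesis .
qed

section \<open>From mollifications to the weak gradient itself\<close>

lemma norm_mollify_le:
  assumes m: "mollifier \<epsilon> \<psi>" and [measurable]: "g \<in> borel_measurable borel"
  shows "ennreal (norm (mollify \<psi> g y)) \<le> (\<integral>\<^sup>+z. ennreal (\<psi> z) * ennreal (norm (g (y - z))) \<partial>lborel)"
proof (cases "integrable lborel (\<lambda>z. \<psi> z *\<^sub>R g (y - z))")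
  case True
  have "ennreal (norm (mollify \<psi> g y)) \<le> (\<integral>\<^sup>+z. ennreal (norm (\<psi> z *\<^sub>R g (y - z))) \<partial>lborel)"
    unfolding mollify_reflect[OF m assms(2)] by (rule integral_norm_bound_ennreal[OF True])
  then show ?thesis using mollifierD(2)[OF m] by (simp add: ennreal_mult)
qed (simp add: mollify_reflect[OF m assms(2)] not_integrable_integral_eq)

text \<open>Each translation by a vector shorter than \<open>\<epsilon>\<close> carries the shell
  into the shell enlarged by \<open>\<epsilon>\<close>, and the weights of the translates add up to
  1.\<close>

lemma nn_integral_mollify_shell_le:
  fixes F :: "real ^ 'n \<Rightarrow> ennreal"
  assumes m: "mollifier \<epsilon> \<psi>" and [measurable]: "F \<in> borel_measurable borel"
  shows "(\<integral>\<^sup>+y\<in>{y. a < norm (y - x) \<and> norm (y - x) < b}. (\<integral>\<^sup>+z. ennreal (\<psi> z) * F (y - z) \<partial>lborel) \<partial>lborel)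
    \<le> (\<integral>\<^sup>+y\<in>{y. a - \<epsilon> \<le> norm (y - x) \<and> norm (y - x) \<le> b + \<epsilon>}. F y \<partial>lborel)" (is "?L \<le> ?I")
proof -
  note [measurable] = mollifierD(7)[OF m]
  let ?S = "{y. a < norm (y - x) \<and> norm (y - x) < b}"
  let ?T = "{y. a - \<epsilon> \<le> norm (y - x) \<and> norm (y - x) \<le> b + \<epsilon>}"
  have [measurable]: "?S \<in> sets borel" "?T \<in> sets borel" by measurable
  have "?L = (\<integral>\<^sup>+y. (\<integral>\<^sup>+z. ennreal (\<psi> z) * F (y - z) * indicator ?S y \<partial>lborel) \<partial>lborel)"
    by (intro nn_integral_cong nn_integral_multc[symmetric]) measurable
  also have "\<dots> = (\<integral>\<^sup>+z. (\<integral>\<^sup>+y. ennreal (\<psi> z) * F (y - z) * indicator ?S y \<partial>lborel) \<partial>lborel)"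
    by (rule lborel_pair.Fubini') measurable
  also have "\<dots> \<le> (\<integral>\<^sup>+z. ennreal (\<psi> z) * ?I \<partial>lborel)"
  proof (rule nn_integral_mono)
    fix z
    show "(\<integral>\<^sup>+y. ennreal (\<psi> z) * F (y - z) * indicator ?S y \<partial>lborel) \<le> ennreal (\<psi> z) * ?I"
    proof (cases "norm z < \<epsilon>")
      case False
      then show ?thesis using mollifierD(3)[OF m, of z] by simp
    next
      case True
      have "(\<integral>\<^sup>+y. ennreal (\<psi> z) * F (y - z) * indicator ?S y \<partial>lborel)
        \<le> (\<integral>\<^sup>+y. ennreal (\<psi> z) * (F (y + - z) * indicator ?T (y + - z)) \<partial>lborel)"
      proof (rule nn_integral_mono)
        fix y
        have "y + - z \<in> ?T" if "y \<in> ?S"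
          using that True norm_triangle_ineq2[of "y - x" z] norm_triangle_ineq4[of "y - x" z]
          by (simp add: algebra_simps)
        then show "ennreal (\<psi> z) * F (y - z) * indicator ?S y \<le> ennreal (\<psi> z) * (F (y + - z) * indicator ?T (y + - z))"
          by (cases "y \<in> ?S") (simp_all del: mem_Collect_eq)
      qed
      also have "\<dots> = ennreal (\<psi> z) * (\<integral>\<^sup>+y. F (y + - z) * indicator ?T (y + - z) \<partial>lborel)"
        by (rule nn_integral_cmult) measurable
      also have "(\<integral>\<^sup>+y. F (y + - z) * indicator ?T (y + - z) \<partial>lborel) = ?I"
        by (rule nn_integral_lborel_translate[of "\<lambda>y. F y * indicator ?T y" "- z"]) measurable
      finally show ?thesis .
    qed
  qed
  also have "\<dots> = ?I"
    using mollifierD(8)[OF m] by (subst nn_integral_multc) auto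
  finally show ?thesis .
qed

text \<open>The 4 collects the \<open>1 / 2\<close> in \<open>s * L / 2\<close> and the factor 2 in
  front of the two modulars of \<open>annulus_estimate\<close>. The power \<open>2 ^ (n - 1)\<close>
  comes from \<open>b \<le> 2 * a\<close>, and the maximum with 1 lets one constant dominate the
  coefficients of both modulars.\<close>

definition shell_const :: "nat \<Rightarrow> real" where
  "shell_const n = 1 / (4 * osc_const n * max 1 (dual_const n * 2 ^ (n - 1)))"

lemma shell_const_pos: "2 \<le> n \<Longrightarrow> 0 < shell_const n"
  unfolding shell_const_def using osc_const_pos[of n] by (intro divide_pos_pos mult_pos_pos) auto

text \<open>For each fixed \<open>s\<close> the estimate of \<open>annulus_estimate\<close> passes
  to the limit in \<open>k\<close>. Scaled so that \<open>young_dual n A s\<close> has coefficient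
  1, it reads \<open>s * t \<le> young_dual n A s + I / P\<close> with
  \<open>t = shell_const n * L / a\<close>, and the supremum over \<open>s\<close> turns it into a
  bound for the conjugate of \<open>young_dual\<close> at \<open>t\<close>, which dominates
  \<open>young_lower\<close>.\<close>

lemma shell_lower_bound:
  fixes w :: "nat \<Rightarrow> real ^ 'n \<Rightarrow> real" and g :: "real ^ 'n \<Rightarrow> real ^ 'n"
  assumes n: "2 \<le> CARD('n)" and A: "young_function A" and fin: "\<forall>t\<ge>0. young_lower CARD('n) A t < \<infinity>"
    and ab: "0 < a" "a < b" "b \<le> 2 * a" and L: "0 < L"
    and w: "\<And>k y. (w k has_derivative (\<lambda>h. D k y \<bullet> h)) (at y)" and D: "\<And>k. continuous_on UNIV (D k)"
    and m: "\<And>k. mollifier (\<epsilon> k) (\<psi> k)" and \<epsilon>: "\<epsilon> \<longlonglongrightarrow> 0" and gm [measurable]: "g \<in> borel_measurable borel"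
    and Dg: "\<And>k y. a < norm (y - x) \<Longrightarrow> norm (y - x) < b \<Longrightarrow> D k y = mollify (\<psi> k) g y"
    and F: "(\<integral>\<^sup>+y. A (norm (g y)) \<partial>lborel) < \<infinity>"
    and osc: "\<And>r. a \<le> r \<Longrightarrow> r \<le> b \<Longrightarrow>
      eventually (\<lambda>k. \<exists>p q. norm p = 1 \<and> norm q = 1 \<and> L \<le> w k (x + r *\<^sub>R p) - w k (x + r *\<^sub>R q)) sequentially"
  shows "ennreal ((b - a) * a ^ (CARD('n) - 1)) * young_lower CARD('n) A (shell_const CARD('n) * L / a)
    \<le> (\<integral>\<^sup>+y\<in>{y. a \<le> norm (y - x) \<and> norm (y - x) \<le> b}. A (norm (g y)) \<partial>lborel)"
proof -
  let ?n = "CARD('n)"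
  have dim: "DIM(real ^ 'n) = ?n" by simp
  define f where "f y = A (max 0 (norm (g y)))" for y
  have [measurable]: "f \<in> borel_measurable borel"
    unfolding f_def[abs_def] by (rule measurable_compose[OF _ measurable_young_function[OF A]]) measurable
  have fA: "f y = A (norm (g y))" for y by (simp add: f_def)
  define I where "I = (\<integral>\<^sup>+y\<in>{y. a \<le> norm (y - x) \<and> norm (y - x) \<le> b}. f y \<partial>lborel)"
  define R where "R k = {r \<in> {a..b}. \<exists>p q. norm p = 1 \<and> norm q = 1 \<and> L \<le> w k (x + r *\<^sub>R p) - w k (x + r *\<^sub>R q)}" for k
  have wc: "continuous_on UNIV (w k)" for k
    by (rule has_derivative_continuous_on[of UNIV "w k" "\<lambda>x h. D k x \<bullet> h"]) (use w in auto)
  \<comment> \<open>The set of good radii is the projection of a compact set of triples consisting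
    of a radius and two unit vectors. This settles its measurability.\<close>
  have "compact (R k)" for k
  proof -
    let ?C = "({a..b} \<times> sphere 0 1 \<times> sphere 0 1) \<inter> {z. L \<le> w k (x + fst z *\<^sub>R fst (snd z)) - w k (x + fst z *\<^sub>R snd (snd z))}"
    have "closed {z. L \<le> w k (x + fst z *\<^sub>R fst (snd z)) - w k (x + fst z *\<^sub>R snd (snd z))}"
      by (intro closed_Collect_le continuous_intros continuous_on_compose2[OF wc]) auto
    then have "compact ?C" by (intro compact_Int_closed compact_Times) auto
    then have "compact (fst ` ?C)" by (intro compact_continuous_image continuous_intros)
    also have "fst ` ?C = R k"
    proof (intro equalityI subsetI)
      fix r assume "r \<in> R k"
      then obtain p q where "r \<in> {a..b}" "norm p = 1" "norm q = 1" "L \<le> w k (x + r *\<^sub>R p) - w k (x + r *\<^sub>R q)"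
        by (auto simp: R_def)
      then have "(r, p, q) \<in> ?C" by simp
      then have "fst (r, p, q) \<in> fst ` ?C" by (rule imageI)
      then show "r \<in> fst ` ?C" by (simp only: fst_conv)
    qed (auto simp: R_def, blast)
    finally show ?thesis .
  qed
  then have Rm [measurable]: "R k \<in> sets borel" for k by (intro borel_compact)
  \<comment> \<open>For each radius the oscillation is large from some index on, without uniformity
    in the radius. Dominated convergence needs no more to show that the good radii fill the interval
    in measure.\<close>
  have "(\<lambda>k. \<integral>\<^sup>+r. indicator (R k) r \<partial>lborel) \<longlonglongrightarrow> (\<integral>\<^sup>+r. indicator {a..b} r \<partial>lborel)"
  proof (rule nn_integral_dominated_convergence[where w = "indicator {a..b}"])
    show "AE r in lborel. (\<lambda>k. indicator (R k) r :: ennreal) \<longlonglongrightarrow> indicator {a..b} r"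
    proof (rule AE_I2)
      fix r :: real
      show "(\<lambda>k. indicator (R k) r :: ennreal) \<longlonglongrightarrow> indicator {a..b} r"
      proof (cases "r \<in> {a..b}")
        case True
        have "eventually (\<lambda>k. indicator (R k) r = (1::ennreal)) sequentially"
          using osc[of r] True by (auto simp: R_def indicator_def elim!: eventually_mono)
        then show ?thesis using True by (simp add: tendsto_eventually)
      next
        case False
        then have "r \<notin> R k" for k unfolding R_def by blast
        then show ?thesis using False by simp
      qed
    qed
    have Rsub: "R k \<subseteq> {a..b}" for k by (auto simp: R_def)
    show "AE r in lborel. indicator (R k) r \<le> (indicator {a..b} r :: ennreal)" for k
      using Rsub[of k] by (intro AE_I2) (auto simp: indicator_def)
    show "(\<integral>\<^sup>+r. indicator {a..b} r \<partial>lborel) < \<infinity>" using ab by simp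
  qed measurable
  then have Rlim: "(\<lambda>k. emeasure lborel (R k)) \<longlonglongrightarrow> ennreal (b - a)" using ab by simp
  let ?T = "\<lambda>k. {y. a - \<epsilon> k \<le> norm (y - x) \<and> norm (y - x) \<le> b + \<epsilon> k}"
  have Tlim: "(\<lambda>k. \<integral>\<^sup>+y\<in>?T k. f y \<partial>lborel) \<longlonglongrightarrow> I"
    unfolding I_def
  proof (rule nn_integral_dominated_convergence[where w = f])
    show "(\<integral>\<^sup>+y. f y \<partial>lborel) < \<infinity>" using F by (simp add: fA)
    \<comment> \<open>The predicate \<open>mollifier\<close> does not state positivity of its
      radius, but a nonpositive radius would make the mollifier vanish identically, against total
      mass 1. Positivity keeps the bounding spheres inside every enlarged shell.\<close>
    have e0: "0 < \<epsilon> k" for k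
    proof (rule ccontr)
      assume "\<not> 0 < \<epsilon> k"
      then have "\<psi> k = (\<lambda>_. 0)" using mollifierD(3)[OF m[of k]] by (force simp: fun_eq_iff intro: order_trans[OF _ norm_ge_zero])
      then show False using mollifierD(5)[OF m[of k]] by simp
    qed
    show "AE y in lborel. (\<lambda>k. f y * indicator (?T k) y) \<longlonglongrightarrow> f y * indicator {y. a \<le> norm (y - x) \<and> norm (y - x) \<le> b} y"
    proof (intro AE_I2 tendsto_eventually)
      fix y
      consider "a \<le> norm (y - x) \<and> norm (y - x) \<le> b" | "norm (y - x) < a" | "b < norm (y - x)" by linarith
      then have "eventually (\<lambda>k. indicator (?T k) y = (indicator {y. a \<le> norm (y - x) \<and> norm (y - x) \<le> b} y :: ennreal)) sequentially"
      proof cases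
        case 1
        then have "indicator (?T k) y = (indicator {y. a \<le> norm (y - x) \<and> norm (y - x) \<le> b} y :: ennreal)" for k
          using e0[of k] by (auto simp: indicator_def)
        then show ?thesis by simp
      next
        case 2
        then have "eventually (\<lambda>k. \<epsilon> k < a - norm (y - x)) sequentially" using order_tendstoD(2)[OF \<epsilon>] by simp
        then show ?thesis by eventually_elim (use 2 in \<open>auto simp: indicator_def\<close>)
      next
        case 3
        then have "eventually (\<lambda>k. \<epsilon> k < norm (y - x) - b) sequentially" using order_tendstoD(2)[OF \<epsilon>] by simp
        then show ?thesis by eventually_elim (use 3 in \<open>auto simp: indicator_def\<close>)
      qed
      then show "\<forall>\<^sub>F k in sequentially. f y * indicator (?T k) y = f y * indicator {y. a \<le> norm (y - x) \<and> norm (y - x) \<le> b} y"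
        by eventually_elim simp
    qed
  qed (auto simp: indicator_def intro!: AE_I2)
  have main: "ennreal (s * L / 2 * a ^ (?n - 2)) * ennreal (b - a) \<le> ennreal (osc_const ?n) *
    (2 * I + 2 * (ennreal (dual_const ?n * (b - a) * b ^ (?n - 1)) * young_dual ?n A s))" if s: "0 < s" for s
  proof (rule LIMSEQ_le)
    show "(\<lambda>k. ennreal (s * L / 2 * a ^ (?n - 2)) * emeasure lborel (R k)) \<longlonglongrightarrow> ennreal (s * L / 2 * a ^ (?n - 2)) * ennreal (b - a)"
      by (rule ennreal_tendsto_cmult[OF _ Rlim]) simp
    show "(\<lambda>k. ennreal (osc_const ?n) * (2 * (\<integral>\<^sup>+y\<in>?T k. f y \<partial>lborel)
        + 2 * (ennreal (dual_const ?n * (b - a) * b ^ (?n - 1)) * young_dual ?n A s))) \<longlonglongrightarrow>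
      ennreal (osc_const ?n) * (2 * I + 2 * (ennreal (dual_const ?n * (b - a) * b ^ (?n - 1)) * young_dual ?n A s))"
      by (intro ennreal_tendsto_cmult tendsto_add tendsto_const Tlim) auto
    have "ennreal (s * L / 2 * a ^ (?n - 2)) * emeasure lborel (R k) \<le> ennreal (osc_const ?n) * (2 * (\<integral>\<^sup>+y\<in>?T k. f y \<partial>lborel)
        + 2 * (ennreal (dual_const ?n * (b - a) * b ^ (?n - 1)) * young_dual ?n A s))" for k
    proof -
      note [measurable] = mollifierD(7)[OF m[of k]]
      define G where "G y = (\<integral>\<^sup>+z. ennreal (\<psi> k z) * f (y - z) \<partial>lborel)" for y
      have Gm [measurable]: "G \<in> borel_measurable borel"
      proof -
        have "(\<lambda>y. \<integral>\<^sup>+z. ennreal (\<psi> k z) * f (y - z) \<partial>lborel) \<in> borel_measurable lborel"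
          by (rule lborel.borel_measurable_nn_integral) measurable
        then show ?thesis by (simp add: G_def[abs_def])
      qed
      \<comment> \<open>Young's inequality is used under the averaging integral, before the modular
        is formed. This gives a majorant for the mollified gradient without Jensen's
        inequality.\<close>
      have young: "ennreal (norm (D k y) * t) \<le> G y + young_conjugate A t"
        if "0 \<le> t" "a < norm (y - x)" "norm (y - x) < b" for y t
      proof -
        have "ennreal (norm (D k y) * t) = ennreal (norm (mollify (\<psi> k) g y)) * ennreal t"
          using Dg[OF that(2,3)] that(1) by (simp add: ennreal_mult)
        also have "\<dots> \<le> (\<integral>\<^sup>+z. ennreal (\<psi> k z) * ennreal (norm (g (y - z))) \<partial>lborel) * ennreal t"
          by (intro mult_right_mono norm_mollify_le[OF m]) auto
        also have "\<dots> = (\<integral>\<^sup>+z. ennreal (\<psi> k z) * ennreal (norm (g (y - z))) * ennreal t \<partial>lborel)"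
          by (rule nn_integral_multc[symmetric]) measurable
        also have "\<dots> \<le> (\<integral>\<^sup>+z. ennreal (\<psi> k z) * f (y - z) + ennreal (\<psi> k z) * young_conjugate A t \<partial>lborel)"
        proof (rule nn_integral_mono)
          fix z
          have "ennreal (norm (g (y - z))) * ennreal t = ennreal (norm (g (y - z)) * t)"
            using that(1) by (simp add: ennreal_mult)
          also have "\<dots> \<le> f (y - z) + young_conjugate A t"
            unfolding fA by (rule young_inequality) simp
          finally have "ennreal (\<psi> k z) * (ennreal (norm (g (y - z))) * ennreal t) \<le> ennreal (\<psi> k z) * (f (y - z) + young_conjugate A t)"
            by (intro mult_left_mono) auto
          then show "ennreal (\<psi> k z) * ennreal (norm (g (y - z))) * ennreal t \<le> ennreal (\<psi> k z) * f (y - z) + ennreal (\<psi> k z) * young_conjugate A t"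
            by (simp only: distrib_left mult.assoc)
        qed
        also have "\<dots> = G y + (\<integral>\<^sup>+z. ennreal (\<psi> k z) * young_conjugate A t \<partial>lborel)"
          unfolding G_def by (rule nn_integral_add) measurable
        also have "(\<integral>\<^sup>+z. ennreal (\<psi> k z) * young_conjugate A t \<partial>lborel) = young_conjugate A t"
          using mollifierD(8)[OF m[of k]] by (subst nn_integral_multc) auto
        finally show ?thesis .
      qed
      have "ennreal (s * L / 2 * a ^ (DIM(real ^ 'n) - 2)) * emeasure lborel (R k) \<le> ennreal (osc_const DIM(real ^ 'n)) *
        (2 * (\<integral>\<^sup>+y\<in>{y. a < norm (y - x) \<and> norm (y - x) < b}. G y \<partial>lborel)
          + 2 * (ennreal (dual_const DIM(real ^ 'n) * (b - a) * b ^ (DIM(real ^ 'n) - 1)) * young_dual DIM(real ^ 'n) A s))"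
      proof (rule annulus_estimate[OF _ w D ab(1,2) L s _ Rm _ Gm young])
        show "2 \<le> DIM(real ^ 'n)" using n by simp
      qed (auto simp: R_def)
      also have "\<dots> \<le> ennreal (osc_const DIM(real ^ 'n)) * (2 * (\<integral>\<^sup>+y\<in>?T k. f y \<partial>lborel)
          + 2 * (ennreal (dual_const DIM(real ^ 'n) * (b - a) * b ^ (DIM(real ^ 'n) - 1)) * young_dual DIM(real ^ 'n) A s))"
        unfolding G_def
        by (intro mult_left_mono add_mono order_refl nn_integral_mollify_shell_le[OF m]) auto
      finally show ?thesis by (simp only: dim)
    qed
    then show "\<exists>N. \<forall>k\<ge>N. ennreal (s * L / 2 * a ^ (?n - 2)) * emeasure lborel (R k) \<le> ennreal (osc_const ?n) * (2 * (\<integral>\<^sup>+y\<in>?T k. f y \<partial>lborel)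
        + 2 * (ennreal (dual_const ?n * (b - a) * b ^ (?n - 1)) * young_dual ?n A s))" by blast
  qed
  \<comment> \<open>With \<open>c = 1 / (2 * osc_const n * G * P)\<close> the coefficient of the
    dual function becomes exactly 1 and that of \<open>I\<close> becomes
    \<open>1 / P\<close>.\<close>
  define G where "G = max 1 (dual_const ?n * 2 ^ (?n - 1))"
  have G: "1 \<le> G" "dual_const ?n * 2 ^ (?n - 1) \<le> G" by (auto simp: G_def)
  define P where "P = (b - a) * a ^ (?n - 1)"
  have P: "0 < P" using ab by (simp add: P_def)
  define c where "c = 1 / (2 * osc_const ?n * G * P)"
  have oc: "0 < osc_const ?n" using osc_const_pos[OF n] .
  have c: "0 < c" using oc G P by (simp add: c_def)
  have "young_conjugate (young_dual ?n A) (shell_const ?n * L / a) \<le> I * ennreal (1 / P)"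
  proof (rule young_conjugate_leI)
    fix s :: real assume s0: "0 \<le> s"
    show "ennreal (s * (shell_const ?n * L / a)) \<le> young_dual ?n A s + I * ennreal (1 / P)"
    proof (cases "s = 0")
      case False
      then have s: "0 < s" using s0 by simp
      have an: "a ^ (?n - 1) = a * a ^ (?n - 2)"
        using n by (metis Suc_diff_Suc diff_Suc_1 less_eq_Suc_le numeral_2_eq_2 power_Suc zero_less_diff diff_diff_left plus_1_eq_Suc Suc_1)
      have dle: "dual_const ?n * (b - a) * b ^ (?n - 1) \<le> G * P"
      proof -
        have "b ^ (?n - 1) \<le> (2 * a) ^ (?n - 1)" using ab by (intro power_mono) auto
        then have "dual_const ?n * (b - a) * b ^ (?n - 1) \<le> dual_const ?n * (b - a) * (2 * a) ^ (?n - 1)"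
          using ab by (intro mult_left_mono) (auto simp: dual_const_def cone_const_nonneg)
        also have "\<dots> = (dual_const ?n * 2 ^ (?n - 1)) * P" by (simp add: P_def power_mult_distrib)
        also have "\<dots> \<le> G * P" using G P by (intro mult_right_mono) auto
        finally show ?thesis .
      qed
      have "s * (shell_const ?n * L / a) = c * (s * L / 2 * a ^ (?n - 2) * (b - a))"
      proof -
        have sc: "shell_const ?n = 1 / (4 * osc_const ?n * G)" by (simp only: shell_const_def G_def)
        have "b - a \<noteq> 0" "a \<noteq> 0" "G \<noteq> 0" "osc_const ?n \<noteq> 0" using ab oc G by auto
        then show ?thesis unfolding sc c_def P_def an by (simp add: field_simps)
      qed
      then have "ennreal (s * (shell_const ?n * L / a)) = ennreal c * (ennreal (s * L / 2 * a ^ (?n - 2)) * ennreal (b - a))"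
      proof -
        have "ennreal (s * L / 2 * a ^ (?n - 2) * (b - a)) = ennreal (s * L / 2 * a ^ (?n - 2)) * ennreal (b - a)"
          by (rule ennreal_mult'') (use ab in simp)
        moreover have "ennreal (c * (s * L / 2 * a ^ (?n - 2) * (b - a))) = ennreal c * ennreal (s * L / 2 * a ^ (?n - 2) * (b - a))"
          by (rule ennreal_mult') (use c in simp)
        ultimately show ?thesis using \<open>s * (shell_const ?n * L / a) = c * (s * L / 2 * a ^ (?n - 2) * (b - a))\<close>
          by (simp only:)
      qed
      also have "\<dots> \<le> ennreal c * (ennreal (osc_const ?n) * (2 * I + 2 * (ennreal (dual_const ?n * (b - a) * b ^ (?n - 1)) * young_dual ?n A s)))"
        by (intro mult_left_mono main s) auto
      also have "\<dots> \<le> ennreal c * (ennreal (osc_const ?n) * (2 * (ennreal G * I) + 2 * (ennreal (G * P) * young_dual ?n A s)))"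
      proof (intro mult_left_mono add_mono mult_right_mono ennreal_leI dle)
        have "1 * I \<le> ennreal G * I" using G by (intro mult_right_mono) auto
        then show "I \<le> ennreal G * I" by simp
      qed auto
      also have "\<dots> = (ennreal c * (ennreal (osc_const ?n) * (2 * ennreal G))) * I + (ennreal c * (ennreal (osc_const ?n) * (2 * ennreal (G * P)))) * young_dual ?n A s"
        by (simp only: distrib_left mult_ac)
      also have "ennreal c * (ennreal (osc_const ?n) * (2 * ennreal G)) = ennreal (1 / P)"
        using c oc G P by (simp add: ennreal_mult'[symmetric] ennreal_numeral[symmetric] del: ennreal_numeral) (simp add: c_def field_simps)
      also have "ennreal c * (ennreal (osc_const ?n) * (2 * ennreal (G * P))) = 1"
        using c oc G P by (simp add: ennreal_mult'[symmetric] ennreal_numeral[symmetric] del: ennreal_numeral) (simp add: c_def field_simps)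
      finally show ?thesis by (simp add: add.commute mult.commute)
    qed simp
  qed
  moreover have "young_lower ?n A (shell_const ?n * L / a) \<le> young_conjugate (young_dual ?n A) (shell_const ?n * L / a)"
    using shell_const_pos[OF n] L ab by (intro young_lower_le_conjugate[OF A fin]) auto
  ultimately have "ennreal P * young_lower ?n A (shell_const ?n * L / a) \<le> ennreal P * (I * ennreal (1 / P))"
    by (intro mult_left_mono) auto
  also have "\<dots> = I" using P by (simp add: mult.left_commute[of "ennreal P"] ennreal_mult'[symmetric])
  finally show ?thesis by (simp add: P_def I_def fA)
qed

section \<open>Infinite potentials and capacity\<close>

lemma young_conjugate_convex:
  assumes c: "c \<in> {0..1}" and st: "0 \<le> s" "0 \<le> t"
  shows "young_conjugate A ((1 - c) * s + c * t) \<le> ennreal (1 - c) * young_conjugate A s + ennreal c * young_conjugate A t"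
proof (rule young_conjugate_leI)
  fix r :: real assume r: "0 \<le> r"
  have "ennreal (r * ((1 - c) * s + c * t)) = ennreal (1 - c) * ennreal (r * s) + ennreal c * ennreal (r * t)"
  proof -
    have "r * ((1 - c) * s + c * t) = (1 - c) * (r * s) + c * (r * t)" by (simp add: algebra_simps)
    moreover have "ennreal ((1 - c) * (r * s) + c * (r * t)) = ennreal ((1 - c) * (r * s)) + ennreal (c * (r * t))"
      using c st r by (intro ennreal_plus) auto
    ultimately show ?thesis using c by (simp only: ennreal_mult' atLeastAtMost_iff diff_ge_0_iff_ge)
  qed
  also have "\<dots> \<le> ennreal (1 - c) * (A r + young_conjugate A s) + ennreal c * (A r + young_conjugate A t)"
    by (intro add_mono mult_left_mono young_inequality r) auto
  also have "\<dots> = (ennreal (1 - c) + ennreal c) * A r + (ennreal (1 - c) * young_conjugate A s + ennreal c * young_conjugate A t)"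
    by (simp add: distrib_left distrib_right add_ac)
  also have "ennreal (1 - c) + ennreal c = 1"
    using c by (simp add: ennreal_plus[symmetric] del: ennreal_plus)
  finally show "ennreal (r * ((1 - c) * s + c * t)) \<le> A r + (ennreal (1 - c) * young_conjugate A s + ennreal c * young_conjugate A t)"
    by simp
qed

lemma young_lower_convex:
  assumes A: "young_function A" and c: "c \<in> {0..1}" and st: "0 \<le> s" "0 \<le> t"
  shows "young_lower n A ((1 - c) * s + c * t) \<le> ennreal (1 - c) * young_lower n A s + ennreal c * young_lower n A t"
proof (cases "n = 2")
  case True
  have "\<forall>s\<ge>0. \<forall>t\<ge>0. \<forall>c\<in>{0..1}. A ((1 - c) * s + c * t) \<le> ennreal (1 - c) * A s + ennreal c * A t"
    using A by (simp add: young_function_def)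
  then show ?thesis using True c st by (simp add: young_lower_def)
next
  case False
  then show ?thesis using young_conjugate_convex[OF c st] by (simp add: young_lower_def Let_def)
qed

text \<open>A finite convex function on an open interval is continuous. Through this lemma
  \<open>\<Psi>\<close> is continuous on every half line \<open>{S..}\<close> with
  \<open>S > 0\<close>.\<close>

lemma continuous_on_young_lower:
  assumes A: "young_function A" and fin: "\<forall>t\<ge>0. young_lower n A t < \<infinity>"
  shows "continuous_on {0<..} (\<lambda>t. enn2real (young_lower n A t))"
proof (rule convex_on_continuous)
  show "convex_on {0<..} (\<lambda>t. enn2real (young_lower n A t))"
  proof (rule convex_onI)
    fix c s t :: real assume *: "0 < c" "c < 1" "s \<in> {0<..}" "t \<in> {0<..}"
    have e: "young_lower n A r = ennreal (enn2real (young_lower n A r))" if "0 \<le> r" for r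
      using fin that by simp
    have "ennreal (enn2real (young_lower n A ((1 - c) * s + c * t)))
      \<le> ennreal (1 - c) * young_lower n A s + ennreal c * young_lower n A t"
      using young_lower_convex[OF A, of c s t n] * e[of "(1 - c) * s + c * t"] by simp
    also have "\<dots> = ennreal (1 - c) * ennreal (enn2real (young_lower n A s)) + ennreal c * ennreal (enn2real (young_lower n A t))"
      using * e[of s] e[of t] by simp
    also have "\<dots> = ennreal ((1 - c) * enn2real (young_lower n A s) + c * enn2real (young_lower n A t))"
      using * by (simp add: ennreal_mult'[symmetric] ennreal_plus[symmetric] del: ennreal_plus)
    finally show "enn2real (young_lower n A ((1 - c) *\<^sub>R s + c *\<^sub>R t)) \<le> (1 - c) * enn2real (young_lower n A s) + c * enn2real (young_lower n A t)"
      using * by (subst (asm) ennreal_le_iff) auto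
  qed simp
qed simp

text \<open>Radii \<open>r\<close> are parametrised by \<open>t = 1 / r\<close>, so that the lower Riemann sums over thin shells
  are sums for the integral in the divergence condition.\<close>

lemma shell_integral_lower_bound:
  fixes f :: "real ^ 'n \<Rightarrow> ennreal" and H :: "real \<Rightarrow> ennreal" and K :: "real \<Rightarrow> real"
  assumes n: "1 \<le> CARD('n)" and [measurable]: "f \<in> borel_measurable borel" and H: "\<And>s t. 0 \<le> s \<Longrightarrow> s \<le> t \<Longrightarrow> H s \<le> H t"
    and Hm [measurable]: "H \<in> borel_measurable borel"
    and R: "0 < R"
    and shell: "\<And>a b. 0 < a \<Longrightarrow> a < b \<Longrightarrow> b \<le> 2 * a \<Longrightarrow> b \<le> R \<Longrightarrow>
      ennreal ((b - a) * a ^ (CARD('n) - 1)) * H (1 / a) \<le> (\<integral>\<^sup>+y\<in>{y. a \<le> norm (y - x) \<and> norm (y - x) \<le> b}. f y \<partial>lborel)"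
    and T: "1 / R \<le> S" "S < T" and K: "continuous_on {S..T} K" "\<And>t. t \<in> {S..T} \<Longrightarrow> 0 < K t"
    and [measurable]: "K \<in> borel_measurable borel"
  shows "(\<integral>\<^sup>+t\<in>{S..<T}. ennreal (1 / (t * K t)) * H t \<partial>lborel)
    \<le> ennreal (2 ^ (CARD('n) + 2)) * (\<integral>\<^sup>+y\<in>{y. 1 / T < norm (y - x) \<and> norm (y - x) < 1 / S}.
        ennreal (1 / (norm (y - x) ^ CARD('n) * K (1 / norm (y - x)))) * f y \<partial>lborel)"
proof -
  let ?n = "CARD('n)"
  have S: "0 < S" using T(1) R by (meson less_le_trans zero_less_divide_1_iff)
  define k where "k t = 1 / K t" for t
  have kc: "continuous_on {S..T} k" unfolding k_def[abs_def]
    by (intro continuous_intros K(1)) (use K(2) in \<open>auto simp: less_le\<close>)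
  have kpos: "0 < k t" if "t \<in> {S..T}" for t using K(2)[OF that] by (simp add: k_def)
  obtain t0 where t0: "t0 \<in> {S..T}" "\<And>t. t \<in> {S..T} \<Longrightarrow> k t0 \<le> k t"
    using continuous_attains_inf[OF compact_Icc _ kc] T by auto
  have "uniformly_continuous_on {S..T} k" by (rule compact_uniformly_continuous[OF kc compact_Icc])
  \<comment> \<open>The tolerance is half of the minimum of \<open>k\<close>, so on an interval
    shorter than \<open>d\<close> the function \<open>k\<close> stays within a factor 2 of its value
    at the left end.\<close>
  then obtain d where d: "0 < d" "\<And>s t. s \<in> {S..T} \<Longrightarrow> t \<in> {S..T} \<Longrightarrow> dist t s < d \<Longrightarrow> dist (k t) (k s) < k t0 / 2"
  proof (rule uniformly_continuous_onE)
    show "0 < k t0 / 2" using kpos[OF t0(1)] by simp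
  qed blast
  \<comment> \<open>The bound by \<open>S\<close> makes consecutive division points satisfy
    \<open>c (Suc i) \<le> 2 * c i\<close>, which is the condition \<open>b \<le> 2 * a\<close> for
    the reciprocal radii.\<close>
  define e where "e = min d S"
  have e: "0 < e" "e \<le> d" "e \<le> S" using d S by (auto simp: e_def)
  obtain N :: nat where N: "(T - S) / e < real N" using reals_Archimedean2 by blast
  have "0 < (T - S) / e" using T e by simp
  then have N0: "0 < real N" using N by linarith
  define h where "h = (T - S) / real N"
  have h: "0 < h" "h < e" "real N * h = T - S"
    using T N N0 e by (auto simp: h_def field_simps)
  define c where "c i = S + real i * h" for i
  have c: "c i < c (Suc i)" "c (Suc i) - c i = h" "S \<le> c i" for i using h by (auto simp: c_def algebra_simps)
  have cb: "c i \<le> T" if "i \<le> N" for i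
  proof -
    have "real i * h \<le> real N * h" using that h by (intro mult_right_mono) auto
    then show ?thesis using h by (simp add: c_def)
  qed
  have cmono: "c i \<le> c j" if "i \<le> j" for i j
    using that h by (simp add: c_def mult_right_mono)
  let ?X = "\<lambda>i. {y::real ^ 'n. 1 / c (Suc i) < norm (y - x) \<and> norm (y - x) < 1 / c i}"
  let ?Y = "{y::real ^ 'n. 1 / T < norm (y - x) \<and> norm (y - x) < 1 / S}"
  let ?g = "\<lambda>y. ennreal (1 / (norm (y - x) ^ ?n * K (1 / norm (y - x)))) * f y"
  have [measurable]: "?X i \<in> sets borel" "?Y \<in> sets borel" for i by measurable
  have piece: "(\<integral>\<^sup>+t\<in>{c i..<c (Suc i)}. ennreal (1 / (t * K t)) * H t \<partial>lborel) \<le> ennreal (2 ^ (?n + 2)) * (\<integral>\<^sup>+y\<in>?X i. ?g y \<partial>lborel)"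
    if i: "i < N" for i
  proof -
    have ci: "0 < c i" "0 < c (Suc i)" using c(3)[of i] c(3)[of "Suc i"] S by auto
    have cin: "c i \<in> {S..T}" using c(3)[of i] cb[of i] i by auto
    have c2: "c (Suc i) \<le> 2 * c i" using c(2)[of i] c(3)[of i] h e by linarith
    have kk: "k (c i) / 2 \<le> k t \<and> k t \<le> 2 * k (c i)" if "c i \<le> t" "t \<le> c (Suc i)" for t
    proof -
      have t: "t \<in> {S..T}" using that c(3)[of i] cb[of "Suc i"] i by auto
      have "dist t (c i) < d" using that c(2)[of i] h e by (simp add: dist_real_def)
      from d(2)[OF cin t this] have "\<bar>k t - k (c i)\<bar> < k t0 / 2" by (simp add: dist_real_def)
      moreover have "k t0 \<le> k (c i)" by (rule t0(2)[OF cin])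
      moreover have "0 < k (c i)" by (rule kpos[OF cin])
      ultimately show ?thesis by linarith
    qed
    define \<kappa> where "\<kappa> = k (c i)"
    have \<kappa>: "0 < \<kappa>" using kpos[OF cin] by (simp add: \<kappa>_def)
    have "(\<integral>\<^sup>+t\<in>{c i..<c (Suc i)}. ennreal (1 / (t * K t)) * H t \<partial>lborel)
      \<le> (\<integral>\<^sup>+t. (ennreal (2 * \<kappa> / c i) * H (c (Suc i))) * indicator {c i..<c (Suc i)} t \<partial>lborel)"
    proof (rule nn_integral_mono)
      fix t
      have "ennreal (1 / (t * K t)) * H t \<le> ennreal (2 * \<kappa> / c i) * H (c (Suc i))" if t: "c i \<le> t" "t < c (Suc i)"
      proof (intro mult_mono ennreal_leI H)
        have "1 / (t * K t) = k t / t" by (simp add: k_def)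
        also have "\<dots> \<le> 2 * \<kappa> / c i"
          using kk[of t] t ci \<kappa> by (intro frac_le) (auto simp: \<kappa>_def)
        finally show "1 / (t * K t) \<le> 2 * \<kappa> / c i" .
      qed (use t ci in auto)
      then show "ennreal (1 / (t * K t)) * H t * indicator {c i..<c (Suc i)} t \<le> (ennreal (2 * \<kappa> / c i) * H (c (Suc i))) * indicator {c i..<c (Suc i)} t"
        by (auto simp: indicator_def)
    qed
    also have "\<dots> = ennreal (2 * \<kappa> / c i) * H (c (Suc i)) * ennreal h"
      using c(1,2)[of i] by (subst nn_integral_cmult_indicator) auto
    also have "\<dots> = ennreal (2 * \<kappa> / c i * h) * H (c (Suc i))"
    proof -
      have "ennreal (2 * \<kappa> / c i * h) = ennreal (2 * \<kappa> / c i) * ennreal h"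
        by (rule ennreal_mult'') (use h in simp)
      then show ?thesis by (simp only: mult_ac)
    qed
    \<comment> \<open>The constant \<open>2 ^ (n + 2)\<close> is \<open>2 ^ n\<close> from comparing
      \<open>c (Suc i) ^ n\<close> with \<open>c i ^ n\<close>, times 4 from using
      \<open>2 * \<kappa>\<close> as upper and \<open>\<kappa> / 2\<close> as lower bound for
      \<open>k\<close>.\<close>
    also have "\<dots> \<le> ennreal (2 ^ (?n + 2) * (c i ^ ?n * (\<kappa> / 2)) * ((1 / c i - 1 / c (Suc i)) * (1 / c (Suc i)) ^ (?n - 1))) * H (c (Suc i))"
    proof (intro mult_right_mono ennreal_leI)
      have "(c (Suc i)) ^ ?n \<le> (2 * c i) ^ ?n" using c2 ci by (intro power_mono) auto
      then have "(c (Suc i)) ^ ?n \<le> 2 ^ ?n * c i ^ ?n" by (simp add: power_mult_distrib)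
      then have p: "1 \<le> 2 ^ ?n * c i ^ ?n / (c (Suc i)) ^ ?n" using ci by simp
      have n': "c (Suc i) ^ ?n = c (Suc i) * c (Suc i) ^ (?n - 1)" using n by (cases ?n) auto
      have "1 / c i - 1 / c (Suc i) = h / (c i * c (Suc i))" using ci c(2)[of i] by (simp add: field_simps)
      then have "2 ^ (?n + 2) * (c i ^ ?n * (\<kappa> / 2)) * ((1 / c i - 1 / c (Suc i)) * (1 / c (Suc i)) ^ (?n - 1))
          = (2 * \<kappa> / c i * h) * (2 ^ ?n * c i ^ ?n / (c (Suc i)) ^ ?n)"
        using ci unfolding n' by (simp add: power_divide power_add mult_ac)
      also have "\<dots> \<ge> (2 * \<kappa> / c i * h) * 1"
        using p h \<kappa> ci by (intro mult_left_mono) auto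
      finally show "2 * \<kappa> / c i * h \<le> 2 ^ (?n + 2) * (c i ^ ?n * (\<kappa> / 2)) * ((1 / c i - 1 / c (Suc i)) * (1 / c (Suc i)) ^ (?n - 1))"
        by simp
    qed simp
    also have "\<dots> = ennreal (2 ^ (?n + 2)) * (ennreal (c i ^ ?n * (\<kappa> / 2)) *
        (ennreal ((1 / c i - 1 / c (Suc i)) * (1 / c (Suc i)) ^ (?n - 1)) * H (1 / (1 / c (Suc i)))))"
    proof -
      have "0 \<le> 1 / c i - 1 / c (Suc i)" using ci c(1)[of i] by (simp add: frac_le)
      then show ?thesis using ci \<kappa>
        by (simp add: ennreal_mult'[symmetric] ennreal_mult''[symmetric] mult.assoc[symmetric])
    qed
    also have "\<dots> \<le> ennreal (2 ^ (?n + 2)) * (ennreal (c i ^ ?n * (\<kappa> / 2)) *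
        (\<integral>\<^sup>+y\<in>{y. 1 / c (Suc i) \<le> norm (y - x) \<and> norm (y - x) \<le> 1 / c i}. f y \<partial>lborel))"
    proof (intro mult_left_mono shell)
      show "1 / c (Suc i) < 1 / c i" using ci c(1)[of i] by (intro divide_strict_left_mono) auto
      show "1 / c i \<le> 2 * (1 / c (Suc i))" using ci c2 by (simp add: field_simps)
      have "1 / c i \<le> 1 / S" using c(3)[of i] S by (intro divide_left_mono) auto
      also have "\<dots> \<le> R" using T(1) S R by (simp add: field_simps)
      finally show "1 / c i \<le> R" .
    qed (use ci in auto)
    also have "(\<integral>\<^sup>+y\<in>{y. 1 / c (Suc i) \<le> norm (y - x) \<and> norm (y - x) \<le> 1 / c i}. f y \<partial>lborel) = (\<integral>\<^sup>+y\<in>?X i. f y \<partial>lborel)"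
    proof (rule nn_integral_cong_AE)
      \<comment> \<open>The shell hypothesis concerns closed shells, whereas disjointness in the
        final sum requires open ones; they differ by two spheres, which are null sets.\<close>
      have sph: "AE y in lborel. norm (y - x) \<noteq> r" for r
      proof -
        have "negligible (sphere x r)" by (rule negligible_sphere)
        then have "sphere x r \<in> null_sets lebesgue" by (simp add: negligible_iff_null_sets)
        then have "AE y in lebesgue. y \<notin> sphere x r" by (rule AE_not_in)
        then have "AE y in lborel. y \<notin> sphere x r" by (simp add: AE_completion_iff)
        then show ?thesis by eventually_elim (auto simp: dist_norm norm_minus_commute)
      qed
      show "AE y in lborel. f y * indicator {y. 1 / c (Suc i) \<le> norm (y - x) \<and> norm (y - x) \<le> 1 / c i} y = f y * indicator (?X i) y"
        using sph[of "1 / c (Suc i)"] sph[of "1 / c i"] by eventually_elim (auto simp: indicator_def)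
    qed
    also have "ennreal (c i ^ ?n * (\<kappa> / 2)) * (\<integral>\<^sup>+y\<in>?X i. f y \<partial>lborel) = (\<integral>\<^sup>+y. ennreal (c i ^ ?n * (\<kappa> / 2)) * (f y * indicator (?X i) y) \<partial>lborel)"
      by (rule nn_integral_cmult[symmetric]) measurable
    also have "\<dots> \<le> (\<integral>\<^sup>+y\<in>?X i. ?g y \<partial>lborel)"
    proof (rule nn_integral_mono)
      fix y :: "real ^ 'n"
      have "c i ^ ?n * (\<kappa> / 2) \<le> 1 / (norm (y - x) ^ ?n * K (1 / norm (y - x)))" if y: "y \<in> ?X i"
      proof -
        define t where "t = 1 / norm (y - x)"
        have y0: "0 < norm (y - x)" using y ci by (auto intro: less_trans[of 0 "1 / c (Suc i)"])
        have t: "c i \<le> t" "t \<le> c (Suc i)" using y y0 ci by (auto simp: t_def field_simps)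
        have "c i ^ ?n * (\<kappa> / 2) \<le> t ^ ?n * k t"
          using kk[OF t] t ci \<kappa> by (intro mult_mono power_mono) (auto simp: \<kappa>_def)
        also have "\<dots> = 1 / (norm (y - x) ^ ?n * K (1 / norm (y - x)))"
          using y0 by (simp add: t_def k_def power_divide)
        finally show ?thesis .
      qed
      then show "ennreal (c i ^ ?n * (\<kappa> / 2)) * (f y * indicator (?X i) y) \<le> ?g y * indicator (?X i) y"
        by (cases "y \<in> ?X i") (simp_all add: ennreal_leI mult_right_mono del: mem_Collect_eq)
    qed
    finally show ?thesis by (simp add: mult_left_mono)
  qed
  have ind: "(\<Sum>i<N. indicator (?X i) y) \<le> (indicator ?Y y :: ennreal)" for y
  proof (cases "\<exists>i<N. y \<in> ?X i")
    case True
    then obtain i where i: "i < N" "y \<in> ?X i" by blast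
    have inv: "1 / c b \<le> 1 / c a" if "a \<le> b" for a b
      using cmono[OF that] c(3)[of a] c(3)[of b] S by (intro divide_left_mono mult_pos_pos) linarith+
    have "y \<notin> ?X j" if "j \<noteq> i" for j
    proof (cases "j < i")
      case True
      then have "1 / c i \<le> 1 / c (Suc j)" by (intro inv) auto
      then show ?thesis using i by auto
    next
      case False
      then have "1 / c j \<le> 1 / c (Suc i)" using that by (intro inv) auto
      then show ?thesis using i by auto
    qed
    then have "(\<Sum>j<N. indicator (?X j) y) = (\<Sum>j<N. if j = i then 1 else 0 :: ennreal)"
      using i by (intro sum.cong) (auto simp: indicator_def)
    also have "\<dots> = 1" using i by simp
    also have "1 \<le> (indicator ?Y y :: ennreal)"
    proof -
      have "1 / T \<le> 1 / c (Suc i)" using cb[of "Suc i"] c(3)[of "Suc i"] i S by (intro divide_left_mono mult_pos_pos) linarith+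
      moreover have "1 / c i \<le> 1 / S" using c(3)[of i] S by (intro divide_left_mono mult_pos_pos) linarith+
      ultimately show ?thesis using i by (auto simp: indicator_def)
    qed
    finally show ?thesis .
  next
    case False
    then have "(\<Sum>i<N. indicator (?X i) y :: ennreal) = 0" by (intro sum.neutral) auto
    then show ?thesis by simp
  qed
  have cover: "indicator {S..<T} t \<le> (\<Sum>i<N. indicator {c i..<c (Suc i)} t :: ennreal)" for t
  proof (cases "t \<in> {S..<T}")
    case True
    define i where "i = nat \<lfloor>(t - S) / h\<rfloor>"
    have ie: "real i = of_int \<lfloor>(t - S) / h\<rfloor>" using True h by (simp add: i_def)
    have "real i \<le> (t - S) / h" "(t - S) / h < real i + 1" unfolding ie by linarith+
    then have 1: "real i * h \<le> t - S" "t - S < (real i + 1) * h"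
      using h by (simp_all add: pos_le_divide_eq pos_divide_less_eq)
    have "real i * h < real N * h" using 1 True h by auto
    then have iN: "i < N" using mult_less_cancel_right_pos[OF h(1), of "real i" "real N"] by simp
    have "t \<in> {c i..<c (Suc i)}" using 1 by (simp add: c_def algebra_simps)
    then have "(1::ennreal) \<le> (\<Sum>j\<in>{i}. indicator {c j..<c (Suc j)} t)" by simp
    also have "\<dots> \<le> (\<Sum>i<N. indicator {c i..<c (Suc i)} t :: ennreal)"
      using iN by (intro sum_mono2) auto
    finally show ?thesis using True by simp
  qed simp
  have "(\<integral>\<^sup>+t\<in>{S..<T}. ennreal (1 / (t * K t)) * H t \<partial>lborel)
     \<le> (\<integral>\<^sup>+t. (\<Sum>i<N. ennreal (1 / (t * K t)) * H t * indicator {c i..<c (Suc i)} t) \<partial>lborel)"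
    unfolding sum_distrib_left[symmetric] by (intro nn_integral_mono mult_left_mono cover) auto
  also have "\<dots> = (\<Sum>i<N. \<integral>\<^sup>+t\<in>{c i..<c (Suc i)}. ennreal (1 / (t * K t)) * H t \<partial>lborel)"
    by (rule nn_integral_sum) measurable
  also have "\<dots> \<le> (\<Sum>i<N. ennreal (2 ^ (?n + 2)) * (\<integral>\<^sup>+y\<in>?X i. ?g y \<partial>lborel))"
    by (rule sum_mono) (rule piece, simp)
  also have "\<dots> = ennreal (2 ^ (?n + 2)) * (\<Sum>i<N. \<integral>\<^sup>+y\<in>?X i. ?g y \<partial>lborel)"
    by (rule sum_distrib_left[symmetric])
  also have "(\<Sum>i<N. \<integral>\<^sup>+y\<in>?X i. ?g y \<partial>lborel) = (\<integral>\<^sup>+y. (\<Sum>i<N. ?g y * indicator (?X i) y) \<partial>lborel)"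
    by (rule nn_integral_sum[symmetric]) measurable
  also have "\<dots> \<le> (\<integral>\<^sup>+y\<in>?Y. ?g y \<partial>lborel)"
    unfolding sum_distrib_left[symmetric] by (intro nn_integral_mono mult_left_mono ind) auto
  finally show ?thesis by (simp add: mult_left_mono)
qed

section \<open>Divergence of the potential\<close>

lemma inverse_ennreal_antimono:
  assumes "0 \<le> c" "c \<le> d"
  shows "inverse (ennreal d) \<le> inverse (ennreal c)"
  using assms by (cases "c = 0") (auto simp: inverse_ennreal intro!: ennreal_leI le_imp_inverse_le)

lemma tendsto_inverse_ennreal:
  fixes f :: "'a \<Rightarrow> ennreal"
  assumes "(f \<longlongrightarrow> l) F"
  shows "((\<lambda>x. inverse (f x)) \<longlongrightarrow> inverse l) F"
proof -
  have "continuous_on UNIV (\<lambda>x::ennreal. inverse x)"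
    by (intro continuous_on_inverse_ennreal continuous_on_id)
  then have "isCont (\<lambda>x::ennreal. inverse x) l" by (simp add: continuous_on_eq_continuous_at)
  then show ?thesis using assms by (rule isCont_tendsto_compose)
qed

text \<open>The Riemann sum estimate requires a positive continuous denominator on a bounded
  interval, but \<open>\<Psi>\<close> may vanish and the integral extends to infinity. So a positive
  constant \<open>e j\<close> is added to \<open>\<Psi>\<close>, the interval is cut at
  \<open>S + real (Suc j)\<close>, and both are removed by monotone convergence, with the bound by
  the potential \<open>P\<close> independent of \<open>j\<close>.\<close>

lemma potential_infinite:
  fixes f :: "real ^ 'n \<Rightarrow> ennreal"
  assumes n: "2 \<le> CARD('n)" and A: "young_function A" and fin: "\<forall>t\<ge>0. young_lower CARD('n) A t < \<infinity>"
    and \<sigma>: "continuous_on {0..} \<sigma>" "\<forall>t\<ge>0. \<sigma> t \<ge> 0"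
    and div: "diverges_near_infinity
           (\<lambda>t. young_lower CARD('n) A (l * t) /
                (ennreal t * ennreal (\<sigma> t) * young_lower CARD('n) A t))"
    and \<Psi>: "\<forall>t\<ge>0. \<Psi> t = \<sigma> t * enn2real (young_lower CARD('n) A t)"
    and l: "0 < l" and R: "0 < R" and [measurable]: "f \<in> borel_measurable borel"
    and shell: "\<And>a b. 0 < a \<Longrightarrow> a < b \<Longrightarrow> b \<le> 2 * a \<Longrightarrow> b \<le> R \<Longrightarrow>
      ennreal ((b - a) * a ^ (CARD('n) - 1)) * young_lower CARD('n) A (l / a)
        \<le> (\<integral>\<^sup>+y\<in>{y. a \<le> norm (y - x) \<and> norm (y - x) \<le> b}. f y \<partial>lborel)"
  shows "(\<integral>\<^sup>+y. f y / ennreal (norm (x - y) ^ CARD('n) * \<Psi> (1 / norm (x - y))) \<partial>lborel) = \<infinity>"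
proof -
  let ?n = "CARD('n)"
  define yl where "yl = young_lower ?n A"
  define P where "P = (\<integral>\<^sup>+y. f y / ennreal (norm (x - y) ^ ?n * \<Psi> (1 / norm (x - y))) \<partial>lborel)"
  define h where "h t = yl (l * t) / (ennreal t * ennreal (\<sigma> t) * yl t)" for t
  have "\<forall>\<^sub>F a in at_top. (\<integral>\<^sup>+t\<in>{a..}. h t \<partial>lborel) = \<infinity>"
    using div by (simp add: diverges_near_infinity_def h_def yl_def)
  then obtain S where S: "1 / R \<le> S" "(\<integral>\<^sup>+t\<in>{S..}. h t \<partial>lborel) = \<infinity>"
    using eventually_ge_at_top[of "1 / R"] by (metis (mono_tags, lifting) eventually_at_top_linorder linear)
  have S0: "0 < S" using S(1) R by (meson less_le_trans zero_less_divide_1_iff)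
  \<comment> \<open>Values of \<open>young_lower\<close> at negative arguments are meaningless;
    freezing the argument at 0 makes \<open>H\<close> monotone on the whole line and hence Borel
    measurable.\<close>
  define H where "H t = yl (l * max 0 t)" for t
  have Hmono: "H s \<le> H t" if "s \<le> t" for s t
    unfolding H_def yl_def using l that by (intro young_lower_mono[OF A] mult_left_mono) auto
  have [measurable]: "H \<in> borel_measurable borel"
    by (intro borel_measurable_mono_ennreal monoI Hmono)
  have Hfin: "H t < top" for t using fin l by (simp add: H_def yl_def)
  have \<Psi>c: "continuous_on {S..} \<Psi>"
  proof -
    have "continuous_on {S..} (\<lambda>t. \<sigma> t * enn2real (young_lower ?n A t))"
      by (intro continuous_on_mult continuous_on_subset[OF \<sigma>(1)] continuous_on_subset[OF continuous_on_young_lower[OF A fin]])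
        (use S0 in auto)
    then show ?thesis by (rule continuous_on_eq) (use \<Psi> S0 in auto)
  qed
  have \<Psi>0: "0 \<le> \<Psi> t" if "0 \<le> t" for t using \<Psi> \<sigma>(2) that by simp
  define e where "e j = 1 / real (Suc j)" for j
  have e: "0 < e j" for j by (simp add: e_def)
  have elim: "e \<longlonglongrightarrow> 0" unfolding e_def[abs_def] by (rule LIMSEQ_Suc[OF lim_1_over_n])
  define K where "K j t = indicator {S..} t *\<^sub>R \<Psi> t + e j" for j t
  have Km [measurable]: "K j \<in> borel_measurable borel" for j
    unfolding K_def[abs_def]
    by (intro borel_measurable_add borel_measurable_continuous_on_indicator \<Psi>c) auto
  have Kpos: "0 < K j t" for j t using \<Psi>0[of t] e[of j] S0 by (auto simp: K_def indicator_def add_nonneg_pos)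
  \<comment> \<open>The sequence increases in \<open>j\<close>: the interval grows, and the added
    constant \<open>e j\<close> in the denominator decreases.\<close>
  define F where "F j t = ennreal (1 / (t * K j t)) * H t * indicator {S..<S + real (Suc j)} t" for j t
  have bound: "(\<integral>\<^sup>+t. F j t \<partial>lborel) \<le> ennreal (2 ^ (?n + 2)) * P" for j
  proof -
    have "(\<integral>\<^sup>+t. F j t \<partial>lborel) \<le> ennreal (2 ^ (?n + 2)) * (\<integral>\<^sup>+y\<in>{y. 1 / (S + real (Suc j)) < norm (y - x) \<and> norm (y - x) < 1 / S}.
        ennreal (1 / (norm (y - x) ^ ?n * K j (1 / norm (y - x)))) * f y \<partial>lborel)"
      unfolding F_def
    proof (rule shell_integral_lower_bound[OF _ _ Hmono _ R _ S(1)])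
      show "ennreal ((b - a) * a ^ (?n - 1)) * H (1 / a) \<le> (\<integral>\<^sup>+y\<in>{y. a \<le> norm (y - x) \<and> norm (y - x) \<le> b}. f y \<partial>lborel)"
        if "0 < a" "a < b" "b \<le> 2 * a" "b \<le> R" for a b
        using shell[OF that] that(1) by (simp add: H_def yl_def)
      show "continuous_on {S..S + real (Suc j)} (K j)"
      proof -
        have "continuous_on {S..S + real (Suc j)} (\<lambda>t. \<Psi> t + e j)"
          by (intro continuous_intros continuous_on_subset[OF \<Psi>c]) auto
        then show ?thesis by (rule continuous_on_eq) (auto simp: K_def)
      qed
    qed (use n Kpos in auto)
    also have "\<dots> \<le> ennreal (2 ^ (?n + 2)) * P"
      unfolding P_def
    proof (intro mult_left_mono nn_integral_mono)
      fix y :: "real ^ 'n"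
      let ?Y = "{y. 1 / (S + real (Suc j)) < norm (y - x) \<and> norm (y - x) < 1 / S}"
      show "ennreal (1 / (norm (y - x) ^ ?n * K j (1 / norm (y - x)))) * f y * indicator ?Y y
        \<le> f y / ennreal (norm (x - y) ^ ?n * \<Psi> (1 / norm (x - y)))"
      proof (cases "y \<in> ?Y")
        case True
        define r where "r = norm (y - x)"
        have "0 < 1 / (S + real (Suc j))" using S0 by simp
        then have r: "0 < r" "r < 1 / S" using True by (auto simp: r_def simp del: of_nat_Suc)
        have t: "S \<le> 1 / r" using r S0 by (simp add: field_simps)
        have K: "K j (1 / r) = \<Psi> (1 / r) + e j" using t by (simp add: K_def)
        have "ennreal (1 / (r ^ ?n * K j (1 / r))) = inverse (ennreal (r ^ ?n * K j (1 / r)))"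
          using r Kpos[of j "1 / r"] by (subst inverse_ennreal) (auto simp: inverse_eq_divide)
        also have "\<dots> \<le> inverse (ennreal (r ^ ?n * \<Psi> (1 / r)))"
          using r \<Psi>0[of "1 / r"] e[of j] unfolding K by (intro inverse_ennreal_antimono mult_left_mono) auto
        finally have "ennreal (1 / (r ^ ?n * K j (1 / r))) * f y \<le> inverse (ennreal (r ^ ?n * \<Psi> (1 / r))) * f y"
          by (intro mult_right_mono) auto
        then show ?thesis using True by (simp add: r_def norm_minus_commute divide_ennreal_def mult.commute)
      qed simp
    qed simp
    finally show ?thesis .
  qed
  have "(\<lambda>j. \<integral>\<^sup>+t. F j t \<partial>lborel) \<longlonglongrightarrow> (\<integral>\<^sup>+t. h t * indicator {S..} t \<partial>lborel)"
  proof (rule nn_integral_LIMSEQ)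
    show "incseq F"
    proof (intro incseq_SucI le_funI)
      fix j t
      show "F j t \<le> F (Suc j) t"
      proof (cases "t \<in> {S..<S + real (Suc j)}")
        case True
        have "K (Suc j) t \<le> K j t" by (simp add: K_def e_def frac_le)
        then have "1 / (t * K j t) \<le> 1 / (t * K (Suc j) t)"
          using True S0 Kpos[of j t] Kpos[of "Suc j" t] by (intro divide_left_mono mult_left_mono mult_pos_pos) auto
        then show ?thesis using True by (auto simp: F_def indicator_def intro!: mult_right_mono ennreal_leI)
      qed (simp add: F_def)
    qed
    show "F j \<in> borel_measurable lborel" for j unfolding F_def[abs_def] by measurable
    fix t
    show "(\<lambda>j. F j t) \<longlonglongrightarrow> h t * indicator {S..} t"
    proof (cases "S \<le> t")
      case True
      then have t: "0 < t" using S0 by simp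
      have "(\<lambda>j. ennreal (t * (\<Psi> t + e j))) \<longlonglongrightarrow> ennreal (t * (\<Psi> t + 0))"
        by (intro tendsto_ennrealI tendsto_intros elim)
      then have "(\<lambda>j. inverse (ennreal (t * (\<Psi> t + e j)))) \<longlonglongrightarrow> inverse (ennreal (t * \<Psi> t))"
        using tendsto_inverse_ennreal by fastforce
      then have "(\<lambda>j. H t * inverse (ennreal (t * (\<Psi> t + e j)))) \<longlonglongrightarrow> H t * inverse (ennreal (t * \<Psi> t))"
        by (rule ennreal_tendsto_cmult[OF Hfin])
      moreover have "eventually (\<lambda>j. F j t = H t * inverse (ennreal (t * (\<Psi> t + e j)))) sequentially"
      proof -
        obtain j0 :: nat where j0: "t - S < real j0" using reals_Archimedean2 by blast
        show ?thesis
        proof (rule eventually_sequentiallyI[of j0])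
          fix j assume "j0 \<le> j"
          then have "t \<in> {S..<S + real (Suc j)}" using j0 True by auto
          moreover have "inverse (ennreal (t * (\<Psi> t + e j))) = ennreal (1 / (t * K j t))"
            using t Kpos[of j t] True by (subst inverse_ennreal) (auto simp: inverse_eq_divide K_def)
          ultimately show "F j t = H t * inverse (ennreal (t * (\<Psi> t + e j)))"
            by (simp add: F_def mult.commute)
        qed
      qed
      ultimately have "(\<lambda>j. F j t) \<longlonglongrightarrow> H t * inverse (ennreal (t * \<Psi> t))"
        by (simp add: tendsto_cong)
      also have "H t * inverse (ennreal (t * \<Psi> t)) = h t"
      proof -
        have "ennreal t * ennreal (\<sigma> t) * yl t = ennreal (t * \<Psi> t)"
          using t \<sigma>(2) \<Psi> fin by (simp add: yl_def ennreal_mult mult.assoc)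
        then show ?thesis using t by (simp add: h_def H_def divide_ennreal_def)
      qed
      finally show ?thesis using True by simp
    qed (simp add: F_def)
  qed
  then have "(\<integral>\<^sup>+t. h t * indicator {S..} t \<partial>lborel) \<le> ennreal (2 ^ (?n + 2)) * P"
    by (rule LIMSEQ_le_const2) (use bound in blast)
  then have "ennreal (2 ^ (?n + 2)) * P = \<infinity>" using S(2) by (simp add: top_unique)
  then have "P = \<infinity>" by (simp add: ennreal_mult_eq_top_iff)
  then show ?thesis by (simp add: P_def)
qed

section \<open>Points at which the oscillation does not vanish\<close>

lemma ex_borel_integrable:
  fixes f :: "'a::euclidean_space \<Rightarrow> 'b::euclidean_space"
  assumes f: "integrable lebesgue f"
  obtains f' where "integrable lborel f'" "AE y in lborel. f' y = f y"
proof -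
  have "\<exists>h. h \<in> borel_measurable borel \<and> (AE y in lborel. f y \<bullet> b = h y)" for b
  proof -
    have "(\<lambda>y. f y \<bullet> b) \<in> borel_measurable lebesgue" using f by auto
    then show ?thesis using completion_ex_borel_measurable_real[of "\<lambda>y. f y \<bullet> b" lborel] by auto
  qed
  then obtain h where h: "\<And>b. h b \<in> borel_measurable borel" "\<And>b. AE y in lborel. f y \<bullet> b = h b y"
    by metis
  define f' where "f' y = (\<Sum>b\<in>Basis. h b y *\<^sub>R b)" for y
  have [measurable]: "f' \<in> borel_measurable borel" unfolding f'_def[abs_def] using h(1) by measurable
  have "AE y in lborel. \<forall>b\<in>Basis. f y \<bullet> b = h b y"
    by (rule AE_finite_allI) (auto simp: h)
  then have AE: "AE y in lborel. f' y = f y"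
  proof eventually_elim
    case (elim y)
    then have "f' y = (\<Sum>b\<in>Basis. (f y \<bullet> b) *\<^sub>R b)" by (simp add: f'_def)
    then show ?case by (simp add: euclidean_representation)
  qed
  have "integrable lebesgue f'"
    by (rule integrable_cong_AE_imp[OF f]) (use AE in \<open>auto intro!: measurable_completion AE_completion elim: eventually_mono\<close>)
  then have "integrable lborel f'" by (subst (asm) integrable_completion) auto
  with AE show thesis by (rule that[rotated])
qed

text \<open>The radii are chosen so small that translations move both \<open>u\<close> and
  \<open>g\<close> little in the mean. Pointwise convergence almost everywhere is then obtained by
  passing to a subsequence, which preserves all the other properties.\<close>

lemma mollifier_sequence:
  fixes u :: "real ^ 'n \<Rightarrow> real" and g :: "real ^ 'n \<Rightarrow> 'b::euclidean_space"
  assumes u: "integrable lborel u" and g: "integrable lborel g" and R: "0 < R"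
  obtains \<epsilon> :: "nat \<Rightarrow> real" and \<psi> :: "nat \<Rightarrow> real ^ 'n \<Rightarrow> real" where
    "\<And>k. mollifier (\<epsilon> k) (\<psi> k)" "\<And>k. \<epsilon> k \<le> R" "\<epsilon> \<longlonglongrightarrow> 0"
    "(\<lambda>k. \<integral>\<^sup>+y. ennreal (norm (mollify (\<psi> k) u y - u y)) \<partial>lborel) \<longlonglongrightarrow> 0"
    "(\<lambda>k. \<integral>\<^sup>+y. ennreal (norm (mollify (\<psi> k) g y - g y)) \<partial>lborel) \<longlonglongrightarrow> 0"
    "AE y in lborel. (\<lambda>k. mollify (\<psi> k) u y) \<longlonglongrightarrow> u y"
proof -
  define e where "e k = 1 / real (Suc k)" for k
  have e: "0 < e k" for k by (simp add: e_def)
  have elim: "e \<longlonglongrightarrow> 0" unfolding e_def[abs_def] by (rule LIMSEQ_Suc[OF lim_1_over_n])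
  let ?P = "\<lambda>k p. mollifier (fst p) (snd p) \<and> 0 < fst p \<and> fst p \<le> R \<and> fst p \<le> e k \<and>
      (\<integral>\<^sup>+y. ennreal (norm (mollify (snd p) u y - u y)) \<partial>lborel) \<le> ennreal (e k) \<and>
      (\<integral>\<^sup>+y. ennreal (norm (mollify (snd p) g y - g y)) \<partial>lborel) \<le> ennreal (e k)"
  have "\<exists>p. ?P k p" for k
  proof -
    obtain d1 where d1: "0 < d1" "\<And>h. norm h < d1 \<Longrightarrow> (\<integral>\<^sup>+x. norm (u (x + h) - u x) \<partial>lborel) \<le> ennreal (e k)"
      using L1_continuous_translation[OF u e[of k]] by blast
    obtain d2 where d2: "0 < d2" "\<And>h. norm h < d2 \<Longrightarrow> (\<integral>\<^sup>+x. norm (g (x + h) - g x) \<partial>lborel) \<le> ennreal (e k)"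
      using L1_continuous_translation[OF g e[of k]] by blast
    define \<epsilon> where "\<epsilon> = min (min d1 d2) (min R (e k))"
    have \<epsilon>: "0 < \<epsilon>" "\<epsilon> \<le> d1" "\<epsilon> \<le> d2" "\<epsilon> \<le> R" "\<epsilon> \<le> e k" using d1 d2 R e[of k] by (auto simp: \<epsilon>_def)
    obtain \<psi> :: "real ^ 'n \<Rightarrow> real" where m: "mollifier \<epsilon> \<psi>" using mollifier_exists[OF \<epsilon>(1)] by blast
    have "?P k (\<epsilon>, \<psi>)"
      using m \<epsilon> mollify_L1_le[OF u m, of "ennreal (e k)"] mollify_L1_le[OF g m, of "ennreal (e k)"] d1(2) d2(2) by auto
    then show ?thesis by blast
  qed
  then have "\<forall>k. \<exists>p. ?P k p" by (rule allI)
  from choice[OF this] obtain p where p: "\<forall>k. ?P k (p k)" ..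
  define \<epsilon> where "\<epsilon> k = fst (p k)" for k
  define \<psi> where "\<psi> k = snd (p k)" for k
  have m: "mollifier (\<epsilon> k) (\<psi> k)" and \<epsilon>: "0 < \<epsilon> k" "\<epsilon> k \<le> R" "\<epsilon> k \<le> e k"
    and mu: "(\<integral>\<^sup>+y. ennreal (norm (mollify (\<psi> k) u y - u y)) \<partial>lborel) \<le> ennreal (e k)"
    and mg: "(\<integral>\<^sup>+y. ennreal (norm (mollify (\<psi> k) g y - g y)) \<partial>lborel) \<le> ennreal (e k)" for k
    using p by (auto simp: \<epsilon>_def \<psi>_def)
  have \<epsilon>lim: "\<epsilon> \<longlonglongrightarrow> 0"
    by (rule tendsto_sandwich[OF _ _ tendsto_const elim]) (use \<epsilon> in \<open>auto intro!: always_eventually less_imp_le\<close>)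
  have eelim: "(\<lambda>k. ennreal (e k)) \<longlonglongrightarrow> 0" using tendsto_ennrealI[OF elim] by simp
  have limu: "(\<lambda>k. \<integral>\<^sup>+y. ennreal (norm (mollify (\<psi> k) u y - u y)) \<partial>lborel) \<longlonglongrightarrow> 0"
    by (rule tendsto_sandwich[OF _ _ tendsto_const eelim]) (use mu in \<open>auto intro!: always_eventually\<close>)
  have limg: "(\<lambda>k. \<integral>\<^sup>+y. ennreal (norm (mollify (\<psi> k) g y - g y)) \<partial>lborel) \<longlonglongrightarrow> 0"
    by (rule tendsto_sandwich[OF _ _ tendsto_const eelim]) (use mg in \<open>auto intro!: always_eventually\<close>)
  have um [measurable]: "u \<in> borel_measurable borel" using u by auto
  have mm [measurable]: "mollify (\<psi> k) u \<in> borel_measurable borel" for k by (rule measurable_mollify[OF m um])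
  have int: "integrable lborel (\<lambda>y. mollify (\<psi> k) u y - u y)" for k
  proof (rule integrableI_bounded)
    show "(\<integral>\<^sup>+y. ennreal (norm (mollify (\<psi> k) u y - u y)) \<partial>lborel) < \<infinity>"
      using mu[of k] by (simp add: le_less_trans[OF _ ennreal_less_top])
  qed measurable
  have "(\<lambda>k. \<integral>y. norm (mollify (\<psi> k) u y - u y) \<partial>lborel) \<longlonglongrightarrow> 0"
  proof (rule tendsto_sandwich[OF _ _ tendsto_const elim])
    have "(\<integral>y. norm (mollify (\<psi> k) u y - u y) \<partial>lborel) \<le> e k" for k
    proof -
      have "ennreal (\<integral>y. norm (mollify (\<psi> k) u y - u y) \<partial>lborel) = (\<integral>\<^sup>+y. ennreal (norm (mollify (\<psi> k) u y - u y)) \<partial>lborel)"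
        using int[of k] by (intro nn_integral_eq_integral[symmetric]) auto
      then have "ennreal (\<integral>y. norm (mollify (\<psi> k) u y - u y) \<partial>lborel) \<le> ennreal (e k)"
        using mu[of k] by (simp only:)
      then show ?thesis by (simp only: ennreal_le_iff[OF less_imp_le[OF e]])
    qed
    then show "\<forall>\<^sub>F k in sequentially. (\<integral>y. norm (mollify (\<psi> k) u y - u y) \<partial>lborel) \<le> e k" by simp
  qed (auto intro!: always_eventually)
  from tendsto_L1_AE_subseq[OF int this] obtain r where r: "strict_mono r"
    "AE y in lborel. (\<lambda>k. mollify (\<psi> (r k)) u y - u y) \<longlonglongrightarrow> 0" by blast
  show thesis
  proof (rule that[of "\<lambda>k. \<epsilon> (r k)" "\<lambda>k. \<psi> (r k)"])
    show "(\<lambda>k. \<epsilon> (r k)) \<longlonglongrightarrow> 0" using LIMSEQ_subseq_LIMSEQ[OF \<epsilon>lim r(1)] by (simp add: o_def)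
    show "(\<lambda>k. \<integral>\<^sup>+y. ennreal (norm (mollify (\<psi> (r k)) u y - u y)) \<partial>lborel) \<longlonglongrightarrow> 0"
      using LIMSEQ_subseq_LIMSEQ[OF limu r(1)] by (simp add: o_def)
    show "(\<lambda>k. \<integral>\<^sup>+y. ennreal (norm (mollify (\<psi> (r k)) g y - g y)) \<partial>lborel) \<longlonglongrightarrow> 0"
      using LIMSEQ_subseq_LIMSEQ[OF limg r(1)] by (simp add: o_def)
    show "AE y in lborel. (\<lambda>k. mollify (\<psi> (r k)) u y) \<longlonglongrightarrow> u y"
      using r(2) by eventually_elim (simp add: LIM_zero_iff)
  qed (use m \<epsilon> in auto)
qed

text \<open>Everything is localised to a ball \<open>cball x R\<close> inside \<open>U\<close>. With
  mollification radii at most \<open>R / 2\<close>, the gradient of the mollified function is the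
  mollified weak gradient on \<open>cball x (R / 2)\<close>, so the oscillation and shell estimates
  apply to all shells inside that ball, and \<open>potential_infinite\<close> concludes.\<close>

lemma bad_point_potential:
  fixes u :: "real ^ 'n \<Rightarrow> real"
  assumes n: "2 \<le> CARD('n)" and A: "young_function A" and fin: "\<forall>t\<ge>0. young_lower CARD('n) A t < \<infinity>"
    and \<sigma>: "continuous_on {0..} \<sigma>" "\<forall>t\<ge>0. \<sigma> t \<ge> 0"
    and div: "\<forall>l>0. diverges_near_infinity
           (\<lambda>t. young_lower CARD('n) A (l * t) /
                (ennreal t * ennreal (\<sigma> t) * young_lower CARD('n) A t))"
    and \<Psi>: "\<forall>t\<ge>0. \<Psi> t = \<sigma> t * enn2real (young_lower CARD('n) A t)"
    and \<Omega>: "open \<Omega>" and wm: "weakly_monotone \<Omega> u" and um: "u \<in> borel_measurable (lebesgue_on \<Omega>)"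
    and U: "open U" "U \<subseteq> \<Omega>" and wg: "weak_gradient U u g" and \<Lambda>: "0 < \<Lambda>"
    and mod: "(\<integral>\<^sup>+y\<in>U. A (norm (g y) / \<Lambda>) \<partial>lebesgue) \<le> 1" and x: "x \<in> U" and L: "0 < L"
    and bad: "\<And>r m M. 0 < r \<Longrightarrow> cball x r \<subseteq> \<Omega> \<Longrightarrow> AE y in lborel. y \<in> ball x r \<longrightarrow> m \<le> u y \<and> u y \<le> M \<Longrightarrow> L \<le> M - m"
  shows "potential \<Psi> (\<lambda>y. A (norm (g y) / \<Lambda>) * indicator U y) x = \<infinity>"
proof -
  let ?n = "CARD('n)"
  obtain R where R: "0 < R" "cball x R \<subseteq> U" using open_contains_cball[of U] U(1) x by blast
  let ?V = "cball x R"
  have "set_integrable lebesgue ?V u" "set_integrable lebesgue ?V g"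
    using wg R unfolding weak_gradient_def locally_integrable_def by (meson compact_cball)+
  then have iu: "integrable lebesgue (\<lambda>y. indicator ?V y *\<^sub>R u y)" and ig: "integrable lebesgue (\<lambda>y. indicator ?V y *\<^sub>R g y)"
    by (simp_all add: set_integrable_def)
  obtain uB where uB: "integrable lborel uB" "AE y in lborel. uB y = indicator ?V y *\<^sub>R u y"
    using ex_borel_integrable[OF iu] by blast
  obtain gB where gB: "integrable lborel gB" "AE y in lborel. gB y = indicator ?V y *\<^sub>R g y"
    using ex_borel_integrable[OF ig] by blast
  have uB': "AE y in lborel. uB y = (if y \<in> ?V then u y else 0)" using uB(2) by eventually_elim (simp add: indicator_def)
  have gB': "AE y in lborel. gB y = (if y \<in> ?V then g y else 0)" using gB(2) by eventually_elim (simp add: indicator_def)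
  have [measurable]: "uB \<in> borel_measurable borel" "gB \<in> borel_measurable borel" using uB gB by auto
  obtain \<epsilon> \<psi> where m: "\<And>k. mollifier (\<epsilon> k) (\<psi> k)" and \<epsilon>R: "\<And>k. \<epsilon> k \<le> R / 2" and \<epsilon>: "\<epsilon> \<longlonglongrightarrow> 0"
    and lim1: "(\<lambda>k. \<integral>\<^sup>+y. ennreal (norm (mollify (\<psi> k) uB y - uB y)) \<partial>lborel) \<longlonglongrightarrow> 0"
    and lim2: "(\<lambda>k. \<integral>\<^sup>+y. ennreal (norm (mollify (\<psi> k) gB y - gB y)) \<partial>lborel) \<longlonglongrightarrow> 0"
    and limAE: "AE y in lborel. (\<lambda>k. mollify (\<psi> k) uB y) \<longlonglongrightarrow> uB y"
    using mollifier_sequence[OF uB(1) gB(1), of "R / 2"] R by auto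
  define w where "w k = mollify (\<psi> k) uB" for k
  define D where "D k = grad (w k)" for k
  have sm: "smooth (w k)" for k unfolding w_def by (rule mollify_smooth[OF uB(1) m])
  have w: "(w k has_derivative (\<lambda>h. D k y \<bullet> h)) (at y)" for k y
    unfolding D_def by (intro has_derivative_grad smooth_imp_differentiable sm)
  have D: "continuous_on UNIV (D k)" for k
    unfolding D_def by (intro smooth_imp_continuous_on_grad sm)
  have Dg: "D k y = mollify (\<psi> k) gB y" if "norm (y - x) \<le> R / 2" for k y
    unfolding D_def w_def
  proof (rule grad_mollify_eq_mollify[OF wg R(2) m _ uB(1) uB' gB(1) gB'])
    show "cball y (\<epsilon> k) \<subseteq> ?V"
    proof
      fix z assume "z \<in> cball y (\<epsilon> k)"
      then have "norm (z - y) \<le> R / 2" using \<epsilon>R[of k] by (simp add: dist_norm norm_minus_commute)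
      then have "norm (z - x) \<le> R" using that norm_triangle_ineq[of "z - y" "y - x"] by simp
      then show "z \<in> ?V" by (simp add: dist_norm norm_minus_commute)
    qed
  qed
  have osc: "eventually (\<lambda>k. \<exists>y z. norm (y - x) = r \<and> norm (z - x) = r \<and> L / 4 \<le> w k y - w k z) sequentially"
    if r: "0 < r" "r \<le> R / 2" for r
  proof (rule eventually_large_oscillation[OF wm um \<Omega> r(1) _ uB(1) gB(1) _ w D _ _ _ L])
    have rV: "cball x r \<subseteq> ?V" using r R by auto
    then show sub: "cball x r \<subseteq> \<Omega>" using R U by blast
    show "AE y in lborel. y \<in> ball x r \<longrightarrow> u y = uB y"
      using uB' by eventually_elim (use r R in auto)
    show "(\<lambda>k. \<integral>\<^sup>+y\<in>ball x r. ennreal \<bar>uB y - w k y\<bar> \<partial>lborel) \<longlonglongrightarrow> 0"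
    proof (rule tendsto_sandwich[OF _ _ tendsto_const lim1])
      show "\<forall>\<^sub>F k in sequentially. (\<integral>\<^sup>+y\<in>ball x r. ennreal \<bar>uB y - w k y\<bar> \<partial>lborel) \<le> (\<integral>\<^sup>+y. ennreal (norm (mollify (\<psi> k) uB y - uB y)) \<partial>lborel)"
        by (intro always_eventually allI nn_integral_mono) (auto simp: w_def indicator_def abs_minus_commute)
    qed auto
    show "(\<lambda>k. \<integral>\<^sup>+y\<in>ball x r. ennreal (norm (gB y - D k y)) \<partial>lborel) \<longlonglongrightarrow> 0"
    proof (rule tendsto_sandwich[OF _ _ tendsto_const lim2])
      have "ennreal (norm (gB y - D k y)) * indicator (ball x r) y \<le> ennreal (norm (mollify (\<psi> k) gB y - gB y))" for k y
        using Dg[of y k] r by (auto simp: indicator_def dist_norm norm_minus_commute)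
      then show "\<forall>\<^sub>F k in sequentially. (\<integral>\<^sup>+y\<in>ball x r. ennreal (norm (gB y - D k y)) \<partial>lborel) \<le> (\<integral>\<^sup>+y. ennreal (norm (mollify (\<psi> k) gB y - gB y)) \<partial>lborel)"
        by (intro always_eventually allI nn_integral_mono)
    qed auto
    show "AE y in lborel. y \<in> ball x r \<longrightarrow> (\<lambda>k. w k y) \<longlonglongrightarrow> uB y"
      using limAE by eventually_elim (simp add: w_def)
    show "L \<le> M - m" if "AE y in lborel. y \<in> ball x r \<longrightarrow> m \<le> u y \<and> u y \<le> M" for m M
      by (rule bad[OF r(1) sub that])
  qed
  define gL where "gL y = (1 / \<Lambda>) *\<^sub>R gB y" for y
  have gLm [measurable]: "gL \<in> borel_measurable borel" unfolding gL_def[abs_def] by measurable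
  have ngL: "norm (gL y) = norm (gB y) / \<Lambda>" for y using \<Lambda> by (simp add: gL_def)
  define f where "f y = A (max 0 (norm (gL y)))" for y
  have fm [measurable]: "f \<in> borel_measurable borel"
    unfolding f_def[abs_def] by (rule measurable_compose[OF _ measurable_young_function[OF A]]) measurable
  have fA: "f y = A (norm (gL y))" for y by (simp add: f_def)
  have A0: "A 0 = 0" using A by (simp add: young_function_def)
  \<comment> \<open>Outside \<open>cball x R\<close> the cut off gradient is zero and so is
    \<open>A 0\<close>. Thus the density used for the shells lies below the global one, and an
    infinite potential passes from the former to the latter.\<close>
  have fle: "AE y in lborel. f y \<le> A (norm (g y) / \<Lambda>) * indicator U y"
    using gB' by eventually_elim (use R(2) in \<open>auto simp: fA ngL A0\<close>)
  have fint: "(\<integral>\<^sup>+y. A (norm (gL y)) \<partial>lborel) < \<infinity>"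
  proof -
    have "(\<integral>\<^sup>+y. A (norm (gL y)) \<partial>lborel) \<le> (\<integral>\<^sup>+y\<in>U. A (norm (g y) / \<Lambda>) \<partial>lborel)"
      using fle unfolding fA by (rule nn_integral_mono_AE)
    also have "\<dots> \<le> 1" using mod by (simp add: nn_integral_completion)
    finally show ?thesis by (simp add: le_less_trans)
  qed
  \<comment> \<open>The \<open>4\<close> is the loss in passing from the essential oscillation
    \<open>L\<close> on balls to the oscillation of mollifications on spheres;
    \<open>\<Lambda>\<close> rescales \<open>u\<close> so that the modular of its gradient is at
    most 1.\<close>
  define l where "l = shell_const ?n * (L / (4 * \<Lambda>))"
  have l: "0 < l" using shell_const_pos[OF n] L \<Lambda> by (simp add: l_def)
  have shell: "ennreal ((b - a) * a ^ (?n - 1)) * young_lower ?n A (l / a)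
        \<le> (\<integral>\<^sup>+y\<in>{y. a \<le> norm (y - x) \<and> norm (y - x) \<le> b}. f y \<partial>lborel)"
    if ab: "0 < a" "a < b" "b \<le> 2 * a" "b \<le> R / 2" for a b
    unfolding l_def fA
  proof (rule shell_lower_bound[OF n A fin ab(1-3) _ _ _ m \<epsilon> gLm _ fint,
        where w = "\<lambda>k y. w k y / \<Lambda>" and D = "\<lambda>k y. (1 / \<Lambda>) *\<^sub>R D k y"])
    show "0 < L / (4 * \<Lambda>)" using L \<Lambda> by simp
    show "((\<lambda>y. w k y / \<Lambda>) has_derivative (\<lambda>h. ((1 / \<Lambda>) *\<^sub>R D k y) \<bullet> h)) (at y)" for k y
      using has_derivative_mult_right[OF w[of k y], of "1 / \<Lambda>"] by simp
    show "continuous_on UNIV (\<lambda>y. (1 / \<Lambda>) *\<^sub>R D k y)" for k by (intro continuous_intros D)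
    show "(1 / \<Lambda>) *\<^sub>R D k y = mollify (\<psi> k) gL y" if "a < norm (y - x)" "norm (y - x) < b" for k y
    proof -
      have "mollify (\<psi> k) gL y = (1 / \<Lambda>) *\<^sub>R mollify (\<psi> k) gB y"
        unfolding mollify_def gL_def by (simp add: scaleR_left_commute[of _ "1 / \<Lambda>"] del: scaleR_scaleR)
      then show ?thesis using Dg[of y k] that ab by simp
    qed
    show "eventually (\<lambda>k. \<exists>p q. norm p = 1 \<and> norm q = 1 \<and> L / (4 * \<Lambda>) \<le> w k (x + r *\<^sub>R p) / \<Lambda> - w k (x + r *\<^sub>R q) / \<Lambda>) sequentially"
      if r: "a \<le> r" "r \<le> b" for r
    proof -
      have r0: "0 < r" "r \<le> R / 2" using r ab by auto
      from osc[OF r0] show ?thesis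
      proof eventually_elim
        case (elim k)
        then obtain y z where yz: "norm (y - x) = r" "norm (z - x) = r" "L / 4 \<le> w k y - w k z" by blast
        have "L / (4 * \<Lambda>) = (L / 4) / \<Lambda>" by simp
        also have "\<dots> \<le> (w k y - w k z) / \<Lambda>" using yz(3) \<Lambda> by (intro divide_right_mono) auto
        also have "\<dots> = w k (x + r *\<^sub>R ((1 / r) *\<^sub>R (y - x))) / \<Lambda> - w k (x + r *\<^sub>R ((1 / r) *\<^sub>R (z - x))) / \<Lambda>"
          using r0 by (simp add: diff_divide_distrib)
        finally show ?case using yz r0
          by (intro exI[of _ "(1 / r) *\<^sub>R (y - x)"] exI[of _ "(1 / r) *\<^sub>R (z - x)"] conjI) auto
      qed
    qed
  qed
  have "\<infinity> = (\<integral>\<^sup>+y. f y / ennreal (norm (x - y) ^ ?n * \<Psi> (1 / norm (x - y))) \<partial>lborel)"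
    using potential_infinite[OF n A fin \<sigma> div[rule_format, OF l] \<Psi> l _ fm shell, of "R / 2"] R by simp
  also have "\<dots> \<le> (\<integral>\<^sup>+y. (A (norm (g y) / \<Lambda>) * indicator U y) / ennreal (norm (x - y) ^ ?n * \<Psi> (1 / norm (x - y))) \<partial>lborel)"
    using fle by (intro nn_integral_mono_AE) (auto elim!: eventually_mono intro: divide_right_mono_ennreal)
  also have "\<dots> = potential \<Psi> (\<lambda>y. A (norm (g y) / \<Lambda>) * indicator U y) x"
    by (simp add: potential_def nn_integral_completion)
  finally show ?thesis by (simp add: top_unique)
qed

section \<open>Capacity of the exceptional set\<close>

text \<open>Dividing by \<open>c\<close> turns a simple function below \<open>c * h\<close> into a
  simple function below \<open>h\<close>. Only simple functions are integrated with a factor, so no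
  measurability of \<open>h\<close> enters.\<close>

lemma nn_integral_cmult_le:
  fixes h :: "'a \<Rightarrow> ennreal"
  assumes c: "0 < c"
  shows "(\<integral>\<^sup>+y. ennreal c * h y \<partial>M) \<le> ennreal c * (\<integral>\<^sup>+y. h y \<partial>M)"
  unfolding nn_integral_def[of M "\<lambda>y. ennreal c * h y"]
proof (rule SUP_least)
  fix s assume "s \<in> {g. simple_function M g \<and> g \<le> (\<lambda>y. ennreal c * h y)}"
  then have s: "simple_function M s" "\<And>y. s y \<le> ennreal c * h y" by (auto simp: le_fun_def)
  have c1: "ennreal (1 / c) * (ennreal c * a) = a" "ennreal c * (ennreal (1 / c) * a) = a" for a
    using c by (simp_all add: mult.assoc[symmetric] ennreal_mult'[symmetric])
  have "integral\<^sup>S M s = (\<integral>\<^sup>+y. s y \<partial>M)" by (rule nn_integral_eq_simple_integral[symmetric, OF s(1)])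
  also have "\<dots> = (\<integral>\<^sup>+y. ennreal c * (ennreal (1 / c) * s y) \<partial>M)" by (simp only: c1)
  also have "\<dots> = ennreal c * (\<integral>\<^sup>+y. ennreal (1 / c) * s y \<partial>M)"
    by (rule nn_integral_cmult) (use borel_measurable_simple_function[OF s(1)] in measurable)
  also have "\<dots> \<le> ennreal c * (\<integral>\<^sup>+y. h y \<partial>M)"
  proof (intro mult_left_mono nn_integral_mono)
    fix y
    have "ennreal (1 / c) * s y \<le> ennreal (1 / c) * (ennreal c * h y)" by (intro mult_left_mono s(2)) simp
    then show "ennreal (1 / c) * s y \<le> h y" by (simp only: c1)
  qed simp
  finally show "integral\<^sup>S M s \<le> ennreal c * (\<integral>\<^sup>+y. h y \<partial>M)" .
qed

text \<open>The kernel need not be measurable here, hence the detour through the previous lemma.\<close>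

lemma capacity_zeroI:
  fixes f :: "nat \<Rightarrow> real ^ 'n \<Rightarrow> ennreal"
  assumes fm: "\<And>i. f i \<in> borel_measurable lebesgue" and f1: "\<And>i. (\<integral>\<^sup>+y. f i y \<partial>lebesgue) \<le> 1"
    and E: "\<And>x. x \<in> E \<Longrightarrow> \<exists>i. potential \<Psi> (f i) x = \<infinity>"
  shows "capacity \<Psi> E = 0"
proof -
  have "capacity \<Psi> E \<le> 0 + ennreal e" if e: "0 < e" for e
  proof -
    \<comment> \<open>The weights sum to \<open>e\<close>, so the weighted sum of the
      \<open>f i\<close> has integral at most \<open>e\<close>. Each weight is positive, so wherever
      some \<open>f i\<close> has infinite potential the sum has infinite potential too.\<close>
    define c where "c i = e * (1 / 2) ^ Suc i" for i :: nat
    have c: "0 < c i" for i using e by (simp add: c_def)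
    have csum: "(\<Sum>i. ennreal (c i)) = ennreal e"
    proof -
      have "c sums (e * 1)" unfolding c_def by (intro sums_mult power_half_series)
      then have "c sums e" by simp
      then show ?thesis using c by (intro suminf_ennreal_eq) (auto intro: less_imp_le)
    qed
    define F where "F y = (\<Sum>i. ennreal (c i) * f i y)" for y
    note fm [measurable]
    have Fm: "F \<in> borel_measurable lebesgue" unfolding F_def[abs_def] by measurable
    have "(\<integral>\<^sup>+y. F y \<partial>lebesgue) = (\<Sum>i. \<integral>\<^sup>+y. ennreal (c i) * f i y \<partial>lebesgue)"
      unfolding F_def by (rule nn_integral_suminf) measurable
    also have "\<dots> = (\<Sum>i. ennreal (c i) * (\<integral>\<^sup>+y. f i y \<partial>lebesgue))"
      by (intro suminf_cong nn_integral_cmult fm)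
    also have "\<dots> \<le> (\<Sum>i. ennreal (c i) * 1)"
      by (intro suminf_le mult_left_mono f1) auto
    also have "\<dots> = ennreal e" using csum by simp
    finally have int: "(\<integral>\<^sup>+y. F y \<partial>lebesgue) \<le> ennreal e" .
    have pot: "1 \<le> potential \<Psi> F x" if x: "x \<in> E" for x
    proof -
      obtain i where i: "potential \<Psi> (f i) x = \<infinity>" using E[OF x] by blast
      let ?k = "\<lambda>y. ennreal (norm (x - y) ^ CARD('n) * \<Psi> (1 / norm (x - y)))"
      have "f i y \<le> ennreal (1 / c i) * F y" for y
      proof -
        have "(\<Sum>j\<in>{i}. ennreal (c j) * f j y) \<le> F y"
          unfolding F_def by (rule sum_le_suminf) auto
        then have "ennreal (1 / c i) * (ennreal (c i) * f i y) \<le> ennreal (1 / c i) * F y"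
          by (intro mult_left_mono) auto
        moreover have "ennreal (1 / c i) * ennreal (c i) = 1"
          using c[of i] by (subst ennreal_mult'[symmetric]) auto
        ultimately show ?thesis by (simp only: mult.assoc[symmetric] mult_1)
      qed
      then have "f i y / ?k y \<le> ennreal (1 / c i) * (F y / ?k y)" for y
        unfolding ennreal_times_divide by (rule divide_right_mono_ennreal)
      then have le: "potential \<Psi> (f i) x \<le> (\<integral>\<^sup>+y. ennreal (1 / c i) * (F y / ?k y) \<partial>lebesgue)"
        unfolding potential_def by (intro nn_integral_mono)
      show ?thesis
      proof (rule ccontr)
        assume "\<not> 1 \<le> potential \<Psi> F x"
        then have P: "potential \<Psi> F x < \<infinity>" by (simp add: not_le order.strict_trans[of _ 1 top])
        have "potential \<Psi> (f i) x \<le> (\<integral>\<^sup>+y. ennreal (1 / c i) * (F y / ?k y) \<partial>lebesgue)" by (rule le)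
        also have "\<dots> \<le> ennreal (1 / c i) * potential \<Psi> F x"
          unfolding potential_def by (rule nn_integral_cmult_le) (use c[of i] in simp)
        also have "\<dots> < \<infinity>" using P by (simp add: ennreal_mult_less_top)
        finally show False using i by simp
      qed
    qed
    have "capacity \<Psi> E \<le> (\<integral>\<^sup>+y. F y \<partial>lebesgue)"
      unfolding capacity_def using Fm pot by (intro Inf_lower) blast
    with int show ?thesis by simp
  qed
  then have "capacity \<Psi> E \<le> 0" by (rule ennreal_le_epsilon)
  then show ?thesis by simp
qed

lemma measurable_young_modular:
  assumes A: "young_function A" and g: "(\<lambda>y. norm (g y)) \<in> borel_measurable (lebesgue_on U)" and U: "U \<in> sets borel"
    and l: "0 < l"
  shows "(\<lambda>y. A (norm (g y) / l) * indicator U y) \<in> borel_measurable (lebesgue :: 'a::euclidean_space measure)"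
proof -
  have "(\<lambda>y. A (max 0 (norm (g y) / l))) \<in> borel_measurable (lebesgue_on U)"
    by (rule measurable_compose[OF _ measurable_young_function[OF A]]) (intro borel_measurable_divide g borel_measurable_const)
  then have "(\<lambda>y. A (norm (g y) / l)) \<in> borel_measurable (lebesgue_on U)" using l by simp
  then show ?thesis using U by (subst (asm) borel_measurable_restrict_space_iff_ennreal) auto
qed

text \<open>The bound is imposed on all pairs of essential bounds \<open>m\<close> and
  \<open>M\<close> on the ball, and not on a difference of essential extrema. Where \<open>u\<close>
  has no such bounds on any ball the condition is vacuous, so points of local essential
  unboundedness belong to the set.\<close>

definition oscillation_set :: "(real ^ 'n) set \<Rightarrow> (real ^ 'n \<Rightarrow> real) \<Rightarrow> (real ^ 'n) set" where
  "oscillation_set \<Omega> u = {x \<in> \<Omega>. \<exists>L>0. \<forall>r>0. cball x r \<subseteq> \<Omega> \<longrightarrow>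
     (\<forall>m M. (AE y in lborel. y \<in> ball x r \<longrightarrow> m \<le> u y \<and> u y \<le> M) \<longrightarrow> L \<le> M - m)}"

text \<open>The membership of \<open>u\<close> is only local: the weak gradient and the scale that
  makes its modular at most 1 depend on the ball. By Lindelof countably many balls cover
  \<open>\<Omega>\<close>, and each supplies one density of integral at most 1 for
  \<open>capacity_zeroI\<close>.\<close>

lemma capacity_oscillation_set:
  fixes \<Omega> :: "(real ^ 'n) set"
  assumes n: "2 \<le> CARD('n)" and A: "young_function A" and fin: "\<forall>t\<ge>0. young_lower CARD('n) A t < \<infinity>"
    and \<sigma>: "continuous_on {0..} \<sigma>" "\<forall>t\<ge>0. \<sigma> t \<ge> 0"
    and div: "\<forall>l>0. diverges_near_infinity
           (\<lambda>t. young_lower CARD('n) A (l * t) /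
                (ennreal t * ennreal (\<sigma> t) * young_lower CARD('n) A t))"
    and \<Psi>: "\<forall>t\<ge>0. \<Psi> t = \<sigma> t * enn2real (young_lower CARD('n) A t)"
    and \<Omega>: "open \<Omega>" and wm: "weakly_monotone \<Omega> u" and u: "u \<in> orlicz_sobolev_loc A \<Omega>"
  shows "capacity \<Psi> (oscillation_set \<Omega> u) = 0"
proof -
  have um: "u \<in> borel_measurable (lebesgue_on \<Omega>)" using u by (simp add: orlicz_sobolev_loc_def)
  \<comment> \<open>The empty set is added so that the family can be enumerated by the natural
    numbers even if \<open>\<Omega>\<close> is empty.\<close>
  define \<F> where "\<F> = insert {} {ball x r | x r. 0 < r \<and> cball x r \<subseteq> \<Omega>}"
  have F: "open S \<and> S \<subseteq> \<Omega> \<and> bounded S \<and> compactly_inside S \<Omega>" if "S \<in> \<F>" for S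
    using that ball_subset_cball by (auto simp: \<F>_def compactly_inside_def)
  obtain \<F>' where F': "\<F>' \<subseteq> \<F>" "countable \<F>'" "\<Union>\<F>' = \<Union>\<F>" using Lindelof[of \<F>] F by blast
  define V where "V = from_nat_into (insert {} \<F>')"
  have V: "V i \<in> \<F>" for i
    using from_nat_into[of "insert {} \<F>'" i] F' by (auto simp: V_def \<F>_def)
  have cov: "\<exists>i. x \<in> V i" if x: "x \<in> \<Omega>" for x
  proof -
    obtain r where "0 < r" "cball x r \<subseteq> \<Omega>" using open_contains_cball[of \<Omega>] \<Omega> x by blast
    then have "x \<in> \<Union>\<F>" by (auto simp: \<F>_def intro!: exI[of _ "ball x r"])
    then obtain S where "S \<in> \<F>'" "x \<in> S" unfolding F'(3)[symmetric] by blast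
    moreover obtain i where "S = V i"
      using from_nat_into_surj[of "insert {} \<F>'" S] F'(2) \<open>S \<in> \<F>'\<close> unfolding V_def by auto
    ultimately show ?thesis by blast
  qed
  have "\<exists>g l. weak_gradient (V i) u g \<and> (\<lambda>y. norm (g y)) \<in> borel_measurable (lebesgue_on (V i)) \<and> 0 < l \<and>
      (\<integral>\<^sup>+y\<in>V i. A (norm (g y) / l) \<partial>lebesgue) \<le> 1" (is "\<exists>g l. ?P i g l") for i
  proof -
    have "u \<in> orlicz_sobolev A (V i)" using u F[OF V[of i]] by (simp add: orlicz_sobolev_loc_def)
    then obtain g where g: "weak_gradient (V i) u g" "(\<lambda>x. norm (g x)) \<in> orlicz A (V i)"
      by (auto simp: orlicz_sobolev_def)
    then have "luxemburg_norm A (V i) (\<lambda>x. norm (g x)) < \<infinity>" and gm: "(\<lambda>y. norm (g y)) \<in> borel_measurable (lebesgue_on (V i))"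
      by (auto simp: orlicz_def)
    then obtain l where "0 < l" "(\<integral>\<^sup>+y\<in>V i. A (\<bar>norm (g y)\<bar> / l) \<partial>lebesgue) \<le> 1"
      unfolding luxemburg_norm_def by (auto simp: Inf_less_iff)
    then show ?thesis using g(1) gm by auto
  qed
  then have "\<forall>i. \<exists>p. ?P i (fst p) (snd p)" by fastforce
  from choice[OF this] obtain p where p: "\<forall>i. ?P i (fst (p i)) (snd (p i))" ..
  define g where "g i = fst (p i)" for i
  define l where "l i = snd (p i)" for i
  have g: "\<And>i. weak_gradient (V i) u (g i)" "\<And>i. (\<lambda>y. norm (g i y)) \<in> borel_measurable (lebesgue_on (V i))"
    and l: "\<And>i. 0 < l i" "\<And>i. (\<integral>\<^sup>+y\<in>V i. A (norm (g i y) / l i) \<partial>lebesgue) \<le> 1"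
    using p by (auto simp: g_def l_def)
  show ?thesis
  proof (rule capacity_zeroI[where f = "\<lambda>i y. A (norm (g i y) / l i) * indicator (V i) y"])
    show "(\<lambda>y. A (norm (g i y) / l i) * indicator (V i) y) \<in> borel_measurable lebesgue" for i
      using F[OF V[of i]] by (intro measurable_young_modular A g l) auto
    show "(\<integral>\<^sup>+y. A (norm (g i y) / l i) * indicator (V i) y \<partial>lebesgue) \<le> 1" for i by (rule l)
    fix x assume "x \<in> oscillation_set \<Omega> u"
    then obtain L where x: "x \<in> \<Omega>" and L: "0 < L"
      and bad: "\<And>r m M. 0 < r \<Longrightarrow> cball x r \<subseteq> \<Omega> \<Longrightarrow> AE y in lborel. y \<in> ball x r \<longrightarrow> m \<le> u y \<and> u y \<le> M \<Longrightarrow> L \<le> M - m"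
      by (auto simp: oscillation_set_def)
    obtain i where i: "x \<in> V i" using cov[OF x] by blast
    have "potential \<Psi> (\<lambda>y. A (norm (g i y) / l i) * indicator (V i) y) x = \<infinity>"
      using F[OF V[of i]]
      by (intro bad_point_potential[OF n A fin \<sigma> div \<Psi> \<Omega> wm um _ _ g(1) l i L bad]) auto
    then show "\<exists>i. potential \<Psi> (\<lambda>y. A (norm (g i y) / l i) * indicator (V i) y) x = \<infinity>" by blast
  qed
qed

section \<open>The continuous representative\<close>

lemma AE_ball_bounds_meet:
  fixes u :: "'a::euclidean_space \<Rightarrow> real"
  assumes "0 < r" "0 < s" "AE y in lborel. y \<in> ball x r \<longrightarrow> m \<le> u y" "AE y in lborel. y \<in> ball x s \<longrightarrow> u y \<le> M"
  shows "m \<le> M"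
proof (rule ccontr)
  assume nle: "\<not> m \<le> M"
  let ?B = "ball x (min r s)"
  have "AE y in lborel. y \<notin> ?B"
    using assms(3,4) by eventually_elim (use nle in auto)
  then have "emeasure lborel ?B = 0"
    by (intro AE_iff_measurable[THEN iffD1, of _ _ "\<lambda>y. y \<notin> ?B"]) auto
  moreover have rs: "0 < min r s" using assms(1,2) by simp
  have "0 < unit_ball_vol (real DIM('a)) * min r s ^ DIM('a)" by (intro mult_pos_pos zero_less_power rs) simp
  then have "0 < emeasure lborel ?B" unfolding emeasure_ball[OF less_imp_le[OF rs]] ennreal_less_zero_iff .
  ultimately show False by simp
qed

text \<open>Off the exceptional set the essential oscillation over small balls tends to zero, so the
  supremum of the essential lower bounds near \<open>x\<close> is a limit value of \<open>u\<close>.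
  It lies between any essential bounds valid on a ball around \<open>x\<close>, which yields
  continuity at once; agreement with \<open>u\<close> almost everywhere follows by testing with
  countably many balls and levels.\<close>

lemma continuous_representative_off_oscillation_set:
  fixes u :: "real ^ 'n \<Rightarrow> real"
  assumes \<Omega>: "open \<Omega>"
  obtains v where "AE x in lebesgue_on \<Omega>. v x = u x" "continuous_on (\<Omega> - oscillation_set \<Omega> u) v"
proof -
  let ?E = "oscillation_set \<Omega> u"
  define lower where "lower x = {m. \<exists>r>0. AE y in lborel. y \<in> ball x r \<longrightarrow> m \<le> u y}" for x
  \<comment> \<open>Keeping \<open>u\<close> on the exceptional set makes the agreement almost
    everywhere independent of whether that set is Lebesgue null.\<close>
  define v where "v x = (if x \<in> ?E then u x else Sup (lower x))" for x
  have good: "\<exists>r m M. 0 < r \<and> (AE y in lborel. y \<in> ball x r \<longrightarrow> m \<le> u y \<and> u y \<le> M) \<and> M - m < e"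
    if "x \<in> \<Omega> - ?E" "0 < e" for x e
    using that unfolding oscillation_set_def by (force simp: not_le)
  \<comment> \<open>The ball need only contain \<open>x\<close> and need not be centred there, so
    one ball controls \<open>v\<close> at all its points off the exceptional set
    simultaneously.\<close>
  have between: "m \<le> v x \<and> v x \<le> M"
    if x: "x \<in> \<Omega> - ?E" and "x \<in> ball z r" and AE: "AE y in lborel. y \<in> ball z r \<longrightarrow> m \<le> u y \<and> u y \<le> M" for x z r m M
  proof -
    obtain s where s: "0 < s" "ball x s \<subseteq> ball z r"
      using \<open>x \<in> ball z r\<close> open_contains_ball[of "ball z r"] open_ball[of z r] by blast
    have m: "AE y in lborel. y \<in> ball x s \<longrightarrow> m \<le> u y" and M: "AE y in lborel. y \<in> ball x s \<longrightarrow> u y \<le> M"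
      using AE s(2) by (auto elim!: eventually_mono)
    have min: "m \<in> lower x" using s m by (auto simp: lower_def)
    have up: "m' \<le> M" if "m' \<in> lower x" for m'
      using that AE_ball_bounds_meet[OF _ s(1) _ M] by (auto simp: lower_def)
    have "m \<le> Sup (lower x)" using up by (intro cSup_upper min bdd_aboveI)
    moreover have "Sup (lower x) \<le> M" using min up by (intro cSup_least) auto
    ultimately show ?thesis using x by (simp add: v_def)
  qed
  have cont: "continuous_on (\<Omega> - ?E) v"
    unfolding continuous_on_iff
  proof (intro ballI allI impI)
    fix x e assume x: "x \<in> \<Omega> - ?E" and e: "(0::real) < e"
    obtain r m M where r: "0 < r" "AE y in lborel. y \<in> ball x r \<longrightarrow> m \<le> u y \<and> u y \<le> M" "M - m < e"
      using good[OF x e] by blast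
    have "dist (v y) (v x) < e" if "y \<in> \<Omega> - ?E" "dist y x < r" for y
      using between[OF that(1) _ r(2)] between[OF x _ r(2)] that(2) r by (auto simp: dist_real_def dist_commute)
    then show "\<exists>d>0. \<forall>y\<in>\<Omega> - ?E. dist y x < d \<longrightarrow> dist (v y) (v x) < e" using r(1) by blast
  qed
  obtain Q :: "(real ^ 'n) set" where Q: "countable Q" "\<And>X. open X \<Longrightarrow> X \<noteq> {} \<Longrightarrow> \<exists>d\<in>Q. d \<in> X"
    using countable_dense_setE by metis
  \<comment> \<open>Each essential bound fails on a null set that depends on ball and level.
    Restricting centres to a countable dense set, and radii and levels to rationals, leaves a single
    null set.\<close>
  let ?I = "Q \<times> (\<rat> :: real set) \<times> (\<rat> :: real set)"
  have cI: "countable ?I" using Q(1) by (intro countable_SIGMA countable_rat)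
  have "AE x in lborel. \<forall>p\<in>?I. (AE y in lborel. y \<in> ball (fst p) (fst (snd p)) \<longrightarrow> snd (snd p) \<le> u y) \<longrightarrow>
      x \<in> ball (fst p) (fst (snd p)) \<longrightarrow> snd (snd p) \<le> u x"
    unfolding AE_ball_countable[OF cI] by auto
  moreover have "AE x in lborel. \<forall>p\<in>?I. (AE y in lborel. y \<in> ball (fst p) (fst (snd p)) \<longrightarrow> u y \<le> snd (snd p)) \<longrightarrow>
      x \<in> ball (fst p) (fst (snd p)) \<longrightarrow> u x \<le> snd (snd p)"
    unfolding AE_ball_countable[OF cI] by auto
  ultimately have "AE x in lborel. x \<in> \<Omega> \<longrightarrow> v x = u x"
  proof eventually_elim
    case (elim x)
    show ?case
    proof (rule impI, cases "x \<in> ?E")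
      case True
      then show "v x = u x" by (simp add: v_def)
    next
      case False
      assume "x \<in> \<Omega>"
      with False have x: "x \<in> \<Omega> - ?E" by simp
      have "\<bar>v x - u x\<bar> \<le> 0 + e" if e: "0 < e" for e
      proof -
        obtain r m M where r: "0 < r" "AE y in lborel. y \<in> ball x r \<longrightarrow> m \<le> u y \<and> u y \<le> M" "M - m < e / 3"
          using good[OF x, of "e / 3"] e by auto
        \<comment> \<open>A centre within \<open>r / 4\<close> of \<open>x\<close> and a radius
          between \<open>r / 4\<close> and \<open>r / 2\<close> give a ball of the countable family
          that contains \<open>x\<close> and lies in \<open>ball x r\<close>. The rational levels
          lose at most \<open>e / 3\<close> on either side.\<close>
        obtain c where c: "c \<in> Q" "c \<in> ball x (r / 4)" using Q(2)[of "ball x (r / 4)"] r(1) by auto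
        obtain \<rho> where \<rho>: "\<rho> \<in> \<rat>" "r / 4 < \<rho>" "\<rho> < r / 2" using Rats_dense_in_real[of "r / 4" "r / 2"] r(1) by auto
        obtain m' where m': "m' \<in> \<rat>" "m - e / 3 < m'" "m' < m" using Rats_dense_in_real[of "m - e / 3" m] e by auto
        obtain M' where M': "M' \<in> \<rat>" "M < M'" "M' < M + e / 3" using Rats_dense_in_real[of M "M + e / 3"] e by auto
        have xc: "x \<in> ball c \<rho>" using c \<rho> by (simp add: dist_commute)
        have sub: "ball c \<rho> \<subseteq> ball x r"
        proof
          fix y assume "y \<in> ball c \<rho>"
          then show "y \<in> ball x r" using c \<rho> dist_triangle[of x y c] by simp
        qed
        have "AE y in lborel. y \<in> ball c \<rho> \<longrightarrow> m' \<le> u y" "AE y in lborel. y \<in> ball c \<rho> \<longrightarrow> u y \<le> M'"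
          using r(2) sub m' M' by (auto elim!: eventually_mono)
        then have "m' \<le> u x" "u x \<le> M'"
          using elim(1)[rule_format, of "(c, \<rho>, m')"] elim(2)[rule_format, of "(c, \<rho>, M')"] c \<rho> m' M' xc by auto
        moreover have "m \<le> v x" "v x \<le> M" using between[OF x _ r(2)] r(1) by auto
        ultimately show ?thesis using m' M' r(3) e by linarith
      qed
      then have "\<bar>v x - u x\<bar> \<le> 0" by (rule field_le_epsilon)
      then show "v x = u x" by simp
    qed
  qed
  then have "AE x in lebesgue. x \<in> \<Omega> \<longrightarrow> v x = u x" by (rule AE_completion)
  then have "AE x in lebesgue_on \<Omega>. v x = u x"
    using \<Omega> by (subst AE_restrict_space_iff) auto
  then show thesis using that cont by blast
qed

theorem theorem3p3:
  fixes \<Omega> :: "(real ^ 'n) set"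
    and A :: "real \<Rightarrow> ennreal"
    and \<sigma> \<Psi> :: "real \<Rightarrow> real"
  assumes "CARD('n) \<ge> 2"
    and "open \<Omega>"
    and "young_function A"
    and "CARD('n) = 2 \<or>
         CARD('n) \<ge> 3 \<and>
         converges_near_infinity (\<lambda>t. epowr (ennreal t / A t) (1 / (real CARD('n) - 2)))"
    and "\<forall>t\<ge>0. young_lower CARD('n) A t < \<infinity>"
    and "continuous_on {0..} \<sigma>"
    and "\<forall>t\<ge>0. \<sigma> t \<ge> 0"
    and "\<forall>l>0. diverges_near_infinity
           (\<lambda>t. young_lower CARD('n) A (l * t) /
                (ennreal t * ennreal (\<sigma> t) * young_lower CARD('n) A t))"
    and "\<forall>t\<ge>0. \<Psi> t = \<sigma> t * enn2real (young_lower CARD('n) A t)"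
  shows "\<forall>u. u \<in> orlicz_sobolev_loc A \<Omega> \<and> weakly_monotone \<Omega> u \<longrightarrow>
           (\<exists>v E. (AE x in lebesgue_on \<Omega>. v x = u x) \<and>
                  E \<subseteq> \<Omega> \<and> capacity \<Psi> E = 0 \<and> continuous_on (\<Omega> - E) v)"
proof (intro allI impI)
  fix u assume u: "u \<in> orlicz_sobolev_loc A \<Omega> \<and> weakly_monotone \<Omega> u"
  obtain v where v: "AE x in lebesgue_on \<Omega>. v x = u x" "continuous_on (\<Omega> - oscillation_set \<Omega> u) v"
    using continuous_representative_off_oscillation_set[OF assms(2)] by blast
  have "capacity \<Psi> (oscillation_set \<Omega> u) = 0"
    using u by (intro capacity_oscillation_set[OF assms(1,3,5,6,7,8,9,2)]) auto
  moreover have "oscillation_set \<Omega> u \<subseteq> \<Omega>" by (auto simp: oscillation_set_def)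
  ultimately show "\<exists>v E. (AE x in lebesgue_on \<Omega>. v x = u x) \<and>
                  E \<subseteq> \<Omega> \<and> capacity \<Psi> E = 0 \<and> continuous_on (\<Omega> - E) v"
    using v by blast
qed

end
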